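(* Assume (A) and let $R_\delta:=\big\{x\in\mathcal X:\big[\frac{\Delta}{n-1}-V-A\big]^2\le\big[\frac{\Delta}{n-1}-V-\delta\big]^2\big\}$. There exist an integer $N$ and constants $C_1,C_2,C_3,C_4>0$, $0<\gamma<1$, not depending on $n$, $k$ or the initial state, such that for all $n\ge N$, every initial state $x^{(0)}\in R_\delta$ and every $k\ge1$, $$\|\mathcal L(X^{(k)})-\pi\|_{\mathrm{TV}}\le\big[C_1+f(x^{(0)})\big]\gamma^k+C_2\frac{k(1+k)}{n}+C_3\frac{k}{\sqrt n}+C_4f(x^{(0)})\frac kn .$$
   Context: Fix $V>0$, $a>0$, $b_0>0$. For each $n\ge2$ observed data $Y_1,\dots,Y_n\in\mathbb R$ are given; $\bar Y=\frac1n\sum_iY_i$, $\Delta=\Delta_n=\sum_{i=1}^n(Y_i-\bar Y)^2$. Model: $Y_i\mid\theta_i\sim\mathcal N(\theta_i,V)$, $\theta_i\mid\mu,A\sim\mathcal N(\mu,A)$ independently ($1\le i\le n$), flat prior on $\mu\in\mathbb R$, $A\sim\mathrm{IG}(a,b_0)$ (density $\propto A^{-a-1}e^{-b_0/A}$ on $(0,\infty)$). The posterior $\pi$ on $\mathcal X=(0,\infty)\times\mathbb R\times\mathbb R^n$, $x=(A,\mu,\theta_1,\dots,\theta_n)$, has density $\propto A^{-a-1}e^{-b_0/A}\prod_{i=1}^n A^{-1/2}e^{-(\theta_i-\mu)^2/(2A)}e^{-(Y_i-\theta_i)^2/(2V)}$. Write $\bar\theta=\frac1n\sum_i\theta_i$.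 The Gibbs sampler $X^{(k)}=(A^{(k)},\mu^{(k)},\theta^{(k)}_1,\dots,\theta^{(k)}_n)$ updates: $\mu^{(k+1)}\sim\mathcal N(\bar\theta^{(k)},A^{(k)}/n)$; then independently $\theta_i^{(k+1)}\sim\mathcal N\big(\frac{\mu^{(k+1)}V+Y_iA^{(k)}}{V+A^{(k)}},\frac{A^{(k)}V}{V+A^{(k)}}\big)$, $i=1,\dots,n$; then $A^{(k+1)}\sim\mathrm{IG}\big(a+\frac{n-1}2,\ b_0+\frac12\sum_i(\theta_i^{(k+1)}-\bar\theta^{(k+1)})^2\big)$. Assumption (A): there are $\delta>0$, $M<\infty$ and an integer $N_0$ with $\frac{\Delta_n}{n-1}\le M$ for all $n$ and $\frac{\Delta_n}{n-1}\ge V+\delta$ for all $n\ge N_0$. Drift function: $f(x)=n(\bar\theta-\bar Y)^2+n\big[\big(\frac{\Delta}{n-1}-V\big)-A\big]^2$. $\|\cdot\|_{\mathrm{TV}}$ is total variation distance. *)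

theory Defs
  imports "HOL-Probability.Probability"
begin

text \<open>Data: a triangular array; for sample size n the observations are Y n 0, ..., Y n (n-1).\<close>

definition Ybar :: "(nat \<Rightarrow> nat \<Rightarrow> real) \<Rightarrow> nat \<Rightarrow> real" where
  "Ybar Y n = (\<Sum>i<n. Y n i) / real n"

definition Delta :: "(nat \<Rightarrow> nat \<Rightarrow> real) \<Rightarrow> nat \<Rightarrow> real" where
  "Delta Y n = (\<Sum>i<n. (Y n i - Ybar Y n)\<^sup>2)"

definition tbar :: "nat \<Rightarrow> (nat \<Rightarrow> real) \<Rightarrow> real" where
  "tbar n \<theta> = (\<Sum>i<n. \<theta> i) / real n"

definition Apos :: "real measure" where
  "Apos = restrict_space lborel {0<..}"

text \<open>State space (0,inf) x R x R^n, states x = (A, mu, theta); theta as extensional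
  functions on {..<n}.\<close>
definition Xsp :: "nat \<Rightarrow> (real \<times> real \<times> (nat \<Rightarrow> real)) measure" where
  "Xsp n = Apos \<Otimes>\<^sub>M lborel \<Otimes>\<^sub>M PiM {..<n} (\<lambda>_. lborel)"

definition ig_density :: "real \<Rightarrow> real \<Rightarrow> real \<Rightarrow> real" where
  "ig_density \<alpha> \<beta> x =
     (if x > 0 then \<beta> powr \<alpha> / Gamma \<alpha> * x powr (-\<alpha> - 1) * exp (-\<beta> / x) else 0)"

definition post_dens ::
  "real \<Rightarrow> real \<Rightarrow> real \<Rightarrow> (nat \<Rightarrow> nat \<Rightarrow> real) \<Rightarrow> nat
     \<Rightarrow> real \<times> real \<times> (nat \<Rightarrow> real) \<Rightarrow> real" where
  "post_dens V a b0 Y n x = (case x of (A, \<mu>, \<theta>) \<Rightarrow>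
     A powr (-a - 1) * exp (-b0 / A) *
     (\<Prod>i<n. A powr (-1/2) * exp (-(\<theta> i - \<mu>)\<^sup>2 / (2 * A))
              * exp (-(Y n i - \<theta> i)\<^sup>2 / (2 * V))))"

definition posterior ::
  "real \<Rightarrow> real \<Rightarrow> real \<Rightarrow> (nat \<Rightarrow> nat \<Rightarrow> real) \<Rightarrow> nat
     \<Rightarrow> (real \<times> real \<times> (nat \<Rightarrow> real)) measure" where
  "posterior V a b0 Y n =
     density (Xsp n) (\<lambda>x. ennreal (post_dens V a b0 Y n x /
                                    (\<integral>y. post_dens V a b0 Y n y \<partial>Xsp n)))"

text \<open>One sweep of the Gibbs sampler: mu, then theta_1..theta_n, then A.
  Normal distributions are parametrized by mean and standard deviation.\<close>
definition gibbs_step ::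
  "real \<Rightarrow> real \<Rightarrow> real \<Rightarrow> (nat \<Rightarrow> nat \<Rightarrow> real) \<Rightarrow> nat
     \<Rightarrow> real \<times> real \<times> (nat \<Rightarrow> real) \<Rightarrow> (real \<times> real \<times> (nat \<Rightarrow> real)) measure" where
  "gibbs_step V a b0 Y n x = (case x of (A, \<mu>, \<theta>) \<Rightarrow>
     bind (density lborel (normal_density (tbar n \<theta>) (sqrt (A / real n)))) (\<lambda>\<mu>'.
     bind (PiM {..<n} (\<lambda>i. density lborel
             (normal_density ((\<mu>' * V + Y n i * A) / (V + A)) (sqrt (A * V / (V + A)))))) (\<lambda>\<theta>'.
     bind (density Apos (ig_density (a + (real n - 1) / 2)
                                    (b0 + (\<Sum>i<n. (\<theta>' i - tbar n \<theta>')\<^sup>2) / 2))) (\<lambda>A'.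
     return (Xsp n) (A', \<mu>', \<theta>')))))"

primrec gibbs_law ::
  "real \<Rightarrow> real \<Rightarrow> real \<Rightarrow> (nat \<Rightarrow> nat \<Rightarrow> real) \<Rightarrow> nat
     \<Rightarrow> real \<times> real \<times> (nat \<Rightarrow> real) \<Rightarrow> nat \<Rightarrow> (real \<times> real \<times> (nat \<Rightarrow> real)) measure" where
  "gibbs_law V a b0 Y n x0 0 = return (Xsp n) x0"
| "gibbs_law V a b0 Y n x0 (Suc k) = bind (gibbs_law V a b0 Y n x0 k) (gibbs_step V a b0 Y n)"

definition tv_dist :: "'a measure \<Rightarrow> 'a measure \<Rightarrow> real" where
  "tv_dist P Q = (SUP B \<in> sets P. \<bar>measure P B - measure Q B\<bar>)"

definition drift ::
  "real \<Rightarrow> (nat \<Rightarrow> nat \<Rightarrow> real) \<Rightarrow> nat \<Rightarrow> real \<times> real \<times> (nat \<Rightarrow> real) \<Rightarrow> real" where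
  "drift V Y n x = (case x of (A, \<mu>, \<theta>) \<Rightarrow>
     real n * (tbar n \<theta> - Ybar Y n)\<^sup>2
     + real n * ((Delta Y n / (real n - 1) - V) - A)\<^sup>2)"

definition Rset ::
  "real \<Rightarrow> (nat \<Rightarrow> nat \<Rightarrow> real) \<Rightarrow> real \<Rightarrow> nat \<Rightarrow> (real \<times> real \<times> (nat \<Rightarrow> real)) set" where
  "Rset V Y \<delta> n = {x \<in> space (Xsp n).
     (Delta Y n / (real n - 1) - V - fst x)\<^sup>2 \<le> (Delta Y n / (real n - 1) - V - \<delta>)\<^sup>2}"

end

theory Submission
  imports Defs
begin

text \<open>One sweep is a fixed map of the state and of noise whose law does not depend on the state, and
  the next state depends on the current one only through \<open>A\<close> and the mean \<open>t\<close> of \<open>\<theta>\<close>. Feeding the same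
  noise to two copies contracts \<open>\<rho> = sqrt n * (\<bar>A - A'\<bar> + \<bar>t - t'\<bar>)\<close> in mean, up to relative errors
  \<open>O(1 / sqrt n)\<close>, as long as \<open>A\<close> is bounded away from \<open>0\<close> and \<open>(A', t')\<close> is close to the point
  where the posterior concentrates; the sets where this holds are left in one sweep with probability
  \<open>O(1 / sqrt n)\<close>. A further sweep turns \<open>\<rho>\<close> into total variation, because the Gaussian transition
  laws have a Hellinger affinity controlled by \<open>\<rho>\<close>. The second copy starts from the posterior, whose
  concentration follows from moment identities.

  The draw of \<open>A\<close> integrates \<open>\<mu>\<close> out, so only the posterior law of \<open>(A, \<theta>)\<close> is invariant; the law of
  \<open>\<mu>\<close> is off by \<open>O(1 / sqrt n)\<close> in total variation.\<close>

text \<open>Write \<open>d = Delta/(n-1) - V\<close> and \<open>u = A/(V+A)\<close>. Up to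
  fluctuations a sweep sends \<open>A - d\<close> to \<open>(1 - u^2)(A - d)\<close> and
  \<open>t - Ybar\<close> to \<open>(1 - u)(t - Ybar)\<close>, so a lower bound on \<open>A\<close>
  makes both factors uniform. Between two arbitrary points, however, the mean map of
  \<open>A\<close> may expand: it has slope 1 at \<open>A = 0\<close> and, as \<open>d > 0\<close>,
  a larger slope just above. This is why the two copies are treated differently. The first only
  needs \<open>A\<close> away from 0, which the set of admissible starting points provides; the
  second has to stay within a tolerance of \<open>(d, Ybar)\<close>, and the secant slope towards
  such a point is again about \<open>1 - u^2\<close>. The same closeness controls the second
  obstacle, a difference in \<open>A\<close> that acts on \<open>t\<close> with weight
  \<open>sqrt n |t' - Ybar|\<close>. The factor \<open>sqrt n\<close> in \<open>\<rho>\<close> is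
  the scale on which the posterior has spread of order one and on which one sweep is Lipschitz into
  total variation with a constant free of \<open>n\<close>.\<close>

type_synonym state = "real \<times> real \<times> (nat \<Rightarrow> real)"

subsection \<open>The half-line as a measure space\<close>

lemma space_Apos: "space Apos = {0<..}"
  by (simp add: Apos_def space_restrict_space)

lemma measurable_AposI: "f \<in> measurable borel N \<Longrightarrow> f \<in> measurable Apos N"
  unfolding Apos_def by (rule measurable_restrict_space1) (simp cong: measurable_cong_sets)

lemma measurable_into_Apos:
  assumes "f \<in> borel_measurable M" "\<And>x. x \<in> space M \<Longrightarrow> f x > (0::real)"
  shows "f \<in> measurable M Apos"
  unfolding Apos_def using assms by (intro measurable_restrict_space2) auto

lemma nn_integral_Apos:
  "(\<integral>\<^sup>+x. f x \<partial>Apos) = (\<integral>\<^sup>+x. f x * indicator {0<..} x \<partial>lborel)"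
  unfolding Apos_def by (subst nn_integral_restrict_space) auto

lemma sigma_finite_Apos: "sigma_finite_measure Apos"
  unfolding Apos_def by (rule sigma_finite_measure_restrict_space) (auto intro: sigma_finite_lborel)

subsection \<open>Normal distributions as images of standard ones\<close>

lemma prob_space_std_normal: "prob_space std_normal_distribution"
  using real_dist_normal_dist by (simp add: real_distribution_def)

lemma normal_eq_distr:
  assumes "s > 0"
  shows "density lborel (normal_density m s) = distr std_normal_distribution lborel (\<lambda>x. m + s * x)"
proof -
  interpret prob_space std_normal_distribution by (rule prob_space_std_normal)
  have "distributed std_normal_distribution lborel (\<lambda>x. x) std_normal_density"
    unfolding distributed_def by (auto simp: distr_id2 intro!: measure_eqI)
  from normal_density_affine[OF this, of s m] assms
  have "distributed std_normal_distribution lborel (\<lambda>x. m + s * x) (normal_density m s)" by simp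
  then show ?thesis by (simp add: distributed_def)
qed

definition normals :: "nat \<Rightarrow> (nat \<Rightarrow> real) measure" where
  "normals n = PiM {..<n} (\<lambda>_. std_normal_distribution)"

lemma sets_normals [measurable_cong]: "sets (normals n) = sets (PiM {..<n} (\<lambda>_. lborel))"
  unfolding normals_def by (intro sets_PiM_cong) auto

lemma prob_space_normals: "prob_space (normals n)"
  unfolding normals_def by (intro prob_space_PiM prob_space_std_normal)

text \<open>A finite product measure is determined by its values on boxes, and the preimage of a box
  under a coordinatewise affine map is a box. Means vary with the coordinate and the standard
  deviation does not, as in the draw of \<open>\<theta>\<close>.\<close>

lemma PiM_normal_eq_distr:
  assumes "s > 0"
  shows "PiM {..<n} (\<lambda>i. density lborel (normal_density (m i) s)) =
    distr (normals n) (PiM {..<n} (\<lambda>_. lborel)) (\<lambda>z. \<lambda>i\<in>{..<n}. m i + s * z i)"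
proof -
  interpret N: product_prob_space "\<lambda>i. density lborel (normal_density (m i) s)" "{..<n}"
    by (intro product_prob_spaceI prob_space_normal_density assms)
  interpret S: product_prob_space "\<lambda>i::nat. std_normal_distribution" "{..<n}"
    by (intro product_prob_spaceI prob_space_std_normal)
  have "distr (normals n) (PiM {..<n} (\<lambda>_. lborel)) (\<lambda>z. \<lambda>i\<in>{..<n}. m i + s * z i)
      = PiM {..<n} (\<lambda>i. density lborel (normal_density (m i) s))"
  proof (rule N.PiM_eqI)
    show "sets (distr (normals n) (PiM {..<n} (\<lambda>_. lborel)) (\<lambda>z. \<lambda>i\<in>{..<n}. m i + s * z i)) =
      sets (PiM {..<n} (\<lambda>i. density lborel (normal_density (m i) s)))"
      by (simp, intro sets_PiM_cong) auto
  next
    fix A assume A: "\<And>i. i \<in> {..<n} \<Longrightarrow> A i \<in> sets (density lborel (normal_density (m i) s))"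
    then have A': "i < n \<Longrightarrow> A i \<in> sets borel" for i by simp
    have vs: "(\<lambda>z. \<lambda>i\<in>{..<n}. m i + s * z i) -` PiE {..<n} A \<inter> space (normals n) =
        PiE {..<n} (\<lambda>i. (\<lambda>x. m i + s * x) -` A i)"
      by (auto simp: normals_def space_PiM PiE_iff extensional_def)
    have "emeasure (distr (normals n) (PiM {..<n} (\<lambda>_. lborel)) (\<lambda>z. \<lambda>i\<in>{..<n}. m i + s * z i)) (PiE {..<n} A)
      = emeasure (normals n) (PiE {..<n} (\<lambda>i. (\<lambda>x. m i + s * x) -` A i))"
      unfolding vs[symmetric] using A' by (intro emeasure_distr) (auto intro!: sets_PiM_I_finite)
    also have "\<dots> = (\<Prod>i<n. emeasure std_normal_distribution ((\<lambda>x. m i + s * x) -` A i))"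
      unfolding normals_def
    proof (intro S.emeasure_PiM)
      fix i assume "i \<in> {..<n}"
      then have [measurable]: "A i \<in> sets borel" using A' by simp
      have "(\<lambda>x. m i + s * x) -` A i \<inter> space borel \<in> sets borel" by measurable
      then show "(\<lambda>x. m i + s * x) -` A i \<in> sets std_normal_distribution" by simp
    qed auto
    also have "\<dots> = (\<Prod>i<n. emeasure (density lborel (normal_density (m i) s)) (A i))"
      using A' by (intro prod.cong refl) (auto simp: normal_eq_distr[OF assms] emeasure_distr)
    finally show "emeasure (distr (normals n) (PiM {..<n} (\<lambda>_. lborel)) (\<lambda>z. \<lambda>i\<in>{..<n}. m i + s * z i)) (PiE {..<n} A)
      = (\<Prod>i<n. emeasure (density lborel (normal_density (m i) s)) (A i))" .
  qed auto
  then show ?thesis ..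
qed

text \<open>The indicator of a box is a product of indicators, so the integral over a box
  factorises. The affinity argument and the factorisation of the posterior both work with joint
  densities and need this bridge from product measures.\<close>

lemma PiM_density_lborel:
  fixes f :: "'i \<Rightarrow> real \<Rightarrow> ennreal"
  assumes I: "finite I" and f[measurable]: "\<And>i. f i \<in> borel_measurable borel"
    and p: "\<And>i. prob_space (density lborel (f i))"
  shows "PiM I (\<lambda>i. density lborel (f i)) = density (PiM I (\<lambda>_. lborel)) (\<lambda>x. \<Prod>i\<in>I. f i (x i))"
proof -
  interpret N: product_prob_space "\<lambda>i. density lborel (f i)" I
    by (intro product_prob_spaceI p)
  interpret L: product_sigma_finite "\<lambda>i::'i. lborel :: real measure"
    by standard
  have "density (PiM I (\<lambda>_. lborel)) (\<lambda>x. \<Prod>i\<in>I. f i (x i)) = PiM I (\<lambda>i. density lborel (f i))"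
  proof (rule N.PiM_eqI[OF I])
    show "sets (density (PiM I (\<lambda>_. lborel)) (\<lambda>x. \<Prod>i\<in>I. f i (x i))) = sets (PiM I (\<lambda>i. density lborel (f i)))"
      by (simp, intro sets_PiM_cong) auto
  next
    fix A assume "\<And>i. i \<in> I \<Longrightarrow> A i \<in> sets (density lborel (f i))"
    then have A: "i \<in> I \<Longrightarrow> A i \<in> sets borel" for i by simp
    have PA: "PiE I A \<in> sets (PiM I (\<lambda>_. lborel))"
      using A I by (auto intro!: sets_PiM_I_finite)
    have "emeasure (density (PiM I (\<lambda>_. lborel)) (\<lambda>x. \<Prod>i\<in>I. f i (x i))) (PiE I A)
        = (\<integral>\<^sup>+x. (\<Prod>i\<in>I. f i (x i)) * indicator (PiE I A) x \<partial>PiM I (\<lambda>_. lborel))"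
      by (rule emeasure_density[OF _ PA]) measurable
    also have "\<dots> = (\<integral>\<^sup>+x. (\<Prod>i\<in>I. f i (x i) * indicator (A i) (x i)) \<partial>PiM I (\<lambda>_. lborel))"
    proof (intro nn_integral_cong)
      fix x assume x: "x \<in> space (PiM I (\<lambda>_. lborel :: real measure))"
      then have "indicator (PiE I A) x = (\<Prod>i\<in>I. indicator (A i) (x i) :: ennreal)"
        using I by (auto simp: indicator_def PiE_iff space_PiM prod_zero_iff)
      then show "(\<Prod>i\<in>I. f i (x i)) * indicator (PiE I A) x = (\<Prod>i\<in>I. f i (x i) * indicator (A i) (x i))"
        by (simp add: prod.distrib)
    qed
    also have "\<dots> = (\<Prod>i\<in>I. \<integral>\<^sup>+x. f i x * indicator (A i) x \<partial>lborel)"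
      using A by (intro L.product_nn_integral_prod[OF I]) (auto intro!: borel_measurable_times borel_measurable_indicator)
    also have "\<dots> = (\<Prod>i\<in>I. emeasure (density lborel (f i)) (A i))"
      using A by (intro prod.cong refl) (simp add: emeasure_density)
    finally show "emeasure (density (PiM I (\<lambda>_. lborel)) (\<lambda>x. \<Prod>i\<in>I. f i (x i))) (PiE I A)
        = (\<Prod>i\<in>I. emeasure (density lborel (f i)) (A i))" .
  qed
  then show ?thesis ..
qed

subsection \<open>The inverse gamma distribution\<close>

definition ig :: "real \<Rightarrow> real \<Rightarrow> real measure" where
  "ig \<alpha> \<beta> = density Apos (ig_density \<alpha> \<beta>)"

lemma sets_ig [measurable_cong]: "sets (ig \<alpha> \<beta>) = sets Apos"
  by (simp add: ig_def)

lemma space_ig: "space (ig \<alpha> \<beta>) = {0<..}"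
  by (simp add: ig_def space_Apos)

lemma ig_density_measurable [measurable]: "ig_density \<alpha> \<beta> \<in> borel_measurable borel"
  unfolding ig_density_def by measurable

lemma ig_density_nonneg: "\<alpha> > 0 \<Longrightarrow> ig_density \<alpha> \<beta> x \<ge> 0"
  by (auto simp: ig_density_def intro!: mult_nonneg_nonneg divide_nonneg_nonneg less_imp_le[OF Gamma_real_pos])

lemma ig_density_measurable_Apos [measurable]: "ig_density \<alpha> \<beta> \<in> borel_measurable Apos"
  by (rule measurable_AposI) measurable

text \<open>The substitution sending \<open>x\<close> to \<open>\<beta> / x\<close> turns the
  density into the gamma density of shape \<open>\<alpha>\<close>, whose mass is the Gamma
  integral.\<close>

lemma nn_integral_ig_density:
  assumes \<alpha>: "\<alpha> > 0" and \<beta>: "\<beta> > 0"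
  shows "(\<integral>\<^sup>+x. ig_density \<alpha> \<beta> x \<partial>lborel) = 1"
proof -
  let ?f = "\<lambda>x. ig_density \<alpha> \<beta> x"
  let ?G = "\<lambda>t. t powr (\<alpha> - 1) / exp t / Gamma \<alpha>"
  have "((\<lambda>t. t powr (\<alpha> - 1) / exp t) has_integral Gamma \<alpha>) {0<..}"
  proof -
    \<comment> \<open>The Gamma integral is available on the closed half-line; the point 0 is
      discarded because \<open>\<beta> / x\<close> is a bijection of the open half-line.\<close>
    have "((\<lambda>t. if t \<in> {0<..} then t powr (\<alpha> - 1) / exp t else 0) has_integral Gamma \<alpha>) {0..}"
      by (rule has_integral_spike[OF _ _ Gamma_integral_real[OF \<alpha>], of "{0}"]) auto
    then show ?thesis by (subst (asm) has_integral_restrict) auto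
  qed
  from has_integral_divide[OF this, of "Gamma \<alpha>"] have G: "(?G has_integral 1) {0<..}"
    using Gamma_real_pos[OF \<alpha>] by simp
  have eq: "\<bar>- \<beta> / x\<^sup>2\<bar> * ?f (\<beta> / x) = ?G x" if x: "x > 0" for x :: real
  proof -
    have e: "(\<beta> / x) powr (-\<alpha> - 1) = \<beta> powr (-\<alpha> - 1) * x powr (\<alpha> + 1)"
      using x \<beta> powr_minus[of x "-\<alpha> - 1"] by (simp add: powr_divide) (simp add: divide_inverse add.commute)
    have "\<bar>- \<beta> / x\<^sup>2\<bar> * ?f (\<beta> / x) = \<beta> / x\<^sup>2 * (\<beta> powr \<alpha> / Gamma \<alpha> * (\<beta> / x) powr (-\<alpha> - 1) * exp (- \<beta> / (\<beta> / x)))"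
      using x \<beta> by (simp add: ig_density_def)
    also have "\<dots> = (\<beta> powr 1 * \<beta> powr \<alpha> * \<beta> powr (-\<alpha> - 1)) * (x powr (-2) * x powr (\<alpha> + 1)) * exp (- x) / Gamma \<alpha>"
      unfolding e using x \<beta> by (simp add: powr_minus powr_numeral field_simps)
    also have "\<dots> = ?G x" using x \<beta> by (simp add: powr_add[symmetric] exp_minus field_simps)
    finally show ?thesis .
  qed
  have im: "(\<lambda>x. \<beta> / x) ` {0<..} = {0<..}"
  proof (intro equalityI subsetI)
    fix y :: real assume "y \<in> {0<..}"
    then show "y \<in> (\<lambda>x. \<beta> / x) ` {0<..}" using \<beta> by (intro image_eqI[of _ _ "\<beta> / y"]) auto
  qed (use \<beta> in auto)
  have "(\<lambda>x. \<bar>- \<beta> / x\<^sup>2\<bar> * ?f (\<beta> / x)) absolutely_integrable_on {0<..} \<and>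
      integral {0<..} (\<lambda>x. \<bar>- \<beta> / x\<^sup>2\<bar> * ?f (\<beta> / x)) = 1"
  proof
    have g: "?G absolutely_integrable_on {0<..}"
      using G Gamma_real_pos[OF \<alpha>] by (intro nonnegative_absolutely_integrable_1) (auto intro: less_imp_le)
    show "(\<lambda>x. \<bar>- \<beta> / x\<^sup>2\<bar> * ?f (\<beta> / x)) absolutely_integrable_on {0<..}"
      by (rule absolutely_integrable_spike[OF g, of "{}"]) (use eq in auto)
    show "integral {0<..} (\<lambda>x. \<bar>- \<beta> / x\<^sup>2\<bar> * ?f (\<beta> / x)) = 1"
      using integral_unique[OF G] integral_cong[of "{0<..}" "\<lambda>x. \<bar>- \<beta> / x\<^sup>2\<bar> * ?f (\<beta> / x)" ?G] eq by auto
  qed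
  then have "?f absolutely_integrable_on (\<lambda>x. \<beta> / x) ` {0<..} \<and> integral ((\<lambda>x. \<beta> / x) ` {0<..}) ?f = 1"
    by (subst (asm) has_absolute_integral_change_of_variables_1')
       (use \<beta> in \<open>auto intro!: derivative_eq_intros inj_onI simp: power2_eq_square field_simps\<close>)
  then have "(?f has_integral 1) {0<..}"
    unfolding im by (metis absolutely_integrable_on_def has_integral_integral)
  then have "(\<integral>\<^sup>+x. ennreal (indicator {0<..} x * ?f x) \<partial>lborel) = ennreal 1"
    by (intro nn_integral_has_integral_lebesgue ig_density_nonneg[OF \<alpha>])
  also have "(\<lambda>x. indicator {0<..} x * ?f x) = ?f"
    by (auto simp: indicator_def ig_density_def)
  finally show ?thesis by simp
qed

lemma nn_integral_ig:
  fixes f :: "real \<Rightarrow> ennreal"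
  assumes f[measurable]: "f \<in> borel_measurable Apos"
  shows "(\<integral>\<^sup>+x. f x \<partial>ig \<alpha> \<beta>) = (\<integral>\<^sup>+x. ig_density \<alpha> \<beta> x * f x \<partial>Apos)"
  unfolding ig_def by (rule nn_integral_density) measurable

lemma prob_space_ig:
  assumes "\<alpha> > 0" and "\<beta> > 0"
  shows "prob_space (ig \<alpha> \<beta>)"
proof
  have "emeasure (ig \<alpha> \<beta>) (space (ig \<alpha> \<beta>)) = (\<integral>\<^sup>+x. 1 \<partial>ig \<alpha> \<beta>)" by simp
  also have "\<dots> = (\<integral>\<^sup>+x. ig_density \<alpha> \<beta> x \<partial>lborel)"
    by (subst nn_integral_ig) (auto simp: nn_integral_Apos ig_density_def indicator_def intro!: nn_integral_cong)
  finally show "emeasure (ig \<alpha> \<beta>) (space (ig \<alpha> \<beta>)) = 1"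
    by (simp add: nn_integral_ig_density[OF assms])
qed

lemma ig_density_scale:
  assumes "\<beta> > 0" "h > 0"
  shows "\<beta> * ig_density \<alpha> \<beta> (h * \<beta>) = ig_density \<alpha> 1 h"
proof -
  have "\<beta> * ig_density \<alpha> \<beta> (h * \<beta>) = (\<beta> powr 1 * \<beta> powr \<alpha> * \<beta> powr (-\<alpha> - 1)) * h powr (-\<alpha> - 1) * exp (- (1 / h)) / Gamma \<alpha>"
    using assms by (simp add: ig_density_def powr_mult field_simps)
  also have "\<dots> = ig_density \<alpha> 1 h"
  proof -
    have "\<beta> powr 1 * \<beta> powr \<alpha> * \<beta> powr (-\<alpha> - 1) = 1"
      using assms by (simp only: powr_add[symmetric]) simp
    then show ?thesis unfolding ig_density_def using assms by simp
  qed
  finally show ?thesis .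
qed

text \<open>\<open>\<beta>\<close> is a scale parameter. Hence the draw of \<open>A\<close> is a
  multiple of an inverse gamma variable whose law is free of the state, and two copies can share
  that variable.\<close>

lemma ig_scale_eq_distr:
  assumes \<beta>: "\<beta> > 0"
  shows "ig \<alpha> \<beta> = distr (ig \<alpha> 1) Apos (\<lambda>h. h * \<beta>)"
proof (rule measure_eqI)
  fix B assume "B \<in> sets (ig \<alpha> \<beta>)"
  then have B[measurable]: "B \<in> sets Apos" by (simp add: sets_ig)
  have m[measurable]: "(\<lambda>h. h * \<beta>) \<in> measurable Apos Apos"
    using \<beta> by (intro measurable_into_Apos measurable_AposI) (auto simp: space_Apos)
  have Bb: "B \<in> sets borel" and B0: "B \<subseteq> {0<..}"
    using B unfolding Apos_def by (auto simp: sets_restrict_space)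
  have "emeasure (ig \<alpha> \<beta>) B = (\<integral>\<^sup>+x. ennreal (ig_density \<alpha> \<beta> x) * indicator B x \<partial>lborel)"
    using B0 unfolding ig_def
    by (subst emeasure_density) (auto simp: nn_integral_Apos indicator_def intro!: nn_integral_cong)
  also have "\<dots> = ennreal \<bar>\<beta>\<bar> * (\<integral>\<^sup>+x. ennreal (ig_density \<alpha> \<beta> (0 + \<beta> * x)) * indicator B (0 + \<beta> * x) \<partial>lborel)"
    using \<beta> Bb by (intro nn_integral_real_affine) auto
  also have "\<dots> = (\<integral>\<^sup>+x. ennreal \<beta> * (ennreal (ig_density \<alpha> \<beta> (\<beta> * x)) * indicator B (\<beta> * x)) \<partial>lborel)"
    using \<beta> Bb by (subst nn_integral_cmult) (auto simp: nn_integral_cmult)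
  also have "\<dots> = (\<integral>\<^sup>+x. ennreal (ig_density \<alpha> 1 x) * indicator B (x * \<beta>) * indicator {0<..} x \<partial>lborel)"
  proof (intro nn_integral_cong)
    fix x :: real
    show "ennreal \<beta> * (ennreal (ig_density \<alpha> \<beta> (\<beta> * x)) * indicator B (\<beta> * x)) = ennreal (ig_density \<alpha> 1 x) * indicator B (x * \<beta>) * indicator {0<..} x"
    proof (cases "x > 0")
      case True
      then have "ennreal \<beta> * ennreal (ig_density \<alpha> \<beta> (\<beta> * x)) = ig_density \<alpha> 1 x"
        using ig_density_scale[OF \<beta> True, of \<alpha>] \<beta> by (simp add: ennreal_mult'[symmetric] mult.commute)
      then show ?thesis using True by (simp add: mult.assoc[symmetric] mult.commute[of x])
    next
      case False
      then have "\<beta> * x \<le> 0" using \<beta> by (simp add: mult_le_0_iff)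
      then show ?thesis using False by (auto simp: ig_density_def)
    qed
  qed
  also have "\<dots> = (\<integral>\<^sup>+x. indicator B (x * \<beta>) \<partial>ig \<alpha> 1)"
    by (subst nn_integral_ig) (auto simp: nn_integral_Apos)
  also have "\<dots> = emeasure (distr (ig \<alpha> 1) Apos (\<lambda>h. h * \<beta>)) B"
    by (subst nn_integral_distr[of "\<lambda>h. h * \<beta>" "ig \<alpha> 1" Apos "indicator B", symmetric]) auto
  finally show "emeasure (ig \<alpha> \<beta>) B = emeasure (distr (ig \<alpha> 1) Apos (\<lambda>h. h * \<beta>)) B" .
qed (simp add: sets_ig)

text \<open>Multiplying the density by \<open>x powr p\<close> only shifts the shape from
  \<open>\<alpha>\<close> to \<open>\<alpha> - p\<close>, so the integral is a ratio of normalising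
  constants. Positive \<open>p\<close> serve the fluctuation of the draw of \<open>A\<close>, the
  values -1 and -2 the concentration of the posterior.\<close>

lemma nn_integral_ig_powr:
  assumes \<alpha>: "\<alpha> - p > 0" "\<alpha> > 0" and \<beta>: "\<beta> > 0"
  shows "(\<integral>\<^sup>+x. ennreal (x powr p) \<partial>ig \<alpha> \<beta>) = ennreal (\<beta> powr p * Gamma (\<alpha> - p) / Gamma \<alpha>)"
proof -
  let ?c = "\<beta> powr p * Gamma (\<alpha> - p) / Gamma \<alpha>"
  have c: "?c \<ge> 0" using Gamma_real_pos[OF \<alpha>(1)] Gamma_real_pos[OF \<alpha>(2)] by simp
  have eq: "ig_density \<alpha> \<beta> x * x powr p = ?c * ig_density (\<alpha> - p) \<beta> x" for x
  proof (cases "x > 0")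
    case True
    have "x powr (- (\<alpha> - p) - 1) = x powr (-\<alpha> - 1) * x powr p"
      by (simp add: powr_add[symmetric] algebra_simps)
    moreover have "\<beta> powr \<alpha> = \<beta> powr p * \<beta> powr (\<alpha> - p)"
      by (simp add: powr_add[symmetric])
    ultimately show ?thesis
      using True Gamma_real_pos[OF \<alpha>(1)] Gamma_real_pos[OF \<alpha>(2)] unfolding ig_density_def by simp
  qed (simp add: ig_density_def)
  have m[measurable]: "(\<lambda>x. ennreal (x powr p)) \<in> borel_measurable Apos"
    by (rule measurable_AposI) measurable
  have "(\<integral>\<^sup>+x. ennreal (x powr p) \<partial>ig \<alpha> \<beta>) = (\<integral>\<^sup>+x. ennreal ?c * ennreal (ig_density (\<alpha> - p) \<beta> x) \<partial>lborel)"
    unfolding nn_integral_ig[OF m] nn_integral_Apos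
  proof (intro nn_integral_cong)
    fix x :: real
    have "ennreal (ig_density \<alpha> \<beta> x) * ennreal (x powr p) = ennreal ?c * ennreal (ig_density (\<alpha> - p) \<beta> x)"
      using eq[of x] c by (simp add: ennreal_mult'[symmetric] ennreal_mult''[symmetric])
    then show "ennreal (ig_density \<alpha> \<beta> x) * ennreal (x powr p) * indicator {0<..} x
        = ennreal ?c * ennreal (ig_density (\<alpha> - p) \<beta> x)"
      by (auto simp: indicator_def ig_density_def)
  qed
  also have "\<dots> = ennreal ?c"
    by (subst nn_integral_cmult) (auto simp: nn_integral_ig_density[OF \<alpha>(1) \<beta>])
  finally show ?thesis .
qed

lemma ig_powr_moment:
  assumes \<alpha>: "\<alpha> - p > 0" "\<alpha> > 0" and \<beta>: "\<beta> > 0"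
  shows "integrable (ig \<alpha> \<beta>) (\<lambda>x. x powr p)"
    and "(\<integral>x. x powr p \<partial>ig \<alpha> \<beta>) = \<beta> powr p * Gamma (\<alpha> - p) / Gamma \<alpha>"
proof -
  have m: "(\<lambda>x. x powr p) \<in> borel_measurable (ig \<alpha> \<beta>)"
    by (simp cong: measurable_cong_sets add: sets_ig) (rule measurable_AposI, measurable)
  have c: "\<beta> powr p * Gamma (\<alpha> - p) / Gamma \<alpha> \<ge> 0" using Gamma_real_pos[OF \<alpha>(1)] Gamma_real_pos[OF \<alpha>(2)] by simp
  show "integrable (ig \<alpha> \<beta>) (\<lambda>x. x powr p)"
    by (rule integrableI_nonneg[OF m]) (auto simp: nn_integral_ig_powr[OF assms])
  show "(\<integral>x. x powr p \<partial>ig \<alpha> \<beta>) = \<beta> powr p * Gamma (\<alpha> - p) / Gamma \<alpha>"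
    using c by (subst integral_eq_nn_integral[OF m]) (auto simp: nn_integral_ig_powr[OF assms])
qed

text \<open>Nonnegativity of the variance of \<open>|f|\<close>. First absolute moments of the noise
  are obtained from second moments in this way.\<close>

lemma (in prob_space) expectation_abs_le_sqrt:
  fixes f :: "'a \<Rightarrow> real"
  assumes f[measurable]: "f \<in> borel_measurable M" and f2: "integrable M (\<lambda>x. (f x)\<^sup>2)"
  shows "integrable M f" and "expectation (\<lambda>x. \<bar>f x\<bar>) \<le> sqrt (expectation (\<lambda>x. (f x)\<^sup>2))"
proof -
  show i: "integrable M f" by (rule square_integrable_imp_integrable[OF f f2])
  define c where "c = expectation (\<lambda>x. \<bar>f x\<bar>)"
  have "0 \<le> expectation (\<lambda>x. (\<bar>f x\<bar> - c)\<^sup>2)" by simp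
  also have "\<dots> = expectation (\<lambda>x. (f x)\<^sup>2 - 2 * c * \<bar>f x\<bar> + c\<^sup>2)"
    by (simp add: power2_diff algebra_simps)
  also have "\<dots> = expectation (\<lambda>x. (f x)\<^sup>2) - 2 * c * c + c\<^sup>2"
    using i f2 by (simp add: c_def prob_space)
  finally have "c\<^sup>2 \<le> expectation (\<lambda>x. (f x)\<^sup>2)" by (simp add: power2_eq_square)
  then show "expectation (\<lambda>x. \<bar>f x\<bar>) \<le> sqrt (expectation (\<lambda>x. (f x)\<^sup>2))"
    unfolding c_def[symmetric] by (rule real_le_rsqrt)
qed

subsection \<open>Moments of the inverse gamma distribution\<close>

lemma Gamma_nonzero: "(\<alpha> :: real) > 0 \<Longrightarrow> Gamma \<alpha> \<noteq> 0"
  using Gamma_real_pos[of \<alpha>] by linarith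

lemma Gamma_minus_1: "\<alpha> > 1 \<Longrightarrow> Gamma (\<alpha> - 1 :: real) = Gamma \<alpha> / (\<alpha> - 1)"
  using Gamma_plus1[of "\<alpha> - 1"] by (auto simp: field_simps nonpos_Ints_def)

lemma measurable_igI: "f \<in> measurable borel N \<Longrightarrow> f \<in> measurable (ig \<alpha> \<beta>) N"
  by (simp cong: measurable_cong_sets add: sets_ig measurable_AposI)

lemma ig_mean:
  assumes \<alpha>: "\<alpha> > 1" and \<beta>: "\<beta> > 0"
  shows "integrable (ig \<alpha> \<beta>) (\<lambda>x. x)" and "(\<integral>x. x \<partial>ig \<alpha> \<beta>) = \<beta> / (\<alpha> - 1)"
proof -
  have e: "x powr 1 = x" if "x \<in> space (ig \<alpha> \<beta>)" for x
    using that by (simp add: space_ig)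
  show "integrable (ig \<alpha> \<beta>) (\<lambda>x. x)"
    using ig_powr_moment(1)[of \<alpha> 1 \<beta>] \<alpha> \<beta> by (subst Bochner_Integration.integrable_cong[OF refl e[symmetric]]) auto
  show "(\<integral>x. x \<partial>ig \<alpha> \<beta>) = \<beta> / (\<alpha> - 1)"
    using ig_powr_moment(2)[of \<alpha> 1 \<beta>] \<alpha> \<beta> Gamma_nonzero[of \<alpha>]
    by (subst Bochner_Integration.integral_cong[OF refl e[symmetric]]) (auto simp: Gamma_minus_1)
qed

lemma ig_second_moment:
  assumes \<alpha>: "\<alpha> > 2" and \<beta>: "\<beta> > 0"
  shows "integrable (ig \<alpha> \<beta>) (\<lambda>x. x\<^sup>2)" and "(\<integral>x. x\<^sup>2 \<partial>ig \<alpha> \<beta>) = \<beta>\<^sup>2 / ((\<alpha> - 1) * (\<alpha> - 2))"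
proof -
  have e: "x powr 2 = x\<^sup>2" if "x \<in> space (ig \<alpha> \<beta>)" for x
    using that by (simp add: space_ig)
  have g: "Gamma (\<alpha> - 2) = Gamma \<alpha> / ((\<alpha> - 1) * (\<alpha> - 2))"
    using Gamma_minus_1[of "\<alpha> - 1"] Gamma_minus_1[of \<alpha>] \<alpha> by simp
  show "integrable (ig \<alpha> \<beta>) (\<lambda>x. x\<^sup>2)"
    using ig_powr_moment(1)[of \<alpha> 2 \<beta>] \<alpha> \<beta> by (subst Bochner_Integration.integrable_cong[OF refl e[symmetric]]) auto
  show "(\<integral>x. x\<^sup>2 \<partial>ig \<alpha> \<beta>) = \<beta>\<^sup>2 / ((\<alpha> - 1) * (\<alpha> - 2))"
    using ig_powr_moment(2)[of \<alpha> 2 \<beta>] \<alpha> \<beta> Gamma_nonzero[of \<alpha>]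
    by (subst Bochner_Integration.integral_cong[OF refl e[symmetric]]) (auto simp: g)
qed

text \<open>The variance is exactly the squared mean divided by \<open>\<alpha> - 2\<close>. For
  \<open>\<alpha>\<close> of order \<open>n / 2\<close> the relative deviation is therefore of order
  \<open>1 / sqrt n\<close>.\<close>

lemma ig_mean_deviation:
  assumes \<alpha>: "\<alpha> > 2" and \<beta>: "\<beta> > 0"
  shows "(\<integral>x. \<bar>x - \<beta> / (\<alpha> - 1)\<bar> \<partial>ig \<alpha> \<beta>) \<le> \<beta> / (\<alpha> - 1) / sqrt (\<alpha> - 2)"
proof -
  interpret prob_space "ig \<alpha> \<beta>" using assms by (intro prob_space_ig) auto
  let ?m = "\<beta> / (\<alpha> - 1)"
  have i1: "integrable (ig \<alpha> \<beta>) (\<lambda>x. x)" and m1: "(\<integral>x. x \<partial>ig \<alpha> \<beta>) = ?m"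
    using ig_mean[of \<alpha> \<beta>] assms by auto
  note i2 = ig_second_moment[OF assms]
  have e: "(\<lambda>x. (x - ?m)\<^sup>2) = (\<lambda>x. x\<^sup>2 - 2 * ?m * x + ?m\<^sup>2)"
    by (auto simp: power2_diff algebra_simps)
  have I: "integrable (ig \<alpha> \<beta>) (\<lambda>x. (x - ?m)\<^sup>2)"
    unfolding e using i1 i2(1) by (intro Bochner_Integration.integrable_add Bochner_Integration.integrable_diff) auto
  have "(\<integral>x. (x - ?m)\<^sup>2 \<partial>ig \<alpha> \<beta>) = \<beta>\<^sup>2 / ((\<alpha> - 1) * (\<alpha> - 2)) - 2 * ?m * ?m + ?m\<^sup>2"
    unfolding e using i1 i2 m1 by (simp add: prob_space)
  also have "\<dots> = (?m / sqrt (\<alpha> - 2))\<^sup>2"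
  proof -
    have r: "\<alpha> - 1 \<noteq> 0" "\<alpha> - 2 \<noteq> 0" using \<alpha> by auto
    have "(?m / sqrt (\<alpha> - 2))\<^sup>2 = ?m\<^sup>2 / (\<alpha> - 2)" using \<alpha> by (simp only: power_divide real_sqrt_pow2)
    also have "\<dots> = \<beta>\<^sup>2 * (1 / ((\<alpha> - 1) * (\<alpha> - 1) * (\<alpha> - 2)))" by (simp add: power2_eq_square)
    also have "1 / ((\<alpha> - 1) * (\<alpha> - 1) * (\<alpha> - 2)) = 1 / ((\<alpha> - 1) * (\<alpha> - 2)) - 1 / ((\<alpha> - 1) * (\<alpha> - 1))"
      using r by (simp add: divide_simps)
    also have "\<beta>\<^sup>2 * \<dots> = \<beta>\<^sup>2 / ((\<alpha> - 1) * (\<alpha> - 2)) - 2 * ?m * ?m + ?m\<^sup>2"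
      by (simp add: power2_eq_square algebra_simps)
    finally show ?thesis ..
  qed
  finally have v: "(\<integral>x. (x - ?m)\<^sup>2 \<partial>ig \<alpha> \<beta>) = (?m / sqrt (\<alpha> - 2))\<^sup>2" .
  have "(\<integral>x. \<bar>x - ?m\<bar> \<partial>ig \<alpha> \<beta>) \<le> sqrt (\<integral>x. (x - ?m)\<^sup>2 \<partial>ig \<alpha> \<beta>)"
    by (rule expectation_abs_le_sqrt(2)[OF _ I]) (rule measurable_igI, measurable)
  also have "\<dots> = ?m / sqrt (\<alpha> - 2)" unfolding v using assms by (simp add: real_sqrt_abs)
  finally show ?thesis .
qed

lemma nn_integral_ig_inverse:
  assumes \<alpha>: "\<alpha> > 0" and \<beta>: "\<beta> > 0"
  shows "(\<integral>\<^sup>+x. ennreal (1 / x) \<partial>ig \<alpha> \<beta>) = ennreal (\<alpha> / \<beta>)"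
proof -
  have "(\<integral>\<^sup>+x. ennreal (1 / x) \<partial>ig \<alpha> \<beta>) = (\<integral>\<^sup>+x. ennreal (x powr (-1)) \<partial>ig \<alpha> \<beta>)"
    by (intro nn_integral_cong) (auto simp: space_ig powr_minus divide_inverse)
  also have "\<dots> = ennreal (\<alpha> / \<beta>)"
  proof -
    have "Gamma (\<alpha> + 1) = \<alpha> * Gamma \<alpha>" using \<alpha> by (intro Gamma_plus1) (auto simp: nonpos_Ints_def)
    then show ?thesis using \<alpha> \<beta> Gamma_nonzero[OF \<alpha>]
      by (subst nn_integral_ig_powr) (auto simp: powr_minus divide_simps)
  qed
  finally show ?thesis .
qed

lemma nn_integral_ig_inverse_square:
  assumes \<alpha>: "\<alpha> > 0" and \<beta>: "\<beta> > 0"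
  shows "(\<integral>\<^sup>+x. ennreal (1 / x\<^sup>2) \<partial>ig \<alpha> \<beta>) = ennreal (\<alpha> * (\<alpha> + 1) / \<beta>\<^sup>2)"
proof -
  have "(\<integral>\<^sup>+x. ennreal (1 / x\<^sup>2) \<partial>ig \<alpha> \<beta>) = (\<integral>\<^sup>+x. ennreal (x powr (-2)) \<partial>ig \<alpha> \<beta>)"
    by (intro nn_integral_cong) (auto simp: space_ig powr_minus divide_inverse)
  also have "\<dots> = ennreal (\<alpha> * (\<alpha> + 1) / \<beta>\<^sup>2)"
  proof -
    have "Gamma (\<alpha> + 1) = \<alpha> * Gamma \<alpha>" using \<alpha> by (intro Gamma_plus1) (auto simp: nonpos_Ints_def)
    moreover have "Gamma (\<alpha> + 1 + 1) = (\<alpha> + 1) * Gamma (\<alpha> + 1)"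
      using \<alpha> by (intro Gamma_plus1) (auto simp: nonpos_Ints_def)
    ultimately have "Gamma (\<alpha> + 2) = (\<alpha> + 1) * (\<alpha> * Gamma \<alpha>)" by (simp add: add.assoc)
    then show ?thesis using \<alpha> \<beta> Gamma_nonzero[OF \<alpha>]
      by (subst nn_integral_ig_powr) (auto simp: powr_minus divide_simps)
  qed
  finally show ?thesis .
qed

subsection \<open>Sums of independent standard normal variables\<close>

lemma integral_normals_component:
  fixes f :: "real \<Rightarrow> real"
  assumes f: "integrable std_normal_distribution f" and i: "i < n"
  shows "integrable (normals n) (\<lambda>z. f (z i))"
    and "(\<integral>z. f (z i) \<partial>normals n) = (\<integral>x. f x \<partial>std_normal_distribution)"
proof -
  have d: "distr (normals n) std_normal_distribution (\<lambda>z. z i) = std_normal_distribution"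
    unfolding normals_def using i by (intro distr_PiM_component prob_space_std_normal) auto
  have m[measurable]: "(\<lambda>z. z i) \<in> measurable (normals n) std_normal_distribution"
    unfolding normals_def using i by (intro measurable_component_singleton) auto
  show "integrable (normals n) (\<lambda>z. f (z i))"
    using integrable_distr[OF m, of f] f unfolding d by simp
  show "(\<integral>z. f (z i) \<partial>normals n) = (\<integral>x. f x \<partial>std_normal_distribution)"
    using integral_distr[OF m, of f] borel_measurable_integrable[OF f] unfolding d by simp
qed

lemma integral_normals_pair:
  fixes f g :: "real \<Rightarrow> real"
  assumes f: "integrable std_normal_distribution f" and g: "integrable std_normal_distribution g"
    and ij: "i < n" "j < n" "i \<noteq> j"
  shows "integrable (normals n) (\<lambda>z. f (z i) * g (z j))"
    and "(\<integral>z. f (z i) * g (z j) \<partial>normals n) =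
      (\<integral>x. f x \<partial>std_normal_distribution) * (\<integral>x. g x \<partial>std_normal_distribution)"
proof -
  interpret S: product_prob_space "\<lambda>i::nat. std_normal_distribution" "{..<n}"
    by (intro product_prob_spaceI prob_space_std_normal)
  \<comment> \<open>The two factors are completed by constant ones to a product over all
    coordinates, the form in which independence is available.\<close>
  define F where "F k = (if k = i then f else if k = j then g else (\<lambda>_. 1))" for k
  have split: "(\<Prod>k<n. G k) = G i * G j" if "\<And>k. k \<noteq> i \<Longrightarrow> k \<noteq> j \<Longrightarrow> G k = 1" for G :: "nat \<Rightarrow> real"
  proof -
    have "(\<Prod>k<n. G k) = (\<Prod>k\<in>{i, j}. G k)"
      using ij that by (intro prod.mono_neutral_right) auto
    then show ?thesis using ij by simp
  qed
  have Fi: "k \<in> {..<n} \<Longrightarrow> integrable std_normal_distribution (F k)" for k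
    using f g prob_space.finite_measure[OF prob_space_std_normal]
    by (auto simp: F_def intro: finite_measure.integrable_const)
  have e: "(\<lambda>z. \<Prod>k<n. F k (z k)) = (\<lambda>z. f (z i) * g (z j))"
    by (subst split) (use ij in \<open>auto simp: F_def\<close>)
  show "integrable (normals n) (\<lambda>z. f (z i) * g (z j))"
    using S.product_integrable_prod[of "{..<n}" F] Fi unfolding e normals_def by simp
  have "(\<integral>z. f (z i) * g (z j) \<partial>normals n) = (\<Prod>k<n. \<integral>x. F k x \<partial>std_normal_distribution)"
    using S.product_integral_prod[of "{..<n}" F] Fi unfolding e normals_def by simp
  also have "\<dots> = (\<integral>x. f x \<partial>std_normal_distribution) * (\<integral>x. g x \<partial>std_normal_distribution)"
    by (subst split) (use ij prob_space.prob_space[OF prob_space_std_normal] in \<open>auto simp: F_def\<close>)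
  finally show "(\<integral>z. f (z i) * g (z j) \<partial>normals n) =
      (\<integral>x. f x \<partial>std_normal_distribution) * (\<integral>x. g x \<partial>std_normal_distribution)" .
qed

text \<open>Cross terms vanish by independence and centring; only the diagonal survives.\<close>

lemma normals_sum_square:
  fixes f :: "nat \<Rightarrow> real \<Rightarrow> real"
  assumes f: "\<And>i. i < n \<Longrightarrow> integrable std_normal_distribution (f i)"
    and f2: "\<And>i. i < n \<Longrightarrow> integrable std_normal_distribution (\<lambda>x. (f i x)\<^sup>2)"
    and f0: "\<And>i. i < n \<Longrightarrow> (\<integral>x. f i x \<partial>std_normal_distribution) = 0"
  shows "integrable (normals n) (\<lambda>z. (\<Sum>i<n. f i (z i))\<^sup>2)"
    and "(\<integral>z. (\<Sum>i<n. f i (z i))\<^sup>2 \<partial>normals n) = (\<Sum>i<n. \<integral>x. (f i x)\<^sup>2 \<partial>std_normal_distribution)"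
proof -
  have e: "(\<lambda>z. (\<Sum>i<n. f i (z i))\<^sup>2) = (\<lambda>z. \<Sum>i<n. \<Sum>j<n. f i (z i) * f j (z j))"
    by (simp add: power2_eq_square sum_product)
  have I: "integrable (normals n) (\<lambda>z. f i (z i) * f j (z j))" if "i < n" "j < n" for i j
    using integral_normals_pair(1)[OF f[OF that(1)] f[OF that(2)] that]
      integral_normals_component(1)[OF f2[OF that(1)] that(1)]
    by (cases "i = j") (auto simp: power2_eq_square)
  show "integrable (normals n) (\<lambda>z. (\<Sum>i<n. f i (z i))\<^sup>2)"
    unfolding e using I by (intro Bochner_Integration.integrable_sum) auto
  have v: "(\<integral>z. f i (z i) * f j (z j) \<partial>normals n) = (if i = j then \<integral>x. (f i x)\<^sup>2 \<partial>std_normal_distribution else 0)"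
    if "i < n" "j < n" for i j
    using integral_normals_pair(2)[OF f[OF that(1)] f[OF that(2)] that] f0[OF that(1)]
      integral_normals_component(2)[OF f2[OF that(1)] that(1)]
    by (cases "i = j") (auto simp: power2_eq_square)
  have "(\<integral>z. (\<Sum>i<n. f i (z i))\<^sup>2 \<partial>normals n) = (\<Sum>i<n. \<Sum>j<n. \<integral>z. f i (z i) * f j (z j) \<partial>normals n)"
    unfolding e using I by (subst Bochner_Integration.integral_sum) (auto intro!: Bochner_Integration.integrable_sum)
  also have "\<dots> = (\<Sum>i<n. \<Sum>j<n. if i = j then \<integral>x. (f i x)\<^sup>2 \<partial>std_normal_distribution else 0)"
    using v by (intro sum.cong refl) auto
  also have "\<dots> = (\<Sum>i<n. \<integral>x. (f i x)\<^sup>2 \<partial>std_normal_distribution)"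
    by (simp add: sum.delta')
  finally show "(\<integral>z. (\<Sum>i<n. f i (z i))\<^sup>2 \<partial>normals n) = (\<Sum>i<n. \<integral>x. (f i x)\<^sup>2 \<partial>std_normal_distribution)" .
qed

lemma normals_linear:
  fixes c :: "nat \<Rightarrow> real"
  shows "integrable (normals n) (\<lambda>z. \<Sum>i<n. c i * z i)"
    and "(\<integral>z. (\<Sum>i<n. c i * z i) \<partial>normals n) = 0"
    and "integrable (normals n) (\<lambda>z. (\<Sum>i<n. c i * z i)\<^sup>2)"
    and "(\<integral>z. (\<Sum>i<n. c i * z i)\<^sup>2 \<partial>normals n) = (\<Sum>i<n. (c i)\<^sup>2)"
    and "(\<integral>z. \<bar>\<Sum>i<n. c i * z i\<bar> \<partial>normals n) \<le> sqrt (\<Sum>i<n. (c i)\<^sup>2)"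
proof -
  interpret N: prob_space "normals n" by (rule prob_space_normals)
  have i1: "integrable std_normal_distribution (\<lambda>x. x)" and i2: "integrable std_normal_distribution (\<lambda>x. x\<^sup>2)"
    using integrable_std_normal_distribution_moment[of 1] integrable_std_normal_distribution_moment[of 2] by auto
  have e1: "(\<integral>x. x \<partial>std_normal_distribution) = 0" and e2: "(\<integral>x. x\<^sup>2 \<partial>std_normal_distribution) = 1"
    using integral_std_normal_distribution_moment_odd[of 1] std_normal_distribution_even_moments(1)[of 1] by auto
  have f: "integrable std_normal_distribution (\<lambda>x. c i * x)" "integrable std_normal_distribution (\<lambda>x. (c i * x)\<^sup>2)"
    "(\<integral>x. c i * x \<partial>std_normal_distribution) = 0" "(\<integral>x. (c i * x)\<^sup>2 \<partial>std_normal_distribution) = (c i)\<^sup>2" for i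
    using i1 i2 e1 e2 by (simp_all add: power_mult_distrib)
  show I: "integrable (normals n) (\<lambda>z. \<Sum>i<n. c i * z i)"
    using integral_normals_component(1)[OF f(1)] by (intro Bochner_Integration.integrable_sum) auto
  show "(\<integral>z. (\<Sum>i<n. c i * z i) \<partial>normals n) = 0"
  proof -
    have "(\<integral>z. (\<Sum>i<n. c i * z i) \<partial>normals n) = (\<Sum>i<n. \<integral>z. c i * z i \<partial>normals n)"
      using integral_normals_component(1)[OF f(1)] by (intro Bochner_Integration.integral_sum) auto
    also have "\<dots> = 0"
      using integral_normals_component(2)[OF f(1)] f(3) by (intro sum.neutral ballI) (simp only: lessThan_iff)
    finally show ?thesis .
  qed
  show J: "integrable (normals n) (\<lambda>z. (\<Sum>i<n. c i * z i)\<^sup>2)"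
    using f by (intro normals_sum_square) auto
  show K: "(\<integral>z. (\<Sum>i<n. c i * z i)\<^sup>2 \<partial>normals n) = (\<Sum>i<n. (c i)\<^sup>2)"
    using normals_sum_square(2)[of n "\<lambda>i x. c i * x"] f by simp
  show "(\<integral>z. \<bar>\<Sum>i<n. c i * z i\<bar> \<partial>normals n) \<le> sqrt (\<Sum>i<n. (c i)\<^sup>2)"
    using N.expectation_abs_le_sqrt(2)[OF borel_measurable_integrable[OF I] J] by (simp add: K)
qed

lemma normals_sum_of_squares:
  shows "integrable (normals n) (\<lambda>z. \<Sum>i<n. (z i)\<^sup>2)"
    and "(\<integral>z. (\<Sum>i<n. (z i)\<^sup>2) \<partial>normals n) = real n"
    and "(\<integral>z. \<bar>(\<Sum>i<n. (z i)\<^sup>2) - real n\<bar> \<partial>normals n) \<le> sqrt (2 * real n)"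
proof -
  interpret N: prob_space "normals n" by (rule prob_space_normals)
  interpret S: prob_space std_normal_distribution by (rule prob_space_std_normal)
  have i2: "integrable std_normal_distribution (\<lambda>x. x\<^sup>2)" and i4: "integrable std_normal_distribution (\<lambda>x. x^4)"
    using integrable_std_normal_distribution_moment by auto
  have e2: "(\<integral>x. x\<^sup>2 \<partial>std_normal_distribution) = 1" and e4: "(\<integral>x. x^4 \<partial>std_normal_distribution) = 3"
    using std_normal_distribution_even_moments(1)[of 1] std_normal_distribution_even_moments(1)[of 2]
    by (auto simp: fact_numeral)
  \<comment> \<open>With second moment 1 and fourth moment 3 the variance of a squared standard
    normal is \<open>3 - 2 + 1 = 2\<close>, the source of \<open>sqrt (2 * real n)\<close>.\<close>
  have q: "(\<lambda>x::real. (x\<^sup>2 - 1)\<^sup>2) = (\<lambda>x. x^4 - 2 * x\<^sup>2 + 1)"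
    by (auto simp: power2_diff power_mult[symmetric])
  have f: "integrable std_normal_distribution (\<lambda>x. x\<^sup>2 - 1)" "integrable std_normal_distribution (\<lambda>x. (x\<^sup>2 - 1)\<^sup>2)"
    "(\<integral>x. x\<^sup>2 - 1 \<partial>std_normal_distribution) = 0" "(\<integral>x. (x\<^sup>2 - 1)\<^sup>2 \<partial>std_normal_distribution) = 2"
    using i2 i4 e2 e4 S.prob_space unfolding q by simp_all
  show I: "integrable (normals n) (\<lambda>z. \<Sum>i<n. (z i)\<^sup>2)"
    using integral_normals_component(1)[OF i2] by (intro Bochner_Integration.integrable_sum) auto
  show "(\<integral>z. (\<Sum>i<n. (z i)\<^sup>2) \<partial>normals n) = real n"
    using integral_normals_component[OF i2] e2 by (subst Bochner_Integration.integral_sum) auto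
  have e: "(\<lambda>z. (\<Sum>i<n. (z i)\<^sup>2) - real n) = (\<lambda>z. \<Sum>i<n. (z i)\<^sup>2 - 1)"
    by (simp add: sum_subtractf)
  have "(\<integral>z. (\<Sum>i<n. (z i)\<^sup>2 - 1)\<^sup>2 \<partial>normals n) = 2 * real n"
    using normals_sum_square(2)[of n "\<lambda>i x. x\<^sup>2 - 1"] f by simp
  moreover have "(\<integral>z. \<bar>\<Sum>i<n. (z i)\<^sup>2 - 1\<bar> \<partial>normals n) \<le> sqrt (\<integral>z. (\<Sum>i<n. (z i)\<^sup>2 - 1)\<^sup>2 \<partial>normals n)"
    using normals_sum_square(1)[of n "\<lambda>i x. x\<^sup>2 - 1"] f I borel_measurable_integrable[OF I]
    by (intro N.expectation_abs_le_sqrt(2)) (auto simp: e[symmetric])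
  ultimately show "(\<integral>z. \<bar>(\<Sum>i<n. (z i)\<^sup>2) - real n\<bar> \<partial>normals n) \<le> sqrt (2 * real n)"
    by (simp add: sum_subtractf)
qed

subsection \<open>Hellinger affinity and total variation\<close>

text \<open>Pointwise \<open>|f - g| = |sqrt f - sqrt g| (sqrt f + sqrt g)\<close>, and the integral
  of the squared difference of the roots is 2 minus twice the affinity. In place of the
  Cauchy-Schwarz inequality, a pointwise inequality with a free parameter \<open>l\<close> is
  integrated and \<open>l\<close> is optimised at the end. Functions into \<open>[0,1]\<close> are
  allowed because the later stages of a sweep will act as test functions.\<close>

lemma integral_diff_le_affinity:
  fixes f g h :: "'a \<Rightarrow> real"
  assumes f: "integrable M f" "\<And>x. f x \<ge> 0" "(\<integral>x. f x \<partial>M) = 1"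
    and g: "integrable M g" "\<And>x. g x \<ge> 0" "(\<integral>x. g x \<partial>M) = 1"
    and h[measurable]: "h \<in> borel_measurable M" and h01: "\<And>x. 0 \<le> h x" "\<And>x. h x \<le> 1"
    and b: "(\<integral>x. sqrt (f x * g x) \<partial>M) \<ge> 1 - e"
  shows "\<bar>(\<integral>x. h x \<partial>density M f) - (\<integral>x. h x \<partial>density M g)\<bar> \<le> sqrt (8 * e)"
proof -
  have [measurable]: "f \<in> borel_measurable M" "g \<in> borel_measurable M"
    using f g by auto
  have amgm: "sqrt (f x * g x) \<le> (f x + g x) / 2" for x
    using arith_geo_mean_sqrt[OF f(2) g(2)] by simp
  have I: "integrable M (\<lambda>x. sqrt (f x * g x))"
    by (rule Bochner_Integration.integrable_bound[of _ "\<lambda>x. (f x + g x) / 2"]) (use f g amgm in auto)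
  have hf: "integrable M (\<lambda>x. f x * h x)" "integrable M (\<lambda>x. g x * h x)"
    by (rule Bochner_Integration.integrable_bound[OF f(1)] Bochner_Integration.integrable_bound[OF g(1)],
        simp, use f g h01 in \<open>auto simp: abs_mult intro!: AE_I2 mult_right_le_one_le\<close>)+
  have "(\<integral>x. sqrt (f x * g x) \<partial>M) \<le> (\<integral>x. (f x + g x) / 2 \<partial>M)"
    by (intro integral_mono I) (use f g amgm in auto)
  also have "\<dots> = 1" using f g by simp
  finally have e: "e \<ge> 0" using b by simp
  have "\<bar>(\<integral>x. h x \<partial>density M f) - (\<integral>x. h x \<partial>density M g)\<bar> = \<bar>\<integral>x. f x * h x - g x * h x \<partial>M\<bar>"
    using hf f g by (subst (1 2) integral_density) auto
  also have "\<dots> \<le> (\<integral>x. \<bar>f x * h x - g x * h x\<bar> \<partial>M)"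
    by (rule integral_abs_bound)
  also have "\<dots> \<le> (\<integral>x. \<bar>f x - g x\<bar> \<partial>M)"
    by (rule integral_mono)
       (use hf f g h01 in \<open>auto simp: left_diff_distrib[symmetric] abs_mult intro!: mult_right_le_one_le\<close>,
        use integrable_abs[OF Bochner_Integration.integrable_diff[OF hf]] h01 in
          \<open>simp add: left_diff_distrib[symmetric] abs_mult\<close>)
  finally have 1: "\<bar>(\<integral>x. h x \<partial>density M f) - (\<integral>x. h x \<partial>density M g)\<bar> \<le> (\<integral>x. \<bar>f x - g x\<bar> \<partial>M)" .
  \<comment> \<open>With \<open>u\<close>, \<open>v\<close> the two roots,
    \<open>|u - v| (u + v)\<close> is at most \<open>l/2 (u - v)^2 + (u + v)^2 / (2 l)\<close>, and
    the last square is at most \<open>2 (u^2 + v^2)\<close>, whose integral is 4.\<close>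
  have 2: "(\<integral>x. \<bar>f x - g x\<bar> \<partial>M) \<le> l * e + 2 / l" if l: "l > 0" for l
  proof -
    have pt: "\<bar>f x - g x\<bar> \<le> l / 2 * (f x + g x - 2 * sqrt (f x * g x)) + 1 / (2 * l) * (2 * (f x + g x))" for x
    proof -
      define u where "u = sqrt (f x)"
      define v where "v = sqrt (g x)"
      have uv: "u \<ge> 0" "v \<ge> 0" "f x = u\<^sup>2" "g x = v\<^sup>2" "sqrt (f x * g x) = u * v"
        using f(2) g(2) by (auto simp: u_def v_def real_sqrt_mult)
      have "\<bar>f x - g x\<bar> = \<bar>u - v\<bar> * (u + v)"
      proof -
        have "f x - g x = (u - v) * (u + v)" using uv by (simp add: power2_eq_square algebra_simps)
        then show ?thesis using uv by (simp add: abs_mult)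
      qed
      also have "\<dots> \<le> l / 2 * (u - v)\<^sup>2 + 1 / (2 * l) * (u + v)\<^sup>2"
      proof -
        have "0 \<le> (l * \<bar>u - v\<bar> - (u + v))\<^sup>2 / (2 * l)" using l by simp
        also have "\<dots> = (l\<^sup>2 * (u - v)\<^sup>2 - 2 * l * (\<bar>u - v\<bar> * (u + v)) + (u + v)\<^sup>2) / (2 * l)"
          by (simp only: power2_diff power_mult_distrib power2_abs) (simp add: mult_ac)
        also have "\<dots> = l / 2 * (u - v)\<^sup>2 + 1 / (2 * l) * (u + v)\<^sup>2 - \<bar>u - v\<bar> * (u + v)"
          using l by (simp add: add_divide_distrib diff_divide_distrib power2_eq_square)
        finally show ?thesis by simp
      qed
      also have "\<dots> \<le> l / 2 * (u - v)\<^sup>2 + 1 / (2 * l) * (2 * (u\<^sup>2 + v\<^sup>2))"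
        using l zero_le_power2[of "u - v"]
        by (intro add_left_mono mult_left_mono) (auto simp: power2_diff power2_sum)
      also have "\<dots> = l / 2 * (f x + g x - 2 * sqrt (f x * g x)) + 1 / (2 * l) * (2 * (f x + g x))"
        unfolding uv(5) unfolding uv(3,4) by (simp add: power2_diff algebra_simps)
      finally show ?thesis .
    qed
    have "(\<integral>x. \<bar>f x - g x\<bar> \<partial>M) \<le> (\<integral>x. l / 2 * (f x + g x - 2 * sqrt (f x * g x)) + 1 / (2 * l) * (2 * (f x + g x)) \<partial>M)"
      using f g I by (intro integral_mono pt) auto
    also have "\<dots> = l / 2 * (2 - 2 * (\<integral>x. sqrt (f x * g x) \<partial>M)) + 1 / (2 * l) * 4"
      using f g I by simp
    also have "\<dots> \<le> l / 2 * (2 * e) + 1 / (2 * l) * 4"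
      using b l by (intro add_right_mono mult_left_mono) auto
    finally show ?thesis using l by simp
  qed
  \<comment> \<open>For positive \<open>e\<close> the minimiser \<open>l = sqrt (2 / e)\<close>
    yields \<open>sqrt (8 * e)\<close>; for \<open>e = 0\<close> a large \<open>l\<close> forces the
    integral to vanish.\<close>
  have 3: "(\<integral>x. \<bar>f x - g x\<bar> \<partial>M) \<le> sqrt (8 * e)"
  proof (cases "e = 0")
    case True
    have "(\<integral>x. \<bar>f x - g x\<bar> \<partial>M) \<le> 0"
    proof (rule ccontr)
      assume "\<not> ?thesis"
      then show False
        using 2[of "4 / (\<integral>x. \<bar>f x - g x\<bar> \<partial>M)"] True by simp
    qed
    then show ?thesis using True by simp
  next
    case False
    then have "e > 0" using e by simp
    then have "sqrt (2 / e) * e + 2 / sqrt (2 / e) = sqrt (8 * e)"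
    proof -
      have s: "e = sqrt e * sqrt e" "sqrt e > 0" using \<open>e > 0\<close> by auto
      have "sqrt (2 / e) * e = sqrt 2 * sqrt e"
        using s by (simp add: real_sqrt_divide divide_simps)
      moreover have "2 / sqrt (2 / e) = sqrt 2 * sqrt e"
        using s by (simp add: real_sqrt_divide divide_simps)
      moreover have "sqrt 8 = 2 * sqrt 2" using real_sqrt_mult[of 4 2] by simp
      ultimately show ?thesis by (simp add: real_sqrt_mult)
    qed
    with 2[of "sqrt (2 / e)"] \<open>e > 0\<close> show ?thesis by simp
  qed
  from 1 3 show ?thesis by linarith
qed

text \<open>The Bhattacharyya coefficient of two normal laws given by means and standard
  deviations.\<close>

definition gauss_aff :: "real \<Rightarrow> real \<Rightarrow> real \<Rightarrow> real \<Rightarrow> real" where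
  "gauss_aff m1 s1 m2 s2 = sqrt (2 * s1 * s2 / (s1\<^sup>2 + s2\<^sup>2)) * exp (- (m1 - m2)\<^sup>2 / (4 * (s1\<^sup>2 + s2\<^sup>2)))"

text \<open>Completing the square: the geometric mean of two normal densities is a constant times a
  third normal density. As that one integrates to 1, the constant is the affinity.\<close>

lemma sqrt_normal_density_mult:
  assumes s: "s1 > 0" "s2 > 0"
  defines "q \<equiv> s1\<^sup>2 + s2\<^sup>2"
  shows "sqrt (normal_density m1 s1 x * normal_density m2 s2 x) =
    gauss_aff m1 s1 m2 s2 * normal_density ((m1 * s2\<^sup>2 + m2 * s1\<^sup>2) / q) (s1 * s2 * sqrt (2 / q)) x"
proof -
  have q: "q > 0" using s by (simp add: q_def add_pos_pos)
  let ?m = "(m1 * s2\<^sup>2 + m2 * s1\<^sup>2) / q" and ?s = "s1 * s2 * sqrt (2 / q)"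
  have nd: "normal_density m s x = 1 / (sqrt (2 * pi) * s) * exp (- (x - m)\<^sup>2 / (2 * s\<^sup>2))" if "s > 0" for m s
    using that by (simp add: normal_density_def real_sqrt_mult)
  have s': "?s > 0" using s q by simp
  have s2: "?s\<^sup>2 = 2 * s1\<^sup>2 * s2\<^sup>2 / q" using q by (simp add: power_mult_distrib)
  have expo: "- (x - m1)\<^sup>2 / (2 * s1\<^sup>2) / 2 + - (x - m2)\<^sup>2 / (2 * s2\<^sup>2) / 2
      = - (m1 - m2)\<^sup>2 / (4 * q) + - (x - ?m)\<^sup>2 / (2 * ?s\<^sup>2)"
  proof -
    have "x - ?m = (q * x - (m1 * s2\<^sup>2 + m2 * s1\<^sup>2)) / q" using q by (simp add: field_simps)
    then have "- (x - ?m)\<^sup>2 / (2 * ?s\<^sup>2) = - (q * x - (m1 * s2\<^sup>2 + m2 * s1\<^sup>2))\<^sup>2 / (4 * s1\<^sup>2 * s2\<^sup>2 * q)"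
      unfolding s2 using q s by (simp add: power_divide field_simps power2_eq_square)
    \<comment> \<open>The completed square with all denominators cleared, where it is a polynomial
      identity.\<close>
    moreover have "(x - m1)\<^sup>2 * s2\<^sup>2 * q + (x - m2)\<^sup>2 * s1\<^sup>2 * q
       = (m1 - m2)\<^sup>2 * s1\<^sup>2 * s2\<^sup>2 + (q * x - (m1 * s2\<^sup>2 + m2 * s1\<^sup>2))\<^sup>2"
      unfolding q_def by algebra
    moreover have "- (x - m1)\<^sup>2 / (2 * s1\<^sup>2) / 2 + - (x - m2)\<^sup>2 / (2 * s2\<^sup>2) / 2
        = - ((x - m1)\<^sup>2 * s2\<^sup>2 * q + (x - m2)\<^sup>2 * s1\<^sup>2 * q) / (4 * s1\<^sup>2 * s2\<^sup>2 * q)"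
      using q s by (simp add: divide_simps) (simp add: algebra_simps)
    moreover have "- ((m1 - m2)\<^sup>2 * s1\<^sup>2 * s2\<^sup>2 + r) / (4 * s1\<^sup>2 * s2\<^sup>2 * q)
        = - (m1 - m2)\<^sup>2 / (4 * q) + - r / (4 * s1\<^sup>2 * s2\<^sup>2 * q)" for r
      using q s by (simp add: add_divide_distrib diff_divide_distrib)
    ultimately show ?thesis by simp
  qed
  have "sqrt (normal_density m1 s1 x * normal_density m2 s2 x) =
     sqrt (1 / (2 * pi * (s1 * s2))) * exp (- (x - m1)\<^sup>2 / (2 * s1\<^sup>2) / 2 + - (x - m2)\<^sup>2 / (2 * s2\<^sup>2) / 2)"
  proof -
    have e: "exp a = (exp (a / 2))\<^sup>2" for a :: real by (simp add: power2_eq_square exp_add[symmetric])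
    have "normal_density m1 s1 x * normal_density m2 s2 x = 1 / (2 * pi * (s1 * s2)) *
       (exp (- (x - m1)\<^sup>2 / (2 * s1\<^sup>2) / 2 + - (x - m2)\<^sup>2 / (2 * s2\<^sup>2) / 2))\<^sup>2"
      unfolding nd[OF s(1)] nd[OF s(2)] exp_add power_mult_distrib e[symmetric]
      by (simp add: field_simps)
    then show ?thesis by (simp only: real_sqrt_mult real_sqrt_abs abs_exp_cancel)
  qed
  also have "\<dots> = sqrt (1 / (2 * pi * (s1 * s2))) * exp (- (m1 - m2)\<^sup>2 / (4 * q)) * exp (- (x - ?m)\<^sup>2 / (2 * ?s\<^sup>2))"
    unfolding expo exp_add by simp
  also have "sqrt (1 / (2 * pi * (s1 * s2))) = sqrt (2 * s1 * s2 / q) * (1 / (sqrt (2 * pi) * ?s))"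
  proof -
    have "(1 / (2 * pi * (s1 * s2))) = (2 * s1 * s2 / q) * (1 / (2 * pi * ?s\<^sup>2))"
      unfolding s2 using s q by (simp add: field_simps power2_eq_square)
    also have "sqrt \<dots> = sqrt (2 * s1 * s2 / q) * (1 / (sqrt (2 * pi) * ?s))"
      using s' by (simp only: real_sqrt_mult[of "2 * s1 * s2 / q"] real_sqrt_divide[of 1] real_sqrt_mult[of "2 * pi"]
          real_sqrt_abs abs_of_pos real_sqrt_one)
    finally show ?thesis .
  qed
  finally show ?thesis
    unfolding nd[OF s'] gauss_aff_def q_def[symmetric] by (simp add: mult_ac)
qed

text \<open>The affinity is \<open>sqrt r * exp (- y)\<close> with \<open>r\<close> in
  \<open>[0,1]\<close>, where \<open>1 - r\<close> and \<open>y\<close> are the two terms on the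
  right of the bound. From \<open>sqrt r \<ge> r\<close> and \<open>exp (- y) \<ge> 1 - y\<close> it
  is at least \<open>r - y\<close>.\<close>

lemma gauss_aff_bounds:
  assumes s: "s1 > 0" "s2 > 0"
  shows "1 - gauss_aff m1 s1 m2 s2 \<le> (s1 - s2)\<^sup>2 / (s1\<^sup>2 + s2\<^sup>2) + (m1 - m2)\<^sup>2 / (4 * (s1\<^sup>2 + s2\<^sup>2))"
    and "0 \<le> gauss_aff m1 s1 m2 s2" "gauss_aff m1 s1 m2 s2 \<le> 1"
proof -
  define q where "q = s1\<^sup>2 + s2\<^sup>2"
  have q: "q > 0" using s by (simp add: q_def add_pos_pos)
  define r where "r = 2 * s1 * s2 / q"
  define y where "y = (m1 - m2)\<^sup>2 / (4 * q)"
  have r: "r = 1 - (s1 - s2)\<^sup>2 / q" "r \<ge> 0"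
    using q s by (simp_all add: r_def q_def field_simps power2_diff)
  have r1: "r \<le> 1" using q by (simp add: r(1))
  have y: "y \<ge> 0" using q by (simp add: y_def)
  have g: "gauss_aff m1 s1 m2 s2 = sqrt r * exp (- y)"
    by (simp add: gauss_aff_def r_def y_def q_def)
  show "0 \<le> gauss_aff m1 s1 m2 s2" "gauss_aff m1 s1 m2 s2 \<le> 1"
    unfolding g using r r1 y by (auto intro!: mult_le_one)
  have "r * r \<le> r * 1" using r r1 by (intro mult_left_mono) auto
  then have "r \<le> sqrt r" by (intro real_le_rsqrt) (simp add: power2_eq_square)
  have "r - y \<le> r * (1 - y)" using r1 y mult_right_mono[of r 1 y] by (simp add: algebra_simps)
  also have "\<dots> \<le> r * exp (- y)" using exp_ge_add_one_self[of "- y"] r by (intro mult_left_mono) auto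
  also have "\<dots> \<le> sqrt r * exp (- y)" using \<open>r \<le> sqrt r\<close> by (intro mult_right_mono) auto
  finally show "1 - gauss_aff m1 s1 m2 s2 \<le> (s1 - s2)\<^sup>2 / (s1\<^sup>2 + s2\<^sup>2) + (m1 - m2)\<^sup>2 / (4 * (s1\<^sup>2 + s2\<^sup>2))"
    unfolding g using r(1) by (simp add: y_def q_def)
qed

text \<open>Affinities of products multiply, and the Weierstrass inequality bounds 1 minus a product
  by the sum of the defects. The relative change of the standard deviation is counted once per
  coordinate, so its cost is of order \<open>sqrt n\<close>.\<close>

lemma normals_tv:
  fixes f :: "(nat \<Rightarrow> real) \<Rightarrow> real"
  assumes s: "s1 > 0" "s2 > 0"
    and f[measurable]: "f \<in> borel_measurable (PiM {..<n} (\<lambda>_. lborel))" and f01: "\<And>x. 0 \<le> f x" "\<And>x. f x \<le> 1"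
  shows "\<bar>(\<integral>z. f (\<lambda>i\<in>{..<n}. m1 i + s1 * z i) \<partial>normals n) - (\<integral>z. f (\<lambda>i\<in>{..<n}. m2 i + s2 * z i) \<partial>normals n)\<bar>
    \<le> sqrt (8 * (real n * ((s1 - s2)\<^sup>2 / (s1\<^sup>2 + s2\<^sup>2)) + (\<Sum>i<n. (m1 i - m2 i)\<^sup>2) / (4 * (s1\<^sup>2 + s2\<^sup>2))))"
proof -
  let ?L = "PiM {..<n} (\<lambda>_. lborel :: real measure)"
  interpret L: product_sigma_finite "\<lambda>i::nat. lborel :: real measure" by standard
  define D where "D m s = (\<lambda>x. \<Prod>i<n. normal_density (m i) s (x i))" for m :: "nat \<Rightarrow> real" and s
  have D0: "D m s x \<ge> 0" for m s x unfolding D_def by (intro prod_nonneg) auto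
  have Di: "integrable ?L (D m s)" "(\<integral>x. D m s x \<partial>?L) = 1" if "s > 0" for m s
    unfolding D_def using that
    by (auto intro!: L.product_integrable_prod) (subst L.product_integral_prod; simp)
  have Dd: "(\<integral>z. f (\<lambda>i\<in>{..<n}. m i + s * z i) \<partial>normals n) = (\<integral>x. f x \<partial>density ?L (D m s))" if "s > 0" for m s
  proof -
    have "density ?L (D m s) = distr (normals n) ?L (\<lambda>z. \<lambda>i\<in>{..<n}. m i + s * z i)"
      unfolding PiM_normal_eq_distr[OF that, symmetric] D_def
      by (subst PiM_density_lborel) (auto simp: prod_ennreal that intro: prob_space_normal_density)
    moreover have "(\<integral>x. f x \<partial>distr (normals n) ?L (\<lambda>z. \<lambda>i\<in>{..<n}. m i + s * z i))
        = (\<integral>z. f (\<lambda>i\<in>{..<n}. m i + s * z i) \<partial>normals n)"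
      by (rule integral_distr) measurable
    ultimately show ?thesis by simp
  qed
  define q where "q = s1\<^sup>2 + s2\<^sup>2"
  define m where "m i = (m1 i * s2\<^sup>2 + m2 i * s1\<^sup>2) / q" for i
  define s where "s = s1 * s2 * sqrt (2 / q)"
  have s': "s > 0" using assms(1,2) by (simp add: s_def q_def add_pos_pos)
  let ?y = "\<lambda>i. (s1 - s2)\<^sup>2 / (s1\<^sup>2 + s2\<^sup>2) + (m1 i - m2 i)\<^sup>2 / (4 * (s1\<^sup>2 + s2\<^sup>2))"
  have sq: "sqrt (D m1 s1 x * D m2 s2 x) = (\<Prod>i<n. gauss_aff (m1 i) s1 (m2 i) s2) * D m s x" for x
  proof -
    have "sqrt (\<Prod>i\<in>A. g i) = (\<Prod>i\<in>A. sqrt (g i))" for A and g :: "nat \<Rightarrow> real"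
      by (induction A rule: infinite_finite_induct) (auto simp: real_sqrt_mult)
    then show ?thesis
      unfolding D_def prod.distrib[symmetric]
      by (simp add: sqrt_normal_density_mult[OF assms(1,2)] q_def m_def s_def)
  qed
  have "1 - (\<Sum>i<n. ?y i) \<le> 1 - (\<Sum>i<n. 1 - gauss_aff (m1 i) s1 (m2 i) s2)"
    using gauss_aff_bounds(1)[OF assms(1,2)] by (intro diff_left_mono sum_mono) auto
  also have "\<dots> \<le> (\<Prod>i<n. 1 - (1 - gauss_aff (m1 i) s1 (m2 i) s2))"
    using gauss_aff_bounds(2,3)[OF assms(1,2)] by (intro Weierstrass_prod_ineq) auto
  also have "\<dots> = (\<integral>x. sqrt (D m1 s1 x * D m2 s2 x) \<partial>?L)"
    unfolding sq using Di[OF s'] by simp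
  finally have b: "(\<integral>x. sqrt (D m1 s1 x * D m2 s2 x) \<partial>?L) \<ge> 1 - (\<Sum>i<n. ?y i)" .
  have "(\<Sum>i<n. ?y i) = real n * ((s1 - s2)\<^sup>2 / (s1\<^sup>2 + s2\<^sup>2)) + (\<Sum>i<n. (m1 i - m2 i)\<^sup>2) / (4 * (s1\<^sup>2 + s2\<^sup>2))"
    by (simp add: sum.distrib sum_divide_distrib)
  with integral_diff_le_affinity[OF Di(1) D0 Di(2) Di(1) D0 Di(2) f f01 b, of] s
  show ?thesis by (simp add: Dd)
qed

lemma std_normal_tv:
  fixes f :: "real \<Rightarrow> real"
  assumes s: "s1 > 0" "s2 > 0"
    and f[measurable]: "f \<in> borel_measurable borel" and f01: "\<And>x. 0 \<le> f x" "\<And>x. f x \<le> 1"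
  shows "\<bar>(\<integral>x. f (m1 + s1 * x) \<partial>std_normal_distribution) - (\<integral>x. f (m2 + s2 * x) \<partial>std_normal_distribution)\<bar>
    \<le> sqrt (8 * ((s1 - s2)\<^sup>2 / (s1\<^sup>2 + s2\<^sup>2) + (m1 - m2)\<^sup>2 / (4 * (s1\<^sup>2 + s2\<^sup>2))))"
proof -
  define q where "q = s1\<^sup>2 + s2\<^sup>2"
  define m where "m = (m1 * s2\<^sup>2 + m2 * s1\<^sup>2) / q"
  define s where "s = s1 * s2 * sqrt (2 / q)"
  have s': "s > 0" using assms(1,2) by (simp add: s_def q_def add_pos_pos)
  have d: "(\<integral>x. f (m + s * x) \<partial>std_normal_distribution) = (\<integral>x. f x \<partial>density lborel (normal_density m s))" if "s > 0" for m s
    unfolding normal_eq_distr[OF that] by (subst integral_distr) auto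
  have "(\<integral>x. sqrt (normal_density m1 s1 x * normal_density m2 s2 x) \<partial>lborel) = gauss_aff m1 s1 m2 s2"
    unfolding sqrt_normal_density_mult[OF assms(1,2)] using s' by (simp add: q_def s_def)
  then have "(\<integral>x. sqrt (normal_density m1 s1 x * normal_density m2 s2 x) \<partial>lborel)
      \<ge> 1 - ((s1 - s2)\<^sup>2 / (s1\<^sup>2 + s2\<^sup>2) + (m1 - m2)\<^sup>2 / (4 * (s1\<^sup>2 + s2\<^sup>2)))"
    using gauss_aff_bounds(1)[OF assms(1,2), of m1 m2] by simp
  from integral_diff_le_affinity[OF _ _ _ _ _ _ _ f01 this] s show ?thesis
    by (simp add: d)
qed

subsection \<open>The Gibbs sampler driven by noise with a fixed law\<close>

lemma tbar_measurable [measurable]: "tbar n \<in> borel_measurable (PiM {..<n} (\<lambda>_. lborel))"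
  unfolding tbar_def by measurable

locale gibbs =
  fixes V a b0 :: real and Y :: "nat \<Rightarrow> nat \<Rightarrow> real" and n :: nat
  assumes V: "V > 0" and a: "a > 0" and b0: "b0 > 0" and n2: "n \<ge> 2"
begin

definition shp :: real where "shp = a + (real n - 1) / 2"

definition rate :: "(nat \<Rightarrow> real) \<Rightarrow> real" where
  "rate \<theta> = b0 + (\<Sum>i<n. (\<theta> i - tbar n \<theta>)\<^sup>2) / 2"

definition upd :: "real \<Rightarrow> real \<Rightarrow> (nat \<Rightarrow> real) \<Rightarrow> nat \<Rightarrow> real" where
  "upd A \<mu> z = (\<lambda>i\<in>{..<n}. (\<mu> * V + Y n i * A) / (V + A) + sqrt (A * V / (V + A)) * z i)"

definition noise :: "(real \<times> (nat \<Rightarrow> real) \<times> real) measure" where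
  "noise = std_normal_distribution \<Otimes>\<^sub>M (normals n \<Otimes>\<^sub>M ig shp 1)"

text \<open>The noise \<open>\<omega> = (\<xi>, z, h)\<close> drives \<open>\<mu>\<close>, \<open>\<theta>\<close> and \<open>A\<close>; the argument \<open>t\<close> is the mean of the old \<open>\<theta>\<close>.\<close>

definition mv :: "real \<Rightarrow> real \<Rightarrow> real \<times> (nat \<Rightarrow> real) \<times> real \<Rightarrow> state" where
  "mv A t \<omega> = (snd (snd \<omega>) * rate (upd A (t + sqrt (A / real n) * fst \<omega>) (fst (snd \<omega>))),
     t + sqrt (A / real n) * fst \<omega>, upd A (t + sqrt (A / real n) * fst \<omega>) (fst (snd \<omega>)))"

abbreviation "thetas \<equiv> PiM {..<n} (\<lambda>_. lborel :: real measure)"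

lemma shp_pos: "shp > 0"
  using a n2 by (auto simp: shp_def intro!: add_pos_nonneg)

lemma rate_pos: "rate \<theta> > 0" and rate_ge: "rate \<theta> \<ge> b0"
  using b0 by (auto simp: rate_def intro!: add_pos_nonneg sum_nonneg)

lemma rate_measurable [measurable]: "rate \<in> borel_measurable thetas"
  unfolding rate_def tbar_def by measurable

lemma upd_measurable [measurable (raw)]:
  assumes [measurable]: "f \<in> borel_measurable M" "g \<in> borel_measurable M" "h \<in> measurable M thetas"
  shows "(\<lambda>p. upd (f p) (g p) (h p)) \<in> measurable M thetas"
  unfolding upd_def
proof (rule measurable_restrict)
  fix i assume "i \<in> {..<n}"
  then have [measurable]: "(\<lambda>p. h p i) \<in> borel_measurable M"
    using measurable_compose[OF assms(3) measurable_component_singleton] by simp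
  show "(\<lambda>p. (g p * V + Y n i * f p) / (V + f p) + sqrt (f p * V / (V + f p)) * h p i) \<in> measurable M lborel"
    by measurable
qed

lemma triple_measurable:
  assumes "f \<in> borel_measurable M" "\<And>p. p \<in> space M \<Longrightarrow> f p > 0"
    and "g \<in> borel_measurable M" "h \<in> measurable M thetas"
  shows "(\<lambda>p. (f p, g p, h p)) \<in> measurable M (Xsp n)"
  unfolding Xsp_def using assms
  by (intro measurable_Pair measurable_into_Apos) (auto simp: measurable_lborel1)

lemma prob_space_ig1: "prob_space (ig shp 1)"
  by (intro prob_space_ig shp_pos) simp

lemma prob_space_noise: "prob_space noise"
  unfolding noise_def
  by (intro prob_space_pair prob_space_std_normal prob_space_normals prob_space_ig1)

lemma noise_h_measurable [measurable]: "(\<lambda>\<omega>. snd (snd \<omega>)) \<in> borel_measurable noise"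
  unfolding noise_def
  by (intro measurable_compose[OF measurable_snd] measurable_compose[OF measurable_snd, of _ _ borel] measurable_igI) simp_all

lemma noise_xi_measurable [measurable]: "fst \<in> borel_measurable noise"
  unfolding noise_def by measurable

lemma noise_z_measurable [measurable]: "(\<lambda>\<omega>. fst (snd \<omega>)) \<in> measurable noise thetas"
  unfolding noise_def by measurable

lemma space_noise: "\<omega> \<in> space noise \<Longrightarrow> snd (snd \<omega>) > 0"
  by (auto simp: noise_def space_pair_measure space_ig)

lemma space_Xsp_pos: "x \<in> space (Xsp n) \<Longrightarrow> fst x > 0"
  by (auto simp: Xsp_def space_pair_measure space_Apos)

lemma Xsp_fst_measurable [measurable]: "fst \<in> borel_measurable (Xsp n)"
  unfolding Xsp_def by (intro measurable_compose[OF measurable_fst] measurable_AposI) simp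

lemma Xsp_mu_measurable [measurable]: "(\<lambda>x. fst (snd x)) \<in> borel_measurable (Xsp n)"
  unfolding Xsp_def by measurable

lemma Xsp_theta_measurable [measurable]: "(\<lambda>x. snd (snd x)) \<in> measurable (Xsp n) thetas"
  unfolding Xsp_def by measurable

lemma mv_measurable [measurable]: "mv A t \<in> measurable noise (Xsp n)"
  unfolding mv_def by (intro triple_measurable) (auto intro!: mult_pos_pos space_noise rate_pos)

lemma mv_measurable_pair:
  "(\<lambda>p. mv (fst (fst p)) (tbar n (snd (snd (fst p)))) (snd p)) \<in> measurable (Xsp n \<Otimes>\<^sub>M noise) (Xsp n)"
proof -
  have [measurable]: "(\<lambda>p. fst (fst p)) \<in> borel_measurable (Xsp n \<Otimes>\<^sub>M noise)"
    "(\<lambda>p. snd (snd (snd p))) \<in> borel_measurable (Xsp n \<Otimes>\<^sub>M noise)"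
    "(\<lambda>p. fst (snd p)) \<in> borel_measurable (Xsp n \<Otimes>\<^sub>M noise)"
    "(\<lambda>p. fst (snd (snd p))) \<in> measurable (Xsp n \<Otimes>\<^sub>M noise) thetas"
    "(\<lambda>p. snd (snd (fst p))) \<in> measurable (Xsp n \<Otimes>\<^sub>M noise) thetas"
    by (rule measurable_compose[OF measurable_fst Xsp_fst_measurable]
        measurable_compose[OF measurable_snd noise_h_measurable]
        measurable_compose[OF measurable_snd noise_xi_measurable]
        measurable_compose[OF measurable_snd noise_z_measurable]
        measurable_compose[OF measurable_fst Xsp_theta_measurable])+
  show ?thesis
    unfolding mv_def
    by (intro triple_measurable) (auto intro!: mult_pos_pos space_noise rate_pos simp: space_pair_measure)
qed

text \<open>The equality is between functions of \<open>\<mu>\<close>, so that the kernel under the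
  outermost bind of \<open>gibbs_step\<close> can be exchanged by congruence.\<close>

lemma bind_thetas_ig:
  assumes A: "A > 0"
  defines "K \<equiv> \<lambda>\<mu>. bind (PiM {..<n} (\<lambda>i. density lborel
             (normal_density ((\<mu> * V + Y n i * A) / (V + A)) (sqrt (A * V / (V + A)))))) (\<lambda>\<theta>'.
     bind (ig shp (rate \<theta>')) (\<lambda>A'. return (Xsp n) (A', \<mu>, \<theta>')))"
  shows "K = (\<lambda>\<mu>. normals n \<bind> (\<lambda>z. distr (ig shp 1) (Xsp n) (\<lambda>h. (h * rate (upd A \<mu> z), \<mu>, upd A \<mu> z))))"
proof
  fix \<mu>
  let ?s = "sqrt (A * V / (V + A))"
  interpret I: prob_space "ig shp 1" by (rule prob_space_ig1)
  have s: "?s > 0" using A V by simp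
  have 1: "ig shp (rate \<theta>) \<bind> (\<lambda>A'. return (Xsp n) (A', \<mu>, \<theta>)) = distr (ig shp 1) (Xsp n) (\<lambda>h. (h * rate \<theta>, \<mu>, \<theta>))"
    if th: "\<theta> \<in> space thetas" for \<theta>
  proof -
    have m: "(\<lambda>A'. (A', \<mu>, \<theta>)) \<in> measurable Apos (Xsp n)"
      using th by (intro triple_measurable) (auto simp: space_Apos intro: measurable_AposI)
    have m': "(\<lambda>h. h * rate \<theta>) \<in> measurable (ig shp 1) Apos"
      using rate_pos[of \<theta>] by (intro measurable_into_Apos measurable_igI) (auto simp: space_ig)
    have "ig shp (rate \<theta>) \<bind> (\<lambda>A'. return (Xsp n) (A', \<mu>, \<theta>)) = distr (ig shp (rate \<theta>)) (Xsp n) (\<lambda>A'. (A', \<mu>, \<theta>))"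
      using m by (intro bind_return_distr') (auto simp: space_ig cong: measurable_cong_sets sets_ig)
    also have "\<dots> = distr (ig shp 1) (Xsp n) (\<lambda>h. (h * rate \<theta>, \<mu>, \<theta>))"
      unfolding ig_scale_eq_distr[OF rate_pos] by (subst distr_distr[OF m m']) (simp add: comp_def)
    finally show ?thesis .
  qed
  have k: "(\<lambda>\<theta>. distr (ig shp 1) (Xsp n) (\<lambda>h. (h * rate \<theta>, \<mu>, \<theta>))) \<in> measurable thetas (subprob_algebra (Xsp n))"
  proof (rule measurable_distr2[where M="ig shp 1"])
    have [measurable]: "(\<lambda>p. snd p) \<in> borel_measurable (thetas \<Otimes>\<^sub>M ig shp 1)"
      by (rule measurable_compose[OF measurable_snd]) (rule measurable_igI, simp)
    show "(\<lambda>(\<theta>, h). (h * rate \<theta>, \<mu>, \<theta>)) \<in> thetas \<Otimes>\<^sub>M ig shp 1 \<rightarrow>\<^sub>M Xsp n"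
      unfolding split_beta' by (intro triple_measurable) (auto simp: space_pair_measure space_ig intro!: mult_pos_pos rate_pos)
    show "(\<lambda>\<theta>. ig shp 1) \<in> thetas \<rightarrow>\<^sub>M subprob_algebra (ig shp 1)"
      by (rule measurable_const) (rule I.M_in_subprob)
  qed
  have "K \<mu> = bind (distr (normals n) thetas (upd A \<mu>)) (\<lambda>\<theta>'.
     bind (ig shp (rate \<theta>')) (\<lambda>A'. return (Xsp n) (A', \<mu>, \<theta>')))"
    unfolding K_def PiM_normal_eq_distr[OF s] upd_def ..
  also have "\<dots> = bind (distr (normals n) thetas (upd A \<mu>)) (\<lambda>\<theta>. distr (ig shp 1) (Xsp n) (\<lambda>h. (h * rate \<theta>, \<mu>, \<theta>)))"
    using 1 by (intro bind_cong refl) auto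
  also have "\<dots> = normals n \<bind> (\<lambda>z. distr (ig shp 1) (Xsp n) (\<lambda>h. (h * rate (upd A \<mu> z), \<mu>, upd A \<mu> z)))"
  proof (rule bind_distr[OF _ k])
    show "upd A \<mu> \<in> normals n \<rightarrow>\<^sub>M thetas"
      using upd_measurable[of "\<lambda>_. A" "normals n" "\<lambda>_. \<mu>" "\<lambda>z. z"] by simp
    show "space (normals n) \<noteq> {}" using prob_space.not_empty[OF prob_space_normals] .
  qed
  finally show "K \<mu> = normals n \<bind> (\<lambda>z. distr (ig shp 1) (Xsp n) (\<lambda>h. (h * rate (upd A \<mu> z), \<mu>, upd A \<mu> z)))" .
qed

text \<open>The nested binds collapse by Fubini to the image of one fixed measure. All dependence on
  the state now sits in the map \<open>mv\<close>, so two starting points can be run on the same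
  \<open>\<omega>\<close>. The right-hand side reads \<open>\<theta>\<close> only through its mean
  and does not read \<open>\<mu>\<close>.\<close>

lemma gibbs_step_eq_distr:
  assumes A: "A > 0"
  shows "gibbs_step V a b0 Y n (A, \<mu>, \<theta>) = distr noise (Xsp n) (mv A (tbar n \<theta>))"
proof -
  define t where "t = tbar n \<theta>"
  let ?s = "sqrt (A / real n)"
  interpret I: prob_space "ig shp 1" by (rule prob_space_ig1)
  interpret N: prob_space "normals n" by (rule prob_space_normals)
  interpret S: prob_space std_normal_distribution by (rule prob_space_std_normal)
  have NI: "sigma_finite_measure (normals n \<Otimes>\<^sub>M ig shp 1)"
    by (intro prob_space_imp_sigma_finite prob_space_pair prob_space_normals prob_space_ig1)
  have s: "?s > 0" using A n2 by simp
  define K where "K \<mu> = normals n \<bind> (\<lambda>z. distr (ig shp 1) (Xsp n) (\<lambda>h. (h * rate (upd A \<mu> z), \<mu>, upd A \<mu> z)))" for \<mu>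
  have k1: "(\<lambda>(\<mu>, z). distr (ig shp 1) (Xsp n) (\<lambda>h. (h * rate (upd A \<mu> z), \<mu>, upd A \<mu> z)))
      \<in> measurable (borel \<Otimes>\<^sub>M normals n) (subprob_algebra (Xsp n))"
    unfolding split_beta'
  proof (rule measurable_distr2[where M="ig shp 1"])
    have [measurable]: "(\<lambda>p. snd p) \<in> borel_measurable ((borel \<Otimes>\<^sub>M normals n) \<Otimes>\<^sub>M ig shp 1)"
      by (rule measurable_compose[OF measurable_snd]) (rule measurable_igI, simp)
    show "(\<lambda>(p, h). (h * rate (upd A (fst p) (snd p)), fst p, upd A (fst p) (snd p)))
       \<in> (borel \<Otimes>\<^sub>M normals n) \<Otimes>\<^sub>M ig shp 1 \<rightarrow>\<^sub>M Xsp n"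
      unfolding split_beta' by (intro triple_measurable) (auto simp: space_pair_measure space_ig intro!: mult_pos_pos rate_pos)
    show "(\<lambda>p. ig shp 1) \<in> borel \<Otimes>\<^sub>M normals n \<rightarrow>\<^sub>M subprob_algebra (ig shp 1)"
      by (rule measurable_const) (rule I.M_in_subprob)
  qed
  have K: "K \<in> measurable borel (subprob_algebra (Xsp n))"
    unfolding K_def by (rule measurable_bind'[OF measurable_const k1]) (rule N.M_in_subprob)
  have Ks: "(\<lambda>x. K (t + ?s * x)) \<in> measurable std_normal_distribution (subprob_algebra (Xsp n))"
    by (rule measurable_compose[OF _ K]) simp
  have "gibbs_step V a b0 Y n (A, \<mu>, \<theta>) = bind (density lborel (normal_density t ?s)) K"
    unfolding gibbs_step_def prod.case K_def t_def ig_def[symmetric] shp_def[symmetric] rate_def[symmetric]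
    by (rule arg_cong[OF bind_thetas_ig[OF A]])
  also have "\<dots> = std_normal_distribution \<bind> (\<lambda>x. K (t + ?s * x))"
    unfolding normal_eq_distr[OF s] using K by (intro bind_distr) auto
  also have "\<dots> = distr noise (Xsp n) (mv A t)"
  proof (rule measure_eqI)
    show "sets (std_normal_distribution \<bind> (\<lambda>x. K (t + ?s * x))) = sets (distr noise (Xsp n) (mv A t))"
      using sets_bind[OF sets_kernel[OF Ks] S.not_empty] by simp
  next
    fix B assume "B \<in> sets (std_normal_distribution \<bind> (\<lambda>x. K (t + ?s * x)))"
    then have B[measurable]: "B \<in> sets (Xsp n)" using sets_bind[OF sets_kernel[OF Ks] S.not_empty] by simp
    have "emeasure (std_normal_distribution \<bind> (\<lambda>x. K (t + ?s * x))) B = (\<integral>\<^sup>+x. emeasure (K (t + ?s * x)) B \<partial>std_normal_distribution)"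
      by (rule emeasure_bind[OF _ Ks B]) simp
    also have "\<dots> = (\<integral>\<^sup>+x. \<integral>\<^sup>+w. indicator B (mv A t (x, w)) \<partial>(normals n \<Otimes>\<^sub>M ig shp 1) \<partial>std_normal_distribution)"
    proof (intro nn_integral_cong)
      fix x :: real
      let ?\<mu> = "t + ?s * x"
      have m: "(\<lambda>w. mv A t (x, w)) \<in> measurable (normals n \<Otimes>\<^sub>M ig shp 1) (Xsp n)"
        using measurable_compose[OF _ mv_measurable[of A t], of "\<lambda>w. (x, w)" "normals n \<Otimes>\<^sub>M ig shp 1"]
        by (simp add: noise_def)
      have k2: "(\<lambda>z. distr (ig shp 1) (Xsp n) (\<lambda>h. (h * rate (upd A ?\<mu> z), ?\<mu>, upd A ?\<mu> z))) \<in> measurable (normals n) (subprob_algebra (Xsp n))"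
        using measurable_compose[OF _ k1, of "\<lambda>z. (?\<mu>, z)" "normals n"] by simp
      have "emeasure (K ?\<mu>) B = (\<integral>\<^sup>+z. emeasure (distr (ig shp 1) (Xsp n) (\<lambda>h. (h * rate (upd A ?\<mu> z), ?\<mu>, upd A ?\<mu> z))) B \<partial>normals n)"
        unfolding K_def by (rule emeasure_bind[OF N.not_empty k2 B])
      also have "\<dots> = (\<integral>\<^sup>+z. \<integral>\<^sup>+h. indicator B (mv A t (x, z, h)) \<partial>ig shp 1 \<partial>normals n)"
      proof (intro nn_integral_cong)
        fix z assume z: "z \<in> space (normals n)"
        have m1: "(\<lambda>h. mv A t (x, z, h)) \<in> measurable (ig shp 1) (Xsp n)"
          using measurable_compose[OF measurable_Pair1'[OF z] m] by simp
        have eq: "(\<lambda>h. (h * rate (upd A ?\<mu> z), ?\<mu>, upd A ?\<mu> z)) = (\<lambda>h. mv A t (x, z, h))"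
          by (simp add: mv_def)
        have "emeasure (distr (ig shp 1) (Xsp n) (\<lambda>h. mv A t (x, z, h))) B
            = (\<integral>\<^sup>+y. indicator B y \<partial>distr (ig shp 1) (Xsp n) (\<lambda>h. mv A t (x, z, h)))" by simp
        also have "\<dots> = (\<integral>\<^sup>+h. indicator B (mv A t (x, z, h)) \<partial>ig shp 1)"
          by (rule nn_integral_distr[OF m1]) simp
        finally show "emeasure (distr (ig shp 1) (Xsp n) (\<lambda>h. (h * rate (upd A ?\<mu> z), ?\<mu>, upd A ?\<mu> z))) B
            = (\<integral>\<^sup>+h. indicator B (mv A t (x, z, h)) \<partial>ig shp 1)" unfolding eq .
      qed
      also have "\<dots> = (\<integral>\<^sup>+w. indicator B (mv A t (x, w)) \<partial>(normals n \<Otimes>\<^sub>M ig shp 1))"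
        using I.nn_integral_fst[of "\<lambda>w. indicator B (mv A t (x, w))" "normals n"] measurable_compose[OF m, of "indicator B" borel]
        by simp
      finally show "emeasure (K ?\<mu>) B = (\<integral>\<^sup>+w. indicator B (mv A t (x, w)) \<partial>(normals n \<Otimes>\<^sub>M ig shp 1))" .
    qed
    also have "\<dots> = (\<integral>\<^sup>+w. indicator B (mv A t w) \<partial>noise)"
      using sigma_finite_measure.nn_integral_fst[OF NI, of "\<lambda>w. indicator B (mv A t w)" std_normal_distribution]
         measurable_compose[OF mv_measurable, of "indicator B" borel A t]
      by (simp add: noise_def)
    also have "\<dots> = (\<integral>\<^sup>+y. indicator B y \<partial>distr noise (Xsp n) (mv A t))"
      by (rule nn_integral_distr[symmetric]) simp_all
    also have "\<dots> = emeasure (distr noise (Xsp n) (mv A t)) B" by simp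
    finally show "emeasure (std_normal_distribution \<bind> (\<lambda>x. K (t + ?s * x))) B = emeasure (distr noise (Xsp n) (mv A t)) B" .
  qed
  finally show ?thesis by (simp add: t_def)
qed

section \<open>The transition operator on test functions with values in [0,1]\<close>

definition Pop :: "(state \<Rightarrow> real) \<Rightarrow> state \<Rightarrow> real" where
  "Pop h x = (\<integral>\<omega>. h (mv (fst x) (tbar n (snd (snd x))) \<omega>) \<partial>noise)"

definition test :: "(state \<Rightarrow> real) \<Rightarrow> bool" where
  "test h \<longleftrightarrow> h \<in> borel_measurable (Xsp n) \<and> (\<forall>x. 0 \<le> h x \<and> h x \<le> 1)"

lemma testD: "test h \<Longrightarrow> h \<in> borel_measurable (Xsp n)" "test h \<Longrightarrow> 0 \<le> h x" "test h \<Longrightarrow> h x \<le> 1"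
  unfolding test_def by blast+

lemma integrable_test_mv:
  assumes "test h"
  shows "integrable noise (\<lambda>\<omega>. h (mv A t \<omega>))"
proof -
  interpret prob_space noise by (rule prob_space_noise)
  have [measurable]: "h \<in> borel_measurable (Xsp n)" using assms by (simp add: test_def)
  have "\<bar>h x\<bar> \<le> 1" for x using assms by (cases x) (auto simp: test_def)
  then show ?thesis by (intro integrable_const_bound[of _ 1]) auto
qed

lemma test_Pop:
  assumes h: "test h"
  shows "test (Pop h)"
  unfolding test_def
proof (intro conjI allI)
  interpret prob_space noise by (rule prob_space_noise)
  have [measurable]: "h \<in> borel_measurable (Xsp n)" using h by (simp add: test_def)
  have "(\<lambda>p. h (mv (fst (fst p)) (tbar n (snd (snd (fst p)))) (snd p))) \<in> borel_measurable (Xsp n \<Otimes>\<^sub>M noise)"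
    by (rule measurable_compose[OF mv_measurable_pair]) simp
  then show "Pop h \<in> borel_measurable (Xsp n)"
    unfolding Pop_def by (intro borel_measurable_lebesgue_integral) (simp add: split_beta')
  fix x
  show "0 \<le> Pop h x" unfolding Pop_def using h by (intro integral_nonneg_AE) (auto simp: testD)
  have "Pop h x \<le> (\<integral>\<omega>. 1 \<partial>noise)"
    unfolding Pop_def using h by (intro integral_mono integrable_test_mv[OF h]) (auto simp: testD)
  then show "Pop h x \<le> 1" by (simp add: prob_space)
qed

lemma test_Pop_iter: "test h \<Longrightarrow> test ((Pop ^^ k) h)"
  by (induction k) (auto intro: test_Pop)

lemma gibbs_step_eq_distr':
  assumes "x \<in> space (Xsp n)"
  shows "gibbs_step V a b0 Y n x = distr noise (Xsp n) (mv (fst x) (tbar n (snd (snd x))))"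
  using gibbs_step_eq_distr[of "fst x" "fst (snd x)" "snd (snd x)"] space_Xsp_pos[OF assms] by simp

lemma integral_gibbs_step:
  assumes "test h" "x \<in> space (Xsp n)"
  shows "(\<integral>y. h y \<partial>gibbs_step V a b0 Y n x) = Pop h x"
  unfolding gibbs_step_eq_distr'[OF assms(2)] Pop_def
  by (rule integral_distr) (use assms in \<open>simp_all add: test_def\<close>)

lemma gibbs_step_kernel: "gibbs_step V a b0 Y n \<in> measurable (Xsp n) (subprob_algebra (Xsp n))"
proof -
  interpret prob_space noise by (rule prob_space_noise)
  have "(\<lambda>x. distr noise (Xsp n) (mv (fst x) (tbar n (snd (snd x))))) \<in> measurable (Xsp n) (subprob_algebra (Xsp n))"
      by (rule measurable_distr2[where M=noise])
       (use mv_measurable_pair in \<open>simp add: split_beta'\<close>, intro measurable_const M_in_subprob)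
  then show ?thesis
    using measurable_cong[of "Xsp n" "gibbs_step V a b0 Y n" "\<lambda>x. distr noise (Xsp n) (mv (fst x) (tbar n (snd (snd x))))"]
      gibbs_step_eq_distr' by blast
qed

lemma prob_space_gibbs_step: "x \<in> space (Xsp n) \<Longrightarrow> prob_space (gibbs_step V a b0 Y n x)"
  by (subst gibbs_step_eq_distr') (auto intro: prob_space.prob_space_distr prob_space_noise)

text \<open>Duality between laws and test functions. The three claims are proved together because
  the bind rules for the next law need the previous one to be a probability measure on the right
  sigma-algebra. A further sweep acts next to \<open>h\<close>, whereas \<open>funpow\<close>
  unfolds on the outside, hence \<open>funpow_swap1\<close>.\<close>

lemma gibbs_law_facts:
  assumes x0: "x0 \<in> space (Xsp n)"
  shows "prob_space (gibbs_law V a b0 Y n x0 k) \<and> sets (gibbs_law V a b0 Y n x0 k) = sets (Xsp n) \<and>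
    (\<forall>h. test h \<longrightarrow> (\<integral>x. h x \<partial>gibbs_law V a b0 Y n x0 k) = (Pop ^^ k) h x0)"
proof (induction k)
  case 0
  show ?case using x0 by (auto simp: prob_space_return test_def intro!: integral_return)
next
  case (Suc k)
  let ?L = "gibbs_law V a b0 Y n x0 k"
  interpret L: prob_space ?L using Suc by simp
  have s: "sets ?L = sets (Xsp n)" using Suc by simp
  note sp = sets_eq_imp_space_eq[OF s]
  have K: "gibbs_step V a b0 Y n \<in> measurable ?L (subprob_algebra (Xsp n))"
    using gibbs_step_kernel by (simp cong: measurable_cong_sets add: s)
  have ps: "AE x in ?L. prob_space (gibbs_step V a b0 Y n x)"
    by (rule AE_I2) (simp add: sp prob_space_gibbs_step)
  show ?case
  proof (intro conjI allI impI)
    show "prob_space (gibbs_law V a b0 Y n x0 (Suc k))"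
      using L.prob_space_bind[OF ps K] by simp
    show "sets (gibbs_law V a b0 Y n x0 (Suc k)) = sets (Xsp n)"
      using sets_bind[OF sets_kernel[OF K] L.not_empty] by simp
    fix h assume h: "test h"
    have "(\<integral>x. h x \<partial>gibbs_law V a b0 Y n x0 (Suc k)) = (\<integral>x. \<integral>y. h y \<partial>gibbs_step V a b0 Y n x \<partial>?L)"
      unfolding gibbs_law.simps
    proof (rule integral_bind[where K="Xsp n" and B=1 and B'=1])
      show "AE x in ?L. emeasure (gibbs_step V a b0 Y n x) (space (gibbs_step V a b0 Y n x)) \<le> ennreal 1"
        using ps by eventually_elim (simp add: prob_space.emeasure_space_1)
    qed (use h K in \<open>auto simp: testD intro: L.finite_measure\<close>)
    also have "\<dots> = (\<integral>x. Pop h x \<partial>?L)"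
      by (intro Bochner_Integration.integral_cong refl integral_gibbs_step h) (simp add: sp)
    also have "\<dots> = (Pop ^^ Suc k) h x0"
      using Suc test_Pop[OF h] by (simp add: funpow_swap1)
    finally show "(\<integral>x. h x \<partial>gibbs_law V a b0 Y n x0 (Suc k)) = (Pop ^^ Suc k) h x0" .
  qed
qed

lemma test_indicator: "B \<in> sets (Xsp n) \<Longrightarrow> test (indicator B)"
  by (auto simp: test_def indicator_def)

lemma measure_gibbs_law:
  assumes "x0 \<in> space (Xsp n)" and B: "B \<in> sets (Xsp n)"
  shows "measure (gibbs_law V a b0 Y n x0 k) B = (Pop ^^ k) (indicator B) x0"
proof -
  note f = gibbs_law_facts[OF assms(1), of k]
  interpret prob_space "gibbs_law V a b0 Y n x0 k" using f by simp
  have "measure (gibbs_law V a b0 Y n x0 k) B = (\<integral>x. indicator B x \<partial>gibbs_law V a b0 Y n x0 k)"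
    using f B by simp
  with f test_indicator[OF B] show ?thesis by metis
qed

end

subsection \<open>The sweep in terms of the sufficient statistics of the noise\<close>

lemma (in pair_sigma_finite) integral_mult_pair:
  fixes f :: "'a \<Rightarrow> real" and g :: "'b \<Rightarrow> real"
  assumes f: "integrable M1 f" and g: "integrable M2 g"
  shows "integrable (M1 \<Otimes>\<^sub>M M2) (\<lambda>p. f (fst p) * g (snd p))"
    and "(\<integral>p. f (fst p) * g (snd p) \<partial>(M1 \<Otimes>\<^sub>M M2)) = (\<integral>x. f x \<partial>M1) * (\<integral>y. g y \<partial>M2)"
proof -
  have [measurable]: "f \<in> borel_measurable M1" "g \<in> borel_measurable M2" using f g by auto
  show I: "integrable (M1 \<Otimes>\<^sub>M M2) (\<lambda>p. f (fst p) * g (snd p))"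
    using f g by (intro Fubini_integrable) (auto simp: abs_mult)
  show "(\<integral>p. f (fst p) * g (snd p) \<partial>(M1 \<Otimes>\<^sub>M M2)) = (\<integral>x. f x \<partial>M1) * (\<integral>y. g y \<partial>M2)"
    using integral_fst'[OF I] by simp
qed

lemma sum_square_diff_tbar:
  assumes "n > 0"
  shows "(\<Sum>i<n. (z i - tbar n z)\<^sup>2) = (\<Sum>i<n. (z i)\<^sup>2) - real n * (tbar n z)\<^sup>2"
proof -
  have t: "(\<Sum>i<n. z i) = real n * tbar n z" using assms by (simp add: tbar_def)
  have "(\<Sum>i<n. (z i - tbar n z)\<^sup>2) = (\<Sum>i<n. (z i)\<^sup>2 - 2 * tbar n z * z i + (tbar n z)\<^sup>2)"
    by (intro sum.cong refl) (simp add: power2_diff)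
  also have "\<dots> = (\<Sum>i<n. (z i)\<^sup>2) - 2 * tbar n z * (\<Sum>i<n. z i) + real n * (tbar n z)\<^sup>2"
    by (simp add: sum.distrib sum_subtractf sum_distrib_left)
  finally show ?thesis unfolding t by (simp add: power2_eq_square)
qed

context gibbs
begin

text \<open>The weight of \<open>Y n i\<close> in the conditional mean of \<open>\<theta> i\<close>.
  It is the natural variable of the sweep: \<open>1 - frac A\<close> is the contraction factor of
  the mean of \<open>\<theta>\<close>, and \<open>1 - (frac A)\<^sup>2\<close> that of
  \<open>A\<close>.\<close>

definition frac :: "real \<Rightarrow> real" where "frac A = A / (V + A)"

definition W :: "(nat \<Rightarrow> real) \<Rightarrow> real" where "W z = (\<Sum>i<n. (Y n i - Ybar Y n) * z i)"

definition Q :: "(nat \<Rightarrow> real) \<Rightarrow> real" where "Q z = (\<Sum>i<n. (z i - tbar n z)\<^sup>2)"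

lemma frac_bounds: "A > 0 \<Longrightarrow> 0 < frac A" "A > 0 \<Longrightarrow> frac A < 1"
  using V by (auto simp: frac_def)

lemma one_minus_frac: "A > 0 \<Longrightarrow> 1 - frac A = V / (V + A)"
  using V by (simp add: frac_def field_simps)

lemma frac_diff: "A > 0 \<Longrightarrow> A' > 0 \<Longrightarrow> frac A - frac A' = V * (A - A') / ((V + A) * (V + A'))"
  using V by (simp add: frac_def field_simps)

lemma upd_frac:
  assumes "A > 0" "i < n"
  shows "upd A \<mu> z i = (1 - frac A) * \<mu> + frac A * Y n i + sqrt (V * frac A) * z i"
  using assms V unfolding one_minus_frac[OF assms(1)]
  by (simp add: upd_def frac_def add_divide_distrib mult_ac)

lemma tbar_upd:
  assumes "A > 0"
  shows "tbar n (upd A \<mu> z) = (1 - frac A) * \<mu> + frac A * Ybar Y n + sqrt (V * frac A) * tbar n z"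
proof -
  have "(\<Sum>i<n. upd A \<mu> z i) = (\<Sum>i<n. (1 - frac A) * \<mu> + frac A * Y n i + sqrt (V * frac A) * z i)"
    by (intro sum.cong refl upd_frac assms) simp
  also have "\<dots> = real n * ((1 - frac A) * \<mu>) + frac A * (\<Sum>i<n. Y n i) + sqrt (V * frac A) * (\<Sum>i<n. z i)"
    by (simp add: sum.distrib sum_distrib_left)
  finally show ?thesis using n2 by (simp add: tbar_def Ybar_def add_divide_distrib)
qed

text \<open>Subtracting the mean removes \<open>\<mu>\<close>, so the new \<open>A\<close> depends
  on the old state through \<open>A\<close> alone. The noise enters through \<open>W\<close>, which
  is linear and centred, and \<open>Q\<close>, a chi-square statistic; the mixed term with
  \<open>tbar n z\<close> drops out because the deviations of the data from their mean sum to
  0.\<close>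

lemma rate_upd:
  assumes A: "A > 0"
  shows "rate (upd A \<mu> z) = b0 + ((frac A)\<^sup>2 * Delta Y n + 2 * (frac A * sqrt (V * frac A)) * W z + V * frac A * Q z) / 2"
proof -
  let ?u = "frac A" and ?s = "sqrt (V * frac A)"
  have s2: "?s\<^sup>2 = V * ?u" using frac_bounds[OF A] V by simp
  have Y0: "(\<Sum>i<n. Y n i - Ybar Y n) = 0"
    using n2 by (simp add: sum_subtractf Ybar_def)
  have "(\<Sum>i<n. (upd A \<mu> z i - tbar n (upd A \<mu> z))\<^sup>2)
      = (\<Sum>i<n. (?u * (Y n i - Ybar Y n) + ?s * (z i - tbar n z))\<^sup>2)"
    by (intro sum.cong refl) (simp add: upd_frac A tbar_upd algebra_simps)
  also have "\<dots> = (\<Sum>i<n. ?u\<^sup>2 * (Y n i - Ybar Y n)\<^sup>2 + 2 * (?u * ?s) * ((Y n i - Ybar Y n) * z i)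
        - 2 * (?u * ?s) * tbar n z * (Y n i - Ybar Y n) + ?s\<^sup>2 * (z i - tbar n z)\<^sup>2)"
    by (intro sum.cong refl) (simp add: power2_eq_square algebra_simps)
  also have "\<dots> = ?u\<^sup>2 * Delta Y n + 2 * (?u * ?s) * W z - 2 * (?u * ?s) * tbar n z * (\<Sum>i<n. Y n i - Ybar Y n) + ?s\<^sup>2 * Q z"
    by (simp only: sum.distrib sum_subtractf sum_distrib_left[symmetric] Delta_def W_def Q_def)
  finally show ?thesis unfolding rate_def s2 Y0 by simp
qed

lemma Delta_nonneg: "Delta Y n \<ge> 0"
  by (simp add: Delta_def sum_nonneg)

lemma Q_nonneg: "Q z \<ge> 0"
  by (simp add: Q_def sum_nonneg)

lemma W_moments: "integrable (normals n) W" "(\<integral>z. W z \<partial>normals n) = 0" "(\<integral>z. \<bar>W z\<bar> \<partial>normals n) \<le> sqrt (Delta Y n)"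
  using normals_linear(1,2,5)[of n "\<lambda>i. Y n i - Ybar Y n"] by (simp_all add: W_def[abs_def] Delta_def)

lemma tbar_moments:
  "integrable (normals n) (tbar n)" "(\<integral>z. tbar n z \<partial>normals n) = 0"
  "(\<integral>z. \<bar>tbar n z\<bar> \<partial>normals n) \<le> 1 / sqrt (real n)"
  "integrable (normals n) (\<lambda>z. (tbar n z)\<^sup>2)" "(\<integral>z. (tbar n z)\<^sup>2 \<partial>normals n) = 1 / real n"
proof -
  have t: "tbar n = (\<lambda>z. \<Sum>i<n. (1 / real n) * z i)"
    by (auto simp: tbar_def sum_divide_distrib fun_eq_iff)
  have c: "(\<Sum>i<n. (1 / real n)\<^sup>2) = 1 / real n" using n2 by (simp add: power2_eq_square)
  note l = normals_linear[of n "\<lambda>i. 1 / real n", folded t[THEN fun_cong], unfolded c]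
  show "integrable (normals n) (tbar n)" "(\<integral>z. tbar n z \<partial>normals n) = 0"
    "integrable (normals n) (\<lambda>z. (tbar n z)\<^sup>2)" "(\<integral>z. (tbar n z)\<^sup>2 \<partial>normals n) = 1 / real n"
    using l(1-4) by simp_all
  show "(\<integral>z. \<bar>tbar n z\<bar> \<partial>normals n) \<le> 1 / sqrt (real n)"
    using l(5) by (simp add: real_sqrt_divide)
qed

lemma Q_moments: "integrable (normals n) Q" "(\<integral>z. Q z \<partial>normals n) = real n - 1"
  "(\<integral>z. \<bar>Q z - (real n - 1)\<bar> \<partial>normals n) \<le> sqrt (2 * real n) + 2"
proof -
  interpret N: prob_space "normals n" by (rule prob_space_normals)
  have q: "Q = (\<lambda>z. (\<Sum>i<n. (z i)\<^sup>2) - real n * (tbar n z)\<^sup>2)"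
    using n2 by (auto simp: Q_def fun_eq_iff sum_square_diff_tbar)
  note i = normals_sum_of_squares[of n] tbar_moments
  show I: "integrable (normals n) Q" unfolding q using i by simp
  show "(\<integral>z. Q z \<partial>normals n) = real n - 1" unfolding q using i n2 by simp
  \<comment> \<open>\<open>Q\<close> is compared with the full sum of squares. The correction
    \<open>real n * (tbar n z)\<^sup>2\<close> has mean 1 and the shift from \<open>n\<close> to
    \<open>n - 1\<close> is another 1, whence the summand 2.\<close>
  have "(\<integral>z. \<bar>Q z - (real n - 1)\<bar> \<partial>normals n)
      \<le> (\<integral>z. \<bar>(\<Sum>i<n. (z i)\<^sup>2) - real n\<bar> + (real n * (tbar n z)\<^sup>2 + 1) \<partial>normals n)"
  proof (rule integral_mono)
    show "integrable (normals n) (\<lambda>z. \<bar>Q z - (real n - 1)\<bar>)" using I by simp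
    show "integrable (normals n) (\<lambda>z. \<bar>(\<Sum>i<n. (z i)\<^sup>2) - real n\<bar> + (real n * (tbar n z)\<^sup>2 + 1))"
      using i by simp
    fix z
    have "real n * (tbar n z)\<^sup>2 \<ge> 0" by simp
    then show "\<bar>Q z - (real n - 1)\<bar> \<le> \<bar>(\<Sum>i<n. (z i)\<^sup>2) - real n\<bar> + (real n * (tbar n z)\<^sup>2 + 1)"
      unfolding q by linarith
  qed
  also have "\<dots> = (\<integral>z. \<bar>(\<Sum>i<n. (z i)\<^sup>2) - real n\<bar> \<partial>normals n) + 2"
    using i n2 N.prob_space by simp
  finally show "(\<integral>z. \<bar>Q z - (real n - 1)\<bar> \<partial>normals n) \<le> sqrt (2 * real n) + 2"
    using i(3) by linarith
qed

lemma std_normal_abs: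
  "integrable std_normal_distribution (\<lambda>x. \<bar>x\<bar>)" "(\<integral>x. \<bar>x\<bar> \<partial>std_normal_distribution) \<le> 1"
proof -
  interpret S: prob_space std_normal_distribution by (rule prob_space_std_normal)
  have i2: "integrable std_normal_distribution (\<lambda>x. x\<^sup>2)"
    by (rule integrable_std_normal_distribution_moment)
  have e2: "(\<integral>x. x\<^sup>2 \<partial>std_normal_distribution) = 1"
    using std_normal_distribution_even_moments(1)[of 1] by simp
  show "integrable std_normal_distribution (\<lambda>x. \<bar>x\<bar>)"
    using S.expectation_abs_le_sqrt(1)[OF _ i2] by simp
  show "(\<integral>x. \<bar>x\<bar> \<partial>std_normal_distribution) \<le> 1"
    using S.expectation_abs_le_sqrt(2)[OF _ i2] e2 by simp
qed

lemma noise_integral: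
  fixes f :: "real \<Rightarrow> real" and g :: "(nat \<Rightarrow> real) \<Rightarrow> real" and k :: "real \<Rightarrow> real"
  assumes f: "integrable std_normal_distribution f" and g: "integrable (normals n) g" and k: "integrable (ig shp 1) k"
  shows "integrable noise (\<lambda>\<omega>. f (fst \<omega>))" "(\<integral>\<omega>. f (fst \<omega>) \<partial>noise) = (\<integral>x. f x \<partial>std_normal_distribution)"
    and "integrable noise (\<lambda>\<omega>. g (fst (snd \<omega>)))" "(\<integral>\<omega>. g (fst (snd \<omega>)) \<partial>noise) = (\<integral>z. g z \<partial>normals n)"
    and "integrable noise (\<lambda>\<omega>. k (snd (snd \<omega>)))" "(\<integral>\<omega>. k (snd (snd \<omega>)) \<partial>noise) = (\<integral>h. k h \<partial>ig shp 1)"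
    and "integrable noise (\<lambda>\<omega>. g (fst (snd \<omega>)) * k (snd (snd \<omega>)))"
      "(\<integral>\<omega>. g (fst (snd \<omega>)) * k (snd (snd \<omega>)) \<partial>noise) = (\<integral>z. g z \<partial>normals n) * (\<integral>h. k h \<partial>ig shp 1)"
proof -
  interpret I: prob_space "ig shp 1" by (rule prob_space_ig1)
  interpret N: prob_space "normals n" by (rule prob_space_normals)
  interpret S: prob_space std_normal_distribution by (rule prob_space_std_normal)
  interpret NI: pair_prob_space "normals n" "ig shp 1" ..
  interpret SNI: pair_prob_space std_normal_distribution "normals n \<Otimes>\<^sub>M ig shp 1" ..
  have one: "integrable std_normal_distribution (\<lambda>_. 1::real)" "integrable (normals n) (\<lambda>_. 1::real)" "integrable (ig shp 1) (\<lambda>_. 1::real)"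
    "integrable (normals n \<Otimes>\<^sub>M ig shp 1) (\<lambda>_. 1::real)"
    by simp_all
  show "integrable noise (\<lambda>\<omega>. f (fst \<omega>))" "(\<integral>\<omega>. f (fst \<omega>) \<partial>noise) = (\<integral>x. f x \<partial>std_normal_distribution)"
    using SNI.integral_mult_pair[OF f one(4)] NI.prob_space by (simp_all add: noise_def)
  have gk: "integrable noise (\<lambda>\<omega>. g (fst (snd \<omega>)) * k (snd (snd \<omega>)))"
      "(\<integral>\<omega>. g (fst (snd \<omega>)) * k (snd (snd \<omega>)) \<partial>noise) = (\<integral>z. g z \<partial>normals n) * (\<integral>h. k h \<partial>ig shp 1)"
    if "integrable (normals n) g" "integrable (ig shp 1) k" for g and k :: "real \<Rightarrow> real"
    using SNI.integral_mult_pair[OF one(1) NI.integral_mult_pair(1)[OF that]] NI.integral_mult_pair(2)[OF that] S.prob_space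
    by (simp_all add: noise_def)
  show "integrable noise (\<lambda>\<omega>. g (fst (snd \<omega>)) * k (snd (snd \<omega>)))"
      "(\<integral>\<omega>. g (fst (snd \<omega>)) * k (snd (snd \<omega>)) \<partial>noise) = (\<integral>z. g z \<partial>normals n) * (\<integral>h. k h \<partial>ig shp 1)"
    by (rule gk[OF g k])+
  show "integrable noise (\<lambda>\<omega>. g (fst (snd \<omega>)))" "(\<integral>\<omega>. g (fst (snd \<omega>)) \<partial>noise) = (\<integral>z. g z \<partial>normals n)"
    using gk[OF g one(3)] I.prob_space by simp_all
  show "integrable noise (\<lambda>\<omega>. k (snd (snd \<omega>)))" "(\<integral>\<omega>. k (snd (snd \<omega>)) \<partial>noise) = (\<integral>h. k h \<partial>ig shp 1)"
    using gk[OF one(2) k] N.prob_space by simp_all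
qed

end

section \<open>One sweep under common noise: differences of two copies, and fluctuation about the
  mean map\<close>

lemma abs_sqrt_diff_le:
  assumes "x > 0" "y > 0"
  shows "\<bar>sqrt x - sqrt y\<bar> = \<bar>x - y\<bar> / (sqrt x + sqrt y)"
proof -
  have "x - y = (sqrt x - sqrt y) * (sqrt x + sqrt y)"
    using assms by (simp add: algebra_simps)
  moreover have "sqrt x + sqrt y > 0" using assms by (simp add: add_pos_pos)
  ultimately show ?thesis by (simp add: abs_mult)
qed

text \<open>The function \<open>x * sqrt x\<close> has derivative at most 3/2 on the unit interval;
  here this is read off from the factorisation of a difference of cubes. Up to a constant it is the
  coefficient of \<open>W\<close> in \<open>rate_upd\<close>.\<close>

lemma abs_cube_sqrt_diff_le:
  assumes "0 < x" "x \<le> 1" "0 < y" "y \<le> 1"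
  shows "\<bar>x * sqrt x - y * sqrt y\<bar> \<le> 3 / 2 * \<bar>x - y\<bar>"
proof -
  define r s where "r = sqrt x" and "s = sqrt y"
  have rs: "0 < r" "r \<le> 1" "0 < s" "s \<le> 1" "x = r * r" "y = s * s"
    using assms by (auto simp: r_def s_def)
  have "r * r \<le> r * 1" "s * s \<le> s * 1" "r * s \<le> r * 1" "s * r \<le> s * 1" using rs by (auto intro!: mult_left_mono)
  then have b: "r * r + r * s + s * s \<le> 3 / 2 * (r + s)" by (simp add: mult.commute)
  have "\<bar>x * sqrt x - y * sqrt y\<bar> = \<bar>(r - s) * (r * r + r * s + s * s)\<bar>"
    unfolding r_def[symmetric] s_def[symmetric] unfolding rs(5,6) by (simp add: algebra_simps)
  also have "\<dots> = \<bar>r - s\<bar> * (r * r + r * s + s * s)" using rs by (simp add: abs_mult abs_of_pos add_pos_pos)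
  also have "\<dots> \<le> \<bar>r - s\<bar> * (3 / 2 * (r + s))" by (intro mult_left_mono b) simp
  also have "\<dots> = 3 / 2 * \<bar>(r - s) * (r + s)\<bar>" using rs by (simp add: abs_mult)
  also have "(r - s) * (r + s) = x - y" using rs by (simp add: algebra_simps)
  finally show ?thesis .
qed

context gibbs
begin

lemma noise_xi_abs: "integrable noise (\<lambda>\<omega>. \<bar>fst \<omega>\<bar>)" "(\<integral>\<omega>. \<bar>fst \<omega>\<bar> \<partial>noise) \<le> 1"
proof -
  interpret I: prob_space "ig shp 1" by (rule prob_space_ig1)
  note i = noise_integral(1,2)[OF std_normal_abs(1) W_moments(1), of "\<lambda>_. 1"]
  show "integrable noise (\<lambda>\<omega>. \<bar>fst \<omega>\<bar>)" "(\<integral>\<omega>. \<bar>fst \<omega>\<bar> \<partial>noise) \<le> 1"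
    using i std_normal_abs(2) by simp_all
qed

lemma noise_z_integral:
  assumes g: "integrable (normals n) g"
  shows "integrable noise (\<lambda>\<omega>. g (fst (snd \<omega>)) :: real)" "(\<integral>\<omega>. g (fst (snd \<omega>)) \<partial>noise) = (\<integral>z. g z \<partial>normals n)"
proof -
  interpret I: prob_space "ig shp 1" by (rule prob_space_ig1)
  show "integrable noise (\<lambda>\<omega>. g (fst (snd \<omega>)) :: real)" "(\<integral>\<omega>. g (fst (snd \<omega>)) \<partial>noise) = (\<integral>z. g z \<partial>normals n)"
    using noise_integral(3,4)[OF std_normal_abs(1) g, of "\<lambda>_. 1"] by simp_all
qed

lemma noise_tbar_abs: "integrable noise (\<lambda>\<omega>. \<bar>tbar n (fst (snd \<omega>))\<bar>)" "(\<integral>\<omega>. \<bar>tbar n (fst (snd \<omega>))\<bar> \<partial>noise) \<le> 1 / sqrt (real n)"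
  using noise_z_integral[of "\<lambda>z. \<bar>tbar n z\<bar>"] tbar_moments(1,3) by auto

lemma fst_mv_measurable [measurable]: "(\<lambda>\<omega>. fst (mv A t \<omega>)) \<in> borel_measurable noise"
  by (rule measurable_compose[OF mv_measurable Xsp_fst_measurable])

lemma theta_mv_measurable [measurable]: "(\<lambda>\<omega>. snd (snd (mv A t \<omega>))) \<in> measurable noise thetas"
  by (rule measurable_compose[OF mv_measurable Xsp_theta_measurable])

lemma tbar_mv:
  assumes "A > 0"
  shows "tbar n (snd (snd (mv A t \<omega>))) =
    (1 - frac A) * (t + sqrt (A / real n) * fst \<omega>) + frac A * Ybar Y n + sqrt (V * frac A) * tbar n (fst (snd \<omega>))"
  by (simp add: mv_def tbar_upd assms)

lemma fst_mv:
  assumes "A > 0"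
  shows "fst (mv A t \<omega>) = snd (snd \<omega>) * (b0 + ((frac A)\<^sup>2 * Delta Y n + 2 * (frac A * sqrt (V * frac A)) * W (fst (snd \<omega>))
     + V * frac A * Q (fst (snd \<omega>))) / 2)"
  by (simp add: mv_def rate_upd assms)

text \<open>Under common noise \<open>b0\<close> cancels and the inverse gamma variable factors out;
  each remaining coefficient in \<open>rate_upd\<close> is Lipschitz in \<open>frac\<close>. The sum
  \<open>frac A1 + frac A2\<close> from the difference of squares is kept and not bounded by 2,
  since it later produces the factor \<open>1 - u0\<^sup>2\<close>.\<close>

lemma fst_mv_diff:
  assumes A: "A1 > 0" "A2 > 0" and h: "snd (snd \<omega>) > 0"
  shows "\<bar>fst (mv A1 t1 \<omega>) - fst (mv A2 t2 \<omega>)\<bar> \<le> \<bar>frac A1 - frac A2\<bar> / 2 *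
    (((frac A1 + frac A2) * Delta Y n + 3 * sqrt V * \<bar>W (fst (snd \<omega>))\<bar> + V * Q (fst (snd \<omega>))) * snd (snd \<omega>))"
proof -
  let ?u1 = "frac A1" and ?u2 = "frac A2" and ?h = "snd (snd \<omega>)" and ?W = "W (fst (snd \<omega>))" and ?Q = "Q (fst (snd \<omega>))"
  note f = frac_bounds[OF A(1)] frac_bounds[OF A(2)]
  have c: "\<bar>?u1 * sqrt (V * ?u1) - ?u2 * sqrt (V * ?u2)\<bar> \<le> 3 / 2 * sqrt V * \<bar>?u1 - ?u2\<bar>"
  proof -
    have "?u1 * sqrt (V * ?u1) - ?u2 * sqrt (V * ?u2) = sqrt V * (?u1 * sqrt ?u1 - ?u2 * sqrt ?u2)"
      by (simp add: real_sqrt_mult algebra_simps)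
    then have "\<bar>?u1 * sqrt (V * ?u1) - ?u2 * sqrt (V * ?u2)\<bar> = \<bar>sqrt V * (?u1 * sqrt ?u1 - ?u2 * sqrt ?u2)\<bar>"
      by (rule arg_cong)
    also have "\<dots> = sqrt V * \<bar>?u1 * sqrt ?u1 - ?u2 * sqrt ?u2\<bar>"
      unfolding abs_mult using V by simp
    also have "\<dots> \<le> sqrt V * (3 / 2 * \<bar>?u1 - ?u2\<bar>)"
      using f V by (intro mult_left_mono abs_cube_sqrt_diff_le) auto
    finally show ?thesis by simp
  qed
  have "fst (mv A1 t1 \<omega>) - fst (mv A2 t2 \<omega>) = ?h / 2 * ((?u1 - ?u2) * ((?u1 + ?u2) * Delta Y n)
      + 2 * (?u1 * sqrt (V * ?u1) - ?u2 * sqrt (V * ?u2)) * ?W + (?u1 - ?u2) * (V * ?Q))"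
  proof -
    have "h * (b0 + (u1\<^sup>2 * D + 2 * p1 * w + V * u1 * q) / 2) - h * (b0 + (u2\<^sup>2 * D + 2 * p2 * w + V * u2 * q) / 2)
        = h / 2 * ((u1 - u2) * ((u1 + u2) * D) + 2 * (p1 - p2) * w + (u1 - u2) * (V * q))" for h u1 u2 D p1 p2 w q :: real
      by (simp add: algebra_simps power2_eq_square add_divide_distrib diff_divide_distrib)
    then show ?thesis unfolding fst_mv[OF A(1)] fst_mv[OF A(2)] .
  qed
  then have "\<bar>fst (mv A1 t1 \<omega>) - fst (mv A2 t2 \<omega>)\<bar> = \<bar>?h / 2 * ((?u1 - ?u2) * ((?u1 + ?u2) * Delta Y n)
      + 2 * (?u1 * sqrt (V * ?u1) - ?u2 * sqrt (V * ?u2)) * ?W + (?u1 - ?u2) * (V * ?Q))\<bar>"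
    by (rule arg_cong)
  also have "\<dots> = ?h / 2 * \<bar>(?u1 - ?u2) * ((?u1 + ?u2) * Delta Y n)
      + 2 * (?u1 * sqrt (V * ?u1) - ?u2 * sqrt (V * ?u2)) * ?W + (?u1 - ?u2) * (V * ?Q)\<bar>"
    unfolding abs_mult[of "?h / 2"] using h by simp
  also have "\<dots> \<le> ?h / 2 * (\<bar>?u1 - ?u2\<bar> * ((?u1 + ?u2) * Delta Y n) + 3 * sqrt V * \<bar>?u1 - ?u2\<bar> * \<bar>?W\<bar> + \<bar>?u1 - ?u2\<bar> * (V * ?Q))"
  proof (rule mult_left_mono)
    have 1: "\<bar>(?u1 - ?u2) * ((?u1 + ?u2) * Delta Y n)\<bar> = \<bar>?u1 - ?u2\<bar> * ((?u1 + ?u2) * Delta Y n)"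
      unfolding abs_mult using f Delta_nonneg by simp
    have 2: "\<bar>2 * (?u1 * sqrt (V * ?u1) - ?u2 * sqrt (V * ?u2)) * ?W\<bar> \<le> 3 * sqrt V * \<bar>?u1 - ?u2\<bar> * \<bar>?W\<bar>"
    proof -
      have "\<bar>2 * x * w\<bar> \<le> 3 * s * y * \<bar>w\<bar>" if "\<bar>x\<bar> \<le> 3 / 2 * s * y" for x w s y :: real
        using mult_right_mono[OF that, of "2 * \<bar>w\<bar>"] by (simp add: abs_mult)
      from this[OF c] show ?thesis .
    qed
    have 3: "\<bar>(?u1 - ?u2) * (V * ?Q)\<bar> = \<bar>?u1 - ?u2\<bar> * (V * ?Q)"
      unfolding abs_mult using V Q_nonneg by simp
    show "\<bar>(?u1 - ?u2) * ((?u1 + ?u2) * Delta Y n)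
      + 2 * (?u1 * sqrt (V * ?u1) - ?u2 * sqrt (V * ?u2)) * ?W + (?u1 - ?u2) * (V * ?Q)\<bar>
      \<le> \<bar>?u1 - ?u2\<bar> * ((?u1 + ?u2) * Delta Y n) + 3 * sqrt V * \<bar>?u1 - ?u2\<bar> * \<bar>?W\<bar> + \<bar>?u1 - ?u2\<bar> * (V * ?Q)"
    proof -
      have "\<bar>x + y + z\<bar> \<le> x' + y' + z'" if "\<bar>x\<bar> = x'" "\<bar>y\<bar> \<le> y'" "\<bar>z\<bar> = z'" for x y z x' y' z' :: real
        using that by linarith
      from this[OF 1 2 3] show ?thesis .
    qed
  qed (use h in auto)
  also have "\<dots> = \<bar>?u1 - ?u2\<bar> / 2 * (((?u1 + ?u2) * Delta Y n + 3 * sqrt V * \<bar>?W\<bar> + V * ?Q) * ?h)"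
  proof -
    have "h / 2 * (c * x + 3 * s * c * w + c * y) = c / 2 * ((x + 3 * s * w + y) * h)" for h c x s w y :: real
      by (simp add: algebra_simps)
    then show ?thesis .
  qed
  finally show ?thesis .
qed

lemma fst_mv_diff_expectation:
  assumes A: "A1 > 0" "A2 > 0" and s: "shp > 2"
  shows "integrable noise (\<lambda>\<omega>. \<bar>fst (mv A1 t1 \<omega>) - fst (mv A2 t2 \<omega>)\<bar>)"
    and "(\<integral>\<omega>. \<bar>fst (mv A1 t1 \<omega>) - fst (mv A2 t2 \<omega>)\<bar> \<partial>noise) \<le> \<bar>frac A1 - frac A2\<bar> / (2 * (shp - 1)) *
      ((frac A1 + frac A2) * Delta Y n + 3 * sqrt V * sqrt (Delta Y n) + V * (real n - 1))"
proof -
  interpret N: prob_space "normals n" by (rule prob_space_normals)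
  let ?c = "\<bar>frac A1 - frac A2\<bar>"
  let ?g = "\<lambda>z. (frac A1 + frac A2) * Delta Y n + 3 * sqrt V * \<bar>W z\<bar> + V * Q z"
  have g: "integrable (normals n) ?g" using W_moments Q_moments by simp
  have h: "integrable (ig shp 1) (\<lambda>h. h)" "(\<integral>h. h \<partial>ig shp 1) = 1 / (shp - 1)"
    using ig_mean[of shp 1] s by auto
  note I = noise_integral(7,8)[OF std_normal_abs(1) g h(1)]
  have I': "integrable noise (\<lambda>\<omega>. ?c / 2 * (?g (fst (snd \<omega>)) * snd (snd \<omega>)))"
    using I(1) by simp
  show J: "integrable noise (\<lambda>\<omega>. \<bar>fst (mv A1 t1 \<omega>) - fst (mv A2 t2 \<omega>)\<bar>)"
  proof (rule Bochner_Integration.integrable_bound[OF I'])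
    show "AE \<omega> in noise. norm \<bar>fst (mv A1 t1 \<omega>) - fst (mv A2 t2 \<omega>)\<bar> \<le> norm (?c / 2 * (?g (fst (snd \<omega>)) * snd (snd \<omega>)))"
    proof (rule AE_I2)
      fix \<omega> assume "\<omega> \<in> space noise"
      from fst_mv_diff[OF A space_noise[OF this], of t1 t2]
      show "norm \<bar>fst (mv A1 t1 \<omega>) - fst (mv A2 t2 \<omega>)\<bar> \<le> norm (?c / 2 * (?g (fst (snd \<omega>)) * snd (snd \<omega>)))"
        unfolding real_norm_def by linarith
    qed
  qed measurable
  have "(\<integral>\<omega>. \<bar>fst (mv A1 t1 \<omega>) - fst (mv A2 t2 \<omega>)\<bar> \<partial>noise) \<le> (\<integral>\<omega>. ?c / 2 * (?g (fst (snd \<omega>)) * snd (snd \<omega>)) \<partial>noise)"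
    by (intro integral_mono J I' fst_mv_diff A space_noise)
  also have "\<dots> = ?c / 2 * ((\<integral>z. ?g z \<partial>normals n) * (1 / (shp - 1)))"
    using I(2) h(2) by simp
  also have "\<dots> = ?c / 2 * (((frac A1 + frac A2) * Delta Y n + 3 * sqrt V * (\<integral>z. \<bar>W z\<bar> \<partial>normals n) + V * (real n - 1)) * (1 / (shp - 1)))"
    using W_moments(1) Q_moments(1,2) N.prob_space by simp
  also have "\<dots> \<le> ?c / 2 * (((frac A1 + frac A2) * Delta Y n + 3 * sqrt V * sqrt (Delta Y n) + V * (real n - 1)) * (1 / (shp - 1)))"
  proof -
    have "3 * sqrt V * (\<integral>z. \<bar>W z\<bar> \<partial>normals n) \<le> 3 * sqrt V * sqrt (Delta Y n)"
      using W_moments(3) V by (intro mult_left_mono) auto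
    then show ?thesis using s by (intro mult_left_mono mult_right_mono) auto
  qed
  finally show "(\<integral>\<omega>. \<bar>fst (mv A1 t1 \<omega>) - fst (mv A2 t2 \<omega>)\<bar> \<partial>noise) \<le> ?c / (2 * (shp - 1)) *
      ((frac A1 + frac A2) * Delta Y n + 3 * sqrt V * sqrt (Delta Y n) + V * (real n - 1))"
    by simp
qed

text \<open>The difference splits into the contracted \<open>t1 - t2\<close>, a change of weight
  acting on \<open>t2 - Ybar Y n\<close>, and two noise terms. The noise is of size
  \<open>1 / sqrt n\<close>, which the prefactor cancels, so its terms lack the factor
  \<open>sqrt n\<close> carried by the distances. The second term is small only if \<open>t2\<close>
  is close to \<open>Ybar Y n\<close>.\<close>

lemma tbar_mv_diff_expectation:
  fixes t1 t2 :: real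
  assumes A: "A1 > 0" "A2 > 0"
  defines "R \<equiv> \<lambda>\<omega>. sqrt (real n) * \<bar>tbar n (snd (snd (mv A1 t1 \<omega>))) - tbar n (snd (snd (mv A2 t2 \<omega>)))\<bar>"
  shows "integrable noise R"
    and "(\<integral>\<omega>. R \<omega> \<partial>noise) \<le> (1 - frac A1) * (sqrt (real n) * \<bar>t1 - t2\<bar>) + \<bar>frac A1 - frac A2\<bar> * (sqrt (real n) * \<bar>t2 - Ybar Y n\<bar>)
      + \<bar>(1 - frac A1) * sqrt A1 - (1 - frac A2) * sqrt A2\<bar> + \<bar>sqrt (V * frac A1) - sqrt (V * frac A2)\<bar>"
proof -
  interpret prob_space noise by (rule prob_space_noise)
  let ?c1 = "(1 - frac A1) * (sqrt (real n) * \<bar>t1 - t2\<bar>) + \<bar>frac A1 - frac A2\<bar> * (sqrt (real n) * \<bar>t2 - Ybar Y n\<bar>)"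
  let ?c2 = "\<bar>(1 - frac A1) * sqrt A1 - (1 - frac A2) * sqrt A2\<bar>" and ?c3 = "\<bar>sqrt (V * frac A1) - sqrt (V * frac A2)\<bar>"
  let ?B = "\<lambda>\<omega>. ?c1 + ?c2 * \<bar>fst \<omega>\<bar> + ?c3 * (sqrt (real n) * \<bar>tbar n (fst (snd \<omega>))\<bar>)"
  have n: "sqrt (real n) > 0" using n2 by simp
  have B: "R \<omega> \<le> ?B \<omega>" for \<omega> :: "real \<times> (nat \<Rightarrow> real) \<times> real"
  proof -
    let ?a = "tbar n (snd (snd (mv A1 t1 \<omega>))) - tbar n (snd (snd (mv A2 t2 \<omega>)))"
    have "?a = (1 - frac A1) * (t1 - t2) + (frac A2 - frac A1) * (t2 - Ybar Y n)
        + ((1 - frac A1) * sqrt A1 - (1 - frac A2) * sqrt A2) * fst \<omega> / sqrt (real n)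
        + (sqrt (V * frac A1) - sqrt (V * frac A2)) * tbar n (fst (snd \<omega>))"
      unfolding tbar_mv[OF A(1)] tbar_mv[OF A(2)] real_sqrt_divide
      by (simp add: algebra_simps diff_divide_distrib add_divide_distrib)
    then have "sqrt (real n) * ?a = (1 - frac A1) * (sqrt (real n) * (t1 - t2)) + (frac A2 - frac A1) * (sqrt (real n) * (t2 - Ybar Y n))
        + ((1 - frac A1) * sqrt A1 - (1 - frac A2) * sqrt A2) * fst \<omega>
        + (sqrt (V * frac A1) - sqrt (V * frac A2)) * (sqrt (real n) * tbar n (fst (snd \<omega>)))"
      using n by (simp only: distrib_left) (simp add: mult_ac)
    then have "\<bar>sqrt (real n) * ?a\<bar> \<le> \<bar>(1 - frac A1) * (sqrt (real n) * (t1 - t2))\<bar> + \<bar>(frac A2 - frac A1) * (sqrt (real n) * (t2 - Ybar Y n))\<bar>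
        + \<bar>((1 - frac A1) * sqrt A1 - (1 - frac A2) * sqrt A2) * fst \<omega>\<bar>
        + \<bar>(sqrt (V * frac A1) - sqrt (V * frac A2)) * (sqrt (real n) * tbar n (fst (snd \<omega>)))\<bar>"
      by linarith
    also have "\<dots> = ?B \<omega>"
      using frac_bounds[OF A(1)] n by (simp only: abs_mult) (simp add: abs_minus_commute)
    finally show ?thesis using n by (simp add: R_def abs_mult)
  qed
  have BI: "integrable noise ?B"
    using noise_xi_abs(1) noise_tbar_abs(1) by simp
  have R0: "R \<omega> \<ge> 0" for \<omega> by (simp add: R_def)
  show I: "integrable noise R"
  proof (rule Bochner_Integration.integrable_bound[OF BI])
    show "R \<in> borel_measurable noise" unfolding R_def by measurable
    show "AE \<omega> in noise. norm (R \<omega>) \<le> norm (?B \<omega>)"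
    proof (rule AE_I2)
      fix \<omega>
      show "norm (R \<omega>) \<le> norm (?B \<omega>)" using B[of \<omega>] R0[of \<omega>] unfolding real_norm_def by linarith
    qed
  qed
  have "(\<integral>\<omega>. R \<omega> \<partial>noise) \<le> (\<integral>\<omega>. ?B \<omega> \<partial>noise)" by (intro integral_mono I BI B)
  also have "\<dots> = ?c1 + ?c2 * (\<integral>\<omega>. \<bar>fst \<omega>\<bar> \<partial>noise) + ?c3 * (sqrt (real n) * (\<integral>\<omega>. \<bar>tbar n (fst (snd \<omega>))\<bar> \<partial>noise))"
    using noise_xi_abs(1) noise_tbar_abs(1) by (simp add: prob_space)
  also have "\<dots> \<le> ?c1 + ?c2 * 1 + ?c3 * (sqrt (real n) * (1 / sqrt (real n)))"
  proof -
    have "?c2 * (\<integral>\<omega>. \<bar>fst \<omega>\<bar> \<partial>noise) \<le> ?c2 * 1" by (rule mult_left_mono[OF noise_xi_abs(2)]) simp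
    moreover have "?c3 * (sqrt (real n) * (\<integral>\<omega>. \<bar>tbar n (fst (snd \<omega>))\<bar> \<partial>noise)) \<le> ?c3 * (sqrt (real n) * (1 / sqrt (real n)))"
      using n noise_tbar_abs(2) by (intro mult_left_mono) auto
    ultimately show ?thesis by (intro add_mono order_refl)
  qed
  finally show "(\<integral>\<omega>. R \<omega> \<partial>noise) \<le> ?c1 + ?c2 + ?c3" using n by simp
qed

text \<open>By \<open>rate_upd\<close> the centred sum of squares of the new \<open>\<theta>\<close>
  has mean \<open>real n - 1\<close> times this value, so it is the mean of the new \<open>A\<close>
  up to an error of order \<open>1 / n\<close>.\<close>

definition drift_map :: "real \<Rightarrow> real" where
  "drift_map A = (frac A)\<^sup>2 * (Delta Y n / (real n - 1)) + V * frac A"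

text \<open>\<open>d\<close> is the exact fixed point of the mean map, and the contraction factor
  towards it is exact as well. With \<open>B = V + A\<close>, writing \<open>A = u * B\<close> and
  \<open>V = (1 - u) * B\<close> reduces the claim to polynomial algebra.\<close>

lemma drift_map_diff:
  assumes "A > 0"
  defines "d \<equiv> Delta Y n / (real n - 1) - V"
  shows "drift_map A - d = (1 - (frac A)\<^sup>2) * (A - d)"
proof -
  let ?u = "frac A" and ?B = "V + A"
  have B: "?B > 0" using V assms by simp
  have D: "Delta Y n / (real n - 1) = d + V" by (simp add: d_def)
  have A: "A = ?u * ?B" using B by (simp add: frac_def)
  have V': "V = (1 - ?u) * ?B" using B by (simp add: frac_def field_simps)
  have "drift_map A - d = (?u\<^sup>2 - 1) * d + ?u\<^sup>2 * V + V * ?u"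
    unfolding drift_map_def D by (simp add: algebra_simps)
  moreover have "?u\<^sup>2 * V + V * ?u = (1 - ?u\<^sup>2) * A"
  proof -
    have "?u\<^sup>2 * V + V * ?u = (1 - ?u) * ?B * (?u * (1 + ?u))" by (subst (1 2) V') (simp add: power2_eq_square algebra_simps)
    also have "\<dots> = (1 - ?u\<^sup>2) * (?u * ?B)" by (simp add: power2_eq_square algebra_simps)
    finally show ?thesis using A by simp
  qed
  moreover have "(1 - ?u\<^sup>2) * (A - d) = (?u\<^sup>2 - 1) * d + (1 - ?u\<^sup>2) * A" by (simp add: left_diff_distrib right_diff_distrib)
  ultimately show ?thesis by linarith
qed

text \<open>The three summands bound the fluctuation of the inverse gamma draw, that of the sum of
  squares, and the mismatch between the shape parameter and \<open>(n - 1) / 2\<close>.\<close>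

lemma fst_mv_fluctuation:
  fixes t :: real
  assumes A: "A > 0" and s: "shp > 2"
  defines "m \<equiv> 1 / (shp - 1)"
  shows "integrable noise (\<lambda>\<omega>. \<bar>fst (mv A t \<omega>) - drift_map A\<bar>)"
    and "(\<integral>\<omega>. \<bar>fst (mv A t \<omega>) - drift_map A\<bar> \<partial>noise) \<le>
      m / sqrt (shp - 2) * (b0 + (real n - 1) * drift_map A / 2)
      + m * (b0 + (2 * (frac A * sqrt (V * frac A)) * sqrt (Delta Y n) + V * frac A * (sqrt (2 * real n) + 2)) / 2)
      + \<bar>m * ((real n - 1) / 2) - 1\<bar> * drift_map A"
proof -
  interpret N: prob_space "normals n" by (rule prob_space_normals)
  interpret I: prob_space "ig shp 1" by (rule prob_space_ig1)
  interpret prob_space noise by (rule prob_space_noise)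
  let ?u = "frac A" and ?g = "drift_map A"
  let ?S = "\<lambda>z. ?u\<^sup>2 * Delta Y n + 2 * (?u * sqrt (V * ?u)) * W z + V * ?u * Q z"
  note f = frac_bounds[OF A]
  have g0: "?g \<ge> 0" using f V Delta_nonneg n2 by (auto simp: drift_map_def intro!: add_nonneg_nonneg mult_nonneg_nonneg)
  have m: "m > 0" using s by (simp add: m_def)
  have Sg: "?S z - (real n - 1) * ?g = 2 * (?u * sqrt (V * ?u)) * W z + V * ?u * (Q z - (real n - 1))" for z
    using n2 by (simp add: drift_map_def field_simps)
  have S0: "b0 + ?S z / 2 \<ge> 0" for z using rate_upd[OF A, of 0 z] rate_pos[of "upd A 0 z"] by linarith
  have hi: "integrable (ig shp 1) (\<lambda>h. h)" using ig_mean(1)[of shp 1] s by auto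
  have hI: "integrable (ig shp 1) (\<lambda>h. \<bar>h - m\<bar>)" using hi by simp
  have hd: "(\<integral>h. \<bar>h - m\<bar> \<partial>ig shp 1) \<le> m / sqrt (shp - 2)"
    using ig_mean_deviation[OF s, of 1] by (simp add: m_def)
  have SI: "integrable (normals n) (\<lambda>z. b0 + ?S z / 2)" using W_moments Q_moments by simp
  have Se: "(\<integral>z. b0 + ?S z / 2 \<partial>normals n) = b0 + (real n - 1) * ?g / 2"
  proof -
    have "(\<integral>z. b0 + ?S z / 2 \<partial>normals n) = b0 + (?u\<^sup>2 * Delta Y n + 2 * (?u * sqrt (V * ?u)) * (\<integral>z. W z \<partial>normals n)
        + V * ?u * (\<integral>z. Q z \<partial>normals n)) / 2"
      using W_moments(1) Q_moments(1) N.prob_space by simp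
    moreover have "(real n - 1) * ?g / 2 = (?u\<^sup>2 * Delta Y n + V * ?u * (real n - 1)) / 2"
      using n2 by (simp add: drift_map_def field_simps)
    ultimately show ?thesis unfolding W_moments(2) Q_moments(2) by simp
  qed
  have TI: "integrable (normals n) (\<lambda>z. \<bar>?S z - (real n - 1) * ?g\<bar>)" using W_moments Q_moments by simp
  have Te: "(\<integral>z. \<bar>?S z - (real n - 1) * ?g\<bar> \<partial>normals n)
      \<le> 2 * (?u * sqrt (V * ?u)) * sqrt (Delta Y n) + V * ?u * (sqrt (2 * real n) + 2)"
  proof -
    let ?b = "\<lambda>z. 2 * (?u * sqrt (V * ?u)) * \<bar>W z\<bar> + V * ?u * \<bar>Q z - (real n - 1)\<bar>"
    have bI: "integrable (normals n) ?b" using W_moments Q_moments by simp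
    have "\<bar>?S z - (real n - 1) * ?g\<bar> \<le> ?b z" for z
      unfolding Sg using f V abs_triangle_ineq[of "2 * (?u * sqrt (V * ?u)) * W z" "V * ?u * (Q z - (real n - 1))"]
      by (simp add: abs_mult)
    then have "(\<integral>z. \<bar>?S z - (real n - 1) * ?g\<bar> \<partial>normals n) \<le> (\<integral>z. ?b z \<partial>normals n)"
      by (intro integral_mono TI bI)
    also have "\<dots> = 2 * (?u * sqrt (V * ?u)) * (\<integral>z. \<bar>W z\<bar> \<partial>normals n) + V * ?u * (\<integral>z. \<bar>Q z - (real n - 1)\<bar> \<partial>normals n)"
      using W_moments Q_moments by simp
    also have "\<dots> \<le> 2 * (?u * sqrt (V * ?u)) * sqrt (Delta Y n) + V * ?u * (sqrt (2 * real n) + 2)"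
      using f V by (intro add_mono mult_left_mono W_moments(3) Q_moments(3)) auto
    finally show ?thesis .
  qed
  let ?B = "\<lambda>\<omega>. (b0 + ?S (fst (snd \<omega>)) / 2) * \<bar>snd (snd \<omega>) - m\<bar> + m * (b0 + \<bar>?S (fst (snd \<omega>)) - (real n - 1) * ?g\<bar> / 2)
    + \<bar>m * ((real n - 1) / 2) - 1\<bar> * ?g"
  note P = noise_integral(7,8)[OF std_normal_abs(1) SI hI]
  note T = noise_z_integral[OF TI]
  have B: "\<bar>fst (mv A t \<omega>) - ?g\<bar> \<le> ?B \<omega>" for \<omega>
  proof -
    let ?h = "snd (snd \<omega>)" and ?s = "?S (fst (snd \<omega>))"
    have "fst (mv A t \<omega>) - ?g = (?h - m) * (b0 + ?s / 2) + m * (b0 + (?s - (real n - 1) * ?g) / 2) + (m * ((real n - 1) / 2) - 1) * ?g"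
      unfolding fst_mv[OF A] by (simp add: field_simps)
    moreover have "\<bar>(?h - m) * (b0 + ?s / 2)\<bar> = (b0 + ?s / 2) * \<bar>?h - m\<bar>"
      using S0[of "fst (snd \<omega>)"] by (simp only: abs_mult abs_of_nonneg) (rule mult.commute)
    moreover have "\<bar>m * (b0 + (?s - (real n - 1) * ?g) / 2)\<bar> \<le> m * (b0 + \<bar>?s - (real n - 1) * ?g\<bar> / 2)"
    proof -
      have "\<bar>b0 + x / 2\<bar> \<le> b0 + \<bar>x\<bar> / 2" for x :: real using b0 by (simp add: abs_if)
      then show ?thesis using m by (simp only: abs_mult abs_of_pos) (rule mult_left_mono, auto)
    qed
    moreover have "\<bar>(m * ((real n - 1) / 2) - 1) * ?g\<bar> = \<bar>m * ((real n - 1) / 2) - 1\<bar> * ?g"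
      using g0 by (simp add: abs_mult)
    moreover have "\<bar>x\<bar> \<le> p' + q' + r'" if "x = p + q + r" "\<bar>p\<bar> = p'" "\<bar>q\<bar> \<le> q'" "\<bar>r\<bar> = r'" for x p q r p' q' r' :: real
      using that by linarith
    ultimately show ?thesis by blast
  qed
  have BI: "integrable noise ?B" using P(1) T(1) by simp
  show I: "integrable noise (\<lambda>\<omega>. \<bar>fst (mv A t \<omega>) - ?g\<bar>)"
  proof (rule Bochner_Integration.integrable_bound[OF BI])
    show "AE \<omega> in noise. norm \<bar>fst (mv A t \<omega>) - ?g\<bar> \<le> norm (?B \<omega>)"
    proof (rule AE_I2)
      fix \<omega>
      show "norm \<bar>fst (mv A t \<omega>) - ?g\<bar> \<le> norm (?B \<omega>)" using B[of \<omega>] unfolding real_norm_def by linarith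
    qed
  qed measurable
  have "(\<integral>\<omega>. \<bar>fst (mv A t \<omega>) - ?g\<bar> \<partial>noise) \<le> (\<integral>\<omega>. ?B \<omega> \<partial>noise)" by (intro integral_mono I BI B)
  also have "\<dots> = (b0 + (real n - 1) * ?g / 2) * (\<integral>h. \<bar>h - m\<bar> \<partial>ig shp 1)
      + m * (b0 + (\<integral>z. \<bar>?S z - (real n - 1) * ?g\<bar> \<partial>normals n) / 2) + \<bar>m * ((real n - 1) / 2) - 1\<bar> * ?g"
  proof -
    have "(\<integral>\<omega>. ?B \<omega> \<partial>noise) = (\<integral>\<omega>. (b0 + ?S (fst (snd \<omega>)) / 2) * \<bar>snd (snd \<omega>) - m\<bar> \<partial>noise)
        + m * (b0 + (\<integral>\<omega>. \<bar>?S (fst (snd \<omega>)) - (real n - 1) * ?g\<bar> \<partial>noise) / 2) + \<bar>m * ((real n - 1) / 2) - 1\<bar> * ?g"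
      using P(1) T(1) by (simp add: prob_space)
    then show ?thesis unfolding P(2) T(2) Se .
  qed
  also have "\<dots> \<le> (b0 + (real n - 1) * ?g / 2) * (m / sqrt (shp - 2))
      + m * (b0 + (2 * (?u * sqrt (V * ?u)) * sqrt (Delta Y n) + V * ?u * (sqrt (2 * real n) + 2)) / 2) + \<bar>m * ((real n - 1) / 2) - 1\<bar> * ?g"
  proof -
    have "(b0 + (real n - 1) * ?g / 2) * (\<integral>h. \<bar>h - m\<bar> \<partial>ig shp 1) \<le> (b0 + (real n - 1) * ?g / 2) * (m / sqrt (shp - 2))"
      using g0 b0 n2 by (intro mult_left_mono hd) auto
    moreover have "m * (b0 + (\<integral>z. \<bar>?S z - (real n - 1) * ?g\<bar> \<partial>normals n) / 2)
        \<le> m * (b0 + (2 * (?u * sqrt (V * ?u)) * sqrt (Delta Y n) + V * ?u * (sqrt (2 * real n) + 2)) / 2)"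
      using m Te by (intro mult_left_mono) auto
    ultimately show ?thesis by (intro add_mono order_refl)
  qed
  finally show "(\<integral>\<omega>. \<bar>fst (mv A t \<omega>) - ?g\<bar> \<partial>noise) \<le> m / sqrt (shp - 2) * (b0 + (real n - 1) * ?g / 2)
      + m * (b0 + (2 * (?u * sqrt (V * ?u)) * sqrt (Delta Y n) + V * ?u * (sqrt (2 * real n) + 2)) / 2)
      + \<bar>m * ((real n - 1) / 2) - 1\<bar> * ?g" by (simp add: mult.commute)
qed

lemma tbar_mv_fluctuation:
  fixes t :: real
  assumes A: "A > 0"
  defines "R \<equiv> \<lambda>\<omega>. \<bar>tbar n (snd (snd (mv A t \<omega>))) - ((1 - frac A) * t + frac A * Ybar Y n)\<bar>"
  shows "integrable noise R" and "(\<integral>\<omega>. R \<omega> \<partial>noise) \<le> (sqrt A + sqrt V) / sqrt (real n)"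
proof -
  interpret prob_space noise by (rule prob_space_noise)
  note f = frac_bounds[OF A]
  have n: "sqrt (real n) > 0" using n2 by simp
  let ?B = "\<lambda>\<omega>. sqrt A / sqrt (real n) * \<bar>fst \<omega>\<bar> + sqrt V * \<bar>tbar n (fst (snd \<omega>))\<bar>"
  have B: "R \<omega> \<le> ?B \<omega>" for \<omega>
  proof -
    have "R \<omega> = \<bar>(1 - frac A) * (sqrt A / sqrt (real n) * fst \<omega>) + sqrt V * sqrt (frac A) * tbar n (fst (snd \<omega>))\<bar>"
      unfolding R_def tbar_mv[OF A] by (simp add: real_sqrt_divide real_sqrt_mult algebra_simps)
    also have "\<dots> \<le> (1 - frac A) * (sqrt A / sqrt (real n) * \<bar>fst \<omega>\<bar>) + sqrt (frac A) * (sqrt V * \<bar>tbar n (fst (snd \<omega>))\<bar>)"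
      using f V A n abs_triangle_ineq[of "(1 - frac A) * (sqrt A / sqrt (real n) * fst \<omega>)" "sqrt V * sqrt (frac A) * tbar n (fst (snd \<omega>))"]
      by (simp add: abs_mult mult_ac)
    also have "\<dots> \<le> 1 * (sqrt A / sqrt (real n) * \<bar>fst \<omega>\<bar>) + 1 * (sqrt V * \<bar>tbar n (fst (snd \<omega>))\<bar>)"
      using f V A n by (intro add_mono mult_right_mono) auto
    finally show ?thesis by simp
  qed
  have BI: "integrable noise ?B" using noise_xi_abs(1) noise_tbar_abs(1) by simp
  have R0: "R \<omega> \<ge> 0" for \<omega> by (simp add: R_def)
  show I: "integrable noise R"
  proof (rule Bochner_Integration.integrable_bound[OF BI])
    show "R \<in> borel_measurable noise" unfolding R_def by measurable
    show "AE \<omega> in noise. norm (R \<omega>) \<le> norm (?B \<omega>)"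
    proof (rule AE_I2)
      fix \<omega>
      show "norm (R \<omega>) \<le> norm (?B \<omega>)" using B[of \<omega>] R0[of \<omega>] unfolding real_norm_def by linarith
    qed
  qed
  have "(\<integral>\<omega>. R \<omega> \<partial>noise) \<le> (\<integral>\<omega>. ?B \<omega> \<partial>noise)" by (intro integral_mono I BI B)
  also have "\<dots> = sqrt A / sqrt (real n) * (\<integral>\<omega>. \<bar>fst \<omega>\<bar> \<partial>noise) + sqrt V * (\<integral>\<omega>. \<bar>tbar n (fst (snd \<omega>))\<bar> \<partial>noise)"
    using noise_xi_abs(1) noise_tbar_abs(1) by simp
  also have "\<dots> \<le> sqrt A / sqrt (real n) * 1 + sqrt V * (1 / sqrt (real n))"
    using A V n by (intro add_mono mult_left_mono noise_xi_abs(2) noise_tbar_abs(2)) auto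
  finally show "(\<integral>\<omega>. R \<omega> \<partial>noise) \<le> (sqrt A + sqrt V) / sqrt (real n)" by (simp add: add_divide_distrib)
qed

end

section \<open>Uniform constants for one sample size under assumption (A)\<close>

locale gibbs_bd = gibbs +
  fixes \<delta> Mb \<epsilon> :: real
  assumes \<delta>: "\<delta> > 0" and n10: "n \<ge> 10"
    and lower: "V + \<delta> \<le> Delta Y n / (real n - 1)" and upper: "Delta Y n / (real n - 1) \<le> Mb"
    and \<epsilon>: "0 < \<epsilon>" "\<epsilon> \<le> \<delta> / 2"
begin

definition dd :: real where "dd = Delta Y n / (real n - 1) - V"

text \<open>Since \<open>A \<ge> \<delta> / 2\<close> on the good sets, this bounds
  \<open>frac\<close> from below there. Like the constants \<open>KT\<close>, \<open>KA\<close>,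
  \<open>KL\<close>, \<open>esc\<close>, \<open>KP\<close>, \<open>K1\<close>, \<open>K2\<close> to
  come, it involves neither \<open>n\<close> nor the data, which makes the final constants
  uniform.\<close>

definition u0 :: real where "u0 = frac (\<delta> / 2)"

definition rho :: "state \<Rightarrow> state \<Rightarrow> real" where
  "rho x y = sqrt (real n) * \<bar>fst x - fst y\<bar> + sqrt (real n) * \<bar>tbar n (snd (snd x)) - tbar n (snd (snd y))\<bar>"

text \<open>Starting points satisfy the stronger bound \<open>dd - \<delta>\<close>. That radius may
  be 0 and then tolerates no fluctuation; \<open>dd - \<delta> / 2\<close> is at least
  \<open>\<delta> / 2\<close> and still forces \<open>A \<ge> \<delta> / 2\<close>.\<close>

definition good1 :: "real \<Rightarrow> bool" where "good1 A \<longleftrightarrow> \<bar>A - dd\<bar> \<le> dd - \<delta> / 2"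

definition good2 :: "real \<Rightarrow> real \<Rightarrow> bool" where
  "good2 A t \<longleftrightarrow> \<bar>A - dd\<bar> \<le> \<epsilon> \<and> \<bar>t - Ybar Y n\<bar> \<le> \<epsilon>"

lemma dd_ge: "dd \<ge> \<delta>" and dd_le: "dd + V \<le> Mb" and Delta_eq: "Delta Y n = (real n - 1) * (dd + V)"
  using lower upper n2 by (auto simp: dd_def)

lemma Mb_pos: "Mb > 0" using dd_ge dd_le V \<delta> by linarith

lemma good1D: "good1 A \<Longrightarrow> A \<ge> \<delta> / 2" "good1 A \<Longrightarrow> A > 0" "good1 A \<Longrightarrow> A \<le> 2 * Mb"
  using dd_ge dd_le \<delta> V unfolding good1_def by linarith+

lemma good2_good1: "good2 A t \<Longrightarrow> good1 A"
  using dd_ge \<epsilon> unfolding good2_def good1_def by linarith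

lemma u0_bounds: "0 < u0" "u0 < 1"
  using frac_bounds[of "\<delta> / 2"] \<delta> by (auto simp: u0_def)

lemma frac_ge_u0:
  assumes "A \<ge> \<delta> / 2"
  shows "frac A \<ge> u0"
proof -
  have "frac A - u0 = V * (A - \<delta> / 2) / ((V + A) * (V + \<delta> / 2))"
    unfolding u0_def using assms \<delta> by (intro frac_diff) auto
  also have "\<dots> \<ge> 0" using assms \<delta> V by (intro divide_nonneg_nonneg mult_nonneg_nonneg) auto
  finally show ?thesis by simp
qed

lemma frac_diff_le:
  assumes "A > 0" "A' > 0"
  shows "\<bar>frac A - frac A'\<bar> \<le> \<bar>A - A'\<bar> / V"
proof -
  have "\<bar>frac A - frac A'\<bar> = \<bar>A - A'\<bar> * (V / ((V + A) * (V + A')))"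
    unfolding frac_diff[OF assms] using assms V by (simp add: abs_mult)
  also have "\<dots> \<le> \<bar>A - A'\<bar> * (1 / V)"
  proof (rule mult_left_mono)
    have "V * V \<le> (V + A) * (V + A')" using assms V by (intro mult_mono) auto
    then show "V / ((V + A) * (V + A')) \<le> 1 / V" using assms V by (simp add: divide_simps)
  qed simp
  finally show ?thesis by simp
qed

text \<open>From sample size 10 on, \<open>(n - 1) / 2 - 2\<close> is at least \<open>n / 4\<close>,
  whatever the value of \<open>a > 0\<close>.\<close>

lemma shp_bounds: "shp > 2" "2 * (shp - 1) \<ge> real n - 3" "shp - 1 \<ge> real n / 4" "shp - 2 \<ge> real n / 4"
  using a n10 by (auto simp: shp_def field_simps)

subsection \<open>Contraction of two coupled copies\<close>

text \<open>The first summand bounds the secant slope of \<open>drift_map\<close> towards a point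
  within \<open>\<epsilon>\<close> of \<open>dd\<close>. The second comes from \<open>W\<close>,
  whose mean absolute value is at most \<open>sqrt (Delta Y n)\<close>. The last factor is
  \<open>n - 1\<close> over the lower bound \<open>n - 3\<close> of \<open>2 * (shp - 1)\<close>.
  The last two tend to 0 and 1 with growing \<open>n\<close>.\<close>

definition rateA :: real where
  "rateA = ((1 - u0\<^sup>2) * (1 + \<epsilon> / V) + 3 * sqrt Mb / (sqrt V * sqrt (real n - 1))) * ((real n - 1) / (real n - 3))"

text \<open>If \<open>A2 = dd\<close>, then \<open>dd + V = V + A2\<close> and the secant slope
  collapses to \<open>(1 - u1) * (1 + u1)\<close> with \<open>u1 = frac A1\<close>. For
  \<open>A2\<close> within \<open>\<epsilon>\<close> of \<open>dd\<close> the same computation holds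
  up to the factor \<open>1 + \<epsilon> / V\<close>.\<close>

lemma contraction_A:
  assumes g1: "good1 A1" and g2: "good2 A2 t2"
  shows "(\<integral>\<omega>. \<bar>fst (mv A1 t1 \<omega>) - fst (mv A2 t2 \<omega>)\<bar> \<partial>noise) \<le> rateA * \<bar>A1 - A2\<bar>"
proof -
  note A1 = good1D[OF g1] and A2 = good1D[OF good2_good1[OF g2]]
  let ?u1 = "frac A1" and ?u2 = "frac A2" and ?D = "dd + V" and ?r = "1 + \<epsilon> / V"
  define N where "N = real n - 1"
  have N: "N > 0" "N = sqrt N * sqrt N" "sqrt N > 0" using n10 by (auto simp: N_def)
  have D0: "?D \<ge> 0" using dd_ge \<delta> V by linarith
  have r1: "?r \<ge> 1" using \<epsilon> V by simp
  have cu: "\<bar>?u1 - ?u2\<bar> = \<bar>A1 - A2\<bar> * (V / ((V + A1) * (V + A2)))"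
    unfolding frac_diff[OF A1(2) A2(2)] using A1 A2 V by (simp add: abs_mult)
  \<comment> \<open>The additive tolerance becomes a factor, because
    \<open>\<epsilon> \<le> (\<epsilon> / V) * (V + A2)\<close>; the product form then cancels
    against a denominator.\<close>
  have DB: "?D \<le> ?r * (V + A2)"
  proof -
    have "?D \<le> V + A2 + \<epsilon>" using g2 by (simp add: good2_def abs_le_iff)
    moreover have "\<epsilon> / V * (V + A2) = \<epsilon> + \<epsilon> * A2 / V" using V by (simp add: distrib_left)
    moreover have "\<epsilon> * A2 / V \<ge> 0" using \<epsilon> A2 V by simp
    ultimately show ?thesis unfolding distrib_right mult_1_left by linarith
  qed
  have T: "V * ((?u1 + ?u2) * ?D + V) / ((V + A1) * (V + A2)) \<le> (1 - u0\<^sup>2) * ?r"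
  proof -
    have u2: "?u2 * ?D \<le> ?r * A2"
    proof -
      have "?u2 * ?D \<le> ?u2 * (?r * (V + A2))" using frac_bounds[OF A2(2)] by (intro mult_left_mono DB) auto
      also have "\<dots> = ?r * (?u2 * (V + A2))" by simp
      also have "?u2 * (V + A2) = A2" using A2 V by (simp add: frac_def)
      finally show ?thesis .
    qed
    have "(?u1 + ?u2) * ?D + V = ?u1 * ?D + ?u2 * ?D + V" by (simp add: algebra_simps)
    also have "\<dots> \<le> ?u1 * (?r * (V + A2)) + ?r * A2 + ?r * V"
      using r1 V frac_bounds[OF A1(2)] by (intro add_mono mult_left_mono DB u2) auto
    also have "\<dots> = (1 + ?u1) * ?r * (V + A2)"
    proof -
      have "u * (r * (V + A2)) + r * A2 + r * V = (1 + u) * r * (V + A2)" for u r :: real by (simp add: algebra_simps)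
      then show ?thesis .
    qed
    finally have "V * ((?u1 + ?u2) * ?D + V) / ((V + A1) * (V + A2)) \<le> V * ((1 + ?u1) * ?r * (V + A2)) / ((V + A1) * (V + A2))"
      using V A1 A2 by (intro divide_right_mono mult_left_mono) auto
    also have "\<dots> = V / (V + A1) * ((1 + ?u1) * ?r)" using V A2 by simp
    also have "\<dots> = (1 - ?u1\<^sup>2) * ?r"
    proof -
      have "(1 - u) * ((1 + u) * r) = (1 - u\<^sup>2) * r" for u r :: real by (simp add: power2_eq_square algebra_simps)
      then show ?thesis unfolding one_minus_frac[OF A1(2), symmetric] .
    qed
    also have "\<dots> \<le> (1 - u0\<^sup>2) * ?r"
      using frac_ge_u0[OF A1(1)] u0_bounds r1 by (intro mult_right_mono diff_left_mono power_mono) auto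
    finally show ?thesis .
  qed
  have E: "V * (3 * sqrt V * sqrt ?D / sqrt N) / ((V + A1) * (V + A2)) \<le> 3 * sqrt Mb / (sqrt V * sqrt N)"
  proof -
    have "V * (3 * sqrt V * sqrt ?D / sqrt N) / ((V + A1) * (V + A2)) \<le> V * (3 * sqrt V * sqrt Mb / sqrt N) / (V * V)"
      using V A1 A2 N dd_le D0 Mb_pos
      by (intro frac_le mult_left_mono divide_right_mono mult_mono) (auto intro!: mult_pos_pos mult_nonneg_nonneg divide_nonneg_nonneg)
    also have "\<dots> = 3 * sqrt Mb / (sqrt V * sqrt N)"
    proof -
      have "r * r * (3 * r * c / s) / (r * r * (r * r)) = 3 * c / (r * s)" if "r > 0" for r c s :: real
        using that by simp
      from this[of "sqrt V"] show ?thesis using V by simp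
    qed
    finally show ?thesis .
  qed
  have key: "V / ((V + A1) * (V + A2)) * ((?u1 + ?u2) * Delta Y n + 3 * sqrt V * sqrt (Delta Y n) + V * N)
      \<le> ((1 - u0\<^sup>2) * ?r + 3 * sqrt Mb / (sqrt V * sqrt N)) * N"
  proof -
    have DN: "Delta Y n = N * ?D" by (simp add: Delta_eq N_def)
    have s: "sqrt (Delta Y n) = N * (sqrt ?D / sqrt N)"
      unfolding DN real_sqrt_mult using N by (simp add: field_simps)
    have "V / ((V + A1) * (V + A2)) * ((?u1 + ?u2) * Delta Y n + 3 * sqrt V * sqrt (Delta Y n) + V * N)
      = (V * ((?u1 + ?u2) * ?D + V) / ((V + A1) * (V + A2)) + V * (3 * sqrt V * sqrt ?D / sqrt N) / ((V + A1) * (V + A2))) * N"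
      unfolding s unfolding DN by (simp add: algebra_simps add_divide_distrib)
    also have "\<dots> \<le> ((1 - u0\<^sup>2) * ?r + 3 * sqrt Mb / (sqrt V * sqrt N)) * N"
      using N by (intro mult_right_mono add_mono T E) auto
    finally show ?thesis .
  qed
  have q0: "(1 - u0\<^sup>2) * ?r + 3 * sqrt Mb / (sqrt V * sqrt N) \<ge> 0"
    using u0_bounds \<epsilon> V N Mb_pos by (intro add_nonneg_nonneg mult_nonneg_nonneg divide_nonneg_nonneg)
      (auto simp: abs_square_le_1 power2_eq_square intro!: mult_le_one)
  have "(\<integral>\<omega>. \<bar>fst (mv A1 t1 \<omega>) - fst (mv A2 t2 \<omega>)\<bar> \<partial>noise) \<le> \<bar>?u1 - ?u2\<bar> / (2 * (shp - 1)) *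
      ((?u1 + ?u2) * Delta Y n + 3 * sqrt V * sqrt (Delta Y n) + V * N)"
    unfolding N_def by (rule fst_mv_diff_expectation(2)[OF A1(2) A2(2) shp_bounds(1)])
  also have "\<dots> = \<bar>A1 - A2\<bar> * (V / ((V + A1) * (V + A2)) * ((?u1 + ?u2) * Delta Y n + 3 * sqrt V * sqrt (Delta Y n) + V * N)) * (1 / (2 * (shp - 1)))"
    unfolding cu by simp
  also have "\<dots> \<le> \<bar>A1 - A2\<bar> * (((1 - u0\<^sup>2) * ?r + 3 * sqrt Mb / (sqrt V * sqrt N)) * N) * (1 / (real n - 3))"
  proof (rule mult_mono)
    show "1 / (2 * (shp - 1)) \<le> 1 / (real n - 3)"
      using shp_bounds(2) n10 by (intro divide_left_mono) auto
    show "\<bar>A1 - A2\<bar> * (V / ((V + A1) * (V + A2)) * ((?u1 + ?u2) * Delta Y n + 3 * sqrt V * sqrt (Delta Y n) + V * N))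
      \<le> \<bar>A1 - A2\<bar> * (((1 - u0\<^sup>2) * ?r + 3 * sqrt Mb / (sqrt V * sqrt N)) * N)"
      by (rule mult_left_mono[OF key]) simp
    show "0 \<le> \<bar>A1 - A2\<bar> * (((1 - u0\<^sup>2) * ?r + 3 * sqrt Mb / (sqrt V * sqrt N)) * N)"
      using q0 N(1) by (intro mult_nonneg_nonneg) auto
  qed (use shp_bounds in simp)
  also have "\<dots> = rateA * \<bar>A1 - A2\<bar>" by (simp add: rateA_def N_def)
  finally show ?thesis .
qed

text \<open>Lipschitz constants in \<open>A\<close> of the noise coefficients in the mean of
  \<open>\<theta>\<close>: the first two summands for \<open>(1 - frac A) * sqrt A\<close>, the
  third for \<open>sqrt (V * frac A)\<close>.\<close>

definition KT :: real where "KT = 1 / sqrt \<delta> + sqrt (2 * Mb) / V + 1 / (sqrt V * sqrt u0)"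

lemma sqrt_diff_le:
  assumes "A1 \<ge> \<delta> / 2" "A2 \<ge> \<delta> / 2"
  shows "\<bar>sqrt A1 - sqrt A2\<bar> \<le> \<bar>A1 - A2\<bar> / sqrt \<delta>"
proof -
  have "sqrt (\<delta> / 2) \<le> sqrt A1" "sqrt (\<delta> / 2) \<le> sqrt A2" using assms by auto
  moreover have "sqrt \<delta> \<le> 2 * sqrt (\<delta> / 2)"
    using \<delta> by (intro real_le_lsqrt) (auto simp: power_mult_distrib)
  ultimately have "sqrt \<delta> \<le> sqrt A1 + sqrt A2" by linarith
  moreover have "sqrt \<delta> > 0" using \<delta> by simp
  ultimately show ?thesis using assms \<delta>
    by (subst abs_sqrt_diff_le) (auto intro!: divide_left_mono mult_pos_pos add_pos_pos)
qed

lemma sqrt_frac_diff_le: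
  assumes "A1 \<ge> \<delta> / 2" "A2 \<ge> \<delta> / 2"
  shows "\<bar>sqrt (V * frac A1) - sqrt (V * frac A2)\<bar> \<le> \<bar>A1 - A2\<bar> / (sqrt V * sqrt u0)"
proof -
  have A: "A1 > 0" "A2 > 0" using assms \<delta> by auto
  note f = frac_bounds[OF A(1)] frac_bounds[OF A(2)] frac_ge_u0[OF assms(1)] frac_ge_u0[OF assms(2)] u0_bounds
  have s: "sqrt u0 > 0" "sqrt u0 \<le> sqrt (frac A1)" "sqrt (frac A2) > 0" using f by auto
  have "\<bar>sqrt (V * frac A1) - sqrt (V * frac A2)\<bar> = sqrt V * \<bar>sqrt (frac A1) - sqrt (frac A2)\<bar>"
    using V by (simp add: real_sqrt_mult right_diff_distrib[symmetric] abs_mult)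
  also have "\<bar>sqrt (frac A1) - sqrt (frac A2)\<bar> = \<bar>frac A1 - frac A2\<bar> / (sqrt (frac A1) + sqrt (frac A2))"
    using f by (intro abs_sqrt_diff_le) auto
  also have "\<dots> \<le> (\<bar>A1 - A2\<bar> / V) / sqrt u0"
  proof (rule frac_le)
    show "sqrt u0 \<le> sqrt (frac A1) + sqrt (frac A2)" using s by linarith
  qed (use s frac_diff_le[OF A] V in simp_all)
  also have "sqrt V * (\<bar>A1 - A2\<bar> / V / sqrt u0) = \<bar>A1 - A2\<bar> / (sqrt V * sqrt u0)"
  proof -
    have "r * (c / (r * r) / q) = c / (r * q)" if "r > 0" for r c q :: real using that by simp
    from this[of "sqrt V"] show ?thesis using V by simp
  qed
  finally show ?thesis using V by simp
qed

lemma contraction_t: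
  assumes g1: "good1 A1" and g2: "good2 A2 t2"
  shows "(\<integral>\<omega>. sqrt (real n) * \<bar>tbar n (snd (snd (mv A1 t1 \<omega>))) - tbar n (snd (snd (mv A2 t2 \<omega>)))\<bar> \<partial>noise)
    \<le> (1 - u0) * (sqrt (real n) * \<bar>t1 - t2\<bar>) + (\<epsilon> / V + KT / sqrt (real n)) * (sqrt (real n) * \<bar>A1 - A2\<bar>)"
proof -
  note A1 = good1D[OF g1] and A2 = good1D[OF good2_good1[OF g2]]
  let ?u1 = "frac A1" and ?u2 = "frac A2"
  have n: "sqrt (real n) > 0" using n2 by simp
  have 1: "(1 - ?u1) * (sqrt (real n) * \<bar>t1 - t2\<bar>) \<le> (1 - u0) * (sqrt (real n) * \<bar>t1 - t2\<bar>)"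
    using frac_ge_u0[OF A1(1)] n by (intro mult_right_mono) auto
  have 2: "\<bar>?u1 - ?u2\<bar> * (sqrt (real n) * \<bar>t2 - Ybar Y n\<bar>) \<le> (\<bar>A1 - A2\<bar> / V) * (sqrt (real n) * \<epsilon>)"
    using frac_diff_le[OF A1(2) A2(2)] g2 n V by (intro mult_mono) (auto simp: good2_def)
  have 3: "\<bar>(1 - ?u1) * sqrt A1 - (1 - ?u2) * sqrt A2\<bar> \<le> \<bar>A1 - A2\<bar> / sqrt \<delta> + \<bar>A1 - A2\<bar> / V * sqrt (2 * Mb)"
  proof -
    have "\<bar>(1 - ?u1) * sqrt A1 - (1 - ?u2) * sqrt A2\<bar> = \<bar>(1 - ?u1) * (sqrt A1 - sqrt A2) + (?u2 - ?u1) * sqrt A2\<bar>"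
      by (simp add: algebra_simps)
    also have "\<dots> \<le> \<bar>(1 - ?u1) * (sqrt A1 - sqrt A2)\<bar> + \<bar>(?u2 - ?u1) * sqrt A2\<bar>" by (rule abs_triangle_ineq)
    also have "\<dots> = (1 - ?u1) * \<bar>sqrt A1 - sqrt A2\<bar> + \<bar>?u1 - ?u2\<bar> * sqrt A2"
      using frac_bounds[OF A1(2)] A2 by (simp add: abs_mult abs_minus_commute)
    also have "\<dots> \<le> 1 * (\<bar>A1 - A2\<bar> / sqrt \<delta>) + (\<bar>A1 - A2\<bar> / V) * sqrt (2 * Mb)"
      using frac_bounds[OF A1(2)] sqrt_diff_le[OF A1(1) A2(1)] frac_diff_le[OF A1(2) A2(2)] A2 V
      by (intro add_mono mult_mono) auto
    finally show ?thesis by simp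
  qed
  have 4: "\<bar>sqrt (V * ?u1) - sqrt (V * ?u2)\<bar> \<le> \<bar>A1 - A2\<bar> / (sqrt V * sqrt u0)"
    by (rule sqrt_frac_diff_le[OF A1(1) A2(1)])
  have 5: "(\<epsilon> / V + KT / sqrt (real n)) * (sqrt (real n) * \<bar>A1 - A2\<bar>) = (\<bar>A1 - A2\<bar> / V) * (sqrt (real n) * \<epsilon>) +
     (\<bar>A1 - A2\<bar> / sqrt \<delta> + \<bar>A1 - A2\<bar> / V * sqrt (2 * Mb)) + \<bar>A1 - A2\<bar> / (sqrt V * sqrt u0)"
  proof -
    have "(\<epsilon> / V + KT / s) * (s * c) = c / V * (s * \<epsilon>) + (c / sqrt \<delta> + c / V * sqrt (2 * Mb)) + c / (sqrt V * sqrt u0)"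
      if "s > 0" for s c using that by (simp add: KT_def algebra_simps add_divide_distrib)
    then show ?thesis using n .
  qed
  show ?thesis
    using tbar_mv_diff_expectation(2)[OF A1(2) A2(2), of t1 t2] 1 2 3 4 unfolding 5 by linarith
qed

text \<open>\<open>A\<close> is not influenced by \<open>t\<close>, while \<open>t\<close> receives
  from \<open>A\<close> the coefficient \<open>\<epsilon> / V + KT / sqrt n\<close>. In this
  triangular system \<open>\<gamma>\<close> dominates both column sums: \<open>rateA\<close> plus
  that coefficient for the difference in \<open>A\<close>, and \<open>1 - u0\<close> for the
  difference in \<open>t\<close>.\<close>

lemma contraction:
  assumes g1: "good1 A1" and g2: "good2 A2 t2"
    and \<gamma>: "rateA + (\<epsilon> / V + KT / sqrt (real n)) \<le> \<gamma>" "1 - u0 \<le> \<gamma>"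
  shows "integrable noise (\<lambda>\<omega>. rho (mv A1 t1 \<omega>) (mv A2 t2 \<omega>))"
    and "(\<integral>\<omega>. rho (mv A1 t1 \<omega>) (mv A2 t2 \<omega>) \<partial>noise) \<le> \<gamma> * (sqrt (real n) * \<bar>A1 - A2\<bar> + sqrt (real n) * \<bar>t1 - t2\<bar>)"
proof -
  note A1 = good1D[OF g1] and A2 = good1D[OF good2_good1[OF g2]]
  note I = fst_mv_diff_expectation(1)[OF A1(2) A2(2) shp_bounds(1), of t1 t2] tbar_mv_diff_expectation(1)[OF A1(2) A2(2), of t1 t2]
  show "integrable noise (\<lambda>\<omega>. rho (mv A1 t1 \<omega>) (mv A2 t2 \<omega>))"
    unfolding rho_def using I by simp
  have "(\<integral>\<omega>. rho (mv A1 t1 \<omega>) (mv A2 t2 \<omega>) \<partial>noise) = sqrt (real n) * (\<integral>\<omega>. \<bar>fst (mv A1 t1 \<omega>) - fst (mv A2 t2 \<omega>)\<bar> \<partial>noise)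
     + (\<integral>\<omega>. sqrt (real n) * \<bar>tbar n (snd (snd (mv A1 t1 \<omega>))) - tbar n (snd (snd (mv A2 t2 \<omega>)))\<bar> \<partial>noise)"
    unfolding rho_def using I by simp
  also have "\<dots> \<le> sqrt (real n) * (rateA * \<bar>A1 - A2\<bar>) + ((1 - u0) * (sqrt (real n) * \<bar>t1 - t2\<bar>) + (\<epsilon> / V + KT / sqrt (real n)) * (sqrt (real n) * \<bar>A1 - A2\<bar>))"
    by (intro add_mono mult_left_mono contraction_A[OF g1 g2] contraction_t[OF g1 g2]) simp
  also have "\<dots> = (rateA + (\<epsilon> / V + KT / sqrt (real n))) * (sqrt (real n) * \<bar>A1 - A2\<bar>) + (1 - u0) * (sqrt (real n) * \<bar>t1 - t2\<bar>)"
  proof -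
    have "s * (r * x) + (y + q * (s * x)) = (r + q) * (s * x) + y" for s r x y q :: real
      by (simp add: algebra_simps)
    then show ?thesis .
  qed
  also have "\<dots> \<le> \<gamma> * (sqrt (real n) * \<bar>A1 - A2\<bar>) + \<gamma> * (sqrt (real n) * \<bar>t1 - t2\<bar>)"
    using \<gamma> by (intro add_mono mult_right_mono) auto
  finally show "(\<integral>\<omega>. rho (mv A1 t1 \<omega>) (mv A2 t2 \<omega>) \<partial>noise) \<le> \<gamma> * (sqrt (real n) * \<bar>A1 - A2\<bar> + sqrt (real n) * \<bar>t1 - t2\<bar>)"
    by (simp add: distrib_left)
qed

subsection \<open>Escape from the good sets\<close>

text \<open>One summand for each of the three errors in \<open>fst_mv_fluctuation\<close>.\<close>

definition KA :: real where
  "KA = 8 * (b0 + Mb) + 4 * (b0 + sqrt V * sqrt Mb + 2 * V) + 8 * (1 + a) * Mb"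

lemma drift_map_le: "A > 0 \<Longrightarrow> 0 \<le> drift_map A" "A > 0 \<Longrightarrow> drift_map A \<le> 2 * Mb"
proof -
  assume A: "A > 0"
  note f = frac_bounds[OF A]
  have D: "Delta Y n / (real n - 1) = dd + V" by (simp add: dd_def)
  have p: "dd + V > 0" using dd_ge \<delta> V by simp
  show "0 \<le> drift_map A" unfolding drift_map_def D using f p V by simp
  have "(frac A)\<^sup>2 * (dd + V) \<le> 1 * Mb"
    using f p dd_le by (intro mult_mono power_le_one) auto
  moreover have "V * frac A \<le> V * 1" using f V by (intro mult_left_mono) auto
  moreover have "V \<le> Mb" using dd_ge dd_le \<delta> by simp
  ultimately show "drift_map A \<le> 2 * Mb" unfolding drift_map_def D by simp
qed

lemma fluctuation_A:
  assumes A: "A > 0"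
  shows "(\<integral>\<omega>. \<bar>fst (mv A t \<omega>) - drift_map A\<bar> \<partial>noise) \<le> KA / sqrt (real n)"
proof -
  note f = frac_bounds[OF A]
  define s where "s = sqrt (real n)"
  have s: "s > 0" "s \<ge> 1" "real n = s * s" using n10 by (auto simp: s_def)
  define m where "m = 1 / (shp - 1)"
  have m: "m > 0" "m \<le> 4 / real n"
    using shp_bounds(3) n10 by (auto simp: m_def divide_simps split: if_splits)
  have g: "0 \<le> drift_map A" "drift_map A \<le> 2 * Mb" using drift_map_le[OF A] by auto
  have sq: "1 / sqrt (shp - 2) \<le> 2 / s"
  proof -
    have "s / 2 = sqrt (real n / 4)" by (simp add: s_def real_sqrt_divide)
    also have "\<dots> \<le> sqrt (shp - 2)" using shp_bounds(4) by simp
    finally have "1 / sqrt (shp - 2) \<le> 1 / (s / 2)"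
      using s shp_bounds(1) by (intro divide_left_mono) auto
    then show ?thesis by simp
  qed
  have 1: "m / sqrt (shp - 2) * (b0 + (real n - 1) * drift_map A / 2) \<le> 8 * (b0 + Mb) / s"
  proof -
    have "(real n - 1) * drift_map A \<le> real n * (2 * Mb)" using g n10 by (intro mult_mono) auto
    then have i: "b0 + (real n - 1) * drift_map A / 2 \<le> real n * (b0 + Mb)"
    proof -
      have "1 * b0 \<le> real n * b0" using b0 n10 by (intro mult_right_mono) auto
      then show ?thesis using \<open>(real n - 1) * drift_map A \<le> real n * (2 * Mb)\<close> by (simp add: distrib_left)
    qed
    have "m / sqrt (shp - 2) * (b0 + (real n - 1) * drift_map A / 2) = m * (1 / sqrt (shp - 2)) * (b0 + (real n - 1) * drift_map A / 2)" by simp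
    also have "\<dots> \<le> 4 / real n * (2 / s) * (real n * (b0 + Mb))"
      using m s i b0 g n10 shp_bounds by (intro mult_mono sq) auto
    also have "\<dots> = 8 * (b0 + Mb) / s" using n10 by simp
    finally show ?thesis .
  qed
  have 2: "m * (b0 + (2 * (frac A * sqrt (V * frac A)) * sqrt (Delta Y n) + V * frac A * (sqrt (2 * real n) + 2)) / 2)
     \<le> 4 * (b0 + sqrt V * sqrt Mb + 2 * V) / s"
  proof -
    have us: "frac A * sqrt (V * frac A) \<le> 1 * sqrt (V * 1)"
      using f V by (intro mult_mono real_sqrt_le_mono mult_left_mono) auto
    have "Delta Y n \<le> real n * Mb" unfolding Delta_eq using dd_le dd_ge \<delta> V n10 by (intro mult_mono) auto
    then have "sqrt (Delta Y n) \<le> sqrt (real n * Mb)" by simp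
    then have D: "sqrt (Delta Y n) \<le> s * sqrt Mb" by (simp add: s_def real_sqrt_mult)
    have "2 * (frac A * sqrt (V * frac A)) * sqrt (Delta Y n) \<le> 2 * sqrt V * (s * sqrt Mb)"
      using us f V D Delta_nonneg by (intro mult_mono) auto
    moreover have "V * frac A * (sqrt (2 * real n) + 2) \<le> V * 1 * (2 * s + 2 * s)"
    proof -
      have "sqrt (2 * real n) \<le> 2 * s" unfolding s_def by (intro real_le_lsqrt) (auto simp: power_mult_distrib)
      then show ?thesis using f V s by (intro mult_mono add_mono) auto
    qed
    ultimately have "b0 + (2 * (frac A * sqrt (V * frac A)) * sqrt (Delta Y n) + V * frac A * (sqrt (2 * real n) + 2)) / 2
      \<le> s * (b0 + sqrt V * sqrt Mb + 2 * V)"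
    proof -
      have "1 * b0 \<le> s * b0" using b0 s by (intro mult_right_mono) auto
      moreover have "b0 + (x + y) / 2 \<le> s * (b0 + v * w + 2 * V)"
        if "1 * b0 \<le> s * b0" "x \<le> 2 * v * (s * w)" "y \<le> V * 1 * (2 * s + 2 * s)" for x y v w
      proof -
        have "(x + y) / 2 \<le> (2 * v * (s * w) + V * 1 * (2 * s + 2 * s)) / 2"
          by (intro divide_right_mono add_mono that) simp
        also have "\<dots> = s * (v * w + 2 * V)" by (simp add: algebra_simps)
        finally have "1 * b0 + (x + y) / 2 \<le> s * b0 + s * (v * w + 2 * V)" by (rule add_mono[OF that(1)])
        also have "s * b0 + s * (v * w + 2 * V) = s * (b0 + v * w + 2 * V)" by (simp only: distrib_left add.assoc)
        finally show ?thesis by (simp only: mult_1_left)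
      qed
      ultimately show ?thesis
        using \<open>2 * (frac A * sqrt (V * frac A)) * sqrt (Delta Y n) \<le> 2 * sqrt V * (s * sqrt Mb)\<close>
          \<open>V * frac A * (sqrt (2 * real n) + 2) \<le> V * 1 * (2 * s + 2 * s)\<close> by blast
    qed
    then have "m * (b0 + (2 * (frac A * sqrt (V * frac A)) * sqrt (Delta Y n) + V * frac A * (sqrt (2 * real n) + 2)) / 2)
       \<le> 4 / real n * (s * (b0 + sqrt V * sqrt Mb + 2 * V))"
      using m b0 f V Delta_nonneg n10 by (intro mult_mono) auto
    also have "\<dots> = 4 * (b0 + sqrt V * sqrt Mb + 2 * V) / s" using s by simp
    finally show ?thesis .
  qed
  have 3: "\<bar>m * ((real n - 1) / 2) - 1\<bar> * drift_map A \<le> 8 * (1 + a) * Mb / s"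
  proof -
    \<comment> \<open>\<open>shp - 1\<close> and \<open>(n - 1) / 2\<close> differ by
      \<open>a - 1\<close>, so the mismatch is only of order \<open>1 / n\<close>; it is then
      relaxed to \<open>1 / sqrt n\<close>.\<close>
    have "m * ((real n - 1) / 2) - 1 = m * (1 - a)"
      using shp_bounds(1) by (simp add: m_def field_simps) (simp add: shp_def field_simps)
    then have "\<bar>m * ((real n - 1) / 2) - 1\<bar> = m * \<bar>1 - a\<bar>" using m by (simp add: abs_mult)
    also have "\<dots> \<le> 4 / real n * (1 + a)" using m a n10 by (intro mult_mono) auto
    also have "\<dots> \<le> 4 / s * (1 + a)"
      using s a mult_right_mono[of 1 s s] by (intro mult_right_mono divide_left_mono) auto
    finally have "\<bar>m * ((real n - 1) / 2) - 1\<bar> * drift_map A \<le> 4 / s * (1 + a) * (2 * Mb)"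
      using g s a by (intro mult_mono) auto
    then show ?thesis by (simp add: algebra_simps)
  qed
  have "(\<integral>\<omega>. \<bar>fst (mv A t \<omega>) - drift_map A\<bar> \<partial>noise) \<le> 8 * (b0 + Mb) / s + 4 * (b0 + sqrt V * sqrt Mb + 2 * V) / s + 8 * (1 + a) * Mb / s"
    using fst_mv_fluctuation(2)[OF A shp_bounds(1), of t, folded m_def] 1 2 3 by linarith
  also have "\<dots> = KA / sqrt (real n)" by (simp add: KA_def s_def add_divide_distrib)
  finally show ?thesis .
qed

text \<open>Markov's inequality in pointwise form: the mean map carries the good interval into a
  smaller one, so leaving requires a fluctuation of at least
  \<open>u0\<^sup>2 * \<delta> / 2\<close>. Written with 1 on the left it can be added to an
  integrand directly.\<close>

lemma escape1:
  assumes g1: "good1 A" and x: "\<not> good1 A'"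
  shows "1 \<le> \<bar>A' - drift_map A\<bar> * (2 / (u0\<^sup>2 * \<delta>))"
proof -
  note A = good1D[OF g1]
  have u2: "u0\<^sup>2 \<le> (frac A)\<^sup>2" "u0\<^sup>2 > 0" "(frac A)\<^sup>2 \<le> 1"
    using frac_ge_u0[OF A(1)] u0_bounds frac_bounds[OF A(2)] by (auto intro!: power_mono power_le_one)
  have "\<bar>drift_map A - dd\<bar> = (1 - (frac A)\<^sup>2) * \<bar>A - dd\<bar>"
    using drift_map_diff[OF A(2)] u2 by (simp add: dd_def abs_mult)
  also have "\<dots> \<le> (1 - u0\<^sup>2) * (dd - \<delta> / 2)"
    using g1 u2 by (intro mult_mono) (auto simp: good1_def)
  \<comment> \<open>As \<open>dd - \<delta> / 2 \<ge> \<delta> / 2\<close>, the gain is bounded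
    below even when \<open>dd\<close> equals \<open>\<delta>\<close>.\<close>
  also have "\<dots> \<le> dd - \<delta> / 2 - u0\<^sup>2 * (\<delta> / 2)"
    using dd_ge u2 mult_left_mono[of "\<delta> / 2" "dd - \<delta> / 2" "u0\<^sup>2"] by (simp add: algebra_simps)
  finally have "\<bar>A' - drift_map A\<bar> \<ge> u0\<^sup>2 * (\<delta> / 2)"
    using x unfolding good1_def by linarith
  then show ?thesis using u2 \<delta> by (simp add: field_simps)
qed

text \<open>Either coordinate may leave. The mean maps shrink the two intervals of radius
  \<open>\<epsilon>\<close> by \<open>1 - u0\<^sup>2\<close> and \<open>1 - u0\<close>, and the sum
  of the two scaled fluctuations covers both cases.\<close>

lemma escape2:
  assumes g2: "good2 A t" and x: "\<not> good2 A' t'"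
  shows "1 \<le> \<bar>A' - drift_map A\<bar> * (1 / (u0\<^sup>2 * \<epsilon>)) + \<bar>t' - ((1 - frac A) * t + frac A * Ybar Y n)\<bar> * (1 / (u0 * \<epsilon>))"
    (is "1 \<le> ?a + ?b")
proof -
  note A = good1D[OF good2_good1[OF g2]]
  have u1: "u0 \<le> frac A" "frac A < 1" using frac_ge_u0[OF A(1)] frac_bounds[OF A(2)] by auto
  have u2: "u0\<^sup>2 \<le> (frac A)\<^sup>2" "u0\<^sup>2 > 0" "(frac A)\<^sup>2 \<le> 1"
    using u0_bounds u1 frac_bounds[OF A(2)] by (auto intro!: power_mono power_le_one)
  have ab: "?a \<ge> 0" "?b \<ge> 0" using u0_bounds \<epsilon> by auto
  consider "\<bar>A' - dd\<bar> > \<epsilon>" | "\<bar>t' - Ybar Y n\<bar> > \<epsilon>" using x unfolding good2_def by linarith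
  then show ?thesis
  proof cases
    case 1
    have "\<bar>drift_map A - dd\<bar> = (1 - (frac A)\<^sup>2) * \<bar>A - dd\<bar>"
      using drift_map_diff[OF A(2)] u2 by (simp add: dd_def abs_mult)
    also have "\<dots> \<le> (1 - u0\<^sup>2) * \<epsilon>"
      using g2 u2 by (intro mult_mono) (auto simp: good2_def)
    finally have "\<bar>A' - drift_map A\<bar> \<ge> u0\<^sup>2 * \<epsilon>"
      using 1 by (simp add: algebra_simps)
    then have "1 \<le> ?a" using u2 \<epsilon> by (simp add: field_simps)
    then show ?thesis using ab by linarith
  next
    case 2
    have "\<bar>((1 - frac A) * t + frac A * Ybar Y n) - Ybar Y n\<bar> = \<bar>(1 - frac A) * (t - Ybar Y n)\<bar>" by (simp add: algebra_simps)
    also have "\<dots> \<le> (1 - u0) * \<epsilon>"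
      unfolding abs_mult using g2 u1 by (intro mult_mono) (auto simp: good2_def)
    finally have "\<bar>t' - ((1 - frac A) * t + frac A * Ybar Y n)\<bar> \<ge> u0 * \<epsilon>"
      using 2 by (simp add: algebra_simps)
    then have "1 \<le> ?b" using u0_bounds \<epsilon> by (simp add: field_simps)
    then show ?thesis using ab by linarith
  qed
qed

end

subsection \<open>Regularisation in total variation\<close>

lemma sqrt_add_le:
  assumes "x \<ge> 0" "y \<ge> 0"
  shows "sqrt (x\<^sup>2 + y\<^sup>2) \<le> x + y"
  using assms by (intro real_le_lsqrt) (auto simp: power2_sum)

text \<open>The square of the sum of the roots is at least \<open>x + y\<close>. This turns the
  standard deviation term of the affinity into a relative difference of variances.\<close>

lemma sqrt_ratio_le:
  assumes "x > 0" "y > 0"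
  shows "(sqrt x - sqrt y)\<^sup>2 / (x + y) \<le> ((x - y) / (x + y))\<^sup>2"
proof -
  have s: "sqrt x + sqrt y > 0" using assms by (simp add: add_pos_pos)
  have q: "x + y > 0" using assms by simp
  have 1: "x + y \<le> (sqrt x + sqrt y)\<^sup>2" using assms by (simp add: power2_sum)
  have "(sqrt x - sqrt y)\<^sup>2 = \<bar>sqrt x - sqrt y\<bar>\<^sup>2" by simp
  also have "\<dots> = (x - y)\<^sup>2 / (sqrt x + sqrt y)\<^sup>2"
    unfolding abs_sqrt_diff_le[OF assms] by (simp add: power_divide)
  also have "\<dots> \<le> (x - y)\<^sup>2 / (x + y)"
    using q s by (intro divide_left_mono 1) auto
  finally have "(sqrt x - sqrt y)\<^sup>2 / (x + y) \<le> (x - y)\<^sup>2 / (x + y) / (x + y)"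
    using q by (intro divide_right_mono) auto
  then show ?thesis by (simp add: power_divide power2_eq_square)
qed

context gibbs
begin

text \<open>The sweep integrated from its last stage backwards: \<open>inner\<close> removes the
  draw of \<open>A\<close>, \<open>middle\<close> then that of \<open>\<theta>\<close>. Each takes
  values in \<open>[0,1]\<close> for an admissible \<open>h\<close> and so serves as the test
  function in the Gaussian estimate of the stage before. \<open>inner\<close> does not read the old
  \<open>A\<close>, so the draw of \<open>A\<close> costs nothing in total variation.\<close>

definition inner :: "(state \<Rightarrow> real) \<Rightarrow> real \<Rightarrow> (nat \<Rightarrow> real) \<Rightarrow> real" where
  "inner h \<mu> \<theta> = (\<integral>x. h (x * rate \<theta>, \<mu>, \<theta>) \<partial>ig shp 1)"

definition middle :: "(state \<Rightarrow> real) \<Rightarrow> real \<Rightarrow> real \<Rightarrow> real" where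
  "middle h A \<mu> = (\<integral>z. inner h \<mu> (upd A \<mu> z) \<partial>normals n)"

lemma inner_measurable:
  assumes h: "test h"
  shows "(\<lambda>p. inner h (fst p) (snd p)) \<in> borel_measurable (borel \<Otimes>\<^sub>M thetas)"
    and "0 \<le> inner h \<mu> \<theta>" "inner h \<mu> \<theta> \<le> 1"
proof -
  interpret I: prob_space "ig shp 1" by (rule prob_space_ig1)
  have [measurable]: "(\<lambda>p. snd p) \<in> borel_measurable ((borel \<Otimes>\<^sub>M thetas) \<Otimes>\<^sub>M ig shp 1)"
    by (rule measurable_compose[OF measurable_snd]) (rule measurable_igI, simp)
  have m: "(\<lambda>p. (snd p * rate (snd (fst p)), fst (fst p), snd (fst p))) \<in> measurable ((borel \<Otimes>\<^sub>M thetas) \<Otimes>\<^sub>M ig shp 1) (Xsp n)"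
    by (intro triple_measurable) (auto simp: space_pair_measure space_ig intro!: mult_pos_pos rate_pos)
  show "(\<lambda>p. inner h (fst p) (snd p)) \<in> borel_measurable (borel \<Otimes>\<^sub>M thetas)"
    unfolding inner_def
    by (rule I.borel_measurable_lebesgue_integral) (use measurable_compose[OF m testD(1)[OF h]] in \<open>simp add: split_beta'\<close>)
  show "0 \<le> inner h \<mu> \<theta>" unfolding inner_def by (intro integral_nonneg_AE) (auto simp: testD[OF h])
  show "inner h \<mu> \<theta> \<le> 1"
  proof (cases "integrable (ig shp 1) (\<lambda>x. h (x * rate \<theta>, \<mu>, \<theta>))")
    case True
    then have "inner h \<mu> \<theta> \<le> (\<integral>x. 1 \<partial>ig shp 1)"
      unfolding inner_def by (intro integral_mono) (auto simp: testD[OF h])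
    then show ?thesis by (simp add: I.prob_space)
  qed (simp add: inner_def not_integrable_integral_eq)
qed

lemma inner_measurable2 [measurable (raw)]:
  assumes h: "test h" and [measurable]: "f \<in> borel_measurable M" "g \<in> measurable M thetas"
  shows "(\<lambda>p. inner h (f p) (g p)) \<in> borel_measurable M"
  using measurable_compose[OF measurable_Pair inner_measurable(1)[OF h], of f M g] by simp

lemma middle_measurable:
  assumes h: "test h"
  shows "middle h A \<in> borel_measurable borel" and "0 \<le> middle h A \<mu>" "middle h A \<mu> \<le> 1"
    and "integrable (normals n) (\<lambda>z. inner h \<mu> (upd A \<mu> z))"
proof -
  interpret N: prob_space "normals n" by (rule prob_space_normals)
  note i = inner_measurable[OF h]
  show I: "integrable (normals n) (\<lambda>z. inner h \<mu> (upd A \<mu> z))"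
    using i by (intro N.integrable_const_bound[of _ 1] inner_measurable2 upd_measurable h) auto
  show "middle h A \<in> borel_measurable borel"
    unfolding middle_def
    by (rule N.borel_measurable_lebesgue_integral) (simp add: split_beta', intro inner_measurable2 upd_measurable h, auto)
  show "0 \<le> middle h A \<mu>" unfolding middle_def by (intro integral_nonneg_AE) (auto simp: i)
  have "middle h A \<mu> \<le> (\<integral>z. 1 \<partial>normals n)"
    unfolding middle_def using i by (intro integral_mono I) auto
  then show "middle h A \<mu> \<le> 1" by (simp add: N.prob_space)
qed

lemma Pop_eq_middle:
  assumes h: "test h"
  shows "(\<integral>\<omega>. h (mv A t \<omega>) \<partial>noise) = (\<integral>x. middle h A (t + sqrt (A / real n) * x) \<partial>std_normal_distribution)"
proof -
  interpret I: prob_space "ig shp 1" by (rule prob_space_ig1)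
  interpret N: prob_space "normals n" by (rule prob_space_normals)
  interpret S: prob_space std_normal_distribution by (rule prob_space_std_normal)
  interpret NI: pair_prob_space "normals n" "ig shp 1" ..
  interpret SNI: pair_prob_space std_normal_distribution "normals n \<Otimes>\<^sub>M ig shp 1" ..
  have m: "(\<lambda>w. h (mv A t (x, w))) \<in> borel_measurable (normals n \<Otimes>\<^sub>M ig shp 1)" for x
    using measurable_compose[OF _ measurable_compose[OF mv_measurable[of A t] testD(1)[OF h]], of "\<lambda>w. (x, w)" "normals n \<Otimes>\<^sub>M ig shp 1"]
    by (simp add: noise_def)
  have I2: "integrable (normals n \<Otimes>\<^sub>M ig shp 1) (\<lambda>w. h (mv A t (x, w)))" for x
    by (rule NI.integrable_const_bound[of _ 1]) (auto simp: testD[OF h] m)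
  have "(\<integral>\<omega>. h (mv A t \<omega>) \<partial>noise) = (\<integral>x. \<integral>w. h (mv A t (x, w)) \<partial>(normals n \<Otimes>\<^sub>M ig shp 1) \<partial>std_normal_distribution)"
    using SNI.integral_fst'[of "\<lambda>\<omega>. h (mv A t \<omega>)"] integrable_test_mv[OF h, of A t] by (simp add: noise_def)
  also have "\<dots> = (\<integral>x. \<integral>z. \<integral>y. h (mv A t (x, z, y)) \<partial>ig shp 1 \<partial>normals n \<partial>std_normal_distribution)"
    by (intro Bochner_Integration.integral_cong refl) (rule NI.integral_fst'[OF I2, symmetric])
  also have "\<dots> = (\<integral>x. middle h A (t + sqrt (A / real n) * x) \<partial>std_normal_distribution)"
    by (simp add: middle_def inner_def mv_def)
  finally show ?thesis .
qed

end

section \<open>Lipschitz bounds from the distance \<open>rho\<close> to test functions, for one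
  sweep and for iterates\<close>

context gibbs_bd
begin

text \<open>In this order: the costs of the standard deviation and of the mean in the draw of
  \<open>\<mu>\<close>, then those of the standard deviation and of the means in the draw of
  \<open>\<theta>\<close>, the last averaged over \<open>\<mu>\<close>.\<close>

definition KL :: real where
  "KL = sqrt 8 * (1 / \<delta> + 1 / (2 * sqrt \<delta>) + (1 / (2 * V * u0) + (sqrt Mb + (\<delta> + sqrt (2 * Mb))) / (V * sqrt (8 * V * u0))))"

lemma KL_pos: "KL > 0"
  unfolding KL_def using \<delta> V u0_bounds Mb_pos
  by (intro mult_pos_pos add_pos_pos divide_pos_pos) auto

text \<open>At fixed \<open>\<mu>\<close> the mean of coordinate \<open>i\<close> changes by
  \<open>(frac A1 - frac A2) * (Y n i - \<mu>)\<close>, and the squares of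
  \<open>Y n i - \<mu>\<close> sum to \<open>Delta Y n + n (\<mu> - Ybar)^2\<close>, of order
  \<open>n\<close> for bounded \<open>\<mu> - Ybar\<close>. Changing \<open>A\<close> in all
  coordinates at once thus costs \<open>sqrt n |A1 - A2|\<close>, the reason for the scale of
  \<open>rho\<close>.\<close>

lemma middle_lipschitz:
  assumes h: "test h" and A: "A1 \<ge> \<delta> / 2" "A2 \<ge> \<delta> / 2"
  shows "\<bar>middle h A1 \<mu> - middle h A2 \<mu>\<bar> \<le> sqrt 8 * (sqrt (real n) * \<bar>A1 - A2\<bar>) *
    (1 / (2 * V * u0) + (sqrt Mb + \<bar>\<mu> - Ybar Y n\<bar>) / (V * sqrt (8 * V * u0)))"
proof -
  have A0: "A1 > 0" "A2 > 0" using A \<delta> by auto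
  let ?u1 = "frac A1" and ?u2 = "frac A2"
  note f = frac_bounds[OF A0(1)] frac_bounds[OF A0(2)] frac_ge_u0[OF A(1)] frac_ge_u0[OF A(2)] u0_bounds
  define s1 s2 where "s1 = sqrt (V * ?u1)" and "s2 = sqrt (V * ?u2)"
  have s: "s1 > 0" "s2 > 0" "s1\<^sup>2 = V * ?u1" "s2\<^sup>2 = V * ?u2" using f V by (auto simp: s1_def s2_def)
  define m where "m A i = (1 - frac A) * \<mu> + frac A * Y n i" for A i
  have up: "upd A \<mu> z = (\<lambda>i\<in>{..<n}. m A i + sqrt (V * frac A) * z i)" if "A > 0" for A z
    using upd_frac[OF that] by (auto simp: m_def fun_eq_iff upd_def)
  define c where "c = \<bar>A1 - A2\<bar>"
  have c: "c \<ge> 0" "\<bar>?u1 - ?u2\<bar> \<le> c / V" using frac_diff_le[OF A0] by (auto simp: c_def)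
  have us: "?u1 + ?u2 \<ge> 2 * u0" using f by linarith
  have e1: "(s1 - s2)\<^sup>2 / (s1\<^sup>2 + s2\<^sup>2) \<le> (c / (2 * V * u0))\<^sup>2"
  proof -
    have "(s1 - s2)\<^sup>2 / (s1\<^sup>2 + s2\<^sup>2) = (sqrt (V * ?u1) - sqrt (V * ?u2))\<^sup>2 / (V * ?u1 + V * ?u2)"
      unfolding s(3,4) unfolding s1_def s2_def ..
    also have "\<dots> \<le> ((V * ?u1 - V * ?u2) / (V * ?u1 + V * ?u2))\<^sup>2"
      using f V by (intro sqrt_ratio_le) auto
    also have "(V * ?u1 - V * ?u2) / (V * ?u1 + V * ?u2) = (?u1 - ?u2) / (?u1 + ?u2)"
      using V by (simp add: right_diff_distrib[symmetric] distrib_left[symmetric])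
    also have "((?u1 - ?u2) / (?u1 + ?u2))\<^sup>2 = (\<bar>?u1 - ?u2\<bar> / (?u1 + ?u2))\<^sup>2" by (simp add: power_divide)
    also have "\<dots> \<le> ((c / V) / (2 * u0))\<^sup>2"
      using c us f V by (intro power_mono frac_le) auto
    finally show ?thesis by (simp add: mult_ac)
  qed
  have e2: "(\<Sum>i<n. (m A1 i - m A2 i)\<^sup>2) / (4 * (s1\<^sup>2 + s2\<^sup>2)) \<le> real n * (c * (sqrt Mb + \<bar>\<mu> - Ybar Y n\<bar>) / (V * sqrt (8 * V * u0)))\<^sup>2"
  proof -
    have mm: "(m A1 i - m A2 i)\<^sup>2 = (?u1 - ?u2)\<^sup>2 * (Y n i - \<mu>)\<^sup>2" for i
    proof -
      have "m A1 i - m A2 i = (?u1 - ?u2) * (Y n i - \<mu>)" by (simp add: m_def algebra_simps)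
      then show ?thesis by (simp only: power_mult_distrib)
    qed
    have Ysum: "(\<Sum>i<n. (Y n i - \<mu>)\<^sup>2) = Delta Y n + real n * (\<mu> - Ybar Y n)\<^sup>2"
    proof -
      have t: "tbar n (\<lambda>i. Y n i - \<mu>) = Ybar Y n - \<mu>"
        using n2 by (simp add: tbar_def Ybar_def sum_subtractf diff_divide_distrib)
      have "(\<Sum>i<n. (Y n i - \<mu>)\<^sup>2) = (\<Sum>i<n. ((Y n i - \<mu>) - tbar n (\<lambda>i. Y n i - \<mu>))\<^sup>2) + real n * (tbar n (\<lambda>i. Y n i - \<mu>))\<^sup>2"
        using sum_square_diff_tbar[of n "\<lambda>i. Y n i - \<mu>"] n2 by simp
      then show ?thesis unfolding t by (simp add: Delta_def power2_commute)
    qed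
    have "(?u1 - ?u2)\<^sup>2 * (Delta Y n + real n * (\<mu> - Ybar Y n)\<^sup>2) \<le> (c / V)\<^sup>2 * (real n * (sqrt Mb + \<bar>\<mu> - Ybar Y n\<bar>)\<^sup>2)"
    proof (rule mult_mono)
      show "(?u1 - ?u2)\<^sup>2 \<le> (c / V)\<^sup>2" using power_mono[OF c(2), of 2] by (simp only: power2_abs abs_ge_zero)
      have "Delta Y n \<le> real n * Mb" unfolding Delta_eq using dd_le dd_ge \<delta> V n10 by (intro mult_mono) auto
      moreover have "(sqrt Mb)\<^sup>2 + \<bar>\<mu> - Ybar Y n\<bar>\<^sup>2 \<le> (sqrt Mb + \<bar>\<mu> - Ybar Y n\<bar>)\<^sup>2"
        unfolding power2_sum using Mb_pos by simp
      then have "real n * (Mb + (\<mu> - Ybar Y n)\<^sup>2) \<le> real n * (sqrt Mb + \<bar>\<mu> - Ybar Y n\<bar>)\<^sup>2"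
        using Mb_pos by (intro mult_left_mono) auto
      ultimately show "Delta Y n + real n * (\<mu> - Ybar Y n)\<^sup>2 \<le> real n * (sqrt Mb + \<bar>\<mu> - Ybar Y n\<bar>)\<^sup>2"
        by (simp add: distrib_left)
    qed (auto intro!: add_nonneg_nonneg Delta_nonneg)
    then have num: "(\<Sum>i<n. (m A1 i - m A2 i)\<^sup>2) \<le> (c / V)\<^sup>2 * (real n * (sqrt Mb + \<bar>\<mu> - Ybar Y n\<bar>)\<^sup>2)"
      unfolding mm sum_distrib_left[symmetric] Ysum .
    have "8 * V * u0 = 4 * V * (2 * u0)" by simp
    also have "\<dots> \<le> 4 * V * (?u1 + ?u2)" using V by (intro mult_left_mono us) simp
    finally have den: "8 * V * u0 \<le> 4 * (s1\<^sup>2 + s2\<^sup>2)" unfolding s(3,4) by (simp add: distrib_left)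
    have "(\<Sum>i<n. (m A1 i - m A2 i)\<^sup>2) / (4 * (s1\<^sup>2 + s2\<^sup>2)) \<le> (c / V)\<^sup>2 * (real n * (sqrt Mb + \<bar>\<mu> - Ybar Y n\<bar>)\<^sup>2) / (8 * V * u0)"
      by (rule frac_le[OF _ num _ den]) (use V u0_bounds in simp_all)
    also have "\<dots> = real n * (c * (sqrt Mb + \<bar>\<mu> - Ybar Y n\<bar>) / (V * sqrt (8 * V * u0)))\<^sup>2"
      using V f by (simp add: power_mult_distrib power_divide)
    finally show ?thesis .
  qed
  let ?B1 = "c / (2 * V * u0)" and ?B2 = "c * (sqrt Mb + \<bar>\<mu> - Ybar Y n\<bar>) / (V * sqrt (8 * V * u0))"
  have B0: "?B1 \<ge> 0" "?B2 \<ge> 0"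
    using c V f Mb_pos by (auto intro!: divide_nonneg_nonneg mult_nonneg_nonneg add_nonneg_nonneg)
  have "\<bar>middle h A1 \<mu> - middle h A2 \<mu>\<bar> \<le> sqrt (8 * (real n * ((s1 - s2)\<^sup>2 / (s1\<^sup>2 + s2\<^sup>2)) + (\<Sum>i<n. (m A1 i - m A2 i)\<^sup>2) / (4 * (s1\<^sup>2 + s2\<^sup>2))))"
    unfolding middle_def up[OF A0(1)] up[OF A0(2)] s1_def[symmetric] s2_def[symmetric]
    by (intro normals_tv s inner_measurable2 h inner_measurable(2,3)) auto
  also have "\<dots> \<le> sqrt (8 * (real n * ?B1\<^sup>2 + real n * ?B2\<^sup>2))"
    by (intro real_sqrt_le_mono mult_left_mono add_mono e1 e2) auto
  also have "\<dots> = sqrt 8 * (sqrt (real n) * sqrt (?B1\<^sup>2 + ?B2\<^sup>2))"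
    by (simp add: real_sqrt_mult[symmetric] distrib_left)
  also have "\<dots> \<le> sqrt 8 * (sqrt (real n) * (?B1 + ?B2))"
    using B0 by (intro mult_left_mono sqrt_add_le) auto
  also have "\<dots> = sqrt 8 * (sqrt (real n) * c) * (1 / (2 * V * u0) + (sqrt Mb + \<bar>\<mu> - Ybar Y n\<bar>) / (V * sqrt (8 * V * u0)))"
    by (simp add: algebra_simps)
  finally show ?thesis by (simp add: c_def)
qed

text \<open>Two replacements: first the law of \<open>\<mu>\<close>, with \<open>middle h A1\<close>
  as test function, then \<open>A1\<close> by \<open>A2\<close> in the draw of
  \<open>\<theta>\<close>. In the second replacement \<open>\<mu>\<close> already belongs to the
  second copy, so closeness of \<open>t2\<close> to \<open>Ybar Y n\<close> bounds
  \<open>\<mu> - Ybar Y n\<close> in mean.\<close>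

lemma Pop_lipschitz:
  assumes h: "test h" and g1: "good1 A1" and g2: "good2 A2 t2"
  shows "\<bar>(\<integral>\<omega>. h (mv A1 t1 \<omega>) \<partial>noise) - (\<integral>\<omega>. h (mv A2 t2 \<omega>) \<partial>noise)\<bar>
    \<le> KL * (sqrt (real n) * \<bar>A1 - A2\<bar> + sqrt (real n) * \<bar>t1 - t2\<bar>)"
proof -
  interpret S: prob_space std_normal_distribution by (rule prob_space_std_normal)
  note A1 = good1D[OF g1] and A2 = good1D[OF good2_good1[OF g2]]
  define r where "r = sqrt (real n)"
  have r: "r \<ge> 1" "r > 0" "r\<^sup>2 = real n" using n10 by (auto simp: r_def)
  define c where "c = \<bar>A1 - A2\<bar>"
  define e where "e = \<bar>t1 - t2\<bar>"
  have ce: "c \<ge> 0" "e \<ge> 0" by (auto simp: c_def e_def)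
  let ?s1 = "sqrt (A1 / real n)" and ?s2 = "sqrt (A2 / real n)"
  note mm = middle_measurable[OF h]
  have mI: "integrable std_normal_distribution (\<lambda>x. middle h A (t + s * x))" for A t s
    by (rule S.integrable_const_bound[of _ 1]) (use mm in \<open>auto intro!: measurable_compose[OF _ mm(1)]\<close>)
  have s: "?s1 > 0" "?s2 > 0" "?s1\<^sup>2 = A1 / real n" "?s2\<^sup>2 = A2 / real n" using A1 A2 n2 by auto
  have 1: "\<bar>(\<integral>x. middle h A1 (t1 + ?s1 * x) \<partial>std_normal_distribution) - (\<integral>x. middle h A1 (t2 + ?s2 * x) \<partial>std_normal_distribution)\<bar>
     \<le> sqrt 8 * (1 / \<delta> * (r * c) + 1 / (2 * sqrt \<delta>) * (r * e))"
  proof -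
    have e1: "(?s1 - ?s2)\<^sup>2 / (?s1\<^sup>2 + ?s2\<^sup>2) \<le> (c / \<delta>)\<^sup>2"
    proof -
      have "(?s1 - ?s2)\<^sup>2 / (?s1\<^sup>2 + ?s2\<^sup>2) \<le> ((A1 / real n - A2 / real n) / (A1 / real n + A2 / real n))\<^sup>2"
        unfolding s(3,4) using A1 A2 n2 by (intro sqrt_ratio_le) auto
      also have "(A1 / real n - A2 / real n) / (A1 / real n + A2 / real n) = (A1 - A2) / (A1 + A2)"
        using n2 by (simp add: diff_divide_distrib[symmetric] add_divide_distrib[symmetric])
      also have "((A1 - A2) / (A1 + A2))\<^sup>2 = (\<bar>A1 - A2\<bar> / (A1 + A2))\<^sup>2" by (simp add: power_divide)
      also have "\<dots> \<le> (c / \<delta>)\<^sup>2"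
        unfolding c_def using A1 A2 \<delta> by (intro power_mono divide_left_mono) auto
      finally show ?thesis .
    qed
    have e2: "(t1 - t2)\<^sup>2 / (4 * (?s1\<^sup>2 + ?s2\<^sup>2)) \<le> (r * e / (2 * sqrt \<delta>))\<^sup>2"
    proof -
      have "(t1 - t2)\<^sup>2 / (4 * (?s1\<^sup>2 + ?s2\<^sup>2)) = real n * e\<^sup>2 / (4 * (A1 + A2))"
        unfolding s(3,4) e_def using n2 by (simp add: add_divide_distrib[symmetric])
      also have "\<dots> \<le> real n * e\<^sup>2 / (4 * \<delta>)"
        using A1 A2 \<delta> by (intro divide_left_mono) auto
      also have "\<dots> = (r * e / (2 * sqrt \<delta>))\<^sup>2" using \<delta> r by (simp add: power_divide power_mult_distrib)
      finally show ?thesis .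
    qed
    have "\<bar>(\<integral>x. middle h A1 (t1 + ?s1 * x) \<partial>std_normal_distribution) - (\<integral>x. middle h A1 (t2 + ?s2 * x) \<partial>std_normal_distribution)\<bar>
      \<le> sqrt (8 * ((?s1 - ?s2)\<^sup>2 / (?s1\<^sup>2 + ?s2\<^sup>2) + (t1 - t2)\<^sup>2 / (4 * (?s1\<^sup>2 + ?s2\<^sup>2))))"
      by (intro std_normal_tv s(1,2) mm)
    also have "\<dots> \<le> sqrt (8 * ((c / \<delta>)\<^sup>2 + (r * e / (2 * sqrt \<delta>))\<^sup>2))"
      by (intro real_sqrt_le_mono mult_left_mono add_mono e1 e2) auto
    also have "\<dots> = sqrt 8 * sqrt ((c / \<delta>)\<^sup>2 + (r * e / (2 * sqrt \<delta>))\<^sup>2)" by (rule real_sqrt_mult)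
    also have "\<dots> \<le> sqrt 8 * (c / \<delta> + r * e / (2 * sqrt \<delta>))"
      using ce r \<delta> by (intro mult_left_mono sqrt_add_le) auto
    \<comment> \<open>Both variances of \<open>\<mu>\<close> carry the same \<open>1 / n\<close>, so
      their relative change costs only \<open>|A1 - A2|\<close>; a factor \<open>r \<ge> 1\<close>
      is given away to reach the common form.\<close>
    also have "\<dots> \<le> sqrt 8 * (1 / \<delta> * (r * c) + 1 / (2 * sqrt \<delta>) * (r * e))"
      using mult_right_mono[OF r(1) ce(1)] \<delta> by (intro mult_left_mono add_mono) (auto intro!: divide_right_mono)
    finally show ?thesis .
  qed
  let ?G = "\<lambda>x. sqrt 8 * (r * c) * (1 / (2 * V * u0) + (sqrt Mb + (\<delta> + sqrt (2 * Mb) * \<bar>x\<bar>)) / (V * sqrt (8 * V * u0)))"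
  have 2: "\<bar>(\<integral>x. middle h A1 (t2 + ?s2 * x) \<partial>std_normal_distribution) - (\<integral>x. middle h A2 (t2 + ?s2 * x) \<partial>std_normal_distribution)\<bar>
     \<le> sqrt 8 * (r * c) * (1 / (2 * V * u0) + (sqrt Mb + (\<delta> + sqrt (2 * Mb))) / (V * sqrt (8 * V * u0)))"
  proof -
    have pt: "\<bar>middle h A1 (t2 + ?s2 * x) - middle h A2 (t2 + ?s2 * x)\<bar> \<le> ?G x" for x
    proof -
      have "sqrt (A2 / real n) \<le> sqrt (2 * Mb)"
        using A2 n2 frac_le[of "2 * Mb" A2 1 "real n"] by (intro real_sqrt_le_mono) auto
      then have "\<bar>?s2 * x\<bar> \<le> sqrt (2 * Mb) * \<bar>x\<bar>" using A2 n2 by (simp add: abs_mult mult_right_mono)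
      moreover have "\<bar>t2 - Ybar Y n\<bar> \<le> \<delta>" using g2 \<epsilon> \<delta> by (simp add: good2_def)
      ultimately have "\<bar>t2 + ?s2 * x - Ybar Y n\<bar> \<le> \<delta> + sqrt (2 * Mb) * \<bar>x\<bar>" by linarith
      then have "sqrt 8 * (r * c) * (1 / (2 * V * u0) + (sqrt Mb + \<bar>t2 + ?s2 * x - Ybar Y n\<bar>) / (V * sqrt (8 * V * u0))) \<le> ?G x"
        using r ce V u0_bounds by (intro mult_left_mono add_left_mono divide_right_mono) auto
      with middle_lipschitz[OF h A1(1) A2(1), of "t2 + ?s2 * x"] show ?thesis unfolding r_def c_def by linarith
    qed
    have GI: "integrable std_normal_distribution ?G" using std_normal_abs(1) by simp
    have "\<bar>(\<integral>x. middle h A1 (t2 + ?s2 * x) \<partial>std_normal_distribution) - (\<integral>x. middle h A2 (t2 + ?s2 * x) \<partial>std_normal_distribution)\<bar>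
      = \<bar>\<integral>x. middle h A1 (t2 + ?s2 * x) - middle h A2 (t2 + ?s2 * x) \<partial>std_normal_distribution\<bar>"
      using mI by simp
    also have "\<dots> \<le> (\<integral>x. \<bar>middle h A1 (t2 + ?s2 * x) - middle h A2 (t2 + ?s2 * x)\<bar> \<partial>std_normal_distribution)"
      by (rule integral_abs_bound)
    also have "\<dots> \<le> (\<integral>x. ?G x \<partial>std_normal_distribution)"
      by (intro integral_mono pt GI integrable_abs Bochner_Integration.integrable_diff mI)
    also have "\<dots> = sqrt 8 * (r * c) * (1 / (2 * V * u0) + (sqrt Mb + (\<delta> + sqrt (2 * Mb) * (\<integral>x. \<bar>x\<bar> \<partial>std_normal_distribution))) / (V * sqrt (8 * V * u0)))"
      using std_normal_abs(1) S.prob_space by simp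
    also have "\<dots> \<le> sqrt 8 * (r * c) * (1 / (2 * V * u0) + (sqrt Mb + (\<delta> + sqrt (2 * Mb) * 1)) / (V * sqrt (8 * V * u0)))"
      using r ce V u0_bounds Mb_pos std_normal_abs(2)
      by (intro mult_left_mono add_left_mono divide_right_mono) auto
    finally show ?thesis by simp
  qed
  let ?q = "1 / (2 * V * u0) + (sqrt Mb + (\<delta> + sqrt (2 * Mb))) / (V * sqrt (8 * V * u0))"
  have q: "?q \<ge> 0" using V u0_bounds Mb_pos \<delta> by (intro add_nonneg_nonneg divide_nonneg_nonneg) auto
  have "\<bar>(\<integral>\<omega>. h (mv A1 t1 \<omega>) \<partial>noise) - (\<integral>\<omega>. h (mv A2 t2 \<omega>) \<partial>noise)\<bar>
     \<le> sqrt 8 * (1 / \<delta> * (r * c) + 1 / (2 * sqrt \<delta>) * (r * e)) + sqrt 8 * (r * c) * ?q"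
    unfolding Pop_eq_middle[OF h] using 1 2 by linarith
  also have "\<dots> = sqrt 8 * ((1 / \<delta> + ?q) * (r * c) + 1 / (2 * sqrt \<delta>) * (r * e))"
  proof -
    have "w * (p * x + o' * y) + w * x * q = w * ((p + q) * x + o' * y)" for w p x o' y q :: real
      by (simp add: algebra_simps)
    then show ?thesis .
  qed
  also have "\<dots> \<le> sqrt 8 * ((1 / \<delta> + 1 / (2 * sqrt \<delta>) + ?q) * (r * c) + (1 / \<delta> + 1 / (2 * sqrt \<delta>) + ?q) * (r * e))"
    using \<delta> q r ce by (intro mult_left_mono add_mono mult_right_mono) auto
  also have "\<dots> = KL * (r * c + r * e)"
  proof -
    have "w * (p * x + p * y) = w * p * (x + y)" for w p x y :: real by (simp add: algebra_simps)
    then show ?thesis unfolding KL_def .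
  qed
  finally show ?thesis by (simp add: r_def c_def e_def)
qed

text \<open>Markov constants of the three ways to leave the good sets in one sweep, through
  \<open>A\<close> of the first copy, \<open>A\<close> of the second and \<open>t\<close> of the
  second, each times its bound on the mean fluctuation without \<open>1 / sqrt n\<close>.\<close>

definition esc :: real where
  "esc = KA * (2 / (u0\<^sup>2 * \<delta>)) + KA * (1 / (u0\<^sup>2 * \<epsilon>)) + (sqrt (2 * Mb) + sqrt V) * (1 / (u0 * \<epsilon>))"

abbreviation tb :: "state \<Rightarrow> real" where "tb x \<equiv> tbar n (snd (snd x))"

text \<open>The first sweep is coupled and the remaining ones are summarised in a test function
  \<open>q\<close>. Where both copies land in their good sets the induction hypothesis applies, and
  \<open>rho\<close> shrinks by \<open>\<gamma>\<close> in mean; elsewhere the difference is at most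
  1 and is paid by the escape bounds. One sweep is left for the base case, which contributes
  \<open>KL\<close>, so \<open>Suc k\<close> sweeps give \<open>k\<close> contractions.\<close>

lemma Pop_iterate_lipschitz:
  assumes h: "test h" and \<gamma>: "rateA + (\<epsilon> / V + KT / sqrt (real n)) \<le> \<gamma>" "1 - u0 \<le> \<gamma>"
    and g1: "good1 (fst x)" and g2: "good2 (fst y) (tb y)"
  shows "\<bar>(Pop ^^ Suc k) h x - (Pop ^^ Suc k) h y\<bar> \<le> KL * \<gamma> ^ k * rho x y + real k * (esc / sqrt (real n))"
  using g1 g2
proof (induction k arbitrary: x y)
  case 0
  then show ?case using Pop_lipschitz[OF h 0, of "tb x"] by (simp add: Pop_def rho_def)
next
  case (Suc k)
  interpret prob_space noise by (rule prob_space_noise)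
  define q where "q = (Pop ^^ Suc k) h"
  have q: "test q" unfolding q_def by (rule test_Pop_iter[OF h])
  note A1 = good1D[OF Suc.prems(1)] and A2 = good1D[OF good2_good1[OF Suc.prems(2)]]
  have \<gamma>0: "\<gamma> \<ge> 0" using \<gamma>(2) u0_bounds by linarith
  define c where "c = KL * \<gamma> ^ k"
  have c: "c \<ge> 0" using KL_pos \<gamma>0 by (simp add: c_def)
  define d where "d = real k * (esc / sqrt (real n))"
  have KA0: "KA \<ge> 0" unfolding KA_def using b0 V Mb_pos a by (auto intro!: add_nonneg_nonneg)
  then have d: "d \<ge> 0" unfolding d_def esc_def using \<delta> \<epsilon> u0_bounds Mb_pos V
    by (auto intro!: mult_nonneg_nonneg divide_nonneg_nonneg add_nonneg_nonneg)
  let ?m1 = "mv (fst x) (tb x)" and ?m2 = "mv (fst y) (tb y)"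
  let ?F1 = "\<lambda>\<omega>. \<bar>fst (?m1 \<omega>) - drift_map (fst x)\<bar>" and ?F2 = "\<lambda>\<omega>. \<bar>fst (?m2 \<omega>) - drift_map (fst y)\<bar>"
  let ?F3 = "\<lambda>\<omega>. \<bar>tb (?m2 \<omega>) - ((1 - frac (fst y)) * tb y + frac (fst y) * Ybar Y n)\<bar>"
  let ?k1 = "2 / (u0\<^sup>2 * \<delta>)" and ?k2 = "1 / (u0\<^sup>2 * \<epsilon>)" and ?k3 = "1 / (u0 * \<epsilon>)"
  have k0: "?k1 \<ge> 0" "?k2 \<ge> 0" "?k3 \<ge> 0" using \<delta> \<epsilon> u0_bounds by auto
  \<comment> \<open>All summands are nonnegative, so one integrable bound serves both cases and no
    event has to be integrated over.\<close>
  let ?B = "\<lambda>\<omega>. c * rho (?m1 \<omega>) (?m2 \<omega>) + d + (?F1 \<omega> * ?k1 + (?F2 \<omega> * ?k2 + ?F3 \<omega> * ?k3))"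
  have B: "\<bar>q (?m1 \<omega>) - q (?m2 \<omega>)\<bar> \<le> ?B \<omega>" for \<omega>
  proof (cases "good1 (fst (?m1 \<omega>)) \<and> good2 (fst (?m2 \<omega>)) (tb (?m2 \<omega>))")
    case True
    then have "\<bar>q (?m1 \<omega>) - q (?m2 \<omega>)\<bar> \<le> c * rho (?m1 \<omega>) (?m2 \<omega>) + d"
      unfolding q_def c_def d_def using Suc.IH by blast
    moreover have "0 \<le> ?F1 \<omega> * ?k1 + (?F2 \<omega> * ?k2 + ?F3 \<omega> * ?k3)"
      using k0 by (intro add_nonneg_nonneg mult_nonneg_nonneg) auto
    ultimately show ?thesis by linarith
  next
    case False
    have "1 \<le> ?F1 \<omega> * ?k1 + (?F2 \<omega> * ?k2 + ?F3 \<omega> * ?k3)"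
    proof (cases "good1 (fst (?m1 \<omega>))")
      case True
      then have "1 \<le> ?F2 \<omega> * ?k2 + ?F3 \<omega> * ?k3"
        using escape2[OF Suc.prems(2)] False by blast
      moreover have "0 \<le> ?F1 \<omega> * ?k1" using k0 by (intro mult_nonneg_nonneg) auto
      ultimately show ?thesis by linarith
    next
      case False
      then have "1 \<le> ?F1 \<omega> * ?k1" using escape1[OF Suc.prems(1)] by blast
      moreover have "0 \<le> ?F2 \<omega> * ?k2 + ?F3 \<omega> * ?k3" using k0 by (intro add_nonneg_nonneg mult_nonneg_nonneg) auto
      ultimately show ?thesis by linarith
    qed
    moreover have "0 \<le> c * rho (?m1 \<omega>) (?m2 \<omega>)" using c by (simp add: rho_def)
    moreover have "\<bar>q (?m1 \<omega>) - q (?m2 \<omega>)\<bar> \<le> 1"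
      using testD(2,3)[OF q, of "?m1 \<omega>"] testD(2,3)[OF q, of "?m2 \<omega>"] by linarith
    ultimately show ?thesis using d by linarith
  qed
  note I1 = contraction[OF Suc.prems \<gamma>, of "tb x"]
  note I2 = fst_mv_fluctuation(1)[OF A1(2) shp_bounds(1), of "tb x"] fst_mv_fluctuation(1)[OF A2(2) shp_bounds(1), of "tb y"]
    tbar_mv_fluctuation(1)[OF A2(2), of "tb y"]
  have BI: "integrable noise ?B"
    using I1(1) I2 by simp
  have "\<bar>(Pop ^^ Suc (Suc k)) h x - (Pop ^^ Suc (Suc k)) h y\<bar> = \<bar>\<integral>\<omega>. q (?m1 \<omega>) - q (?m2 \<omega>) \<partial>noise\<bar>"
    using integrable_test_mv[OF q] by (simp add: q_def Pop_def)
  also have "\<dots> \<le> (\<integral>\<omega>. \<bar>q (?m1 \<omega>) - q (?m2 \<omega>)\<bar> \<partial>noise)" by (rule integral_abs_bound)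
  also have "\<dots> \<le> (\<integral>\<omega>. ?B \<omega> \<partial>noise)"
    by (intro integral_mono BI B integrable_abs Bochner_Integration.integrable_diff integrable_test_mv[OF q])
  also have "\<dots> = c * (\<integral>\<omega>. rho (?m1 \<omega>) (?m2 \<omega>) \<partial>noise) + d + ((\<integral>\<omega>. ?F1 \<omega> \<partial>noise) * ?k1 + ((\<integral>\<omega>. ?F2 \<omega> \<partial>noise) * ?k2 + (\<integral>\<omega>. ?F3 \<omega> \<partial>noise) * ?k3))"
    using I1(1) I2 by (simp add: prob_space)
  also have "\<dots> \<le> c * (\<gamma> * rho x y) + d + (KA / sqrt (real n) * ?k1 + (KA / sqrt (real n) * ?k2 + (sqrt (2 * Mb) + sqrt V) / sqrt (real n) * ?k3))"
  proof -
    have "(\<integral>\<omega>. ?F3 \<omega> \<partial>noise) \<le> (sqrt (fst y) + sqrt V) / sqrt (real n)"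
      by (rule tbar_mv_fluctuation(2)[OF A2(2)])
    also have "\<dots> \<le> (sqrt (2 * Mb) + sqrt V) / sqrt (real n)"
      using A2(3) by (intro divide_right_mono add_right_mono real_sqrt_le_mono) auto
    finally have f3: "(\<integral>\<omega>. ?F3 \<omega> \<partial>noise) \<le> (sqrt (2 * Mb) + sqrt V) / sqrt (real n)" .
    have "(\<integral>\<omega>. rho (?m1 \<omega>) (?m2 \<omega>) \<partial>noise) \<le> \<gamma> * rho x y" using I1(2) by (simp add: rho_def)
    then show ?thesis
      using fluctuation_A[OF A1(2)] fluctuation_A[OF A2(2)] f3
      by (intro add_mono mult_left_mono[OF _ c] mult_right_mono[OF _ k0(1)] mult_right_mono[OF _ k0(2)] mult_right_mono[OF _ k0(3)] order_refl)
  qed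
  also have "\<dots> = KL * \<gamma> ^ Suc k * rho x y + real (Suc k) * (esc / sqrt (real n))"
  proof -
    have "L * g * (w * r) + k * ((K * k1 + K * k2 + p * k3) / s) + (K / s * k1 + (K / s * k2 + p / s * k3))
        = L * (w * g) * r + (1 + k) * ((K * k1 + K * k2 + p * k3) / s)" for L g w r k K k1 k2 k3 p s :: real
      by (simp add: algebra_simps add_divide_distrib)
    then show ?thesis unfolding c_def d_def esc_def power_Suc of_nat_Suc .
  qed
  finally show ?case .
qed

end

subsection \<open>Two factorisations of the posterior\<close>

context gibbs
begin

text \<open>What remains of the unnormalised posterior density once \<open>\<mu>\<close> and
  \<open>A\<close> are integrated out: the Gaussian integral leaves
  \<open>sqrt (2 * pi / real n)\<close>, the inverse gamma integral leaves
  \<open>Gamma shp * rate \<theta> powr (-shp)\<close>.\<close>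

definition theta_weight :: "(nat \<Rightarrow> real) \<Rightarrow> real" where
  "theta_weight \<theta> = (\<Prod>i<n. exp (-(Y n i - \<theta> i)\<^sup>2 / (2 * V))) * (Gamma shp * sqrt (2 * pi / real n)) * rate \<theta> powr (-shp)"

text \<open>What remains once \<open>\<theta>\<close> and then \<open>\<mu>\<close> are integrated
  out; \<open>V + A\<close> is the variance of an observation given \<open>\<mu>\<close> and
  \<open>A\<close>.\<close>

definition A_weight :: "real \<Rightarrow> real" where
  "A_weight A = A powr (-a - 1) * exp (-b0 / A) * sqrt (2 * pi * V / (V + A)) ^ n
     * exp (- Delta Y n / (2 * (V + A))) * sqrt (2 * pi * (V + A) / real n)"

lemma sum_square_diff:
  "(\<Sum>i<n. (z i - \<mu>)\<^sup>2) = (\<Sum>i<n. (z i - tbar n z)\<^sup>2) + real n * (\<mu> - tbar n z)\<^sup>2"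
proof -
  have t: "tbar n (\<lambda>i. z i - \<mu>) = tbar n z - \<mu>"
    using n2 by (simp add: tbar_def sum_subtractf diff_divide_distrib)
  show ?thesis
    using sum_square_diff_tbar[of n "\<lambda>i. z i - \<mu>"] n2 unfolding t by (simp add: power2_commute)
qed

lemma prod_exp_neg: "(\<Prod>i<n. exp (- f i / c)) = exp (- (\<Sum>i<n. f i) / (c :: real))"
  by (simp add: exp_sum[symmetric] sum_negf sum_divide_distrib)

text \<open>Completing the square in \<open>\<mu>\<close> about the mean of \<open>\<theta>\<close>.
  From the total power \<open>-a - 1 - n/2\<close> of \<open>A\<close> one factor
  \<open>A powr (-1/2)\<close> normalises the law of \<open>\<mu>\<close>; what is left has shape
  \<open>a + (n - 1) / 2\<close>, so integrating \<open>\<mu>\<close> out explains the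
  \<open>n - 1\<close> in the draw of \<open>A\<close>.\<close>

lemma post_dens_backward:
  assumes A: "A > 0"
  shows "post_dens V a b0 Y n (A, \<mu>, \<theta>) =
    theta_weight \<theta> * (ig_density shp (rate \<theta>) A * normal_density (tbar n \<theta>) (sqrt (A / real n)) \<mu>)"
proof -
  let ?S = "\<Sum>i<n. (\<theta> i - tbar n \<theta>)\<^sup>2" and ?b = "rate \<theta>" and ?t = "tbar n \<theta>"
  define E where "E = (\<Prod>i<n. exp (-(Y n i - \<theta> i)\<^sup>2 / (2 * V)))"
  have n: "real n > 0" using n2 by simp
  have b: "?b > 0" by (rule rate_pos)
  have G: "Gamma shp > 0" by (rule Gamma_real_pos[OF shp_pos])
  have "post_dens V a b0 Y n (A, \<mu>, \<theta>) = A powr (-a - 1) * exp (-b0 / A) *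
     ((A powr (-1/2)) ^ n * exp (- (\<Sum>i<n. (\<theta> i - \<mu>)\<^sup>2) / (2 * A)) * E)"
    by (simp only: post_dens_def prod.case prod.distrib prod_constant card_lessThan prod_exp_neg E_def)
  also have "(A powr (-1/2)) ^ n = A powr (- real n / 2)"
    using A by (simp add: powr_realpow[symmetric] powr_powr)
  also have "(\<Sum>i<n. (\<theta> i - \<mu>)\<^sup>2) = ?S + real n * (\<mu> - ?t)\<^sup>2" by (rule sum_square_diff)
  finally have l: "post_dens V a b0 Y n (A, \<mu>, \<theta>) =
      E * (A powr (-a - 1) * A powr (- real n / 2)) * (exp (- b0 / A) * exp (- (?S + real n * (\<mu> - ?t)\<^sup>2) / (2 * A)))"
    by (simp only: mult_ac)
  have e: "exp (- b0 / A) * exp (- (?S + real n * (\<mu> - ?t)\<^sup>2) / (2 * A)) =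
    exp (- ?b / A) * exp (- (\<mu> - ?t)\<^sup>2 / (2 * (A / real n)))"
    using A n by (simp add: exp_add[symmetric] rate_def field_simps)
  have p: "A powr (-a - 1) * A powr (- real n / 2) = A powr (- shp - 1) * A powr (-1/2)"
  proof -
    have "(-a - 1) + (- real n / 2) = (- shp - 1) + (-1/2)" by (simp add: shp_def field_simps)
    then show ?thesis by (simp only: powr_add[symmetric])
  qed
  have s: "sqrt (2 * pi / real n) * (1 / sqrt (2 * pi * (A / real n))) = A powr (-1/2)"
    using A n by (simp add: powr_minus powr_half_sqrt real_sqrt_divide real_sqrt_mult field_simps)
  have "theta_weight \<theta> * (ig_density shp ?b A * normal_density ?t (sqrt (A / real n)) \<mu>)
     = E * (A powr (- shp - 1) * (sqrt (2 * pi / real n) * (1 / sqrt (2 * pi * (A / real n))))) * (exp (- ?b / A) * exp (- (\<mu> - ?t)\<^sup>2 / (2 * (A / real n))))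
       * (Gamma shp / Gamma shp) * (?b powr (- shp) * ?b powr shp)"
    using A n by (simp add: theta_weight_def E_def ig_density_def normal_density_def)
  also have "\<dots> = E * (A powr (- shp - 1) * A powr (-1/2)) * (exp (- ?b / A) * exp (- (\<mu> - ?t)\<^sup>2 / (2 * (A / real n))))"
    unfolding s using G b by (simp add: powr_add[symmetric])
  finally show ?thesis unfolding l e p ..
qed

text \<open>Two completed squares: in each \<open>\<theta> i\<close> about the precision-weighted
  mean of \<open>\<mu>\<close> and \<open>Y n i\<close>, which leaves
  \<open>(Y n i - \<mu>)^2\<close> over \<open>2 (V + A)\<close>, and then in \<open>\<mu>\<close>
  about \<open>Ybar Y n\<close>.\<close>

lemma post_dens_forward:
  assumes A: "A > 0"
  shows "post_dens V a b0 Y n (A, \<mu>, \<theta>) =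
    A_weight A * (normal_density (Ybar Y n) (sqrt ((V + A) / real n)) \<mu> *
      (\<Prod>i<n. normal_density ((\<mu> * V + Y n i * A) / (V + A)) (sqrt (A * V / (V + A))) (\<theta> i)))"
proof -
  let ?B = "V + A"
  have B: "?B > 0" using A V by simp
  have n: "real n > 0" using n2 by simp
  have pt: "A powr (-1/2) * exp (-(\<theta> i - \<mu>)\<^sup>2 / (2 * A)) * exp (-(Y n i - \<theta> i)\<^sup>2 / (2 * V)) =
     sqrt (2 * pi * V / ?B) * normal_density ((\<mu> * V + Y n i * A) / ?B) (sqrt (A * V / ?B)) (\<theta> i) * exp (- (Y n i - \<mu>)\<^sup>2 / (2 * ?B))" for i
  proof -
    let ?th = "\<theta> i" and ?y = "Y n i" and ?m = "(\<mu> * V + Y n i * A) / ?B"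
    have s: "sqrt (2 * pi * V / ?B) * (1 / sqrt (2 * pi * (A * V / ?B))) = A powr (-1/2)"
      using A V B by (simp add: powr_minus powr_half_sqrt real_sqrt_divide real_sqrt_mult field_simps)
    have e: "-(?th - \<mu>)\<^sup>2 / (2 * A) + -(?y - ?th)\<^sup>2 / (2 * V) = - (?th - ?m)\<^sup>2 / (2 * (A * V / ?B)) + - (?y - \<mu>)\<^sup>2 / (2 * ?B)"
    proof -
      have m: "?th - ?m = (?B * ?th - (\<mu> * V + ?y * A)) / ?B" using B by (simp add: field_simps)
      have "- (?th - ?m)\<^sup>2 / (2 * (A * V / ?B)) = - (?B * ?th - (\<mu> * V + ?y * A))\<^sup>2 / (2 * A * V * ?B)"
        unfolding m using A V B by (simp add: power_divide power2_eq_square)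
      moreover have "- (?y - \<mu>)\<^sup>2 / (2 * ?B) = - (A * V * (?y - \<mu>)\<^sup>2) / (2 * A * V * ?B)"
        using A V B by simp
      moreover have "-(?th - \<mu>)\<^sup>2 / (2 * A) + -(?y - ?th)\<^sup>2 / (2 * V) = - (V * ?B * (?th - \<mu>)\<^sup>2 + A * ?B * (?y - ?th)\<^sup>2) / (2 * A * V * ?B)"
      proof -
        have "-(?th - \<mu>)\<^sup>2 / (2 * A) = - (V * ?B * (?th - \<mu>)\<^sup>2) / (2 * A * V * ?B)" using A V B by simp
        moreover have "-(?y - ?th)\<^sup>2 / (2 * V) = - (A * ?B * (?y - ?th)\<^sup>2) / (2 * A * V * ?B)" using A V B by simp
        ultimately show ?thesis by (simp add: diff_divide_distrib add_divide_distrib)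
      qed
      moreover have "V * ?B * (?th - \<mu>)\<^sup>2 + A * ?B * (?y - ?th)\<^sup>2 = (?B * ?th - (\<mu> * V + ?y * A))\<^sup>2 + A * V * (?y - \<mu>)\<^sup>2"
        by algebra
      ultimately show ?thesis by (simp add: diff_divide_distrib add_divide_distrib)
    qed
    have "A powr (-1/2) * exp (-(?th - \<mu>)\<^sup>2 / (2 * A)) * exp (-(?y - ?th)\<^sup>2 / (2 * V))
        = A powr (-1/2) * exp (-(?th - \<mu>)\<^sup>2 / (2 * A) + -(?y - ?th)\<^sup>2 / (2 * V))" by (simp only: exp_add mult.assoc)
    also have "\<dots> = A powr (-1/2) * (exp (- (?th - ?m)\<^sup>2 / (2 * (A * V / ?B))) * exp (- (?y - \<mu>)\<^sup>2 / (2 * ?B)))"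
      unfolding e exp_add ..
    also have "\<dots> = sqrt (2 * pi * V / ?B) * normal_density ?m (sqrt (A * V / ?B)) ?th * exp (- (?y - \<mu>)\<^sup>2 / (2 * ?B))"
      unfolding s[symmetric] normal_density_def using A V B by simp
    finally show ?thesis .
  qed
  define D where "D = (\<Prod>i<n. normal_density ((\<mu> * V + Y n i * A) / ?B) (sqrt (A * V / ?B)) (\<theta> i))"
  have Yb: "tbar n (Y n) = Ybar Y n" by (simp add: tbar_def Ybar_def)
  have "post_dens V a b0 Y n (A, \<mu>, \<theta>) = A powr (-a - 1) * exp (-b0 / A) *
     (sqrt (2 * pi * V / ?B) ^ n * D * exp (- (\<Sum>i<n. (Y n i - \<mu>)\<^sup>2) / (2 * ?B)))"
    unfolding post_dens_def prod.case pt
    by (simp only: prod.distrib prod_constant card_lessThan prod_exp_neg D_def)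
  also have "(\<Sum>i<n. (Y n i - \<mu>)\<^sup>2) = Delta Y n + real n * (\<mu> - Ybar Y n)\<^sup>2"
    using sum_square_diff[of "Y n" \<mu>] by (simp only: Yb Delta_def)
  also have "exp (- (Delta Y n + real n * (\<mu> - Ybar Y n)\<^sup>2) / (2 * ?B)) =
      exp (- Delta Y n / (2 * ?B)) * (sqrt (2 * pi * ?B / real n) * normal_density (Ybar Y n) (sqrt (?B / real n)) \<mu>)"
  proof -
    have "exp (- (D + real n * (\<mu> - m)\<^sup>2) / (2 * B)) = exp (- D / (2 * B)) * (sqrt (2 * pi * B / real n) * normal_density m (sqrt (B / real n)) \<mu>)"
      if "B > 0" for B D m
    proof -
      have "- (D + real n * (\<mu> - m)\<^sup>2) / (2 * B) = - D / (2 * B) + - (\<mu> - m)\<^sup>2 / (2 * (B / real n))"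
        using that n by (simp add: field_simps)
      then have "exp (- (D + real n * (\<mu> - m)\<^sup>2) / (2 * B)) = exp (- D / (2 * B)) * exp (- (\<mu> - m)\<^sup>2 / (2 * (B / real n)))"
        by (simp only: exp_add)
      moreover have "(sqrt (B / real n))\<^sup>2 = B / real n" "sqrt (2 * pi * B / real n) \<noteq> 0" using that n by auto
      ultimately show ?thesis by (simp add: normal_density_def)
    qed
    from this[OF B] show ?thesis .
  qed
  finally show ?thesis unfolding A_weight_def D_def[symmetric] by (simp only: mult_ac)
qed

lemma sigma_finite_thetas: "sigma_finite_measure thetas"
proof -
  interpret L: product_sigma_finite "\<lambda>i::nat. lborel :: real measure" by standard
  show ?thesis by (rule L.sigma_finite) simp
qed

lemma theta_weight_measurable [measurable]: "theta_weight \<in> borel_measurable thetas"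
  unfolding theta_weight_def by measurable

lemma theta_weight_pos: "theta_weight \<theta> > 0"
  unfolding theta_weight_def using Gamma_real_pos[OF shp_pos] n2 rate_pos[of \<theta>]
  by (intro mult_pos_pos prod_pos) auto

lemma A_weight_nonneg: "A > 0 \<Longrightarrow> A_weight A \<ge> 0"
  unfolding A_weight_def using V by (intro mult_nonneg_nonneg) auto

lemma A_weight_measurable [measurable]: "A_weight \<in> borel_measurable Apos"
  by (rule measurable_AposI) (unfold A_weight_def, measurable)

lemma nn_integral_normal:
  fixes f :: "real \<Rightarrow> ennreal"
  assumes "s > 0" and [measurable]: "f \<in> borel_measurable borel"
  shows "(\<integral>\<^sup>+x. ennreal (normal_density m s x) * f x \<partial>lborel) = (\<integral>\<^sup>+x. f (m + s * x) \<partial>std_normal_distribution)"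
proof -
  have "(\<integral>\<^sup>+x. ennreal (normal_density m s x) * f x \<partial>lborel) = (\<integral>\<^sup>+x. f x \<partial>density lborel (normal_density m s))"
    by (subst nn_integral_density) auto
  also have "\<dots> = (\<integral>\<^sup>+x. f (m + s * x) \<partial>std_normal_distribution)"
    unfolding normal_eq_distr[OF assms(1)] by (subst nn_integral_distr) auto
  finally show ?thesis .
qed

lemma nn_integral_upd:
  fixes f :: "(nat \<Rightarrow> real) \<Rightarrow> ennreal"
  assumes A: "A > 0" and f[measurable]: "f \<in> borel_measurable thetas"
  shows "(\<integral>\<^sup>+\<theta>. ennreal (\<Prod>i<n. normal_density ((\<mu> * V + Y n i * A) / (V + A)) (sqrt (A * V / (V + A))) (\<theta> i)) * f \<theta> \<partial>thetas)
    = (\<integral>\<^sup>+z. f (upd A \<mu> z) \<partial>normals n)"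
proof -
  let ?m = "\<lambda>i. (\<mu> * V + Y n i * A) / (V + A)" and ?s = "sqrt (A * V / (V + A))"
  have s: "?s > 0" using A V by simp
  have "(\<integral>\<^sup>+\<theta>. ennreal (\<Prod>i<n. normal_density (?m i) ?s (\<theta> i)) * f \<theta> \<partial>thetas)
      = (\<integral>\<^sup>+\<theta>. f \<theta> \<partial>density thetas (\<lambda>\<theta>. \<Prod>i<n. ennreal (normal_density (?m i) ?s (\<theta> i))))"
    by (subst nn_integral_density) (auto simp: prod_ennreal)
  also have "density thetas (\<lambda>\<theta>. \<Prod>i<n. ennreal (normal_density (?m i) ?s (\<theta> i))) = distr (normals n) thetas (upd A \<mu>)"
    unfolding upd_def[abs_def] PiM_normal_eq_distr[OF s, symmetric]
    by (subst PiM_density_lborel) (auto intro: prob_space_normal_density[OF s])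
  also have "(\<integral>\<^sup>+\<theta>. f \<theta> \<partial>distr (normals n) thetas (upd A \<mu>)) = (\<integral>\<^sup>+z. f (upd A \<mu> z) \<partial>normals n)"
    using upd_measurable[of "\<lambda>_. A" "normals n" "\<lambda>_. \<mu>" "\<lambda>z. z"] by (intro nn_integral_distr) auto
  finally show ?thesis .
qed

lemma nn_integral_ig_scale:
  fixes f :: "real \<Rightarrow> ennreal"
  assumes f: "f \<in> borel_measurable Apos" and \<beta>: "\<beta> > 0"
  shows "(\<integral>\<^sup>+A. ennreal (ig_density shp \<beta> A) * f A \<partial>Apos) = (\<integral>\<^sup>+h. f (h * \<beta>) \<partial>ig shp 1)"
proof -
  have m: "(\<lambda>h. h * \<beta>) \<in> measurable (ig shp 1) Apos"
    using \<beta> by (intro measurable_into_Apos measurable_igI) (auto simp: space_ig)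
  have "(\<integral>\<^sup>+A. ennreal (ig_density shp \<beta> A) * f A \<partial>Apos) = (\<integral>\<^sup>+A. f A \<partial>ig shp \<beta>)"
    by (rule nn_integral_ig[OF f, symmetric])
  also have "\<dots> = (\<integral>\<^sup>+h. f (h * \<beta>) \<partial>ig shp 1)"
    unfolding ig_scale_eq_distr[OF \<beta>] by (rule nn_integral_distr[OF m]) (simp add: f)
  finally show ?thesis .
qed

text \<open>The posterior draws \<open>\<theta>\<close>, then \<open>A\<close>, then \<open>\<mu>\<close> (\<open>bk\<close>), or \<open>A\<close>, then \<open>\<mu>\<close>, then \<open>\<theta>\<close> (\<open>fw\<close>); the sweep
  follows the second order with the mean of \<open>\<theta>\<close> in place of \<open>Ybar\<close>.\<close>

definition bk :: "(nat \<Rightarrow> real) \<Rightarrow> real \<Rightarrow> real \<Rightarrow> state" where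
  "bk \<theta> h x = (h * rate \<theta>, tbar n \<theta> + sqrt (h * rate \<theta> / real n) * x, \<theta>)"

definition fw :: "real \<Rightarrow> real \<Rightarrow> (nat \<Rightarrow> real) \<Rightarrow> state" where
  "fw A x z = (A, Ybar Y n + sqrt ((V + A) / real n) * x, upd A (Ybar Y n + sqrt ((V + A) / real n) * x) z)"

lemma Xsp_measurable_A [measurable (raw)]:
  "f \<in> measurable M (Xsp n) \<Longrightarrow> (\<lambda>p. fst (f p)) \<in> borel_measurable M"
  by (rule measurable_compose[OF _ Xsp_fst_measurable])

text \<open>Tonelli in the two orders that the two factorisations demand. Nonnegative integrands
  allow this before the posterior is known to be normalisable.\<close>

lemma nn_integral_Xsp:
  fixes f :: "state \<Rightarrow> ennreal"
  assumes f: "f \<in> borel_measurable (Xsp n)"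
  shows "(\<integral>\<^sup>+x. f x \<partial>Xsp n) = (\<integral>\<^sup>+A. \<integral>\<^sup>+\<mu>. \<integral>\<^sup>+\<theta>. f (A, \<mu>, \<theta>) \<partial>thetas \<partial>lborel \<partial>Apos)"
    and "(\<integral>\<^sup>+x. f x \<partial>Xsp n) = (\<integral>\<^sup>+\<theta>. \<integral>\<^sup>+A. \<integral>\<^sup>+\<mu>. f (A, \<mu>, \<theta>) \<partial>lborel \<partial>Apos \<partial>thetas)"
proof -
  interpret T: sigma_finite_measure thetas by (rule sigma_finite_thetas)
  interpret A: sigma_finite_measure Apos by (rule sigma_finite_Apos)
  interpret LT: pair_sigma_finite lborel thetas by standard
  interpret AT: pair_sigma_finite Apos thetas by standard
  interpret ALT: pair_sigma_finite Apos "lborel \<Otimes>\<^sub>M thetas" by standard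
  have f': "f \<in> borel_measurable (Apos \<Otimes>\<^sub>M (lborel \<Otimes>\<^sub>M thetas))" using f by (simp add: Xsp_def)
  have fA: "(\<lambda>w. f (A, w)) \<in> borel_measurable (lborel \<Otimes>\<^sub>M thetas)" if "A \<in> space Apos" for A
    using measurable_compose[OF measurable_Pair1'[OF that] f'] .
  have 0: "(\<integral>\<^sup>+x. f x \<partial>Xsp n) = (\<integral>\<^sup>+A. \<integral>\<^sup>+w. f (A, w) \<partial>(lborel \<Otimes>\<^sub>M thetas) \<partial>Apos)"
    unfolding Xsp_def by (rule LT.nn_integral_fst[OF f', symmetric])
  show "(\<integral>\<^sup>+x. f x \<partial>Xsp n) = (\<integral>\<^sup>+A. \<integral>\<^sup>+\<mu>. \<integral>\<^sup>+\<theta>. f (A, \<mu>, \<theta>) \<partial>thetas \<partial>lborel \<partial>Apos)"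
    unfolding 0 by (intro nn_integral_cong T.nn_integral_fst[symmetric] fA)
  have "(\<integral>\<^sup>+x. f x \<partial>Xsp n) = (\<integral>\<^sup>+A. \<integral>\<^sup>+\<theta>. \<integral>\<^sup>+\<mu>. f (A, \<mu>, \<theta>) \<partial>lborel \<partial>thetas \<partial>Apos)"
    unfolding 0 by (intro nn_integral_cong LT.nn_integral_snd[symmetric]) (simp add: fA)
  also have "\<dots> = (\<integral>\<^sup>+\<theta>. \<integral>\<^sup>+A. \<integral>\<^sup>+\<mu>. f (A, \<mu>, \<theta>) \<partial>lborel \<partial>Apos \<partial>thetas)"
  proof (rule AT.Fubini'[symmetric])
    have "(\<lambda>p. (fst (fst p), snd p, snd (fst p))) \<in> measurable ((Apos \<Otimes>\<^sub>M thetas) \<Otimes>\<^sub>M lborel) (Apos \<Otimes>\<^sub>M (lborel \<Otimes>\<^sub>M thetas))"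
      by measurable
    from measurable_compose[OF this f']
    have "(\<lambda>(p, \<mu>). f (fst p, \<mu>, snd p)) \<in> borel_measurable ((Apos \<Otimes>\<^sub>M thetas) \<Otimes>\<^sub>M lborel)" by (simp add: split_beta')
    then show "(\<lambda>(A, \<theta>). \<integral>\<^sup>+\<mu>. f (A, \<mu>, \<theta>) \<partial>lborel) \<in> borel_measurable (Apos \<Otimes>\<^sub>M thetas)"
      unfolding split_beta' by (intro lborel.borel_measurable_nn_integral) (simp add: split_beta')
  qed
  finally show "(\<integral>\<^sup>+x. f x \<partial>Xsp n) = (\<integral>\<^sup>+\<theta>. \<integral>\<^sup>+A. \<integral>\<^sup>+\<mu>. f (A, \<mu>, \<theta>) \<partial>lborel \<partial>Apos \<partial>thetas)" .
qed

lemma post_dens_measurable [measurable]: "post_dens V a b0 Y n \<in> borel_measurable (Xsp n)"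
proof -
  have [measurable]: "i < n \<Longrightarrow> (\<lambda>x. snd (snd x) i) \<in> borel_measurable (Xsp n)" for i
    by (rule measurable_compose[OF Xsp_theta_measurable]) simp
  show ?thesis unfolding post_dens_def[abs_def] split_beta' by measurable
qed

lemma post_dens_nonneg: "x \<in> space (Xsp n) \<Longrightarrow> post_dens V a b0 Y n x \<ge> 0"
  by (cases x) (auto simp: post_dens_def intro!: mult_nonneg_nonneg prod_nonneg)

lemma Xsp_section:
  fixes f :: "state \<Rightarrow> ennreal"
  assumes f: "f \<in> borel_measurable (Xsp n)"
  shows "\<theta> \<in> space thetas \<Longrightarrow> A > 0 \<Longrightarrow> (\<lambda>\<mu>. f (A, \<mu>, \<theta>)) \<in> borel_measurable borel"
    and "A > 0 \<Longrightarrow> (\<lambda>\<theta>. f (A, \<mu>, \<theta>)) \<in> borel_measurable thetas"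
proof -
  show "\<theta> \<in> space thetas \<Longrightarrow> A > 0 \<Longrightarrow> (\<lambda>\<mu>. f (A, \<mu>, \<theta>)) \<in> borel_measurable borel"
    by (rule measurable_compose[OF triple_measurable f]) auto
  show "A > 0 \<Longrightarrow> (\<lambda>\<theta>. f (A, \<mu>, \<theta>)) \<in> borel_measurable thetas"
    by (rule measurable_compose[OF triple_measurable f]) auto
qed

lemma nn_integral_post_dens_backward:
  fixes f :: "state \<Rightarrow> ennreal"
  assumes f: "f \<in> borel_measurable (Xsp n)"
  shows "(\<integral>\<^sup>+x. ennreal (post_dens V a b0 Y n x) * f x \<partial>Xsp n) =
    (\<integral>\<^sup>+\<theta>. ennreal (theta_weight \<theta>) * (\<integral>\<^sup>+h. \<integral>\<^sup>+x. f (bk \<theta> h x) \<partial>std_normal_distribution \<partial>ig shp 1) \<partial>thetas)"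
proof -
  interpret S: prob_space std_normal_distribution by (rule prob_space_std_normal)
  have "(\<integral>\<^sup>+x. ennreal (post_dens V a b0 Y n x) * f x \<partial>Xsp n) =
      (\<integral>\<^sup>+\<theta>. \<integral>\<^sup>+A. \<integral>\<^sup>+\<mu>. ennreal (post_dens V a b0 Y n (A, \<mu>, \<theta>)) * f (A, \<mu>, \<theta>) \<partial>lborel \<partial>Apos \<partial>thetas)"
    by (rule nn_integral_Xsp(2)) (use f in measurable)
  also have "\<dots> = (\<integral>\<^sup>+\<theta>. ennreal (theta_weight \<theta>) * (\<integral>\<^sup>+h. \<integral>\<^sup>+x. f (bk \<theta> h x) \<partial>std_normal_distribution \<partial>ig shp 1) \<partial>thetas)"
  proof (intro nn_integral_cong)
    fix \<theta> assume th: "\<theta> \<in> space thetas"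
    let ?J = "\<lambda>A. \<integral>\<^sup>+x. f (A, tbar n \<theta> + sqrt (A / real n) * x, \<theta>) \<partial>std_normal_distribution"
    have m: "(\<lambda>p. f (fst p, tbar n \<theta> + sqrt (fst p / real n) * snd p, \<theta>)) \<in> borel_measurable (Apos \<Otimes>\<^sub>M std_normal_distribution)"
    proof (rule measurable_compose[OF triple_measurable f])
      have [measurable]: "fst \<in> borel_measurable (Apos \<Otimes>\<^sub>M std_normal_distribution)"
        by (rule measurable_compose[OF measurable_fst measurable_AposI]) simp
      show "(\<lambda>p. fst p) \<in> borel_measurable (Apos \<Otimes>\<^sub>M std_normal_distribution)" by simp
      show "(\<lambda>p. tbar n \<theta> + sqrt (fst p / real n) * snd p) \<in> borel_measurable (Apos \<Otimes>\<^sub>M std_normal_distribution)"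
        by measurable
    qed (use th in \<open>auto simp: space_pair_measure space_Apos\<close>)
    have J: "?J \<in> borel_measurable Apos"
      by (rule S.borel_measurable_nn_integral) (use m in \<open>simp add: split_beta'\<close>)
    have "(\<integral>\<^sup>+\<mu>. ennreal (post_dens V a b0 Y n (A, \<mu>, \<theta>)) * f (A, \<mu>, \<theta>) \<partial>lborel)
        = ennreal (theta_weight \<theta>) * (ennreal (ig_density shp (rate \<theta>) A) * ?J A)" if "A \<in> space Apos" for A
    proof -
      have A: "A > 0" using that by (simp add: space_Apos)
      have [measurable]: "(\<lambda>\<mu>. f (A, \<mu>, \<theta>)) \<in> borel_measurable borel" by (rule Xsp_section(1)[OF f th A])
      have "(\<integral>\<^sup>+\<mu>. ennreal (post_dens V a b0 Y n (A, \<mu>, \<theta>)) * f (A, \<mu>, \<theta>) \<partial>lborel)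
        = (\<integral>\<^sup>+\<mu>. ennreal (theta_weight \<theta>) * (ennreal (ig_density shp (rate \<theta>) A) *
            (ennreal (normal_density (tbar n \<theta>) (sqrt (A / real n)) \<mu>) * f (A, \<mu>, \<theta>))) \<partial>lborel)"
        unfolding post_dens_backward[OF A]
        using theta_weight_pos[of \<theta>] ig_density_nonneg[OF shp_pos]
        by (simp add: ennreal_mult' ennreal_mult'' mult.assoc less_imp_le)
      also have "\<dots> = ennreal (theta_weight \<theta>) * (ennreal (ig_density shp (rate \<theta>) A) *
            (\<integral>\<^sup>+\<mu>. ennreal (normal_density (tbar n \<theta>) (sqrt (A / real n)) \<mu>) * f (A, \<mu>, \<theta>) \<partial>lborel))"
        by (subst nn_integral_cmult; measurable?) (subst nn_integral_cmult; measurable?; simp)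
      also have "(\<integral>\<^sup>+\<mu>. ennreal (normal_density (tbar n \<theta>) (sqrt (A / real n)) \<mu>) * f (A, \<mu>, \<theta>) \<partial>lborel) = ?J A"
        using A n2 by (intro nn_integral_normal) auto
      finally show ?thesis .
    qed
    then have "(\<integral>\<^sup>+A. \<integral>\<^sup>+\<mu>. ennreal (post_dens V a b0 Y n (A, \<mu>, \<theta>)) * f (A, \<mu>, \<theta>) \<partial>lborel \<partial>Apos)
       = (\<integral>\<^sup>+A. ennreal (theta_weight \<theta>) * (ennreal (ig_density shp (rate \<theta>) A) * ?J A) \<partial>Apos)"
      by (intro nn_integral_cong)
    also have "\<dots> = ennreal (theta_weight \<theta>) * (\<integral>\<^sup>+A. ennreal (ig_density shp (rate \<theta>) A) * ?J A \<partial>Apos)"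
      by (intro nn_integral_cmult borel_measurable_times_ennreal measurable_compose[OF ig_density_measurable_Apos measurable_ennreal] J)
    also have "(\<integral>\<^sup>+A. ennreal (ig_density shp (rate \<theta>) A) * ?J A \<partial>Apos) = (\<integral>\<^sup>+h. ?J (h * rate \<theta>) \<partial>ig shp 1)"
      by (rule nn_integral_ig_scale[OF J rate_pos])
    finally show "(\<integral>\<^sup>+A. \<integral>\<^sup>+\<mu>. ennreal (post_dens V a b0 Y n (A, \<mu>, \<theta>)) * f (A, \<mu>, \<theta>) \<partial>lborel \<partial>Apos)
       = ennreal (theta_weight \<theta>) * (\<integral>\<^sup>+h. \<integral>\<^sup>+x. f (bk \<theta> h x) \<partial>std_normal_distribution \<partial>ig shp 1)"
      by (simp add: bk_def)
  qed
  finally show ?thesis .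
qed

lemma nn_integral_post_dens_forward:
  fixes f :: "state \<Rightarrow> ennreal"
  assumes f: "f \<in> borel_measurable (Xsp n)"
  shows "(\<integral>\<^sup>+x. ennreal (post_dens V a b0 Y n x) * f x \<partial>Xsp n) =
    (\<integral>\<^sup>+A. ennreal (A_weight A) * (\<integral>\<^sup>+x. \<integral>\<^sup>+z. f (fw A x z) \<partial>normals n \<partial>std_normal_distribution) \<partial>Apos)"
proof -
  interpret N: prob_space "normals n" by (rule prob_space_normals)
  interpret T: sigma_finite_measure thetas by (rule sigma_finite_thetas)
  have "(\<integral>\<^sup>+x. ennreal (post_dens V a b0 Y n x) * f x \<partial>Xsp n) =
      (\<integral>\<^sup>+A. \<integral>\<^sup>+\<mu>. \<integral>\<^sup>+\<theta>. ennreal (post_dens V a b0 Y n (A, \<mu>, \<theta>)) * f (A, \<mu>, \<theta>) \<partial>thetas \<partial>lborel \<partial>Apos)"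
    by (rule nn_integral_Xsp(1)) (use f in measurable)
  also have "\<dots> = (\<integral>\<^sup>+A. ennreal (A_weight A) * (\<integral>\<^sup>+x. \<integral>\<^sup>+z. f (fw A x z) \<partial>normals n \<partial>std_normal_distribution) \<partial>Apos)"
  proof (intro nn_integral_cong)
    fix A assume "A \<in> space Apos"
    then have A: "A > 0" by (simp add: space_Apos)
    let ?J = "\<lambda>\<mu>. \<integral>\<^sup>+z. f (A, \<mu>, upd A \<mu> z) \<partial>normals n"
    let ?D = "\<lambda>\<mu> \<theta>. \<Prod>i<n. normal_density ((\<mu> * V + Y n i * A) / (V + A)) (sqrt (A * V / (V + A))) (\<theta> i)"
    have D0: "?D \<mu> \<theta> \<ge> 0" for \<mu> \<theta> by (intro prod_nonneg) auto
    have m: "(\<lambda>p. f (A, fst p, upd A (fst p) (snd p))) \<in> borel_measurable (lborel \<Otimes>\<^sub>M normals n)"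
      by (rule measurable_compose[OF triple_measurable f]) (use A in measurable)
    have J: "?J \<in> borel_measurable borel"
      using N.borel_measurable_nn_integral[of "\<lambda>\<mu> z. f (A, \<mu>, upd A \<mu> z)" lborel] m by (simp add: split_beta')
    have "(\<integral>\<^sup>+\<theta>. ennreal (post_dens V a b0 Y n (A, \<mu>, \<theta>)) * f (A, \<mu>, \<theta>) \<partial>thetas)
        = ennreal (A_weight A) * (ennreal (normal_density (Ybar Y n) (sqrt ((V + A) / real n)) \<mu>) * ?J \<mu>)" for \<mu>
    proof -
      have [measurable]: "(\<lambda>\<theta>. f (A, \<mu>, \<theta>)) \<in> borel_measurable thetas" by (rule Xsp_section(2)[OF f A])
      have "(\<integral>\<^sup>+\<theta>. ennreal (post_dens V a b0 Y n (A, \<mu>, \<theta>)) * f (A, \<mu>, \<theta>) \<partial>thetas)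
        = (\<integral>\<^sup>+\<theta>. ennreal (A_weight A) * (ennreal (normal_density (Ybar Y n) (sqrt ((V + A) / real n)) \<mu>) *
            (ennreal (?D \<mu> \<theta>) * f (A, \<mu>, \<theta>))) \<partial>thetas)"
        unfolding post_dens_forward[OF A] using A_weight_nonneg[OF A] D0
        by (simp add: ennreal_mult' ennreal_mult'' mult.assoc)
      also have "\<dots> = ennreal (A_weight A) * (ennreal (normal_density (Ybar Y n) (sqrt ((V + A) / real n)) \<mu>) *
            (\<integral>\<^sup>+\<theta>. ennreal (?D \<mu> \<theta>) * f (A, \<mu>, \<theta>) \<partial>thetas))"
        by (subst nn_integral_cmult; measurable?) (subst nn_integral_cmult; measurable?; simp)
      also have "(\<integral>\<^sup>+\<theta>. ennreal (?D \<mu> \<theta>) * f (A, \<mu>, \<theta>) \<partial>thetas) = ?J \<mu>"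
        by (rule nn_integral_upd[OF A]) measurable
      finally show ?thesis .
    qed
    then have "(\<integral>\<^sup>+\<mu>. \<integral>\<^sup>+\<theta>. ennreal (post_dens V a b0 Y n (A, \<mu>, \<theta>)) * f (A, \<mu>, \<theta>) \<partial>thetas \<partial>lborel)
       = (\<integral>\<^sup>+\<mu>. ennreal (A_weight A) * (ennreal (normal_density (Ybar Y n) (sqrt ((V + A) / real n)) \<mu>) * ?J \<mu>) \<partial>lborel)"
      by simp
    also have "\<dots> = ennreal (A_weight A) * (\<integral>\<^sup>+\<mu>. ennreal (normal_density (Ybar Y n) (sqrt ((V + A) / real n)) \<mu>) * ?J \<mu> \<partial>lborel)"
    proof -
      note J[measurable]
      show ?thesis by (intro nn_integral_cmult) measurable
    qed
    also have "(\<integral>\<^sup>+\<mu>. ennreal (normal_density (Ybar Y n) (sqrt ((V + A) / real n)) \<mu>) * ?J \<mu> \<partial>lborel)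
       = (\<integral>\<^sup>+x. ?J (Ybar Y n + sqrt ((V + A) / real n) * x) \<partial>std_normal_distribution)"
      using A V n2 J by (intro nn_integral_normal) auto
    finally show "(\<integral>\<^sup>+\<mu>. \<integral>\<^sup>+\<theta>. ennreal (post_dens V a b0 Y n (A, \<mu>, \<theta>)) * f (A, \<mu>, \<theta>) \<partial>thetas \<partial>lborel)
       = ennreal (A_weight A) * (\<integral>\<^sup>+x. \<integral>\<^sup>+z. f (fw A x z) \<partial>normals n \<partial>std_normal_distribution)"
      by (simp add: fw_def)
  qed
  finally show ?thesis .
qed

end

lemma integral_eq_if_nn_integral_eq:
  fixes f g :: "'a \<Rightarrow> real"
  assumes eq: "(\<integral>\<^sup>+x. ennreal (f x) \<partial>M) = (\<integral>\<^sup>+x. ennreal (g x) \<partial>M)"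
    and f: "f \<in> borel_measurable M" "\<And>x. x \<in> space M \<Longrightarrow> 0 \<le> f x" and g: "g \<in> borel_measurable M" "\<And>x. x \<in> space M \<Longrightarrow> 0 \<le> g x"
  shows "(\<integral>x. f x \<partial>M) = (\<integral>x. g x \<partial>M)"
  using assms by (subst (1 2) integral_eq_nn_integral) auto

lemma emeasure_std_normal_UNIV [simp]: "emeasure std_normal_distribution UNIV = 1"
  using prob_space.emeasure_space_1[OF prob_space_std_normal] by simp

section \<open>Normalisation of the posterior and its two mixture representations\<close>

context gibbs
begin

definition norm_const :: real where "norm_const = (\<integral>y. post_dens V a b0 Y n y \<partial>Xsp n)"

abbreviation "\<pi> \<equiv> posterior V a b0 Y n"

text \<open>\<open>rate \<theta> \<ge> b0\<close> bounds the power by a constant, and a product of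
  Gaussian integrals remains. In this marginal the posterior is easily seen to be proper in spite of
  the flat prior on \<open>\<mu>\<close>.\<close>

lemma theta_weight_finite: "(\<integral>\<^sup>+\<theta>. ennreal (theta_weight \<theta>) \<partial>thetas) < \<infinity>"
proof -
  interpret L: product_sigma_finite "\<lambda>i::nat. lborel :: real measure" by standard
  define K where "K = (Gamma shp * sqrt (2 * pi / real n)) * b0 powr (-shp)"
  have G: "Gamma shp > 0" by (rule Gamma_real_pos[OF shp_pos])
  have K: "K \<ge> 0" using G by (simp add: K_def)
  have e: "exp (-(Y n i - x)\<^sup>2 / (2 * V)) = sqrt (2 * pi * V) * normal_density (Y n i) (sqrt V) x" for i x
    using V by (simp add: normal_density_def power2_commute)
  have "ennreal (theta_weight \<theta>) \<le> ennreal K * (\<Prod>i<n. ennreal (exp (-(Y n i - \<theta> i)\<^sup>2 / (2 * V))))" for \<theta>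
  proof -
    have "rate \<theta> powr (-shp) \<le> b0 powr (-shp)"
      using rate_ge[of \<theta>] b0 shp_pos by (intro powr_mono2') auto
    then have "theta_weight \<theta> \<le> (\<Prod>i<n. exp (-(Y n i - \<theta> i)\<^sup>2 / (2 * V))) * (Gamma shp * sqrt (2 * pi / real n)) * b0 powr (-shp)"
      unfolding theta_weight_def using G by (intro mult_left_mono mult_nonneg_nonneg prod_nonneg) auto
    also have "\<dots> = K * (\<Prod>i<n. exp (-(Y n i - \<theta> i)\<^sup>2 / (2 * V)))" by (simp add: K_def)
    finally have "ennreal (theta_weight \<theta>) \<le> ennreal (K * (\<Prod>i<n. exp (-(Y n i - \<theta> i)\<^sup>2 / (2 * V))))" by (rule ennreal_leI)
    then show ?thesis using K by (simp add: ennreal_mult' prod_ennreal)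
  qed
  then have "(\<integral>\<^sup>+\<theta>. ennreal (theta_weight \<theta>) \<partial>thetas) \<le> (\<integral>\<^sup>+\<theta>. ennreal K * (\<Prod>i<n. ennreal (exp (-(Y n i - \<theta> i)\<^sup>2 / (2 * V)))) \<partial>thetas)"
    by (intro nn_integral_mono)
  also have "\<dots> = ennreal K * (\<integral>\<^sup>+\<theta>. (\<Prod>i<n. ennreal (exp (-(Y n i - \<theta> i)\<^sup>2 / (2 * V)))) \<partial>thetas)"
    by (rule nn_integral_cmult) measurable
  also have "(\<integral>\<^sup>+\<theta>. (\<Prod>i<n. ennreal (exp (-(Y n i - \<theta> i)\<^sup>2 / (2 * V)))) \<partial>thetas)
      = (\<Prod>i<n. \<integral>\<^sup>+x. ennreal (exp (-(Y n i - x)\<^sup>2 / (2 * V))) \<partial>lborel)"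
    by (intro L.product_nn_integral_prod) auto
  also have "(\<lambda>i. \<integral>\<^sup>+x. ennreal (exp (-(Y n i - x)\<^sup>2 / (2 * V))) \<partial>lborel) = (\<lambda>i. ennreal (sqrt (2 * pi * V)))"
  proof
    fix i
    have "(\<integral>\<^sup>+x. ennreal (exp (-(Y n i - x)\<^sup>2 / (2 * V))) \<partial>lborel)
        = (\<integral>\<^sup>+x. ennreal (sqrt (2 * pi * V)) * ennreal (normal_density (Y n i) (sqrt V) x) \<partial>lborel)"
      unfolding e using V by (simp add: ennreal_mult')
    also have "\<dots> = ennreal (sqrt (2 * pi * V))"
      using V by (subst nn_integral_cmult) (auto simp: nn_integral_eq_integral)
    finally show "(\<integral>\<^sup>+x. ennreal (exp (-(Y n i - x)\<^sup>2 / (2 * V))) \<partial>lborel) = ennreal (sqrt (2 * pi * V))" .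
  qed
  also have "ennreal K * (\<Prod>i<n. ennreal (sqrt (2 * pi * V))) < \<infinity>"
    using V by (simp add: ennreal_power ennreal_mult_less_top)
  finally show ?thesis .
qed

lemma nn_integral_post_dens: "(\<integral>\<^sup>+x. ennreal (post_dens V a b0 Y n x) \<partial>Xsp n) = (\<integral>\<^sup>+\<theta>. ennreal (theta_weight \<theta>) \<partial>thetas)"
  using nn_integral_post_dens_backward[of "\<lambda>_. 1"] prob_space.emeasure_space_1[OF prob_space_ig1]
    prob_space.emeasure_space_1[OF prob_space_std_normal] by simp

lemma norm_const: "ennreal norm_const = (\<integral>\<^sup>+x. ennreal (post_dens V a b0 Y n x) \<partial>Xsp n)" "norm_const > 0"
proof -
  \<comment> \<open>\<open>norm_const\<close> is a Bochner integral and would be 0 by default if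
    integrability failed.\<close>
  have "integrable (Xsp n) (post_dens V a b0 Y n)"
    using theta_weight_finite nn_integral_post_dens post_dens_nonneg
    by (intro integrableI_nonneg) (auto intro: AE_I2)
  then show 1: "ennreal norm_const = (\<integral>\<^sup>+x. ennreal (post_dens V a b0 Y n x) \<partial>Xsp n)"
    unfolding norm_const_def using post_dens_nonneg by (intro nn_integral_eq_integral[symmetric]) (auto intro: AE_I2)
  have "(\<integral>\<^sup>+\<theta>. ennreal (theta_weight \<theta>) \<partial>thetas) \<noteq> 0"
  proof
    interpret L: product_sigma_finite "\<lambda>i::nat. lborel :: real measure" by standard
    assume "(\<integral>\<^sup>+\<theta>. ennreal (theta_weight \<theta>) \<partial>thetas) = 0"
    then have "AE \<theta> in thetas. ennreal (theta_weight \<theta>) = 0"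
      by (subst (asm) nn_integral_0_iff_AE) auto
    then have "AE \<theta> in thetas. False"
      by eventually_elim (metis ennreal_eq_0_iff theta_weight_pos not_le)
    then have "emeasure thetas (space thetas) = 0" using emeasure_eq_0_AE[of "\<lambda>_. True" thetas] by simp
    moreover have "emeasure thetas (space thetas) = (\<Prod>i<n. emeasure (lborel :: real measure) UNIV)"
      unfolding space_PiM by (subst L.emeasure_PiM) auto
    ultimately show False by simp
  qed
  then have "ennreal norm_const \<noteq> 0" using 1 nn_integral_post_dens by simp
  then show "norm_const > 0" by (simp add: ennreal_eq_0_iff not_le)
qed

lemma sets_posterior [measurable_cong]: "sets \<pi> = sets (Xsp n)"
  by (simp add: posterior_def)

lemma space_posterior: "space \<pi> = space (Xsp n)"
  by (simp add: posterior_def)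

lemma nn_integral_posterior:
  assumes [measurable]: "f \<in> borel_measurable (Xsp n)"
  shows "(\<integral>\<^sup>+x. f x \<partial>\<pi>) = ennreal (1 / norm_const) * (\<integral>\<^sup>+x. ennreal (post_dens V a b0 Y n x) * f x \<partial>Xsp n)"
proof -
  have "(\<integral>\<^sup>+x. f x \<partial>\<pi>) = (\<integral>\<^sup>+x. ennreal (post_dens V a b0 Y n x / norm_const) * f x \<partial>Xsp n)"
    unfolding posterior_def norm_const_def[symmetric] by (rule nn_integral_density) measurable
  also have "\<dots> = (\<integral>\<^sup>+x. ennreal (1 / norm_const) * (ennreal (post_dens V a b0 Y n x) * f x) \<partial>Xsp n)"
  proof -
    have "ennreal (p / norm_const) * r = ennreal (1 / norm_const) * (ennreal p * r)" for p r
      using ennreal_mult''[of "1 / norm_const" p] norm_const(2)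
      by (simp only: times_divide_eq_right mult_1_right) (simp add: mult.assoc mult.left_commute)
    then show ?thesis by (simp only:)
  qed
  also have "\<dots> = ennreal (1 / norm_const) * (\<integral>\<^sup>+x. ennreal (post_dens V a b0 Y n x) * f x \<partial>Xsp n)"
    by (rule nn_integral_cmult) measurable
  finally show ?thesis .
qed

text \<open>The marginal posterior law of \<open>\<theta>\<close>, the outermost mixing measure for
  \<open>bk\<close>. Correspondingly \<open>Rm\<close> is the marginal posterior law of
  \<open>A\<close>, used with \<open>fw\<close>.\<close>

definition Hm :: "(nat \<Rightarrow> real) measure" where
  "Hm = density thetas (\<lambda>\<theta>. ennreal (1 / norm_const) * ennreal (theta_weight \<theta>))"

definition Rm :: "real measure" where
  "Rm = density Apos (\<lambda>A. ennreal (1 / norm_const) * ennreal (A_weight A))"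

lemma sets_Hm [measurable_cong]: "sets Hm = sets thetas" by (simp add: Hm_def)

lemma space_Rm: "space Rm = {0<..}" by (simp add: Rm_def space_Apos)

lemma bk_measurable: "(\<lambda>p. bk (fst (fst p)) (snd (fst p)) (snd p)) \<in> measurable ((thetas \<Otimes>\<^sub>M ig shp 1) \<Otimes>\<^sub>M std_normal_distribution) (Xsp n)"
proof -
  have [measurable]: "(\<lambda>p. snd (fst p)) \<in> borel_measurable ((thetas \<Otimes>\<^sub>M ig shp 1) \<Otimes>\<^sub>M std_normal_distribution)"
    by (intro measurable_compose[OF measurable_fst] measurable_compose[OF measurable_snd] measurable_igI) simp
  show ?thesis unfolding bk_def
    by (intro triple_measurable) (auto simp: space_pair_measure space_ig intro!: mult_pos_pos rate_pos)
qed

lemma fw_measurable: "(\<lambda>p. fw (fst (fst p)) (snd (fst p)) (snd p)) \<in> measurable ((Apos \<Otimes>\<^sub>M std_normal_distribution) \<Otimes>\<^sub>M normals n) (Xsp n)"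
proof -
  have [measurable]: "(\<lambda>p. fst (fst p)) \<in> borel_measurable ((Apos \<Otimes>\<^sub>M std_normal_distribution) \<Otimes>\<^sub>M normals n)"
    by (intro measurable_compose[OF measurable_fst] measurable_AposI) simp
  show ?thesis unfolding fw_def
    by (intro triple_measurable) (auto simp: space_pair_measure space_Apos)
qed

lemma nn_integral_posterior_bk:
  fixes f :: "state \<Rightarrow> ennreal"
  assumes f: "f \<in> borel_measurable (Xsp n)"
  shows "(\<integral>\<^sup>+x. f x \<partial>\<pi>) = (\<integral>\<^sup>+\<theta>. \<integral>\<^sup>+h. \<integral>\<^sup>+x. f (bk \<theta> h x) \<partial>std_normal_distribution \<partial>ig shp 1 \<partial>Hm)"
proof -
  interpret I: prob_space "ig shp 1" by (rule prob_space_ig1)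
  interpret S: prob_space std_normal_distribution by (rule prob_space_std_normal)
  let ?J = "\<lambda>\<theta>. \<integral>\<^sup>+h. \<integral>\<^sup>+x. f (bk \<theta> h x) \<partial>std_normal_distribution \<partial>ig shp 1"
  have J1: "(\<lambda>p. \<integral>\<^sup>+x. f (bk (fst p) (snd p) x) \<partial>std_normal_distribution) \<in> borel_measurable (thetas \<Otimes>\<^sub>M ig shp 1)"
    by (rule S.borel_measurable_nn_integral) (use measurable_compose[OF bk_measurable f] in \<open>simp add: split_beta'\<close>)
  have J[measurable]: "?J \<in> borel_measurable thetas"
    by (rule I.borel_measurable_nn_integral) (use J1 in \<open>simp add: split_beta'\<close>)
  have "(\<integral>\<^sup>+x. f x \<partial>\<pi>) = ennreal (1 / norm_const) * (\<integral>\<^sup>+\<theta>. ennreal (theta_weight \<theta>) * ?J \<theta> \<partial>thetas)"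
    unfolding nn_integral_posterior[OF f] nn_integral_post_dens_backward[OF f] ..
  also have "\<dots> = (\<integral>\<^sup>+\<theta>. ennreal (1 / norm_const) * (ennreal (theta_weight \<theta>) * ?J \<theta>) \<partial>thetas)"
    by (rule nn_integral_cmult[symmetric]) measurable
  also have "\<dots> = (\<integral>\<^sup>+\<theta>. ?J \<theta> \<partial>Hm)"
    unfolding Hm_def by (subst nn_integral_density) (auto simp: mult.assoc)
  finally show ?thesis .
qed

lemma nn_integral_posterior_fw:
  fixes f :: "state \<Rightarrow> ennreal"
  assumes f: "f \<in> borel_measurable (Xsp n)"
  shows "(\<integral>\<^sup>+x. f x \<partial>\<pi>) = (\<integral>\<^sup>+A. \<integral>\<^sup>+x. \<integral>\<^sup>+z. f (fw A x z) \<partial>normals n \<partial>std_normal_distribution \<partial>Rm)"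
proof -
  interpret N: prob_space "normals n" by (rule prob_space_normals)
  interpret S: prob_space std_normal_distribution by (rule prob_space_std_normal)
  let ?J = "\<lambda>A. \<integral>\<^sup>+x. \<integral>\<^sup>+z. f (fw A x z) \<partial>normals n \<partial>std_normal_distribution"
  have J1: "(\<lambda>p. \<integral>\<^sup>+z. f (fw (fst p) (snd p) z) \<partial>normals n) \<in> borel_measurable (Apos \<Otimes>\<^sub>M std_normal_distribution)"
    by (rule N.borel_measurable_nn_integral) (use measurable_compose[OF fw_measurable f] in \<open>simp add: split_beta'\<close>)
  have J[measurable]: "?J \<in> borel_measurable Apos"
    by (rule S.borel_measurable_nn_integral) (use J1 in \<open>simp add: split_beta'\<close>)
  have "(\<integral>\<^sup>+x. f x \<partial>\<pi>) = ennreal (1 / norm_const) * (\<integral>\<^sup>+A. ennreal (A_weight A) * ?J A \<partial>Apos)"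
    unfolding nn_integral_posterior[OF f] nn_integral_post_dens_forward[OF f] ..
  also have "\<dots> = (\<integral>\<^sup>+A. ennreal (1 / norm_const) * (ennreal (A_weight A) * ?J A) \<partial>Apos)"
    by (rule nn_integral_cmult[symmetric]) measurable
  also have "\<dots> = (\<integral>\<^sup>+A. ?J A \<partial>Rm)"
    unfolding Rm_def by (subst nn_integral_density) (auto simp: mult.assoc)
  finally show ?thesis .
qed

lemma prob_space_posterior: "prob_space \<pi>"
proof
  have "emeasure \<pi> (space \<pi>) = (\<integral>\<^sup>+x. 1 \<partial>\<pi>)" by simp
  also have "\<dots> = ennreal (1 / norm_const) * ennreal norm_const"
    unfolding norm_const(1) by (subst nn_integral_posterior) auto
  also have "\<dots> = 1" using norm_const(2) by (simp add: ennreal_mult'[symmetric])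
  finally show "emeasure \<pi> (space \<pi>) = 1" .
qed

lemma prob_space_Hm: "prob_space Hm"
proof
  have "emeasure Hm (space Hm) = (\<integral>\<^sup>+x. 1 \<partial>\<pi>)"
    by (subst nn_integral_posterior_bk)
      (auto simp: prob_space.emeasure_space_1[OF prob_space_ig1] prob_space.emeasure_space_1[OF prob_space_std_normal])
  then show "emeasure Hm (space Hm) = 1"
    using prob_space.emeasure_space_1[OF prob_space_posterior] by simp
qed

subsection \<open>Invariance of the posterior law of \<open>(A, \<theta>)\<close>\<close>

text \<open>The stages of a sweep as operators on functions: \<open>kerA\<close> redraws
  \<open>A\<close> given \<open>\<theta>\<close>, and \<open>kerT\<close> redraws
  \<open>\<theta>\<close> given \<open>A\<close> and \<open>\<mu>\<close> before doing so. Values in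
  \<open>ennreal\<close> let conditional laws be exchanged without integrability questions.\<close>

definition kerA :: "(state \<Rightarrow> ennreal) \<Rightarrow> real \<Rightarrow> (nat \<Rightarrow> real) \<Rightarrow> ennreal" where
  "kerA f \<mu> \<theta> = (\<integral>\<^sup>+h. f (h * rate \<theta>, \<mu>, \<theta>) \<partial>ig shp 1)"

definition kerT :: "(state \<Rightarrow> ennreal) \<Rightarrow> real \<Rightarrow> real \<Rightarrow> ennreal" where
  "kerT f A \<mu> = (\<integral>\<^sup>+z. kerA f \<mu> (upd A \<mu> z) \<partial>normals n)"

lemma kerA_measurable:
  assumes f: "f \<in> borel_measurable (Xsp n)" and g: "g \<in> borel_measurable M" "k \<in> measurable M thetas"
  shows "(\<lambda>p. kerA f (g p) (k p)) \<in> borel_measurable M"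
proof -
  interpret I: prob_space "ig shp 1" by (rule prob_space_ig1)
  note [measurable] = g
  have [measurable]: "(\<lambda>p. snd p) \<in> borel_measurable (M \<Otimes>\<^sub>M ig shp 1)"
    by (rule measurable_compose[OF measurable_snd]) (rule measurable_igI, simp)
  have m: "(\<lambda>p. (snd p * rate (k (fst p)), g (fst p), k (fst p))) \<in> measurable (M \<Otimes>\<^sub>M ig shp 1) (Xsp n)"
    by (intro triple_measurable) (auto simp: space_pair_measure space_ig intro!: mult_pos_pos rate_pos)
  show ?thesis unfolding kerA_def
    by (rule I.borel_measurable_nn_integral) (use measurable_compose[OF m f] in \<open>simp add: split_beta'\<close>)
qed

lemma kerT_measurable:
  assumes f: "f \<in> borel_measurable (Xsp n)" and g: "g \<in> borel_measurable M" "k \<in> borel_measurable M"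
  shows "(\<lambda>p. kerT f (g p) (k p)) \<in> borel_measurable M"
proof -
  interpret N: prob_space "normals n" by (rule prob_space_normals)
  note [measurable] = g
  have "(\<lambda>p. kerA f (k (fst p)) (upd (g (fst p)) (k (fst p)) (snd p))) \<in> borel_measurable (M \<Otimes>\<^sub>M normals n)"
    by (rule kerA_measurable[OF f]) measurable
  then show ?thesis unfolding kerT_def
    by (intro N.borel_measurable_nn_integral) (simp add: split_beta')
qed

lemma nn_integral_mv:
  assumes f: "f \<in> borel_measurable (Xsp n)"
  shows "(\<integral>\<^sup>+\<omega>. f (mv A t \<omega>) \<partial>noise) = (\<integral>\<^sup>+x. kerT f A (t + sqrt (A / real n) * x) \<partial>std_normal_distribution)"
proof -
  interpret I: prob_space "ig shp 1" by (rule prob_space_ig1)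
  have NI: "sigma_finite_measure (normals n \<Otimes>\<^sub>M ig shp 1)"
    by (intro prob_space_imp_sigma_finite prob_space_pair prob_space_normals prob_space_ig1)
  have m: "(\<lambda>w. f (mv A t (x, w))) \<in> borel_measurable (normals n \<Otimes>\<^sub>M ig shp 1)" for x
    using measurable_compose[OF _ measurable_compose[OF mv_measurable[of A t] f], of "\<lambda>w. (x, w)" "normals n \<Otimes>\<^sub>M ig shp 1"]
    by (simp add: noise_def)
  have "(\<integral>\<^sup>+\<omega>. f (mv A t \<omega>) \<partial>noise) = (\<integral>\<^sup>+x. \<integral>\<^sup>+w. f (mv A t (x, w)) \<partial>(normals n \<Otimes>\<^sub>M ig shp 1) \<partial>std_normal_distribution)"
    using sigma_finite_measure.nn_integral_fst[OF NI, of "\<lambda>\<omega>. f (mv A t \<omega>)" std_normal_distribution]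
      measurable_compose[OF mv_measurable[of A t] f] by (simp add: noise_def)
  also have "\<dots> = (\<integral>\<^sup>+x. \<integral>\<^sup>+z. \<integral>\<^sup>+h. f (mv A t (x, z, h)) \<partial>ig shp 1 \<partial>normals n \<partial>std_normal_distribution)"
    by (intro nn_integral_cong I.nn_integral_fst[symmetric] m)
  also have "\<dots> = (\<integral>\<^sup>+x. kerT f A (t + sqrt (A / real n) * x) \<partial>std_normal_distribution)"
    by (simp add: kerT_def kerA_def mv_def)
  finally show ?thesis .
qed

text \<open>Under the posterior, \<open>\<mu>\<close> given \<open>(A, \<theta>)\<close> has exactly
  the law of the first draw, as \<open>bk\<close> shows, and \<open>\<theta>\<close> given
  \<open>(A, \<mu>)\<close> that of the second, as \<open>fw\<close> shows. These draws preserve the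
  posterior, so a sweep amounts to redrawing \<open>A\<close> alone, given \<open>\<theta>\<close>
  but not \<open>\<mu>\<close>.\<close>

lemma posterior_step:
  assumes f: "f \<in> borel_measurable (Xsp n)"
  shows "(\<integral>\<^sup>+y. \<integral>\<^sup>+\<omega>. f (mv (fst y) (tbar n (snd (snd y))) \<omega>) \<partial>noise \<partial>\<pi>) = (\<integral>\<^sup>+y. kerA f (fst (snd y)) (snd (snd y)) \<partial>\<pi>)"
proof -
  interpret N: prob_space "normals n" by (rule prob_space_normals)
  interpret S: prob_space std_normal_distribution by (rule prob_space_std_normal)
  interpret no: prob_space noise by (rule prob_space_noise)
  have "(\<lambda>p. f (mv (fst (fst p)) (tbar n (snd (snd (fst p)))) (snd p))) \<in> borel_measurable (Xsp n \<Otimes>\<^sub>M noise)"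
    by (rule measurable_compose[OF mv_measurable_pair f])
  then have m: "(\<lambda>y. \<integral>\<^sup>+\<omega>. f (mv (fst y) (tbar n (snd (snd y))) \<omega>) \<partial>noise) \<in> borel_measurable (Xsp n)"
    by (intro no.borel_measurable_nn_integral) (simp add: split_beta')
  have T: "(\<lambda>y. kerT f (fst y) (fst (snd y))) \<in> borel_measurable (Xsp n)"
    by (rule kerT_measurable[OF f]) measurable
  have "(\<integral>\<^sup>+y. \<integral>\<^sup>+\<omega>. f (mv (fst y) (tbar n (snd (snd y))) \<omega>) \<partial>noise \<partial>\<pi>) =
     (\<integral>\<^sup>+\<theta>. \<integral>\<^sup>+h. \<integral>\<^sup>+x. kerT f (h * rate \<theta>) (tbar n \<theta> + sqrt (h * rate \<theta> / real n) * x) \<partial>std_normal_distribution \<partial>ig shp 1 \<partial>Hm)"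
    unfolding nn_integral_posterior_bk[OF m] by (simp add: bk_def nn_integral_mv[OF f] S.emeasure_space_1)
  also have "\<dots> = (\<integral>\<^sup>+y. kerT f (fst y) (fst (snd y)) \<partial>\<pi>)"
    unfolding nn_integral_posterior_bk[OF T] by (simp add: bk_def)
  also have "\<dots> = (\<integral>\<^sup>+y. kerA f (fst (snd y)) (snd (snd y)) \<partial>\<pi>)"
    unfolding nn_integral_posterior_fw[OF T]
    by (subst nn_integral_posterior_fw) (auto intro!: kerA_measurable f simp: fw_def kerT_def N.emeasure_space_1)
  finally show ?thesis .
qed

text \<open>\<open>bk\<close> produces \<open>A\<close> from \<open>\<theta>\<close> before
  \<open>\<mu>\<close>, so for a function blind to \<open>\<mu>\<close> the redraw of
  \<open>A\<close> is a draw from the posterior conditional.\<close>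

lemma posterior_invariant:
  assumes f: "f \<in> borel_measurable (Xsp n)" and ind: "\<And>A \<mu> \<mu>' \<theta>. f (A, \<mu>, \<theta>) = f (A, \<mu>', \<theta>)"
  shows "(\<integral>\<^sup>+y. \<integral>\<^sup>+\<omega>. f (mv (fst y) (tbar n (snd (snd y))) \<omega>) \<partial>noise \<partial>\<pi>) = (\<integral>\<^sup>+y. f y \<partial>\<pi>)"
proof -
  interpret S: prob_space std_normal_distribution by (rule prob_space_std_normal)
  interpret I: prob_space "ig shp 1" by (rule prob_space_ig1)
  have k: "kerA f \<mu> \<theta> = kerA f 0 \<theta>" for \<mu> \<theta> unfolding kerA_def by (subst ind[of _ \<mu> _ 0]) (rule refl)
  have "(\<integral>\<^sup>+y. kerA f (fst (snd y)) (snd (snd y)) \<partial>\<pi>) = (\<integral>\<^sup>+\<theta>. kerA f 0 \<theta> \<partial>Hm)"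
    by (subst nn_integral_posterior_bk) (auto intro!: kerA_measurable f simp: bk_def k[of "_ + _"] S.emeasure_space_1 I.emeasure_space_1)
  also have "\<dots> = (\<integral>\<^sup>+y. f y \<partial>\<pi>)"
    unfolding nn_integral_posterior_bk[OF f] bk_def kerA_def by (subst (2) ind[of _ _ _ 0]) (simp add: S.emeasure_space_1)
  finally show ?thesis using posterior_step[OF f] by simp
qed

lemma integrable_posterior_test: "test h \<Longrightarrow> integrable \<pi> h"
proof -
  assume h: "test h"
  interpret P: prob_space \<pi> by (rule prob_space_posterior)
  have "h \<in> borel_measurable \<pi>" using testD(1)[OF h] by (simp cong: measurable_cong_sets add: sets_posterior)
  then show ?thesis using testD(2,3)[OF h] by (intro P.integrable_const_bound[of _ 1]) auto
qed

lemma ennreal_Pop: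
  assumes h: "test h"
  shows "ennreal (Pop h y) = (\<integral>\<^sup>+\<omega>. ennreal (h (mv (fst y) (tbar n (snd (snd y))) \<omega>)) \<partial>noise)"
  unfolding Pop_def
  by (rule nn_integral_eq_integral[symmetric]) (auto simp: testD[OF h] integrable_test_mv[OF h])

text \<open>After a sweep \<open>A = y * rate \<theta>\<close> is fresh, while \<open>\<mu>\<close>
  was drawn with the old value \<open>w * rate \<theta>\<close>; under the posterior both use
  \<open>y\<close>. So two normal laws with the same mean and variances in the ratio
  \<open>w : y\<close> are compared, where \<open>w\<close> and \<open>y\<close> are independent and
  both concentrate at \<open>m\<close>.\<close>

lemma posterior_step_le:
  assumes h: "test h" and s: "shp > 2"
  shows "(\<integral>y. Pop h y \<partial>\<pi>) \<le> (\<integral>y. h y \<partial>\<pi>) + 2 * sqrt 8 / sqrt (shp - 2)"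
proof -
  interpret I: prob_space "ig shp 1" by (rule prob_space_ig1)
  interpret S: prob_space std_normal_distribution by (rule prob_space_std_normal)
  interpret H: prob_space Hm by (rule prob_space_Hm)
  interpret IS: pair_prob_space "ig shp 1" std_normal_distribution ..
  define F where "F x = ennreal (h x)" for x
  have F: "F \<in> borel_measurable (Xsp n)" unfolding F_def using testD(1)[OF h] by measurable
  define m where "m = 1 / (shp - 1)"
  have m: "m > 0" using s by (simp add: m_def)
  define E where "E = (\<integral>w. \<bar>w - m\<bar> \<partial>ig shp 1)"
  have wI: "integrable (ig shp 1) (\<lambda>w. \<bar>w - m\<bar>)" using ig_mean(1)[of shp 1] s by simp
  have E: "E \<le> m / sqrt (shp - 2)" "E \<ge> 0"
    using ig_mean_deviation[OF s, of 1] by (simp_all add: m_def E_def)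
  have wE: "(\<integral>\<^sup>+w. ennreal \<bar>w - m\<bar> \<partial>ig shp 1) = ennreal E"
    unfolding E_def by (rule nn_integral_eq_integral[OF wI]) simp
  have wM: "(\<lambda>w. \<bar>w - m\<bar>) \<in> borel_measurable (ig shp 1)" using wI by simp
  define c where "c = sqrt 8 / m"
  have c: "c \<ge> 0" using m by (simp add: c_def)
  \<comment> \<open>\<open>y\<close> is the factor in the current \<open>A\<close> and
    \<open>w\<close> the one in the variance of \<open>\<mu>\<close>; the diagonal
    \<open>w = y\<close> is the posterior.\<close>
  define Z where "Z \<theta> y w = (\<integral>\<^sup>+x. F (y * rate \<theta>, tbar n \<theta> + sqrt (w * rate \<theta> / real n) * x, \<theta>) \<partial>std_normal_distribution)" for \<theta> y w
  have Zle: "Z \<theta> y w \<le> Z \<theta> y y + ennreal (c * (\<bar>w - m\<bar> + \<bar>y - m\<bar>))"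
    if th: "\<theta> \<in> space thetas" and y: "y > 0" and w: "w > 0" for \<theta> y w
  proof -
    let ?f = "\<lambda>\<mu>. h (y * rate \<theta>, \<mu>, \<theta>)"
    define z where "z v = (\<integral>x. ?f (tbar n \<theta> + sqrt (v * rate \<theta> / real n) * x) \<partial>std_normal_distribution)" for v
    have fm: "?f \<in> borel_measurable borel"
      by (rule measurable_compose[OF triple_measurable testD(1)[OF h]]) (use y th rate_pos in auto)
    have Zz: "Z \<theta> y v = ennreal (z v)" for v
      unfolding Z_def F_def z_def
    proof (rule nn_integral_eq_integral)
      show "integrable std_normal_distribution (\<lambda>x. ?f (tbar n \<theta> + sqrt (v * rate \<theta> / real n) * x))"
        by (rule S.integrable_const_bound[of _ 1]) (auto simp: testD[OF h] intro!: measurable_compose[OF _ fm])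
    qed (simp add: testD[OF h])
    have z0: "z v \<ge> 0" for v unfolding z_def by (intro integral_nonneg_AE) (auto simp: testD[OF h])
    let ?s1 = "sqrt (w * rate \<theta> / real n)" and ?s2 = "sqrt (y * rate \<theta> / real n)"
    have r: "rate \<theta> / real n > 0" using rate_pos[of \<theta>] n2 by simp
    have s12: "?s1 > 0" "?s2 > 0" using r y w rate_pos[of \<theta>] n2 by auto
    have "\<bar>z w - z y\<bar> \<le> sqrt (8 * ((?s1 - ?s2)\<^sup>2 / (?s1\<^sup>2 + ?s2\<^sup>2) + (tbar n \<theta> - tbar n \<theta>)\<^sup>2 / (4 * (?s1\<^sup>2 + ?s2\<^sup>2))))"
      unfolding z_def by (rule std_normal_tv[OF s12 fm]) (auto simp: testD[OF h])
    also have "\<dots> = sqrt (8 * ((?s1 - ?s2)\<^sup>2 / (?s1\<^sup>2 + ?s2\<^sup>2)))" by simp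
    also have "\<dots> \<le> sqrt (8 * ((\<bar>w - y\<bar> / (w + y))\<^sup>2))"
    proof (intro real_sqrt_le_mono mult_left_mono)
      have q: "?s1\<^sup>2 = w * (rate \<theta> / real n)" "?s2\<^sup>2 = y * (rate \<theta> / real n)" using r w y rate_pos[of \<theta>] by auto
      have "(?s1 - ?s2)\<^sup>2 / (?s1\<^sup>2 + ?s2\<^sup>2) \<le> ((w * (rate \<theta> / real n) - y * (rate \<theta> / real n)) / (w * (rate \<theta> / real n) + y * (rate \<theta> / real n)))\<^sup>2"
        using sqrt_ratio_le[OF mult_pos_pos[OF w r] mult_pos_pos[OF y r]] unfolding q by simp
      also have "(w * (rate \<theta> / real n) - y * (rate \<theta> / real n)) / (w * (rate \<theta> / real n) + y * (rate \<theta> / real n)) = (w - y) / (w + y)"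
        unfolding left_diff_distrib[symmetric] distrib_right[symmetric]
        by (rule mult_divide_mult_cancel_right) (rule less_imp_neq[OF r, symmetric])
      finally show "(?s1 - ?s2)\<^sup>2 / (?s1\<^sup>2 + ?s2\<^sup>2) \<le> (\<bar>w - y\<bar> / (w + y))\<^sup>2" by (simp add: power_divide)
    qed simp
    also have "\<dots> = sqrt 8 * (\<bar>w - y\<bar> / (w + y))" using w y by (simp add: real_sqrt_mult)
    also have "\<dots> \<le> sqrt 8 * ((\<bar>w - m\<bar> + \<bar>y - m\<bar>) / m)"
    proof (rule mult_left_mono)
      \<comment> \<open>If \<open>w + y < m\<close>, the two deviations from \<open>m\<close>
        together exceed \<open>m\<close>, and the left side is at most 1 anyway.\<close>
      show "\<bar>w - y\<bar> / (w + y) \<le> (\<bar>w - m\<bar> + \<bar>y - m\<bar>) / m"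
      proof (cases "w + y \<ge> m")
        case True
        then show ?thesis using m by (intro frac_le) auto
      next
        case False
        have "\<bar>w - y\<bar> / (w + y) \<le> 1" using w y by (simp add: divide_le_eq_1)
        also have "1 \<le> (\<bar>w - m\<bar> + \<bar>y - m\<bar>) / m" using False m by (simp add: le_divide_eq_1)
        finally show ?thesis .
      qed
    qed simp
    finally have "z w \<le> z y + c * (\<bar>w - m\<bar> + \<bar>y - m\<bar>)" by (simp add: c_def)
    then have "ennreal (z w) \<le> ennreal (z y + c * (\<bar>w - m\<bar> + \<bar>y - m\<bar>))" by (rule ennreal_leI)
    also have "\<dots> = ennreal (z y) + ennreal (c * (\<bar>w - m\<bar> + \<bar>y - m\<bar>))" using z0 c by (intro ennreal_plus) auto
    finally show ?thesis unfolding Zz .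
  qed
  have bkF: "(\<lambda>p. F (bk (fst (fst p)) (snd (fst p)) (snd p))) \<in> borel_measurable ((thetas \<Otimes>\<^sub>M ig shp 1) \<Otimes>\<^sub>M std_normal_distribution)"
    by (rule measurable_compose[OF bk_measurable F])
  have Zp: "(\<lambda>p. Z (fst p) (snd p) (snd p)) \<in> borel_measurable (thetas \<Otimes>\<^sub>M ig shp 1)"
    unfolding Z_def by (rule S.borel_measurable_nn_integral) (use bkF in \<open>simp add: split_beta' bk_def\<close>)
  have Zs: "(\<lambda>y. Z \<theta> y y) \<in> borel_measurable (ig shp 1)" if "\<theta> \<in> space thetas" for \<theta>
    using measurable_compose[OF measurable_Pair1'[OF that] Zp] by simp
  have Zi: "(\<lambda>\<theta>. \<integral>\<^sup>+y. Z \<theta> y y \<partial>ig shp 1) \<in> borel_measurable thetas"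
    by (rule I.borel_measurable_nn_integral) (use Zp in \<open>simp add: split_beta'\<close>)
  have sp: "space Hm = space thetas" by (simp add: Hm_def)
  have inner: "(\<integral>\<^sup>+x. kerA F (tbar n \<theta> + sqrt (w * rate \<theta> / real n) * x) \<theta> \<partial>std_normal_distribution) = (\<integral>\<^sup>+y. Z \<theta> y w \<partial>ig shp 1)"
    if th: "\<theta> \<in> space thetas" for \<theta> w
    unfolding kerA_def Z_def
  proof (rule IS.Fubini')
    have [measurable]: "(\<lambda>p. fst p) \<in> borel_measurable (ig shp 1 \<Otimes>\<^sub>M std_normal_distribution)"
      by (intro measurable_compose[OF measurable_fst] measurable_igI) simp
    have "(\<lambda>p. (fst p * rate \<theta>, tbar n \<theta> + sqrt (w * rate \<theta> / real n) * snd p, \<theta>)) \<in> measurable (ig shp 1 \<Otimes>\<^sub>M std_normal_distribution) (Xsp n)"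
      using th by (intro triple_measurable) (auto simp: space_pair_measure space_ig intro!: mult_pos_pos rate_pos)
    from measurable_compose[OF this F]
    show "(\<lambda>(y, x). F (y * rate \<theta>, tbar n \<theta> + sqrt (w * rate \<theta> / real n) * x, \<theta>)) \<in> borel_measurable (ig shp 1 \<Otimes>\<^sub>M std_normal_distribution)"
      by (simp add: split_beta')
  qed
  have kA: "(\<lambda>y. kerA F (fst (snd y)) (snd (snd y))) \<in> borel_measurable (Xsp n)"
    by (rule kerA_measurable[OF F]) measurable
  have "ennreal (\<integral>y. Pop h y \<partial>\<pi>) = (\<integral>\<^sup>+y. ennreal (Pop h y) \<partial>\<pi>)"
    by (intro nn_integral_eq_integral[symmetric] integrable_posterior_test test_Pop h) (auto simp: testD[OF test_Pop[OF h]])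
  also have "\<dots> = (\<integral>\<^sup>+y. kerA F (fst (snd y)) (snd (snd y)) \<partial>\<pi>)"
    unfolding ennreal_Pop[OF h] F_def[symmetric] by (rule posterior_step[OF F])
  also have "\<dots> = (\<integral>\<^sup>+\<theta>. \<integral>\<^sup>+w. \<integral>\<^sup>+y. Z \<theta> y w \<partial>ig shp 1 \<partial>ig shp 1 \<partial>Hm)"
    unfolding nn_integral_posterior_bk[OF kA] bk_def fst_conv snd_conv
    by (intro nn_integral_cong) (simp add: inner sp)
  also have "\<dots> \<le> (\<integral>\<^sup>+\<theta>. (\<integral>\<^sup>+y. Z \<theta> y y \<partial>ig shp 1) + ennreal (c * (E + E)) \<partial>Hm)"
  proof (intro nn_integral_mono)
    fix \<theta> assume "\<theta> \<in> space Hm"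
    then have th: "\<theta> \<in> space thetas" by (simp add: sp)
    note Zs[OF th, measurable] wM[measurable]
    have "(\<integral>\<^sup>+y. Z \<theta> y w \<partial>ig shp 1) \<le> (\<integral>\<^sup>+y. Z \<theta> y y \<partial>ig shp 1) + ennreal (c * (\<bar>w - m\<bar> + E))" if w: "w > 0" for w
    proof -
      have "(\<integral>\<^sup>+y. Z \<theta> y w \<partial>ig shp 1) \<le> (\<integral>\<^sup>+y. Z \<theta> y y + (ennreal (c * \<bar>w - m\<bar>) + ennreal c * ennreal \<bar>y - m\<bar>) \<partial>ig shp 1)"
        using Zle[OF th _ w] c by (intro nn_integral_mono) (simp add: space_ig distrib_left ennreal_mult')
      also have "\<dots> = (\<integral>\<^sup>+y. Z \<theta> y y \<partial>ig shp 1) + (\<integral>\<^sup>+y. ennreal (c * \<bar>w - m\<bar>) + ennreal c * ennreal \<bar>y - m\<bar> \<partial>ig shp 1)"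
        by (rule nn_integral_add) measurable
      also have "(\<integral>\<^sup>+y. ennreal (c * \<bar>w - m\<bar>) + ennreal c * ennreal \<bar>y - m\<bar> \<partial>ig shp 1) = ennreal (c * \<bar>w - m\<bar>) + ennreal c * ennreal E"
        by (subst nn_integral_add) (measurable, simp add: nn_integral_cmult wE I.emeasure_space_1)
      also have "\<dots> = ennreal (c * (\<bar>w - m\<bar> + E))" using c E by (simp add: distrib_left ennreal_mult'[symmetric])
      finally show ?thesis .
    qed
    then have "(\<integral>\<^sup>+w. \<integral>\<^sup>+y. Z \<theta> y w \<partial>ig shp 1 \<partial>ig shp 1) \<le> (\<integral>\<^sup>+w. ((\<integral>\<^sup>+y. Z \<theta> y y \<partial>ig shp 1) + ennreal (c * E)) + ennreal c * ennreal \<bar>w - m\<bar> \<partial>ig shp 1)"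
      using c E by (intro nn_integral_mono) (simp add: space_ig distrib_left ennreal_mult' add_ac)
    also have "\<dots> = ((\<integral>\<^sup>+y. Z \<theta> y y \<partial>ig shp 1) + ennreal (c * E)) + ennreal c * ennreal E"
      by (subst nn_integral_add) (measurable, simp add: nn_integral_cmult wE I.emeasure_space_1)
    also have "\<dots> = (\<integral>\<^sup>+y. Z \<theta> y y \<partial>ig shp 1) + ennreal (c * (E + E))"
    proof -
      have "ennreal (c * (E + E)) = ennreal (c * E) + ennreal (c * E)"
        unfolding distrib_left using c E by (intro ennreal_plus) auto
      then show ?thesis using c by (simp only: ennreal_mult' add.assoc)
    qed
    finally show "(\<integral>\<^sup>+w. \<integral>\<^sup>+y. Z \<theta> y w \<partial>ig shp 1 \<partial>ig shp 1) \<le> (\<integral>\<^sup>+y. Z \<theta> y y \<partial>ig shp 1) + ennreal (c * (E + E))" .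
  qed
  also have "\<dots> = (\<integral>\<^sup>+\<theta>. (\<integral>\<^sup>+y. Z \<theta> y y \<partial>ig shp 1) \<partial>Hm) + ennreal (c * (E + E))"
    using Zi by (subst nn_integral_add) (simp_all add: H.emeasure_space_1 cong: measurable_cong_sets add: sets_Hm)
  also have "(\<integral>\<^sup>+\<theta>. (\<integral>\<^sup>+y. Z \<theta> y y \<partial>ig shp 1) \<partial>Hm) = (\<integral>\<^sup>+y. F y \<partial>\<pi>)"
    unfolding nn_integral_posterior_bk[OF F] Z_def bk_def ..
  also have "(\<integral>\<^sup>+y. F y \<partial>\<pi>) = ennreal (\<integral>y. h y \<partial>\<pi>)"
    unfolding F_def by (intro nn_integral_eq_integral integrable_posterior_test h) (auto simp: testD[OF h])
  also have "ennreal (\<integral>y. h y \<partial>\<pi>) + ennreal (c * (E + E)) = ennreal ((\<integral>y. h y \<partial>\<pi>) + c * (E + E))"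
    using c E by (intro ennreal_plus[symmetric] integral_nonneg_AE) (auto simp: testD[OF h])
  finally have "(\<integral>y. Pop h y \<partial>\<pi>) \<le> (\<integral>y. h y \<partial>\<pi>) + c * (E + E)"
    using c E by (subst (asm) ennreal_le_iff) (auto intro!: add_nonneg_nonneg integral_nonneg_AE simp: testD[OF h])
  also have "c * (E + E) \<le> c * (m / sqrt (shp - 2) + m / sqrt (shp - 2))"
    using c E by (intro mult_left_mono) auto
  also have "\<dots> = 2 * sqrt 8 / sqrt (shp - 2)" using m by (simp add: c_def)
  finally show ?thesis by simp
qed

text \<open>The one-sided estimate applied to \<open>h\<close> and to \<open>1 - h\<close>.\<close>

lemma posterior_step_defect:
  assumes h: "test h" and s: "shp > 2"
  shows "\<bar>(\<integral>y. Pop h y \<partial>\<pi>) - (\<integral>y. h y \<partial>\<pi>)\<bar> \<le> 2 * sqrt 8 / sqrt (shp - 2)"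
proof -
  interpret P: prob_space \<pi> by (rule prob_space_posterior)
  interpret no: prob_space noise by (rule prob_space_noise)
  have h': "test (\<lambda>x. 1 - h x)" using h testD(1)[OF h] by (auto simp: test_def)
  have P: "Pop (\<lambda>x. 1 - h x) = (\<lambda>x. 1 - Pop h x)"
    unfolding Pop_def using integrable_test_mv[OF h] by (simp add: no.prob_space)
  have "1 - (\<integral>y. Pop h y \<partial>\<pi>) \<le> 1 - (\<integral>y. h y \<partial>\<pi>) + 2 * sqrt 8 / sqrt (shp - 2)"
    using posterior_step_le[OF h' s] integrable_posterior_test[OF h] integrable_posterior_test[OF test_Pop[OF h]]
    unfolding P by (simp add: P.prob_space)
  with posterior_step_le[OF h s] show ?thesis by linarith
qed

text \<open>\<open>Pop q\<close> reads a state only through \<open>A\<close> and the mean of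
  \<open>\<theta>\<close>, never through \<open>\<mu>\<close>, so every application of
  \<open>Pop\<close> after the first preserves the posterior integral. The defect in
  \<open>\<mu>\<close> is thus paid once and not once per sweep.\<close>

lemma posterior_Pop_invariant:
  assumes h: "test h"
  shows "(\<integral>y. (Pop ^^ Suc k) h y \<partial>\<pi>) = (\<integral>y. Pop h y \<partial>\<pi>)"
proof (induction k)
  case (Suc k)
  define q where "q = (Pop ^^ k) h"
  have q: "test q" "test (Pop q)" "test (Pop (Pop q))" unfolding q_def by (intro test_Pop test_Pop_iter h)+
  have F: "(\<lambda>x. ennreal (Pop q x)) \<in> borel_measurable (Xsp n)" using testD(1)[OF q(2)] by measurable
  have "ennreal (\<integral>y. Pop (Pop q) y \<partial>\<pi>) = (\<integral>\<^sup>+y. ennreal (Pop (Pop q) y) \<partial>\<pi>)"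
    by (intro nn_integral_eq_integral[symmetric] integrable_posterior_test q) (auto simp: testD[OF q(3)])
  also have "\<dots> = (\<integral>\<^sup>+y. ennreal (Pop q y) \<partial>\<pi>)"
    unfolding ennreal_Pop[OF q(2)] by (rule posterior_invariant[OF F]) (simp add: Pop_def)
  also have "\<dots> = ennreal (\<integral>y. Pop q y \<partial>\<pi>)"
    by (intro nn_integral_eq_integral integrable_posterior_test q) (auto simp: testD[OF q(2)])
  finally have "(\<integral>y. Pop (Pop q) y \<partial>\<pi>) = (\<integral>y. Pop q y \<partial>\<pi>)"
    by (subst (asm) ennreal_inj) (auto intro!: integral_nonneg_AE simp: testD[OF q(2)] testD[OF q(3)])
  then show ?case using Suc by (simp add: q_def)
qed simp

subsection \<open>Concentration of the posterior\<close>

text \<open>The identities below come from \<open>E[\<beta> A\<^sup>-\<^sup>j]\<close> computed in two ways, with \<open>\<beta>\<close> the rate: given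
  \<open>\<theta>\<close> the law of \<open>A\<close> is inverse gamma, given \<open>A\<close> the expected sum of squares is
  \<open>(n - 1)\<close> times the drift map.\<close>

lemma nn_integral_inverse:
  "(\<integral>\<^sup>+y. ennreal (1 / fst y) \<partial>\<pi>) = (\<integral>\<^sup>+\<theta>. ennreal (shp / rate \<theta>) \<partial>Hm)"
  "(\<integral>\<^sup>+y. ennreal (1 / (fst y)\<^sup>2) \<partial>\<pi>) = (\<integral>\<^sup>+\<theta>. ennreal (shp * (shp + 1) / (rate \<theta>)\<^sup>2) \<partial>Hm)"
  "(\<integral>\<^sup>+y. ennreal (rate (snd (snd y)) * (1 / fst y)) \<partial>\<pi>) = ennreal shp"
  "(\<integral>\<^sup>+y. ennreal (rate (snd (snd y)) * (1 / (fst y)\<^sup>2)) \<partial>\<pi>) = (\<integral>\<^sup>+\<theta>. ennreal (shp * (shp + 1) / rate \<theta>) \<partial>Hm)"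
proof -
  interpret H: prob_space Hm by (rule prob_space_Hm)
  have m1: "(\<lambda>h. ennreal (1 / h)) \<in> borel_measurable (ig shp 1)"
    by (rule measurable_igI) measurable
  have m2: "(\<lambda>h. ennreal (1 / h\<^sup>2)) \<in> borel_measurable (ig shp 1)"
    by (rule measurable_igI) measurable
  have i1: "(\<integral>\<^sup>+h. ennreal (c * (1 / h)) \<partial>ig shp 1) = ennreal (c * shp)" if "c \<ge> 0" for c
    using that m1 nn_integral_ig_inverse[OF shp_pos, of 1] shp_pos by (simp only: ennreal_mult' nn_integral_cmult) simp
  have i2: "(\<integral>\<^sup>+h. ennreal (c * (1 / h\<^sup>2)) \<partial>ig shp 1) = ennreal (c * (shp * (shp + 1)))" if "c \<ge> 0" for c
  proof -
    have "(\<integral>\<^sup>+h. ennreal (c * (1 / h\<^sup>2)) \<partial>ig shp 1) = ennreal c * (\<integral>\<^sup>+h. ennreal (1 / h\<^sup>2) \<partial>ig shp 1)"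
      using that m2 by (simp only: ennreal_mult' nn_integral_cmult)
    also have "(\<integral>\<^sup>+h. ennreal (1 / h\<^sup>2) \<partial>ig shp 1) = ennreal (shp * (shp + 1))"
      using nn_integral_ig_inverse_square[OF shp_pos, of 1] by simp
    finally show ?thesis using that by (simp only: ennreal_mult')
  qed
  have r: "rate \<theta> > 0" "rate \<theta> \<noteq> 0" for \<theta> using rate_pos[of \<theta>] by auto
  have e: "1 / (h * rate \<theta>) = 1 / rate \<theta> * (1 / h)" "1 / (h * rate \<theta>)\<^sup>2 = 1 / (rate \<theta>)\<^sup>2 * (1 / h\<^sup>2)"
    "rate \<theta> * (1 / (h * rate \<theta>)) = 1 * (1 / h)" "rate \<theta> * (1 / (h * rate \<theta>)\<^sup>2) = 1 / rate \<theta> * (1 / h\<^sup>2)" for h \<theta>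
    using r[of \<theta>] by (simp_all add: power2_eq_square)
  show "(\<integral>\<^sup>+y. ennreal (1 / fst y) \<partial>\<pi>) = (\<integral>\<^sup>+\<theta>. ennreal (shp / rate \<theta>) \<partial>Hm)"
    using r by (subst nn_integral_posterior_bk) (measurable, simp add: bk_def e(1) i1 less_imp_le del: times_divide_eq_right times_divide_eq_left, simp)
  show "(\<integral>\<^sup>+y. ennreal (1 / (fst y)\<^sup>2) \<partial>\<pi>) = (\<integral>\<^sup>+\<theta>. ennreal (shp * (shp + 1) / (rate \<theta>)\<^sup>2) \<partial>Hm)"
    using r by (subst nn_integral_posterior_bk) (measurable, simp add: bk_def e(2) i2 less_imp_le del: times_divide_eq_right times_divide_eq_left, simp)
  show "(\<integral>\<^sup>+y. ennreal (rate (snd (snd y)) * (1 / fst y)) \<partial>\<pi>) = ennreal shp"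
    using i1[of 1] by (subst nn_integral_posterior_bk) (measurable, simp add: bk_def e(3) H.emeasure_space_1 del: times_divide_eq_right times_divide_eq_left)
  show "(\<integral>\<^sup>+y. ennreal (rate (snd (snd y)) * (1 / (fst y)\<^sup>2)) \<partial>\<pi>) = (\<integral>\<^sup>+\<theta>. ennreal (shp * (shp + 1) / rate \<theta>) \<partial>Hm)"
    using r by (subst nn_integral_posterior_bk) (measurable, simp add: bk_def e(4) i2 less_imp_le del: times_divide_eq_right times_divide_eq_left, simp)
qed

lemma drift_map_nonneg: "A > 0 \<Longrightarrow> drift_map A \<ge> 0"
  using frac_bounds[of A] V Delta_nonneg n2
  by (auto simp: drift_map_def intro!: add_nonneg_nonneg mult_nonneg_nonneg)

lemma drift_map_measurable [measurable]: "drift_map \<in> borel_measurable borel"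
  unfolding drift_map_def frac_def by measurable

lemma rate_upd_expectation:
  assumes A: "A > 0"
  shows "(\<integral>\<^sup>+z. ennreal (rate (upd A \<mu> z)) \<partial>normals n) = ennreal (b0 + (real n - 1) / 2 * drift_map A)"
proof -
  interpret N: prob_space "normals n" by (rule prob_space_normals)
  let ?u = "frac A"
  have I: "integrable (normals n) (\<lambda>z. rate (upd A \<mu> z))"
    unfolding rate_upd[OF A] using W_moments(1) Q_moments(1) by simp
  have "(\<integral>z. rate (upd A \<mu> z) \<partial>normals n) = b0 + (?u\<^sup>2 * Delta Y n + 2 * (?u * sqrt (V * ?u)) * (\<integral>z. W z \<partial>normals n)
        + V * ?u * (\<integral>z. Q z \<partial>normals n)) / 2"
    unfolding rate_upd[OF A] using W_moments(1) Q_moments(1) N.prob_space by simp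
  also have "\<dots> = b0 + (real n - 1) / 2 * drift_map A"
    unfolding W_moments(2) Q_moments(2) using n2 by (simp add: drift_map_def field_simps)
  finally show ?thesis using nn_integral_eq_integral[OF I] rate_pos by (simp add: less_imp_le)
qed

lemma nn_integral_rate_forward:
  assumes g[measurable]: "g \<in> borel_measurable borel" and g0: "\<And>x. g x \<ge> (0 :: real)"
  shows "(\<integral>\<^sup>+y. ennreal (rate (snd (snd y)) * g (fst y)) \<partial>\<pi>) =
    (\<integral>\<^sup>+y. ennreal ((b0 + (real n - 1) / 2 * drift_map (fst y)) * g (fst y)) \<partial>\<pi>)"
proof -
  interpret N: prob_space "normals n" by (rule prob_space_normals)
  interpret S: prob_space std_normal_distribution by (rule prob_space_std_normal)
  have u[measurable]: "(\<lambda>z. rate (upd A \<mu> z)) \<in> borel_measurable (normals n)" for A \<mu>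
    using measurable_compose[OF upd_measurable[of "\<lambda>_. A" "normals n" "\<lambda>_. \<mu>" "\<lambda>z. z"] rate_measurable] by simp
  have e: "(\<integral>\<^sup>+z. ennreal (rate (upd A \<mu> z) * g A) \<partial>normals n) = ennreal ((b0 + (real n - 1) / 2 * drift_map A) * g A)"
    if "A > 0" for A \<mu>
    using g0[of A] rate_upd_expectation[OF that, of \<mu>] by (simp add: ennreal_mult'' nn_integral_multc)
  have "(\<integral>\<^sup>+y. ennreal (rate (snd (snd y)) * g (fst y)) \<partial>\<pi>) =
      (\<integral>\<^sup>+A. \<integral>\<^sup>+x. \<integral>\<^sup>+z. ennreal (rate (upd A (Ybar Y n + sqrt ((V + A) / real n) * x) z) * g A) \<partial>normals n \<partial>std_normal_distribution \<partial>Rm)"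
    by (subst nn_integral_posterior_fw) (measurable, simp add: fw_def)
  also have "\<dots> = (\<integral>\<^sup>+A. ennreal ((b0 + (real n - 1) / 2 * drift_map A) * g A) \<partial>Rm)"
    by (intro nn_integral_cong) (simp add: e space_Rm)
  also have "\<dots> = (\<integral>\<^sup>+y. ennreal ((b0 + (real n - 1) / 2 * drift_map (fst y)) * g (fst y)) \<partial>\<pi>)"
    by (subst nn_integral_posterior_fw) (measurable, simp add: fw_def N.emeasure_space_1)
  finally show ?thesis .
qed

lemma posterior_space_pos: "y \<in> space \<pi> \<Longrightarrow> fst y > 0"
  by (simp add: space_posterior space_Xsp_pos)

text \<open>Let \<open>g\<close> be the drift map and \<open>N = (n - 1) / 2\<close>. In the
  identities for \<open>rate / A\<close> and \<open>rate / A^2\<close> the rate is replaced by its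
  mean \<open>b0 + N g(A)\<close> given \<open>A\<close>; combining them with weights -1 and
  \<open>d\<close> shows that \<open>N\<close> times the wanted moment is the mean of
  \<open>(d (a + 1) + b0) / A - d b0 / A^2 - a\<close>. This is a concave quadratic in
  \<open>1 / A\<close>, bounded in terms of \<open>d\<close>, \<open>a\<close> and
  \<open>b0\<close>. The weight \<open>(V + A)^-2\<close> avoids positive moments of
  \<open>A\<close>.\<close>

lemma posterior_A_moments:
  defines "d \<equiv> Delta Y n / (real n - 1) - V"
  assumes d: "d > 0"
  shows "integrable \<pi> (\<lambda>y. ((fst y - d) / (V + fst y))\<^sup>2)"
    and "(\<integral>y. ((fst y - d) / (V + fst y))\<^sup>2 \<partial>\<pi>) \<le> (d * (a + 1) + b0)\<^sup>2 / (d * b0) / real n"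
proof -
  interpret P: prob_space \<pi> by (rule prob_space_posterior)
  interpret H: prob_space Hm by (rule prob_space_Hm)
  define N where "N = (real n - 1) / 2"
  have N: "N > 0" using n2 by (simp add: N_def)
  have b: "1 / rate \<theta> \<le> 1 / b0" "rate \<theta> > 0" for \<theta> using rate_ge[of \<theta>] rate_pos[of \<theta>] b0 by (auto intro!: divide_left_mono)
  have mf[measurable]: "fst \<in> borel_measurable \<pi>" by (simp cong: measurable_cong_sets add: sets_posterior)
  have mt[measurable]: "(\<lambda>y. rate (snd (snd y))) \<in> borel_measurable \<pi>"
    by (simp cong: measurable_cong_sets add: sets_posterior)
  have dm[measurable]: "(\<lambda>y. drift_map (fst y)) \<in> borel_measurable \<pi>"
    by (rule measurable_compose[OF mf drift_map_measurable])
  have bound: "(\<integral>\<^sup>+\<theta>. ennreal (c * (1 / rate \<theta>) ^ k) \<partial>Hm) < \<infinity>" if "c \<ge> 0" for c and k :: nat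
  proof -
    have "(\<integral>\<^sup>+\<theta>. ennreal (c * (1 / rate \<theta>) ^ k) \<partial>Hm) \<le> (\<integral>\<^sup>+\<theta>. ennreal (c * (1 / b0) ^ k) \<partial>Hm)"
      using that b by (intro nn_integral_mono ennreal_leI mult_left_mono power_mono) (auto simp: less_imp_le)
    then show ?thesis by (simp add: H.emeasure_space_1 le_less_trans)
  qed
  have I1: "integrable \<pi> (\<lambda>y. 1 / fst y)"
  proof (rule integrableI_nonneg)
    show "(\<integral>\<^sup>+y. ennreal (1 / fst y) \<partial>\<pi>) < \<infinity>"
      unfolding nn_integral_inverse(1) using bound[of shp 1] shp_pos by simp
  qed (auto intro!: AE_I2 dest: posterior_space_pos simp: less_imp_le)
  have I2: "integrable \<pi> (\<lambda>y. 1 / (fst y)\<^sup>2)"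
  proof (rule integrableI_nonneg)
    show "(\<integral>\<^sup>+y. ennreal (1 / (fst y)\<^sup>2) \<partial>\<pi>) < \<infinity>"
      unfolding nn_integral_inverse(2) using bound[of "shp * (shp + 1)" 2] shp_pos by (simp add: power_divide)
  qed (auto intro!: AE_I2)
  \<comment> \<open>\<open>nn_integral_rate_forward\<close> asks for a weight that is nonnegative on
    the whole line, hence the absolute value; the posterior lives on \<open>A > 0\<close>.\<close>
  let ?G1 = "\<lambda>y. (b0 + N * drift_map (fst y)) * (1 / \<bar>fst y\<bar>)" and ?G2 = "\<lambda>y. (b0 + N * drift_map (fst y)) * (1 / (fst y)\<^sup>2)"
  have Gm: "?G1 \<in> borel_measurable \<pi>" "?G2 \<in> borel_measurable \<pi>"
    by (intro borel_measurable_times borel_measurable_add borel_measurable_divide borel_measurable_const borel_measurable_abs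
        borel_measurable_power dm mf)+
  have G0: "b0 + N * drift_map (fst y) \<ge> 0" if "y \<in> space \<pi>" for y
    using drift_map_nonneg[OF posterior_space_pos[OF that]] N b0 by simp
  have abs1: "(\<integral>\<^sup>+y. ennreal (rate (snd (snd y)) * (1 / \<bar>fst y\<bar>)) \<partial>\<pi>) = (\<integral>\<^sup>+y. ennreal (rate (snd (snd y)) * (1 / fst y)) \<partial>\<pi>)"
    by (intro nn_integral_cong) (simp add: abs_of_pos[OF posterior_space_pos])
  have n1: "(\<integral>\<^sup>+y. ennreal (?G1 y) \<partial>\<pi>) = ennreal shp"
    using nn_integral_rate_forward[of "\<lambda>A. 1 / \<bar>A\<bar>"] nn_integral_inverse(3) abs1 by (simp add: N_def)
  have n2': "(\<integral>\<^sup>+y. ennreal (?G2 y) \<partial>\<pi>) = (\<integral>\<^sup>+y. ennreal ((shp + 1) * (1 / fst y)) \<partial>\<pi>)"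
  proof -
    have "(\<integral>\<^sup>+y. ennreal (?G2 y) \<partial>\<pi>) = (\<integral>\<^sup>+\<theta>. ennreal (shp * (shp + 1) / rate \<theta>) \<partial>Hm)"
      using nn_integral_rate_forward[of "\<lambda>A. 1 / A\<^sup>2"] nn_integral_inverse(4) by (simp add: N_def)
    also have "\<dots> = (\<integral>\<^sup>+\<theta>. ennreal (shp + 1) * ennreal (shp / rate \<theta>) \<partial>Hm)"
    proof (intro nn_integral_cong)
      fix \<theta>
      have "ennreal (shp + 1) * ennreal (shp / rate \<theta>) = ennreal ((shp + 1) * (shp / rate \<theta>))"
        using shp_pos by (intro ennreal_mult'[symmetric]) simp
      then show "ennreal (shp * (shp + 1) / rate \<theta>) = ennreal (shp + 1) * ennreal (shp / rate \<theta>)"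
        by (simp only: times_divide_eq_right mult.commute)
    qed
    also have "\<dots> = ennreal (shp + 1) * (\<integral>\<^sup>+\<theta>. ennreal (shp / rate \<theta>) \<partial>Hm)"
    proof (rule nn_integral_cmult)
      have [measurable]: "rate \<in> borel_measurable Hm" by (simp cong: measurable_cong_sets add: sets_Hm)
      show "(\<lambda>\<theta>. ennreal (shp / rate \<theta>)) \<in> borel_measurable Hm" by measurable
    qed
    also have "\<dots> = (\<integral>\<^sup>+y. ennreal (shp + 1) * ennreal (1 / fst y) \<partial>\<pi>)"
      unfolding nn_integral_inverse(1)[symmetric] by (rule nn_integral_cmult[symmetric]) measurable
    also have "\<dots> = (\<integral>\<^sup>+y. ennreal ((shp + 1) * (1 / fst y)) \<partial>\<pi>)"
      using shp_pos by (simp only: ennreal_mult'[of "shp + 1"] add_nonneg_nonneg less_imp_le zero_le_one)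
    finally show ?thesis .
  qed
  have J1: "integrable \<pi> ?G1" "(\<integral>y. ?G1 y \<partial>\<pi>) = shp"
  proof -
    show "integrable \<pi> ?G1"
    proof (rule integrableI_nonneg[OF Gm(1)])
      show "(\<integral>\<^sup>+y. ennreal (?G1 y) \<partial>\<pi>) < \<infinity>" unfolding n1 by simp
    qed (auto intro!: AE_I2 divide_nonneg_nonneg G0)
    show "(\<integral>y. ?G1 y \<partial>\<pi>) = shp"
    proof (subst integral_eq_nn_integral[OF Gm(1)])
      show "enn2real (\<integral>\<^sup>+y. ennreal (?G1 y) \<partial>\<pi>) = shp" unfolding n1 using shp_pos by simp
    qed (auto intro!: AE_I2 divide_nonneg_nonneg G0)
  qed
  have J2: "integrable \<pi> ?G2" "(\<integral>y. ?G2 y \<partial>\<pi>) = (shp + 1) * (\<integral>y. 1 / fst y \<partial>\<pi>)"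
  proof -
    have "integrable \<pi> (\<lambda>y. (shp + 1) * (1 / fst y))" by (rule integrable_mult_right[OF I1])
    then have "(\<integral>\<^sup>+y. ennreal ((shp + 1) * (1 / fst y)) \<partial>\<pi>) < \<infinity>"
      using shp_pos by (subst nn_integral_eq_integral) (auto intro!: AE_I2 mult_nonneg_nonneg dest: posterior_space_pos simp: less_imp_le)
    then have "(\<integral>\<^sup>+y. ennreal (?G2 y) \<partial>\<pi>) < \<infinity>" unfolding n2' .
    then show "integrable \<pi> ?G2"
      by (rule integrableI_nonneg[OF Gm(2), rotated]) (auto intro!: AE_I2 divide_nonneg_nonneg G0)
    have "(\<integral>y. ?G2 y \<partial>\<pi>) = (\<integral>y. (shp + 1) * (1 / fst y) \<partial>\<pi>)"
      by (rule integral_eq_if_nn_integral_eq[OF n2' Gm(2)])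
        (use shp_pos in \<open>auto intro!: divide_nonneg_nonneg G0 dest: posterior_space_pos simp: less_imp_le\<close>)
    then show "(\<integral>y. ?G2 y \<partial>\<pi>) = (shp + 1) * (\<integral>y. 1 / fst y \<partial>\<pi>)"
      by (simp only: integral_mult_right_zero)
  qed
  let ?w = "\<lambda>y :: state. ((fst y - d) / (V + fst y))\<^sup>2"
  let ?X = "\<lambda>y. d * (?G2 y - b0 * (1 / (fst y)\<^sup>2) - N * (1 / fst y)) - (?G1 y - b0 * (1 / fst y) - N)"
  \<comment> \<open>The fixed point property in the form \<open>g(A) - A = A^2 q\<close> with
    \<open>q = (d - A) / (V + A)^2\<close>; then \<open>d q - A q\<close> is the square in
    question.\<close>
  have pt: "N * ?w y = ?X y" if "y \<in> space \<pi>" for y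
  proof -
    define A where "A = fst y"
    have A: "A > 0" using posterior_space_pos[OF that] by (simp add: A_def)
    have B: "V + A > 0" using A V by simp
    define q where "q = (d - A) / (V + A)\<^sup>2"
    have g: "drift_map A = A + A\<^sup>2 * q"
    proof -
      have "drift_map A = d + (1 - (frac A)\<^sup>2) * (A - d)" using drift_map_diff[OF A] by (simp add: d_def)
      also have "\<dots> = A + (frac A)\<^sup>2 * (d - A)" by (simp add: algebra_simps)
      finally show ?thesis by (simp add: q_def frac_def power_divide)
    qed
    have 1: "(b0 + N * drift_map A) * (1 / A\<^sup>2) = b0 * (1 / A\<^sup>2) + N * (1 / A) + N * q"
      unfolding g using A by (simp add: field_simps power2_eq_square)
    have 2: "(b0 + N * drift_map A) * (1 / \<bar>A\<bar>) = b0 * (1 / A) + N + N * (A * q)"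
      unfolding g using A by (simp add: field_simps power2_eq_square)
    have 3: "((A - d) / (V + A))\<^sup>2 = (d - A) * q" by (simp add: q_def power_divide power2_eq_square algebra_simps)
    show ?thesis unfolding A_def[symmetric] 1 2 3 by (simp add: algebra_simps)
  qed
  have lin: "integrable \<pi> (\<lambda>y. d * (g2 y - b0 * f2 y - N * f1 y) - (g1 y - b0 * f1 y - N))"
    "(\<integral>y. d * (g2 y - b0 * f2 y - N * f1 y) - (g1 y - b0 * f1 y - N) \<partial>\<pi>)
      = d * ((\<integral>y. g2 y \<partial>\<pi>) - b0 * (\<integral>y. f2 y \<partial>\<pi>) - N * (\<integral>y. f1 y \<partial>\<pi>)) - ((\<integral>y. g1 y \<partial>\<pi>) - b0 * (\<integral>y. f1 y \<partial>\<pi>) - N)"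
    if "integrable \<pi> f1" "integrable \<pi> f2" "integrable \<pi> g1" "integrable \<pi> g2"
    for f1 f2 g1 g2 :: "state \<Rightarrow> real"
    using that P.prob_space by simp_all
  have lin2: "integrable \<pi> (\<lambda>y. k * f1 y - l * f2 y - a)"
    "(\<integral>y. k * f1 y - l * f2 y - a \<partial>\<pi>) = k * (\<integral>y. f1 y \<partial>\<pi>) - l * (\<integral>y. f2 y \<partial>\<pi>) - a"
    if "integrable \<pi> f1" "integrable \<pi> f2" for k l and f1 f2 :: "state \<Rightarrow> real"
    using that P.prob_space by simp_all
  have XI: "integrable \<pi> ?X" by (rule lin(1)[OF I1 I2 J1(1) J2(1)])
  have wI': "integrable \<pi> (\<lambda>y. N * ?w y)" using XI by (subst Bochner_Integration.integrable_cong[OF refl pt]) auto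
  then show "integrable \<pi> ?w" using N by simp
  have "N * (\<integral>y. ?w y \<partial>\<pi>) = (\<integral>y. ?X y \<partial>\<pi>)"
  proof -
    have "(\<integral>y. N * ?w y \<partial>\<pi>) = (\<integral>y. ?X y \<partial>\<pi>)" by (rule Bochner_Integration.integral_cong[OF refl pt])
    then show ?thesis by (simp only: integral_mult_right_zero)
  qed
  also have "\<dots> = d * ((shp + 1) * (\<integral>y. 1 / fst y \<partial>\<pi>) - b0 * (\<integral>y. 1 / (fst y)\<^sup>2 \<partial>\<pi>) - N * (\<integral>y. 1 / fst y \<partial>\<pi>)) - (shp - b0 * (\<integral>y. 1 / fst y \<partial>\<pi>) - N)"
    using lin(2)[OF I1 I2 J1(1) J2(1)] unfolding J1(2) J2(2) .
  also have "\<dots> = (d * (a + 1) + b0) * (\<integral>y. 1 / fst y \<partial>\<pi>) - d * b0 * (\<integral>y. 1 / (fst y)\<^sup>2 \<partial>\<pi>) - a"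
  proof -
    have s: "shp = a + N" by (simp add: shp_def N_def)
    have "d * ((a + N + 1) * x - b0 * z - N * x) - (a + N - b0 * x - N) = (d * (a + 1) + b0) * x - d * b0 * z - a" for x z :: real
      by (simp add: algebra_simps)
    then show ?thesis unfolding s .
  qed
  also have "\<dots> = (\<integral>y. (d * (a + 1) + b0) * (1 / fst y) - d * b0 * (1 / (fst y)\<^sup>2) - a \<partial>\<pi>)"
    by (rule lin2(2)[OF I1 I2, symmetric])
  also have "\<dots> \<le> (\<integral>y. (d * (a + 1) + b0)\<^sup>2 / (4 * (d * b0)) \<partial>\<pi>)"
  proof (rule integral_mono)
    show "integrable \<pi> (\<lambda>y. (d * (a + 1) + b0) * (1 / fst y) - d * b0 * (1 / (fst y)\<^sup>2) - a)"
      by (rule lin2(1)[OF I1 I2])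
    fix y
    have "k * x - e * x\<^sup>2 \<le> k\<^sup>2 / (4 * e)" if "e > 0" for k x e :: real
    proof -
      have "k\<^sup>2 / (4 * e) - (k * x - e * x\<^sup>2) = (2 * e * x - k)\<^sup>2 / (4 * e)"
        using that by (simp add: power2_eq_square field_simps)
      also have "\<dots> \<ge> 0" using that by simp
      finally show ?thesis by simp
    qed
    note k = this[OF mult_pos_pos[OF d b0], of "d * (a + 1) + b0" "1 / fst y", unfolded power_divide power_one]
    have "z - a \<le> z" for z using a by simp
    from order_trans[OF this k]
    show "(d * (a + 1) + b0) * (1 / fst y) - d * b0 * (1 / (fst y)\<^sup>2) - a \<le> (d * (a + 1) + b0)\<^sup>2 / (4 * (d * b0))" .
  qed simp
  also have "\<dots> = (d * (a + 1) + b0)\<^sup>2 / (d * b0) / 4" by (simp add: P.prob_space)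
  finally have "N * (\<integral>y. ?w y \<partial>\<pi>) \<le> (d * (a + 1) + b0)\<^sup>2 / (d * b0) / 4" .
  then have "(\<integral>y. ?w y \<partial>\<pi>) \<le> (d * (a + 1) + b0)\<^sup>2 / (d * b0) / 4 / N"
    by (subst pos_le_divide_eq[OF N]) (simp only: mult.commute)
  also have "\<dots> \<le> (d * (a + 1) + b0)\<^sup>2 / (d * b0) / real n"
  proof -
    have "real n \<le> 4 * N" using n2 by (simp add: N_def)
    then have "x / (4 * N) \<le> x / real n" if "x \<ge> 0" for x using that n2 N by (intro divide_left_mono) auto
    from this[of "(d * (a + 1) + b0)\<^sup>2 / (d * b0)"] show ?thesis using d b0 by simp
  qed
  finally show "(\<integral>y. ?w y \<partial>\<pi>) \<le> (d * (a + 1) + b0)\<^sup>2 / (d * b0) / real n" .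
qed

text \<open>Given \<open>A\<close>, the mean of \<open>\<theta>\<close> minus
  \<open>Ybar Y n\<close> is a sum of two independent centred normals with variances
  \<open>(1 - u) V / n\<close> and \<open>u V / n\<close>, where \<open>u = frac A\<close>. The
  total is free of \<open>A\<close>, so nothing about the law of \<open>A\<close> is
  required.\<close>

lemma posterior_tbar_moment:
  shows "integrable \<pi> (\<lambda>y. (tbar n (snd (snd y)) - Ybar Y n)\<^sup>2)"
    and "(\<integral>y. (tbar n (snd (snd y)) - Ybar Y n)\<^sup>2 \<partial>\<pi>) = V / real n"
proof -
  interpret P: prob_space \<pi> by (rule prob_space_posterior)
  interpret N: prob_space "normals n" by (rule prob_space_normals)
  interpret S: prob_space std_normal_distribution by (rule prob_space_std_normal)
  have mt[measurable]: "(\<lambda>y. tbar n (snd (snd y))) \<in> borel_measurable (Xsp n)" by measurable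
  have m: "(\<lambda>y. (tbar n (snd (snd y)) - Ybar Y n)\<^sup>2) \<in> borel_measurable \<pi>"
    by (simp cong: measurable_cong_sets add: sets_posterior)
  have i2: "integrable std_normal_distribution (\<lambda>x. x\<^sup>2)" and e2: "(\<integral>x. x\<^sup>2 \<partial>std_normal_distribution) = 1"
    using integrable_std_normal_distribution_moment[of 2] std_normal_distribution_even_moments(1)[of 1] by auto
  have key: "(\<integral>\<^sup>+x. \<integral>\<^sup>+z. ennreal ((tbar n (snd (snd (fw A x z))) - Ybar Y n)\<^sup>2) \<partial>normals n \<partial>std_normal_distribution) = ennreal (V / real n)"
    if A: "A > 0" for A
  proof -
    let ?u = "frac A"
    define p where "p = (1 - ?u) * sqrt ((V + A) / real n)"
    define s where "s = sqrt (V * ?u)"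
    have t: "tbar n (snd (snd (fw A x z))) - Ybar Y n = p * x + s * tbar n z" for x z
      by (simp add: fw_def tbar_upd A p_def s_def algebra_simps)
    have z: "(\<integral>\<^sup>+z. ennreal ((p * x + s * tbar n z)\<^sup>2) \<partial>normals n) = ennreal (p\<^sup>2 * x\<^sup>2 + s\<^sup>2 / real n)" for x
    proof -
      have e: "(p * x + s * tbar n z)\<^sup>2 = p\<^sup>2 * x\<^sup>2 + 2 * p * x * s * tbar n z + s\<^sup>2 * (tbar n z)\<^sup>2" for z
        by (simp add: power2_sum power_mult_distrib)
      have I: "integrable (normals n) (\<lambda>z. (p * x + s * tbar n z)\<^sup>2)" unfolding e using tbar_moments(1,4) by simp
      have "(\<integral>z. (p * x + s * tbar n z)\<^sup>2 \<partial>normals n) = p\<^sup>2 * x\<^sup>2 + 2 * p * x * s * (\<integral>z. tbar n z \<partial>normals n) + s\<^sup>2 * (\<integral>z. (tbar n z)\<^sup>2 \<partial>normals n)"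
        unfolding e using tbar_moments(1,4) by (simp add: N.prob_space)
      then show ?thesis using nn_integral_eq_integral[OF I] tbar_moments(2,5) by simp
    qed
    have J: "integrable std_normal_distribution (\<lambda>x. p\<^sup>2 * x\<^sup>2 + s\<^sup>2 / real n)" using i2 by simp
    have "(\<integral>x. p\<^sup>2 * x\<^sup>2 + s\<^sup>2 / real n \<partial>std_normal_distribution) = p\<^sup>2 * (\<integral>x. x\<^sup>2 \<partial>std_normal_distribution) + s\<^sup>2 / real n"
      using i2 S.prob_space by simp
    also have "\<dots> = V / real n"
    proof -
      have B: "V + A > 0" using A V by simp
      have "(sqrt ((V + A) / real n))\<^sup>2 = (V + A) / real n" using B by simp
      then have "p\<^sup>2 = (V / (V + A))\<^sup>2 * ((V + A) / real n)" unfolding p_def one_minus_frac[OF A] by (simp only: power_mult_distrib)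
      also have "\<dots> = V / real n * (V / (V + A))" using B by (simp add: power2_eq_square)
      finally have "p\<^sup>2 = V / real n * (1 - ?u)" unfolding one_minus_frac[OF A] .
      moreover have "s\<^sup>2 = V * ?u" using frac_bounds[OF A] V by (simp add: s_def)
      ultimately show ?thesis unfolding e2 by (simp add: algebra_simps diff_divide_distrib)
    qed
    finally have "(\<integral>\<^sup>+x. ennreal (p\<^sup>2 * x\<^sup>2 + s\<^sup>2 / real n) \<partial>std_normal_distribution) = ennreal (V / real n)"
      using nn_integral_eq_integral[OF J] by simp
    then show ?thesis unfolding t z .
  qed
  have "(\<integral>\<^sup>+y. ennreal ((tbar n (snd (snd y)) - Ybar Y n)\<^sup>2) \<partial>\<pi>) = (\<integral>\<^sup>+A. ennreal (V / real n) \<partial>Rm)"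
    by (subst nn_integral_posterior_fw) (measurable, intro nn_integral_cong key, simp add: space_Rm)
  also have "\<dots> = ennreal (V / real n) * emeasure Rm (space Rm)" by simp
  also have "emeasure Rm (space Rm) = (\<integral>\<^sup>+y. 1 \<partial>\<pi>)"
    by (subst nn_integral_posterior_fw) (auto simp: N.emeasure_space_1)
  also have "\<dots> = 1" by (simp add: P.emeasure_space_1)
  finally have n: "(\<integral>\<^sup>+y. ennreal ((tbar n (snd (snd y)) - Ybar Y n)\<^sup>2) \<partial>\<pi>) = ennreal (V / real n)" by simp
  show "integrable \<pi> (\<lambda>y. (tbar n (snd (snd y)) - Ybar Y n)\<^sup>2)"
    using m n by (intro integrableI_nonneg) auto
  show "(\<integral>y. (tbar n (snd (snd y)) - Ybar Y n)\<^sup>2 \<partial>\<pi>) = V / real n"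
    using m n V by (subst integral_eq_nn_integral) auto
qed

end

subsection \<open>Distance of the iterates from the posterior\<close>

context gibbs_bd
begin

text \<open>A bound on \<open>n\<close> times the moment in \<open>posterior_A_moments\<close>,
  uniform for \<open>dd\<close> between \<open>\<delta>\<close> and \<open>Mb\<close>. From it
  \<open>K1\<close> bounds the mean squared distance of good posterior points from the centre on the
  scale \<open>sqrt n\<close>, and \<open>K2\<close> bounds \<open>n\<close> times the probability
  of a bad point.\<close>

definition KP :: real where "KP = (Mb * (a + 1) + b0)\<^sup>2 / (\<delta> * b0)"

definition K1 :: real where "K1 = (V + 2 * Mb)\<^sup>2 * KP + V"

definition K2 :: real where "K2 = ((V + 2 * Mb) / \<epsilon>)\<^sup>2 * KP + V / \<epsilon>\<^sup>2"

lemma K_nonneg: "KP \<ge> 0" "K1 \<ge> 0" "K2 \<ge> 0"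
  using b0 \<delta> V by (auto simp: KP_def K1_def K2_def)

lemma esc_nonneg: "esc \<ge> 0"
  unfolding esc_def KA_def using \<delta> \<epsilon> u0_bounds Mb_pos V b0 a
  by (auto intro!: mult_nonneg_nonneg divide_nonneg_nonneg add_nonneg_nonneg)

lemma posterior_moments:
  shows "integrable \<pi> (\<lambda>y. ((fst y - dd) / (V + fst y))\<^sup>2)" "(\<integral>y. ((fst y - dd) / (V + fst y))\<^sup>2 \<partial>\<pi>) \<le> KP / real n"
proof -
  have d: "dd > 0" using dd_ge \<delta> by simp
  show "integrable \<pi> (\<lambda>y. ((fst y - dd) / (V + fst y))\<^sup>2)"
    using posterior_A_moments(1) d by (simp add: dd_def)
  have "(\<integral>y. ((fst y - dd) / (V + fst y))\<^sup>2 \<partial>\<pi>) \<le> (dd * (a + 1) + b0)\<^sup>2 / (dd * b0) / real n"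
    using posterior_A_moments(2) d by (simp add: dd_def)
  also have "\<dots> \<le> KP / real n"
    unfolding KP_def using dd_ge dd_le d \<delta> b0 a V
    by (intro divide_right_mono frac_le power_mono add_right_mono mult_right_mono) auto
  finally show "(\<integral>y. ((fst y - dd) / (V + fst y))\<^sup>2 \<partial>\<pi>) \<le> KP / real n" .
qed

text \<open>The weight \<open>1 / (V + A)\<close> degenerates for large \<open>A\<close>, so the cut
  is made at \<open>2 * dd\<close>. Below it the denominator is at most \<open>V + 2 * Mb\<close>;
  above it the ratio, increasing in \<open>A\<close>, is at least its value
  \<open>dd / (V + 2 * dd)\<close> at the cut.\<close>

lemma large_deviation:
  assumes A: "A > 0" and e: "\<bar>A - dd\<bar> > \<epsilon>"
  shows "1 \<le> ((A - dd) / (V + A))\<^sup>2 * ((V + 2 * Mb) / \<epsilon>)\<^sup>2"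
proof -
  have d: "dd \<ge> \<epsilon>" "dd > 0" "dd \<le> Mb" using dd_ge dd_le \<epsilon> \<delta> V by auto
  have "\<epsilon> / (V + 2 * Mb) \<le> \<bar>A - dd\<bar> / (V + A)"
  proof (cases "A \<le> 2 * dd")
    case True
    then show ?thesis using e d A V \<epsilon> by (intro frac_le) auto
  next
    case False
    have "\<epsilon> / (V + 2 * Mb) \<le> dd / (V + 2 * dd)" using d V \<epsilon> by (intro frac_le) auto
    also have "\<dots> \<le> (A - dd) / (V + A)"
    proof -
      have "0 \<le> (A - 2 * dd) * (V + dd)" using False d V by (intro mult_nonneg_nonneg) auto
      then have "dd * (V + A) \<le> (A - dd) * (V + 2 * dd)" by (simp add: algebra_simps)
      then show ?thesis using d V A by (simp add: divide_simps)
    qed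
    also have "\<dots> = \<bar>A - dd\<bar> / (V + A)" using False d by simp
    finally show ?thesis .
  qed
  then have "\<epsilon> / (V + 2 * Mb) * ((V + 2 * Mb) / \<epsilon>) \<le> \<bar>A - dd\<bar> / (V + A) * ((V + 2 * Mb) / \<epsilon>)"
    using \<epsilon> V Mb_pos by (intro mult_right_mono) auto
  moreover have "\<epsilon> / (V + 2 * Mb) * ((V + 2 * Mb) / \<epsilon>) = 1"
    using \<epsilon> V Mb_pos by simp
  ultimately have "1 \<le> \<bar>A - dd\<bar> / (V + A) * ((V + 2 * Mb) / \<epsilon>)" by linarith
  then have "1\<^sup>2 \<le> (\<bar>A - dd\<bar> / (V + A) * ((V + 2 * Mb) / \<epsilon>))\<^sup>2" by (intro power_mono) auto
  then show ?thesis by (simp add: power_mult_distrib power_divide)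
qed

lemma sqrt_abs_le: "sqrt (real n) * \<bar>x\<bar> \<le> 1 + real n * x\<^sup>2"
proof -
  have "0 \<le> (sqrt (real n) * \<bar>x\<bar> - 1 / 2)\<^sup>2" by simp
  also have "\<dots> = real n * x\<^sup>2 - sqrt (real n) * \<bar>x\<bar> + 1 / 4"
    by (simp add: power2_diff power_mult_distrib power2_eq_square[of "1 / 2"])
  finally show ?thesis by simp
qed

text \<open>The coupling bound is averaged over a second starting point \<open>y\<close> drawn from
  the posterior. For good \<open>y\<close> the triangle inequality through
  \<open>(dd, Ybar Y n)\<close> splits \<open>rho\<close>; bad \<open>y\<close> cost at most 1,
  dominated by the same two moments. Passing from the posterior integral of the iterate to that of
  \<open>h\<close> costs one invariance defect.\<close>

lemma iterate_posterior_bound: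
  assumes h: "test h" and \<gamma>: "rateA + (\<epsilon> / V + KT / sqrt (real n)) \<le> \<gamma>" "1 - u0 \<le> \<gamma>"
    and g1: "good1 (fst x)"
  shows "\<bar>(Pop ^^ Suc k) h x - (\<integral>y. h y \<partial>\<pi>)\<bar> \<le>
    \<gamma> ^ Suc k * (2 * (KL / \<gamma>)\<^sup>2 + KL / \<gamma> * (2 + K1) + drift V Y n x) + real (Suc k) / sqrt (real n) * (esc + K2 + 4 * sqrt 8)"
proof -
  interpret P: prob_space \<pi> by (rule prob_space_posterior)
  define q where "q = (Pop ^^ Suc k) h"
  have q: "test q" unfolding q_def by (rule test_Pop_iter[OF h])
  have \<gamma>0: "\<gamma> > 0" using \<gamma>(2) u0_bounds by linarith
  define r where "r = sqrt (real n)"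
  have r: "r > 0" "r \<ge> 1" "real n = r * r" using n10 by (auto simp: r_def)
  define c where "c = KL * \<gamma> ^ k"
  have c: "c \<ge> 0" using KL_pos \<gamma>0 by (simp add: c_def)
  define \<eta> where "\<eta> = real k * (esc / r)"
  have \<eta>: "\<eta> \<ge> 0" using esc_nonneg r by (simp add: \<eta>_def)
  define x1 where "x1 = \<bar>fst x - dd\<bar>"
  define x2 where "x2 = \<bar>tb x - Ybar Y n\<bar>"
  let ?w = "\<lambda>y :: state. ((fst y - dd) / (V + fst y))\<^sup>2"
  let ?v = "\<lambda>y. (tb y - Ybar Y n)\<^sup>2"
  let ?M = "V + 2 * Mb"
  let ?B = "\<lambda>y. c * (r * x1 + r * x2 + 2 + real n * (?M\<^sup>2 * ?w y) + real n * ?v y) + \<eta> + (?w y * (?M / \<epsilon>)\<^sup>2 + ?v y / \<epsilon>\<^sup>2)"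
  have B: "\<bar>q x - q y\<bar> \<le> ?B y" if "y \<in> space \<pi>" for y
  proof -
    have A: "fst y > 0" by (rule posterior_space_pos[OF that])
    have w0: "?w y \<ge> 0" "?v y \<ge> 0" by auto
    have c0: "0 \<le> c * (r * x1 + r * x2 + 2 + real n * (?M\<^sup>2 * ?w y) + real n * ?v y)"
      using c r w0 by (intro mult_nonneg_nonneg add_nonneg_nonneg) (auto simp: x1_def x2_def)
    have t0: "0 \<le> ?w y * (?M / \<epsilon>)\<^sup>2" "0 \<le> ?v y / \<epsilon>\<^sup>2" by auto
    show ?thesis
    proof (cases "good2 (fst y) (tb y)")
      case True
      then have e: "\<bar>fst y - dd\<bar> \<le> \<epsilon>" by (simp add: good2_def)
      have B: "V + fst y \<le> ?M" using e dd_ge dd_le \<epsilon> \<delta> V by linarith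
      have "(fst y - dd)\<^sup>2 = (V + fst y)\<^sup>2 * ?w y" using A V by (simp add: power_divide)
      also have "\<dots> \<le> ?M\<^sup>2 * ?w y" using B A V by (intro mult_right_mono power_mono) auto
      finally have s: "real n * (fst y - dd)\<^sup>2 \<le> real n * (?M\<^sup>2 * ?w y)" by (intro mult_left_mono) auto
      have "rho x y \<le> (r * x1 + r * \<bar>fst y - dd\<bar>) + (r * x2 + r * \<bar>tb y - Ybar Y n\<bar>)"
        unfolding rho_def r_def[symmetric] x1_def x2_def distrib_left[symmetric] using r
        by (intro add_mono mult_left_mono) auto
      also have "\<dots> \<le> r * x1 + r * x2 + 2 + real n * (?M\<^sup>2 * ?w y) + real n * ?v y"
        using s sqrt_abs_le[of "fst y - dd"] sqrt_abs_le[of "tb y - Ybar Y n"] unfolding r_def[symmetric] by linarith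
      finally have "c * rho x y \<le> c * (r * x1 + r * x2 + 2 + real n * (?M\<^sup>2 * ?w y) + real n * ?v y)"
        using c by (rule mult_left_mono)
      moreover have "\<bar>q x - q y\<bar> \<le> c * rho x y + \<eta>"
        unfolding q_def c_def \<eta>_def r_def by (rule Pop_iterate_lipschitz[OF h \<gamma> g1 True])
      ultimately show ?thesis using t0 by linarith
    next
      case False
      have "1 \<le> ?w y * (?M / \<epsilon>)\<^sup>2 + ?v y / \<epsilon>\<^sup>2"
      proof (cases "\<bar>fst y - dd\<bar> > \<epsilon>")
        case True
        then show ?thesis using large_deviation[OF A True] t0 by linarith
      next
        case False
        then have "\<epsilon> < \<bar>tb y - Ybar Y n\<bar>" using \<open>\<not> good2 (fst y) (tb y)\<close> by (simp add: good2_def)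
        then have "\<epsilon>\<^sup>2 \<le> \<bar>tb y - Ybar Y n\<bar>\<^sup>2" using \<epsilon> by (intro power_mono) auto
        then have "1 \<le> ?v y / \<epsilon>\<^sup>2" using \<epsilon> by simp
        then show ?thesis using t0 by linarith
      qed
      moreover have "\<bar>q x - q y\<bar> \<le> 1" using testD(2,3)[OF q, of x] testD(2,3)[OF q, of y] by linarith
      ultimately show ?thesis using c0 \<eta> by linarith
    qed
  qed
  have wI: "integrable \<pi> ?w" "(\<integral>y. ?w y \<partial>\<pi>) \<le> KP / real n" by (rule posterior_moments)+
  have vI: "integrable \<pi> ?v" "(\<integral>y. ?v y \<partial>\<pi>) = V / real n" by (rule posterior_tbar_moment)+
  have lin: "integrable \<pi> (\<lambda>y. c * (l + real n * (k1 * w y) + real n * v y) + \<eta> + (w y * k2 + v y / k3))"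
    "(\<integral>y. c * (l + real n * (k1 * w y) + real n * v y) + \<eta> + (w y * k2 + v y / k3) \<partial>\<pi>) =
      c * (l + real n * (k1 * (\<integral>y. w y \<partial>\<pi>)) + real n * (\<integral>y. v y \<partial>\<pi>)) + \<eta> + ((\<integral>y. w y \<partial>\<pi>) * k2 + (\<integral>y. v y \<partial>\<pi>) / k3)"
    if "integrable \<pi> w" "integrable \<pi> v" for w v :: "state \<Rightarrow> real" and l k1 k2 k3
    using that P.prob_space by simp_all
  have qI: "integrable \<pi> (\<lambda>y. q x - q y)" using integrable_posterior_test[OF q] by simp
  have "\<bar>q x - (\<integral>y. q y \<partial>\<pi>)\<bar> = \<bar>\<integral>y. q x - q y \<partial>\<pi>\<bar>"
    using integrable_posterior_test[OF q] by (simp add: P.prob_space)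
  also have "\<dots> \<le> (\<integral>y. \<bar>q x - q y\<bar> \<partial>\<pi>)" by (rule integral_abs_bound)
  also have "\<dots> \<le> (\<integral>y. ?B y \<partial>\<pi>)"
    by (intro integral_mono integrable_abs qI B lin(1) wI(1) vI(1))
  also have "\<dots> = c * (r * x1 + r * x2 + 2 + real n * (?M\<^sup>2 * (\<integral>y. ?w y \<partial>\<pi>)) + real n * (V / real n)) + \<eta> + ((\<integral>y. ?w y \<partial>\<pi>) * (?M / \<epsilon>)\<^sup>2 + V / real n / \<epsilon>\<^sup>2)"
    unfolding lin(2)[OF wI(1) vI(1)] vI(2) ..
  also have "\<dots> \<le> c * (r * x1 + r * x2 + 2 + real n * (?M\<^sup>2 * (KP / real n)) + real n * (V / real n)) + \<eta> + (KP / real n * (?M / \<epsilon>)\<^sup>2 + V / real n / \<epsilon>\<^sup>2)"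
  proof -
    have 1: "real n * (?M\<^sup>2 * (\<integral>y. ?w y \<partial>\<pi>)) \<le> real n * (?M\<^sup>2 * (KP / real n))" by (intro mult_left_mono wI(2)) auto
    have 2: "(\<integral>y. ?w y \<partial>\<pi>) * (?M / \<epsilon>)\<^sup>2 \<le> KP / real n * (?M / \<epsilon>)\<^sup>2" by (intro mult_right_mono wI(2)) auto
    show ?thesis by (intro add_mono mult_left_mono[OF _ c] order_refl 1 2)
  qed
  also have "\<dots> = c * (r * x1 + r * x2 + (2 + K1)) + \<eta> + K2 / real n"
  proof -
    have "real n * (?M\<^sup>2 * (KP / real n)) = ?M\<^sup>2 * KP" "real n * (V / real n) = V" using n10 by auto
    moreover have "KP / real n * (?M / \<epsilon>)\<^sup>2 + V / real n / \<epsilon>\<^sup>2 = K2 / real n"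
    proof -
      have "p / N * m + v / N / e = (m * p + v / e) / N" for p N m v e :: real
        by (simp add: add_divide_distrib mult.commute)
      then show ?thesis unfolding K2_def .
    qed
    ultimately show ?thesis by (simp add: K1_def)
  qed
  finally have 1: "\<bar>q x - (\<integral>y. q y \<partial>\<pi>)\<bar> \<le> c * (r * x1 + r * x2 + (2 + K1)) + \<eta> + K2 / real n" .
  have 2: "\<bar>(\<integral>y. q y \<partial>\<pi>) - (\<integral>y. h y \<partial>\<pi>)\<bar> \<le> 4 * sqrt 8 / r"
  proof -
    have "\<bar>(\<integral>y. q y \<partial>\<pi>) - (\<integral>y. h y \<partial>\<pi>)\<bar> \<le> 2 * sqrt 8 / sqrt (shp - 2)"
      unfolding q_def posterior_Pop_invariant[OF h] by (rule posterior_step_defect[OF h shp_bounds(1)])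
    also have "\<dots> \<le> 2 * sqrt 8 / (r / 2)"
    proof (rule divide_left_mono)
      have "r / 2 = sqrt (real n / 4)" by (simp add: r_def real_sqrt_divide)
      also have "\<dots> \<le> sqrt (shp - 2)" using shp_bounds(4) by simp
      finally show "r / 2 \<le> sqrt (shp - 2)" .
    qed (use r shp_bounds in auto)
    finally show ?thesis by simp
  qed
  \<comment> \<open>The contraction term is linear in the scaled distances while the drift is
    quadratic; \<open>l * z \<le> l\<^sup>2 + z\<^sup>2\<close> trades one for the other with
    coefficient exactly 1 on the drift. The division by \<open>\<gamma>\<close> in \<open>l\<close>
    pays for the last sweep, which does not contract.\<close>
  have 3: "c * (r * x1 + r * x2 + (2 + K1)) \<le> \<gamma> ^ Suc k * (2 * (KL / \<gamma>)\<^sup>2 + KL / \<gamma> * (2 + K1) + drift V Y n x)"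
  proof -
    define l where "l = KL / \<gamma>"
    have cl: "c = \<gamma> ^ Suc k * l" using \<gamma>0 by (simp add: c_def l_def)
    have am: "l * z \<le> l\<^sup>2 + z\<^sup>2" if "z \<ge> 0" for z
    proof -
      have "0 \<le> (l - z)\<^sup>2 + (l\<^sup>2 + z\<^sup>2)" by simp
      then have "0 \<le> 2 * (l\<^sup>2 + z\<^sup>2 - l * z)" by (simp add: power2_diff)
      then show ?thesis by simp
    qed
    have dr: "drift V Y n x = (r * x1)\<^sup>2 + (r * x2)\<^sup>2"
    proof -
      obtain A m t where "x = (A, m, t)" by (cases x)
      then show ?thesis
        by (simp add: drift_def r_def x1_def x2_def power_mult_distrib dd_def power2_commute)
    qed
    have "l * (r * x1 + r * x2 + (2 + K1)) = l * (r * x1) + l * (r * x2) + l * (2 + K1)" by (simp add: distrib_left)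
    also have "\<dots> \<le> (l\<^sup>2 + (r * x1)\<^sup>2) + (l\<^sup>2 + (r * x2)\<^sup>2) + l * (2 + K1)"
      using r by (intro add_mono am order_refl) (auto simp: x1_def x2_def)
    also have "\<dots> = 2 * l\<^sup>2 + l * (2 + K1) + drift V Y n x" unfolding dr by simp
    finally show ?thesis unfolding cl l_def[symmetric] mult.assoc using \<gamma>0 by (intro mult_left_mono) auto
  qed
  have 4: "\<eta> + K2 / real n + 4 * sqrt 8 / r \<le> real (Suc k) / r * (esc + K2 + 4 * sqrt 8)"
  proof -
    have "K2 / real n \<le> K2 / r"
      using K_nonneg r mult_left_mono[of 1 r r] by (intro divide_left_mono) auto
    moreover have "\<eta> \<le> real (Suc k) * (esc / r)"
      unfolding \<eta>_def using esc_nonneg r by (intro mult_right_mono) auto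
    moreover have "1 * (K2 / r) \<le> real (Suc k) * (K2 / r)" using K_nonneg r by (intro mult_right_mono) auto
    moreover have "1 * (4 * sqrt 8 / r) \<le> real (Suc k) * (4 * sqrt 8 / r)" using r by (intro mult_right_mono) auto
    ultimately have "\<eta> + K2 / real n + 4 * sqrt 8 / r \<le> real (Suc k) * (esc / r) + real (Suc k) * (K2 / r) + real (Suc k) * (4 * sqrt 8 / r)"
      by linarith
    also have "\<dots> = real (Suc k) / r * (esc + K2 + 4 * sqrt 8)" by (simp only: distrib_left times_divide_eq_right times_divide_eq_left)
    finally show ?thesis .
  qed
  have "\<bar>q x - (\<integral>y. h y \<partial>\<pi>)\<bar> \<le> c * (r * x1 + r * x2 + (2 + K1)) + (\<eta> + K2 / real n + 4 * sqrt 8 / r)"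
    using 1 2 by linarith
  also have "\<dots> \<le> \<gamma> ^ Suc k * (2 * (KL / \<gamma>)\<^sup>2 + KL / \<gamma> * (2 + K1) + drift V Y n x) + real (Suc k) / r * (esc + K2 + 4 * sqrt 8)"
    by (intro add_mono 3 4)
  finally show ?thesis unfolding q_def r_def .
qed

lemma tv_dist_bound:
  assumes \<gamma>: "rateA + (\<epsilon> / V + KT / sqrt (real n)) \<le> \<gamma>" "1 - u0 \<le> \<gamma>"
    and x: "x \<in> space (Xsp n)" and g1: "good1 (fst x)"
  shows "tv_dist (gibbs_law V a b0 Y n x (Suc k)) \<pi> \<le>
    \<gamma> ^ Suc k * (2 * (KL / \<gamma>)\<^sup>2 + KL / \<gamma> * (2 + K1) + drift V Y n x) + real (Suc k) / sqrt (real n) * (esc + K2 + 4 * sqrt 8)"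
proof -
  interpret P: prob_space \<pi> by (rule prob_space_posterior)
  have s: "sets (gibbs_law V a b0 Y n x (Suc k)) = sets (Xsp n)" using gibbs_law_facts[OF x, of "Suc k"] by blast
  show ?thesis unfolding tv_dist_def
  proof (rule cSUP_least)
    fix B assume "B \<in> sets (gibbs_law V a b0 Y n x (Suc k))"
    then have B: "B \<in> sets (Xsp n)" using s by blast
    have "measure \<pi> B = (\<integral>y. indicator B y \<partial>\<pi>)"
      using B sets_posterior sets.sets_into_space[OF B] by (simp add: space_posterior Int_absorb1)
    then show "\<bar>measure (gibbs_law V a b0 Y n x (Suc k)) B - measure \<pi> B\<bar> \<le>
      \<gamma> ^ Suc k * (2 * (KL / \<gamma>)\<^sup>2 + KL / \<gamma> * (2 + K1) + drift V Y n x) + real (Suc k) / sqrt (real n) * (esc + K2 + 4 * sqrt 8)"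
      using iterate_posterior_bound[OF test_indicator[OF B] \<gamma> g1, of k] unfolding measure_gibbs_law[OF x B] by simp
  qed auto
qed

end

text \<open>The coefficient that \<open>\<gamma>\<close> has to dominate, arranged so that limits
  can be taken factor by factor; it converges to
  \<open>(1 - U\<^sup>2) * (1 + e) + e\<close>.\<close>

lemma eventually_contraction_factor:
  fixes U e g c1 c2 :: real
  assumes "(1 - U\<^sup>2) * (1 + e) + e < g"
  shows "eventually (\<lambda>n. ((1 - U\<^sup>2) * (1 + e) + c1 * (1 / sqrt (real n - 1))) * ((real n - 1) / (real n - 3)) + (e + c2 * (1 / sqrt (real n))) \<le> g) sequentially"
proof -
  have l: "(\<lambda>n. 1 / sqrt (real n - 1)) \<longlonglongrightarrow> 0" "(\<lambda>n. (real n - 1) / (real n - 3)) \<longlonglongrightarrow> 1" "(\<lambda>n. 1 / sqrt (real n)) \<longlonglongrightarrow> 0"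
  proof -
    have A: "filterlim (\<lambda>n. real n - c) at_top sequentially" for c
      using filterlim_tendsto_add_at_top[OF tendsto_const filterlim_real_sequentially, of "- c"] by simp
    show "(\<lambda>n. 1 / sqrt (real n - 1)) \<longlonglongrightarrow> 0"
      by (rule tendsto_divide_0[OF tendsto_const filterlim_at_top_imp_at_infinity[OF filterlim_compose[OF sqrt_at_top A]]])
    show "(\<lambda>n. 1 / sqrt (real n)) \<longlonglongrightarrow> 0"
      by (rule tendsto_divide_0[OF tendsto_const filterlim_at_top_imp_at_infinity[OF filterlim_compose[OF sqrt_at_top filterlim_real_sequentially]]])
    have "(\<lambda>n. 2 / (real n - 3)) \<longlonglongrightarrow> 0"
      by (rule tendsto_divide_0[OF tendsto_const filterlim_at_top_imp_at_infinity[OF A]])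
    then have "(\<lambda>n. 1 + 2 / (real n - 3)) \<longlonglongrightarrow> 1 + 0" by (intro tendsto_add tendsto_const)
    moreover have "eventually (\<lambda>n. 1 + 2 / (real n - 3) = (real n - 1) / (real n - 3)) sequentially"
      using eventually_gt_at_top[of 3] by eventually_elim (simp add: field_simps)
    ultimately show "(\<lambda>n. (real n - 1) / (real n - 3)) \<longlonglongrightarrow> 1"
      by (simp add: filterlim_cong)
  qed
  have "(\<lambda>n. ((1 - U\<^sup>2) * (1 + e) + c1 * (1 / sqrt (real n - 1))) * ((real n - 1) / (real n - 3)) + (e + c2 * (1 / sqrt (real n))))
     \<longlonglongrightarrow> ((1 - U\<^sup>2) * (1 + e) + c1 * 0) * 1 + (e + c2 * 0)"
    by (intro tendsto_intros l)
  then have "eventually (\<lambda>n. ((1 - U\<^sup>2) * (1 + e) + c1 * (1 / sqrt (real n - 1))) * ((real n - 1) / (real n - 3)) + (e + c2 * (1 / sqrt (real n))) < g) sequentially"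
    by (rule order_tendstoD) (use assms in simp)
  then show ?thesis by eventually_elim simp
qed

theorem mainTheorem7:
  fixes V a b0 \<delta> Mb :: real and N0 :: nat and Y :: "nat \<Rightarrow> nat \<Rightarrow> real"
  assumes V: "V > 0" and a: "a > 0" and b0: "b0 > 0"
    and \<delta>: "\<delta> > 0"
    and A_upper: "\<forall>n\<ge>2. Delta Y n / (real n - 1) \<le> Mb"
    and A_lower: "\<forall>n\<ge>max 2 N0. Delta Y n / (real n - 1) \<ge> V + \<delta>"
  shows "\<exists>(N::nat) C1 C2 C3 C4 \<gamma>::real.
     C1 > 0 \<and> C2 > 0 \<and> C3 > 0 \<and> C4 > 0 \<and> 0 < \<gamma> \<and> \<gamma> < 1 \<and>
     (\<forall>n\<ge>N. \<forall>x0 \<in> Rset V Y \<delta> n. \<forall>k\<ge>(1::nat).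
        tv_dist (gibbs_law V a b0 Y n x0 k) (posterior V a b0 Y n)
          \<le> (C1 + drift V Y n x0) * \<gamma> ^ k
             + C2 * (real k * (1 + real k) / real n)
             + C3 * (real k / sqrt (real n))
             + C4 * drift V Y n x0 * (real k / real n))"
proof -
  \<comment> \<open>\<open>U\<close> is \<open>u0\<close> written without \<open>n\<close>. With
    \<open>e = \<epsilon> / V \<le> U\<^sup>2 / 4\<close> the limiting rate is at most
    \<open>1 - U\<^sup>2 + 2 * e\<close>, hence at most \<open>1 - U\<^sup>2 / 2\<close>;
    \<open>\<gamma>\<close> lies strictly above, which leaves room for the terms vanishing with
    \<open>n\<close>. The cap \<open>\<delta> / 2\<close> on \<open>\<epsilon>\<close> keeps the
    second good set inside the first.\<close>
  define U where "U = \<delta> / 2 / (V + \<delta> / 2)"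
  define \<epsilon> where "\<epsilon> = min (\<delta> / 2) (V * U\<^sup>2 / 4)"
  define \<gamma> where "\<gamma> = 1 - U\<^sup>2 / 4"
  have U: "0 < U" "U < 1" using V \<delta> by (auto simp: U_def)
  have U2: "0 < U\<^sup>2" "U\<^sup>2 < U" using U by (auto simp: power2_eq_square)
  have \<epsilon>: "0 < \<epsilon>" "\<epsilon> \<le> \<delta> / 2" "\<epsilon> / V \<le> U\<^sup>2 / 4"
  proof -
    show "0 < \<epsilon>" "\<epsilon> \<le> \<delta> / 2" using V \<delta> U2 by (auto simp: \<epsilon>_def)
    have "\<epsilon> / V \<le> V * U\<^sup>2 / 4 / V" using V by (intro divide_right_mono) (auto simp: \<epsilon>_def)
    then show "\<epsilon> / V \<le> U\<^sup>2 / 4" using V by simp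
  qed
  have \<gamma>: "0 < \<gamma>" "\<gamma> < 1" "1 - U \<le> \<gamma>" unfolding \<gamma>_def using U U2 by linarith+
  have contr: "(1 - U\<^sup>2) * (1 + \<epsilon> / V) + \<epsilon> / V < \<gamma>"
  proof -
    have "0 < U\<^sup>2 * (\<epsilon> / V)" using U2 \<epsilon>(1) V by (intro mult_pos_pos divide_pos_pos) auto
    moreover have "(1 - u) * (1 + e) + e < 1 - u / 4" if "0 < u * e" "e \<le> u / 4" "0 < u" for u e :: real
      using that by (simp add: algebra_simps)
    ultimately show ?thesis unfolding \<gamma>_def using \<epsilon>(3) U2(1) by blast
  qed
  define T where "T = 1 / sqrt \<delta> + sqrt (2 * Mb) / V + 1 / (sqrt V * sqrt U)"
  obtain N1 where N1: "((1 - U\<^sup>2) * (1 + \<epsilon> / V) + 3 * sqrt Mb / sqrt V * (1 / sqrt (real n - 1))) * ((real n - 1) / (real n - 3))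
      + (\<epsilon> / V + T * (1 / sqrt (real n))) \<le> \<gamma>" if "n \<ge> N1" for n
    using eventually_contraction_factor[OF contr, of "3 * sqrt Mb / sqrt V" T] unfolding eventually_sequentially by blast
  \<comment> \<open>The locale constants are taken with explicit parameters, so that they are fixed
    before \<open>n\<close>. Absolute values plus 1 make \<open>C1\<close> and \<open>C3\<close>
    positive without an instance of the locale.\<close>
  define L where "L = gibbs_bd.KL V \<delta> Mb / \<gamma>"
  define C1 where "C1 = \<bar>2 * L\<^sup>2 + L * (2 + gibbs_bd.K1 V a b0 \<delta> Mb)\<bar> + 1"
  define C3 where "C3 = \<bar>gibbs_bd.esc V a b0 \<delta> Mb \<epsilon> + gibbs_bd.K2 V a b0 \<delta> Mb \<epsilon> + 4 * sqrt 8\<bar> + 1"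
  have bound: "tv_dist (gibbs_law V a b0 Y n x0 k) (posterior V a b0 Y n)
          \<le> (C1 + drift V Y n x0) * \<gamma> ^ k
             + 1 * (real k * (1 + real k) / real n)
             + C3 * (real k / sqrt (real n))
             + 1 * drift V Y n x0 * (real k / real n)"
    if n: "n \<ge> max 10 (max N0 N1)" and x0: "x0 \<in> Rset V Y \<delta> n" and k: "k \<ge> 1" for n x0 k
  proof -
    interpret gibbs_bd V a b0 Y n \<delta> Mb \<epsilon>
      using n V a b0 \<delta> \<epsilon> A_upper A_lower by unfold_locales auto
    have u0: "u0 = U" by (simp add: u0_def frac_def U_def)
    have KT: "KT = T" by (simp add: KT_def T_def u0)
    have rate: "rateA + (\<epsilon> / V + KT / sqrt (real n)) \<le> \<gamma>"
      using N1[of n] n unfolding rateA_def u0 KT by simp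
    have x: "x0 \<in> space (Xsp n)" "(dd - fst x0)\<^sup>2 \<le> (dd - \<delta>)\<^sup>2" using x0 by (auto simp: Rset_def dd_def)
    \<comment> \<open>As \<open>dd \<ge> \<delta>\<close>, the right side is
      \<open>dd - \<delta>\<close>, which is within the radius of \<open>good1\<close>.\<close>
    have "\<bar>dd - fst x0\<bar> \<le> \<bar>dd - \<delta>\<bar>" using x(2) by (simp add: abs_le_square_iff)
    then have g1: "good1 (fst x0)" using dd_ge \<delta> by (simp add: good1_def)
    \<comment> \<open>One sweep is reserved for the passage to total variation, so at least one must
      be available.\<close>
    obtain j where j: "k = Suc j" using k by (cases k) auto
    have dr: "0 \<le> drift V Y n x0" by (cases x0) (simp add: drift_def)
    have "tv_dist (gibbs_law V a b0 Y n x0 k) (posterior V a b0 Y n)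
       \<le> \<gamma> ^ k * (2 * L\<^sup>2 + L * (2 + K1) + drift V Y n x0) + real k / sqrt (real n) * (esc + K2 + 4 * sqrt 8)"
      unfolding j L_def by (rule tv_dist_bound[OF rate _ x(1) g1]) (simp add: u0 \<gamma>(3))
    also have "\<dots> \<le> \<gamma> ^ k * (C1 + drift V Y n x0) + real k / sqrt (real n) * C3"
    proof (intro add_mono mult_left_mono order_refl)
      show "2 * L\<^sup>2 + L * (2 + K1) \<le> C1" "esc + K2 + 4 * sqrt 8 \<le> C3" unfolding C1_def C3_def by linarith+
    qed (use \<gamma> in auto)
    \<comment> \<open>The terms with \<open>C2\<close> and \<open>C4\<close> are nonnegative and are
      added to a bound already established, so the value 1 serves for both.\<close>
    also have "\<dots> \<le> (C1 + drift V Y n x0) * \<gamma> ^ k + 1 * (real k * (1 + real k) / real n)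
             + C3 * (real k / sqrt (real n)) + 1 * drift V Y n x0 * (real k / real n)"
    proof -
      have "0 \<le> real k * (1 + real k) / real n" "0 \<le> drift V Y n x0 * (real k / real n)" using dr by auto
      then show ?thesis by (simp add: mult.commute)
    qed
    finally show ?thesis .
  qed
  have pos: "C1 > 0" "C3 > 0" unfolding C1_def C3_def by linarith+
  show ?thesis
    by (rule exI[of _ "max 10 (max N0 N1)"], rule exI[of _ C1], rule exI[of _ 1], rule exI[of _ C3],
        rule exI[of _ 1], rule exI[of _ \<gamma>]) (intro conjI allI ballI impI zero_less_one pos \<gamma> bound)
qed
end
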